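(* Let $a<b$, $\Omega=(a,b)$, $\lambda\in\mathbb{R}$, $f(u)=\lambda|u|^2u$, and for $0<\varepsilon\le 1$ let $u=u^\varepsilon(x,t)$ be the solution of the Klein–Gordon problem $$\varepsilon^2\partial_{tt}u-\partial_{xx}u+\frac{1}{\varepsilon^2}u+f(u)=0,\quad x\in\Omega,\ t>0,$$ with periodic boundary conditions $u(a,t)=u(b,t)$, $\partial_xu(a,t)=\partial_xu(b,t)$ and initial data $u(x,0)=\phi_1(x)$, $\partial_tu(x,0)=\phi_2(x)/\varepsilon^2$, where $\phi_1,\phi_2$ are complex-valued and independent of $\varepsilon$. Let $0<T<T^*$, $T^*$ the maximal existence time, and assume (A): there is an integer $m_0\ge2$ such that $u\in C^1([0,T];H^{m_0+4}_p(\Omega))$ and $\|u\|_{L^\infty([0,T];H^{m_0+4})}+\varepsilon^2\|\partial_tu\|_{L^\infty([0,T];H^{m_0+4})}\le C$ with $C$ independent of $\varepsilon\in(0,1]$. Set $C_0=\max_{0<\varepsilon\le1}\{\|u\|_{L^\infty([0,T];H^{m_0+4})},\ \varepsilon^2\|\partial_tu\|_{L^\infty([0,T];H^{m_0+4})}\}$. Let $u^n_j,\dot u^n_j$ be produced by the MTI-FP scheme described in the context, $u_I^n=I_N\mathbf{u}^n$, $\dot u_I^n=I_N\dot{\mathbf{u}}^n$, and $e^n=u(\cdot,t_n)-u_I^n$, $\dot e^n=\partial_tu(\cdot,t_n)-\dot u_I^n$. Then there exist constants $0<h_0\le1$ and $0<\tau_0\le1$, independent of $\varepsilon$, such that for every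 $0<\varepsilon\le1$, $0<h\le h_0$, $0<\tau\le\tau_0$ and all $0\le n\le T/\tau$: $$\|e^n\|_{H^2}+\varepsilon^2\|\dot e^n\|_{H^2}\lesssim h^{m_0}+\frac{\tau^2}{\varepsilon^2},\qquad \|e^n\|_{H^2}+\varepsilon^2\|\dot e^n\|_{H^2}\lesssim h^{m_0}+\tau^2+\varepsilon^2,$$ $$\|u_I^n\|_{H^2}\le C_0+1,\qquad \|\dot u_I^n\|_{H^2}\le \frac{C_0+1}{\varepsilon^2}.$$ Consequently $\|e^n\|_{H^2}+\varepsilon^2\|\dot e^n\|_{H^2}\lesssim h^{m_0}+\tau^2+\min\{\tau^2/\varepsilon^2,\varepsilon^2\}\lesssim h^{m_0}+\tau$ for $0\le n\le T/\tau$.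
   Context: Notation: $A\lesssim B$ means $|A|\le CB$ with $C>0$ independent of $\tau$ (or $n$), $h$ and $\varepsilon$. $H^m_p(\Omega)=\{\phi\in H^m(\Omega):\phi^{(k)}(a)=\phi^{(k)}(b),\ k=0,\dots,m-1\}$. $\tau>0$ is the time step, $t_n=n\tau$. Spatial discretization: $N$ an even positive integer, $h=(b-a)/N$, $x_j=a+jh$ ($j=0,\dots,N$), $\mu_l=2\pi l/(b-a)$. For a grid vector $\mathbf v=(v_0,\dots,v_N)$ with $v_0=v_N$, its discrete Fourier coefficients are $\widetilde{v}_l=\frac1N\sum_{j=0}^{N-1}v_je^{-i\mu_l(x_j-a)}$, $l=-N/2,\dots,N/2-1$, and $(I_N\mathbf v)(x)=\sum_{l=-N/2}^{N/2-1}\widetilde v_le^{i\mu_l(x-a)}$; a grid vector is recovered from coefficients via $v_j=\sum_l \widetilde v_l e^{i\mu_l(x_j-a)}$. For a grid vector $\mathbf v$, $\overline{\mathbf v}$ denotes the componentwise conjugate and $\widetilde{(\overline{v})}_l$ its discrete Fourier coefficients. Nonlinear functions: for $z_\pm,\dot z_\pm\in\mathbb C$: $f_\pm(z_+,z_-)=\lambda(|z_\pm|^2+2|z_\mp|^2)z_\pm$, $g_\pm(z_+,z_-)=\lambda z_\pm^2z_\mp$, $\dot f_\pm(z_+,z_-;\dot z_+,\dot z_-)=2\lambda z_\pm\,\mathrm{Re}[\overline{z_\pm}\dot z_\pm+2\overline{z_\mp}\dot z_\mp]+\lambda\dot z_\pm(|z_\pm|^2+2|z_\mp|^2)$, $\dot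 g_\pm(z_+,z_-;\dot z_+,\dot z_-)=2\lambda z_\pm z_\mp\dot z_\pm+\lambda z_\pm^2\dot z_\mp$. Coefficients: $\omega_l=\varepsilon^{-2}\sqrt{1+\mu_l^2\varepsilon^2}$, $\lambda_l^{\pm}=-(1\pm\sqrt{1+\mu_l^2\varepsilon^2})/\varepsilon^2$, $a_l(s)=\frac{\lambda_l^+e^{is\lambda_l^-}-\lambda_l^-e^{is\lambda_l^+}}{\lambda_l^+-\lambda_l^-}$, $b_l(s)=i\frac{e^{is\lambda_l^+}-e^{is\lambda_l^-}}{\varepsilon^2(\lambda_l^--\lambda_l^+)}$, with derivatives $a_l'(s)=i\lambda_l^+\lambda_l^-\frac{e^{is\lambda_l^-}-e^{is\lambda_l^+}}{\lambda_l^+-\lambda_l^-}$, $b_l'(s)=\frac{\lambda_l^+e^{is\lambda_l^+}-\lambda_l^-e^{is\lambda_l^-}}{\varepsilon^2(\lambda_l^+-\lambda_l^-)}$; and $c_l(\tau)=\int_0^\tau b_l(\tau-\theta)d\theta$, $d_l(\tau)=\int_0^\tau b_l(\tau-\theta)\theta\,d\theta$, $c_l'(\tau)=\int_0^\tau b_l'(\tau-\theta)d\theta$, $d_l'(\tau)=\int_0^\tau b_l'(\tau-\theta)\theta\,d\theta$, $p_l(\tau)=\int_0^\tau\frac{\sin(\omega_l(\tau-\theta))}{\varepsilon^2\omega_l}e^{3i\theta/\varepsilon^2}d\theta$, $q_l(\tau)=\int_0^\tau\frac{\sin(\omega_l(\tau-\theta))}{\varepsilon^2\omega_l}e^{3i\theta/\varepsilon^2}\theta\,d\theta$,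 $p_l'(\tau)=\int_0^\tau\frac{\cos(\omega_l(\tau-\theta))}{\varepsilon^2}e^{3i\theta/\varepsilon^2}d\theta$, $q_l'(\tau)=\int_0^\tau\frac{\cos(\omega_l(\tau-\theta))}{\varepsilon^2}e^{3i\theta/\varepsilon^2}\theta\,d\theta$ (here $c_l',d_l',p_l',q_l'$ are names of these quantities). MTI-FP scheme: $u^0_j=\phi_1(x_j)$, $\dot u^0_j=\phi_2(x_j)/\varepsilon^2$. Given $u^n_j,\dot u^n_j$ ($n\ge0$): set $z^0_{+,j}=\frac12(u^n_j-i\varepsilon^2\dot u^n_j)$, $z^0_{-,j}=\frac12(\overline{u^n_j}-i\varepsilon^2\overline{\dot u^n_j})$, $f^0_{\pm,j}=f_\pm(z^0_{+,j},z^0_{-,j})$; define $\dot z^0_\pm$ by $\widetilde{(\dot z^0_\pm)}_l=\frac i2[\frac2\tau\sin(\frac12\mu_l^2\tau)\widetilde{(z^0_\pm)}_l+\widetilde{(f^0_\pm)}_l]$ and $\widetilde{(\dot r^0)}_l=-\widetilde{(\dot z^0_+)}_l-\widetilde{(\overline{\dot z^0_-})}_l$; set $\dot f^0_{\pm,j}=\dot f_\pm(z^0_{+,j},z^0_{-,j};\dot z^0_{+,j},\dot z^0_{-,j})$, $g^0_{\pm,j}=g_\pm(z^0_{+,j},z^0_{-,j})$, $\dot g^0_{\pm,j}=\dot g_\pm(z^0_{+,j},z^0_{-,j};\dot z^0_{+,j},\dot z^0_{-,j})$. Then for $l=-N/2,\dots,N/2-1$: $\widetilde{(z^{n+1}_\pm)}_l=a_l(\tau)\widetilde{(z^0_\pm)}_l+\varepsilon^2b_l(\tau)\widetilde{(\dot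 z^0_\pm)}_l-c_l(\tau)\widetilde{(f^0_\pm)}_l-d_l(\tau)\widetilde{(\dot f^0_\pm)}_l$, $\widetilde{(\dot z^{n+1}_\pm)}_l=a_l'(\tau)\widetilde{(z^0_\pm)}_l+\varepsilon^2b_l'(\tau)\widetilde{(\dot z^0_\pm)}_l-c_l'(\tau)\widetilde{(f^0_\pm)}_l-d_l'(\tau)\widetilde{(\dot f^0_\pm)}_l$, $\widetilde{(r^{n+1})}_l=\frac{\sin(\omega_l\tau)}{\omega_l}\widetilde{(\dot r^0)}_l-p_l(\tau)\widetilde{(g^0_+)}_l-q_l(\tau)\widetilde{(\dot g^0_+)}_l-\overline{p_l(\tau)}\widetilde{(\overline{g^0_-})}_l-\overline{q_l(\tau)}\widetilde{(\overline{\dot g^0_-})}_l$; grid values $z^{n+1}_{\pm,j},\dot z^{n+1}_{\pm,j},r^{n+1}_j$ are obtained from these coefficients; $u^{n+1}_j=e^{i\tau/\varepsilon^2}z^{n+1}_{+,j}+e^{-i\tau/\varepsilon^2}\overline{z^{n+1}_{-,j}}+r^{n+1}_j$; $w^{n+1}_j=f(u^{n+1}_j)-f(e^{i\tau/\varepsilon^2}z^{n+1}_{+,j}+e^{-i\tau/\varepsilon^2}\overline{z^{n+1}_{-,j}})$; $\widetilde{(\dot r^{n+1})}_l=\cos(\omega_l\tau)\widetilde{(\dot r^0)}_l-p_l'(\tau)\widetilde{(g^0_+)}_l-q_l'(\tau)\widetilde{(\dot g^0_+)}_l-\overline{p_l'(\tau)}\widetilde{(\overline{g^0_-})}_l-\overline{q_l'(\tau)}\widetilde{(\overline{\dot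 g^0_-})}_l-\frac{\tau}{2\varepsilon^2}\widetilde{(w^{n+1})}_l$, giving grid values $\dot r^{n+1}_j$; finally $\dot u^{n+1}_j=e^{i\tau/\varepsilon^2}(\dot z^{n+1}_{+,j}+\frac{i}{\varepsilon^2}z^{n+1}_{+,j})+e^{-i\tau/\varepsilon^2}(\overline{\dot z^{n+1}_{-,j}}-\frac{i}{\varepsilon^2}\overline{z^{n+1}_{-,j}})+\dot r^{n+1}_j$. $\mathbf u^n=(u^n_0,\dots,u^n_N)$, $\dot{\mathbf u}^n=(\dot u^n_0,\dots,\dot u^n_N)$. *)

theory Defs
  imports "HOL-Analysis.Analysis"
begin

definition ei :: "real \<Rightarrow> complex" where
  "ei t = exp (\<i> * complex_of_real t)"

definition mu :: "real \<Rightarrow> real \<Rightarrow> int \<Rightarrow> real" where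
  "mu a b l = 2 * pi * real_of_int l / (b - a)"

definition fcoef :: "real \<Rightarrow> real \<Rightarrow> (real \<Rightarrow> complex) \<Rightarrow> int \<Rightarrow> complex" where
  "fcoef a b phi l =
     integral {a..b} (\<lambda>x. phi x * ei (- (mu a b l * (x - a)))) / complex_of_real (b - a)"

definition in_Hp :: "real \<Rightarrow> real \<Rightarrow> nat \<Rightarrow> (real \<Rightarrow> complex) \<Rightarrow> bool" where
  "in_Hp a b m phi \<longleftrightarrow> phi absolutely_integrable_on {a..b} \<and>
     (\<lambda>l::int. (1 + (mu a b l)^2)^m * (cmod (fcoef a b phi l))^2) summable_on UNIV"

definition Hnorm :: "real \<Rightarrow> real \<Rightarrow> nat \<Rightarrow> (real \<Rightarrow> complex) \<Rightarrow> real" where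
  "Hnorm a b m phi =
     sqrt (infsum (\<lambda>l::int. (1 + (mu a b l)^2)^m * (cmod (fcoef a b phi l))^2) UNIV)"

definition C1_Hp :: "real \<Rightarrow> real \<Rightarrow> nat \<Rightarrow> real \<Rightarrow> (real \<Rightarrow> real \<Rightarrow> complex)
     \<Rightarrow> (real \<Rightarrow> real \<Rightarrow> complex) \<Rightarrow> bool" where
  "C1_Hp a b m T v vt \<longleftrightarrow>
     (\<forall>t\<in>{0..T}. in_Hp a b m (v t) \<and> in_Hp a b m (vt t) \<and>
        ((\<lambda>s. Hnorm a b m (\<lambda>x. (v s x - v t x) / complex_of_real (s - t) - vt t x))
            \<longlongrightarrow> 0) (at t within {0..T}) \<and>
        ((\<lambda>s. Hnorm a b m (\<lambda>x. vt s x - vt t x)) \<longlongrightarrow> 0) (at t within {0..T}))"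

definition fnl :: "real \<Rightarrow> complex \<Rightarrow> complex" where
  "fnl lam u = complex_of_real lam * complex_of_real ((cmod u)^2) * u"

definition f_pl :: "real \<Rightarrow> complex \<Rightarrow> complex \<Rightarrow> complex" where
  "f_pl lam zp zm = complex_of_real lam * complex_of_real ((cmod zp)^2 + 2 * (cmod zm)^2) * zp"
definition f_mi :: "real \<Rightarrow> complex \<Rightarrow> complex \<Rightarrow> complex" where
  "f_mi lam zp zm = complex_of_real lam * complex_of_real ((cmod zm)^2 + 2 * (cmod zp)^2) * zm"
definition g_pl :: "real \<Rightarrow> complex \<Rightarrow> complex \<Rightarrow> complex" where
  "g_pl lam zp zm = complex_of_real lam * zp^2 * zm"
definition g_mi :: "real \<Rightarrow> complex \<Rightarrow> complex \<Rightarrow> complex" where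
  "g_mi lam zp zm = complex_of_real lam * zm^2 * zp"
definition fd_pl :: "real \<Rightarrow> complex \<Rightarrow> complex \<Rightarrow> complex \<Rightarrow> complex \<Rightarrow> complex" where
  "fd_pl lam zp zm dzp dzm =
     2 * complex_of_real lam * zp * complex_of_real (Re (cnj zp * dzp + 2 * cnj zm * dzm))
     + complex_of_real lam * dzp * complex_of_real ((cmod zp)^2 + 2 * (cmod zm)^2)"
definition fd_mi :: "real \<Rightarrow> complex \<Rightarrow> complex \<Rightarrow> complex \<Rightarrow> complex \<Rightarrow> complex" where
  "fd_mi lam zp zm dzp dzm =
     2 * complex_of_real lam * zm * complex_of_real (Re (cnj zm * dzm + 2 * cnj zp * dzp))
     + complex_of_real lam * dzm * complex_of_real ((cmod zm)^2 + 2 * (cmod zp)^2)"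
definition gd_pl :: "real \<Rightarrow> complex \<Rightarrow> complex \<Rightarrow> complex \<Rightarrow> complex \<Rightarrow> complex" where
  "gd_pl lam zp zm dzp dzm =
     2 * complex_of_real lam * zp * zm * dzp + complex_of_real lam * zp^2 * dzm"
definition gd_mi :: "real \<Rightarrow> complex \<Rightarrow> complex \<Rightarrow> complex \<Rightarrow> complex \<Rightarrow> complex" where
  "gd_mi lam zp zm dzp dzm =
     2 * complex_of_real lam * zm * zp * dzm + complex_of_real lam * zm^2 * dzp"

definition gridx :: "real \<Rightarrow> real \<Rightarrow> nat \<Rightarrow> nat \<Rightarrow> real" where
  "gridx a b N j = a + real j * ((b - a) / real N)"

definition modes :: "nat \<Rightarrow> int set" where
  "modes N = {- (int N div 2) .. int N div 2 - 1}"

definition dft :: "real \<Rightarrow> real \<Rightarrow> nat \<Rightarrow> (nat \<Rightarrow> complex) \<Rightarrow> int \<Rightarrow> complex" where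
  "dft a b N v l =
     (\<Sum>j<N. v j * ei (- (mu a b l * (gridx a b N j - a)))) / of_nat N"

definition idft :: "real \<Rightarrow> real \<Rightarrow> nat \<Rightarrow> (int \<Rightarrow> complex) \<Rightarrow> nat \<Rightarrow> complex" where
  "idft a b N c j = (\<Sum>l\<in>modes N. c l * ei (mu a b l * (gridx a b N j - a)))"

definition interp :: "real \<Rightarrow> real \<Rightarrow> nat \<Rightarrow> (nat \<Rightarrow> complex) \<Rightarrow> real \<Rightarrow> complex" where
  "interp a b N v x = (\<Sum>l\<in>modes N. dft a b N v l * ei (mu a b l * (x - a)))"

definition omg :: "real \<Rightarrow> real \<Rightarrow> real \<Rightarrow> int \<Rightarrow> real" where
  "omg a b eps l = sqrt (1 + (mu a b l)^2 * eps^2) / eps^2"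
definition lpl :: "real \<Rightarrow> real \<Rightarrow> real \<Rightarrow> int \<Rightarrow> real" where
  "lpl a b eps l = - (1 + sqrt (1 + (mu a b l)^2 * eps^2)) / eps^2"
definition lmi :: "real \<Rightarrow> real \<Rightarrow> real \<Rightarrow> int \<Rightarrow> real" where
  "lmi a b eps l = - (1 - sqrt (1 + (mu a b l)^2 * eps^2)) / eps^2"

definition acf :: "real \<Rightarrow> real \<Rightarrow> real \<Rightarrow> int \<Rightarrow> real \<Rightarrow> complex" where
  "acf a b eps l s =
     (complex_of_real (lpl a b eps l) * ei (s * lmi a b eps l)
      - complex_of_real (lmi a b eps l) * ei (s * lpl a b eps l))
     / complex_of_real (lpl a b eps l - lmi a b eps l)"
definition bcf :: "real \<Rightarrow> real \<Rightarrow> real \<Rightarrow> int \<Rightarrow> real \<Rightarrow> complex" where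
  "bcf a b eps l s =
     \<i> * (ei (s * lpl a b eps l) - ei (s * lmi a b eps l))
     / complex_of_real (eps^2 * (lmi a b eps l - lpl a b eps l))"
definition acf' :: "real \<Rightarrow> real \<Rightarrow> real \<Rightarrow> int \<Rightarrow> real \<Rightarrow> complex" where
  "acf' a b eps l s =
     \<i> * complex_of_real (lpl a b eps l * lmi a b eps l)
     * (ei (s * lmi a b eps l) - ei (s * lpl a b eps l))
     / complex_of_real (lpl a b eps l - lmi a b eps l)"
definition bcf' :: "real \<Rightarrow> real \<Rightarrow> real \<Rightarrow> int \<Rightarrow> real \<Rightarrow> complex" where
  "bcf' a b eps l s =
     (complex_of_real (lpl a b eps l) * ei (s * lpl a b eps l)
      - complex_of_real (lmi a b eps l) * ei (s * lmi a b eps l))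
     / complex_of_real (eps^2 * (lpl a b eps l - lmi a b eps l))"

definition ccf :: "real \<Rightarrow> real \<Rightarrow> real \<Rightarrow> int \<Rightarrow> real \<Rightarrow> complex" where
  "ccf a b eps l tau = integral {0..tau} (\<lambda>th. bcf a b eps l (tau - th))"
definition dcf :: "real \<Rightarrow> real \<Rightarrow> real \<Rightarrow> int \<Rightarrow> real \<Rightarrow> complex" where
  "dcf a b eps l tau = integral {0..tau} (\<lambda>th. bcf a b eps l (tau - th) * complex_of_real th)"
definition ccf' :: "real \<Rightarrow> real \<Rightarrow> real \<Rightarrow> int \<Rightarrow> real \<Rightarrow> complex" where
  "ccf' a b eps l tau = integral {0..tau} (\<lambda>th. bcf' a b eps l (tau - th))"
definition dcf' :: "real \<Rightarrow> real \<Rightarrow> real \<Rightarrow> int \<Rightarrow> real \<Rightarrow> complex" where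
  "dcf' a b eps l tau = integral {0..tau} (\<lambda>th. bcf' a b eps l (tau - th) * complex_of_real th)"

definition pcf :: "real \<Rightarrow> real \<Rightarrow> real \<Rightarrow> int \<Rightarrow> real \<Rightarrow> complex" where
  "pcf a b eps l tau = integral {0..tau} (\<lambda>th.
     complex_of_real (sin (omg a b eps l * (tau - th)) / (eps^2 * omg a b eps l))
     * ei (3 * th / eps^2))"
definition qcf :: "real \<Rightarrow> real \<Rightarrow> real \<Rightarrow> int \<Rightarrow> real \<Rightarrow> complex" where
  "qcf a b eps l tau = integral {0..tau} (\<lambda>th.
     complex_of_real (sin (omg a b eps l * (tau - th)) / (eps^2 * omg a b eps l))
     * ei (3 * th / eps^2) * complex_of_real th)"
definition pcf' :: "real \<Rightarrow> real \<Rightarrow> real \<Rightarrow> int \<Rightarrow> real \<Rightarrow> complex" where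
  "pcf' a b eps l tau = integral {0..tau} (\<lambda>th.
     complex_of_real (cos (omg a b eps l * (tau - th)) / eps^2) * ei (3 * th / eps^2))"
definition qcf' :: "real \<Rightarrow> real \<Rightarrow> real \<Rightarrow> int \<Rightarrow> real \<Rightarrow> complex" where
  "qcf' a b eps l tau = integral {0..tau} (\<lambda>th.
     complex_of_real (cos (omg a b eps l * (tau - th)) / eps^2) * ei (3 * th / eps^2)
     * complex_of_real th)"

definition mti_step :: "real \<Rightarrow> real \<Rightarrow> real \<Rightarrow> nat \<Rightarrow> real \<Rightarrow> real
    \<Rightarrow> (nat \<Rightarrow> complex) \<times> (nat \<Rightarrow> complex) \<Rightarrow> (nat \<Rightarrow> complex) \<times> (nat \<Rightarrow> complex)" where
  "mti_step lam a b N eps tau p =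
   (let un = fst p; udn = snd p;
        D = dft a b N; ID = idft a b N;
        cv = (\<lambda>v j. cnj (v j));
        e2 = complex_of_real (eps^2);
        zp0 = (\<lambda>j. (un j - \<i> * e2 * udn j) / 2);
        zm0 = (\<lambda>j. (cnj (un j) - \<i> * e2 * cnj (udn j)) / 2);
        fp0 = (\<lambda>j. f_pl lam (zp0 j) (zm0 j));
        fm0 = (\<lambda>j. f_mi lam (zp0 j) (zm0 j));
        Zdp = (\<lambda>l. \<i> / 2 * (complex_of_real (2 / tau * sin ((mu a b l)^2 * tau / 2)) * D zp0 l
                             + D fp0 l));
        Zdm = (\<lambda>l. \<i> / 2 * (complex_of_real (2 / tau * sin ((mu a b l)^2 * tau / 2)) * D zm0 l
                             + D fm0 l));
        zdp0 = ID Zdp; zdm0 = ID Zdm;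
        Rd0 = (\<lambda>l. - Zdp l - D (cv zdm0) l);
        dfp0 = (\<lambda>j. fd_pl lam (zp0 j) (zm0 j) (zdp0 j) (zdm0 j));
        dfm0 = (\<lambda>j. fd_mi lam (zp0 j) (zm0 j) (zdp0 j) (zdm0 j));
        gp0 = (\<lambda>j. g_pl lam (zp0 j) (zm0 j));
        gm0 = (\<lambda>j. g_mi lam (zp0 j) (zm0 j));
        dgp0 = (\<lambda>j. gd_pl lam (zp0 j) (zm0 j) (zdp0 j) (zdm0 j));
        dgm0 = (\<lambda>j. gd_mi lam (zp0 j) (zm0 j) (zdp0 j) (zdm0 j));
        zp1 = ID (\<lambda>l. acf a b eps l tau * D zp0 l + e2 * bcf a b eps l tau * Zdp l
                     - ccf a b eps l tau * D fp0 l - dcf a b eps l tau * D dfp0 l);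
        zm1 = ID (\<lambda>l. acf a b eps l tau * D zm0 l + e2 * bcf a b eps l tau * Zdm l
                     - ccf a b eps l tau * D fm0 l - dcf a b eps l tau * D dfm0 l);
        zdp1 = ID (\<lambda>l. acf' a b eps l tau * D zp0 l + e2 * bcf' a b eps l tau * Zdp l
                     - ccf' a b eps l tau * D fp0 l - dcf' a b eps l tau * D dfp0 l);
        zdm1 = ID (\<lambda>l. acf' a b eps l tau * D zm0 l + e2 * bcf' a b eps l tau * Zdm l
                     - ccf' a b eps l tau * D fm0 l - dcf' a b eps l tau * D dfm0 l);
        r1 = ID (\<lambda>l. complex_of_real (sin (omg a b eps l * tau) / omg a b eps l) * Rd0 l
                   - pcf a b eps l tau * D gp0 l - qcf a b eps l tau * D dgp0 l
                   - cnj (pcf a b eps l tau) * D (cv gm0) l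
                   - cnj (qcf a b eps l tau) * D (cv dgm0) l);
        v1 = (\<lambda>j. ei (tau / eps^2) * zp1 j + ei (- tau / eps^2) * cnj (zm1 j));
        u1 = (\<lambda>j. v1 j + r1 j);
        w1 = (\<lambda>j. fnl lam (u1 j) - fnl lam (v1 j));
        rd1 = ID (\<lambda>l. complex_of_real (cos (omg a b eps l * tau)) * Rd0 l
                   - pcf' a b eps l tau * D gp0 l - qcf' a b eps l tau * D dgp0 l
                   - cnj (pcf' a b eps l tau) * D (cv gm0) l
                   - cnj (qcf' a b eps l tau) * D (cv dgm0) l
                   - complex_of_real (tau / (2 * eps^2)) * D w1 l);
        ud1 = (\<lambda>j. ei (tau / eps^2) * (zdp1 j + \<i> / e2 * zp1 j)
                  + ei (- tau / eps^2) * (cnj (zdm1 j) - \<i> / e2 * cnj (zm1 j)) + rd1 j)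
    in (u1, ud1))"

text \<open>The MTI-FP iterates (u^n, udot^n) as grid vectors (index j; values for j = 0..N).\<close>
definition mti :: "real \<Rightarrow> real \<Rightarrow> real \<Rightarrow> nat \<Rightarrow> real \<Rightarrow> real
    \<Rightarrow> (real \<Rightarrow> complex) \<Rightarrow> (real \<Rightarrow> complex) \<Rightarrow> nat
    \<Rightarrow> (nat \<Rightarrow> complex) \<times> (nat \<Rightarrow> complex)" where
  "mti lam a b N eps tau phi1 phi2 n =
     (mti_step lam a b N eps tau ^^ n)
       (\<lambda>j. phi1 (gridx a b N j), \<lambda>j. phi2 (gridx a b N j) / complex_of_real (eps^2))"

end

theory Submission
  imports Defs
begin

text \<open>In the variables \<open>e^(i t/eps^2) z_+ + e^(-i t/eps^2) cnj z_- + r\<close> one step of the scheme recombines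
  to the variation of constants formula on the grid, with the cubic term replaced by its
  linearisation along the two slowly varying amplitudes. In the energy norm built from
  \<open>sqrt (1 + eps^2 mu^2) u\<close> and \<open>eps^2 u_t\<close> the linear flow is a rotation of each Fourier mode, so a step
  is stable with factor \<open>1 + O(tau)\<close>, uniformly in \<open>eps\<close>, on bounded sets of \<open>H^2\<close>.

  The Fourier modes of the exact solution satisfy the semidiscrete equation up to aliasing of size
  \<open>h^m0\<close>. The remaining local error is estimated twice. For \<open>tau \<le> eps^2\<close>, Taylor expansion of the
  amplitudes, whose derivatives are bounded by powers of \<open>1/eps\<close>, gives \<open>tau (tau^2/eps^2)\<close>. In general,
  the carrier phases \<open>e^(2 i t/eps^2)\<close> and \<open>e^(3 i t/eps^2)\<close> do not resonate with the slow motion, and one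
  integration by parts in time gives \<open>tau (tau^2 + eps^2)\<close>. A discrete Gronwall argument adds up the
  local errors; as the total is small, the numerical solution never leaves the bounded set on which
  stability holds.\<close>

section \<open>Weighted norms of Fourier coefficients\<close>

text \<open>The decisive obstacle is the remainder \<open>r\<close>. The amplitudes are extrapolated
  with their initial derivatives, but \<open>r\<close> is absent from the linearised cubic term. It
  starts at zero with velocity minus the sum of the amplitude derivatives, so the cubic term of the
  scheme has a defect linear in the elapsed time. Under the sine kernel this is harmless for tau <=
  eps^2, because the kernel supplies another factor tau / eps^2; under the cosine kernel it is not,
  and the correction with \<open>w\<close> is a trapezoidal rule that cancels it.

  Derivatives are spent as follows. Errors are measured in H^2, and the filtered Laplacian differs
  from mu^2 by tau mu^4, which takes four more; hence order m0 + 4 >= 6. Aliasing, measured in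
  orders up to 3, still gains h^m0. The filter keeps a step bounded on H^2, since tau times the
  filtered symbol is at most 2.

  The two local bounds carry the same factor tau, so their minimum may be taken in each step before
  summation: for tau > eps^2 one has tau^2 + eps^2 <= 2 tau^2 / eps^2, and the second bound alone is
  within a factor 2 of the minimum.\<close>

definition wt :: "real \<Rightarrow> real \<Rightarrow> int \<Rightarrow> real" where
  "wt a b l = 1 + (mu a b l)^2"

text \<open>The H^s norm of a trigonometric polynomial with spectrum in \<open>A\<close>. The index
  set is explicit so that estimates on finite sets need no summability condition; when the full
  series converges, \<open>Hnorm\<close> is the supremum over finite \<open>A\<close>.\<close>

definition wn :: "real \<Rightarrow> real \<Rightarrow> int set \<Rightarrow> nat \<Rightarrow> (int \<Rightarrow> complex) \<Rightarrow> real" where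
  "wn a b A s c = L2_set (\<lambda>l. sqrt (wt a b l ^ s) * cmod (c l)) A"

section \<open>Elementary facts on unimodular exponentials\<close>

lemma ei_cis: "ei t = cis t"
  by (simp add: ei_def cis_conv_exp)

lemma ei_add: "ei (x + y) = ei x * ei y"
  by (simp add: ei_cis cis_mult)

lemma norm_ei [simp]: "cmod (ei t) = 1"
  by (simp add: ei_cis)

lemma cnj_ei [simp]: "cnj (ei t) = ei (- t)"
  by (simp add: ei_cis cis_cnj)

lemma ei_0 [simp]: "ei 0 = 1"
  by (simp add: ei_cis)

lemma ei_mult_minus [simp]: "ei t * ei (- t) = 1" "ei (- t) * ei t = 1"
  by (simp_all flip: ei_add)

lemma ei_eq_1_iff: "ei t = 1 \<longleftrightarrow> (\<exists>k::int. t = 2 * pi * of_int k)"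
  by (auto simp: ei_def exp_eq_1 algebra_simps)

lemma ei_int_period: "ei (2 * pi * of_int k) = 1"
  using ei_eq_1_iff by blast

lemma ei_power: "ei t ^ n = ei (real n * t)"
  unfolding ei_cis by (rule Complex.DeMoivre)

lemma continuous_on_ei [continuous_intros]:
  "continuous_on S f \<Longrightarrow> continuous_on S (\<lambda>x. ei (f x))"
  unfolding ei_def by (intro continuous_intros)

lemma has_vector_derivative_ei:
  "((\<lambda>s. ei (c * s)) has_vector_derivative \<i> * of_real c * ei (c * s)) (at s within S)"
  unfolding ei_def of_real_mult
  by (rule has_vector_derivative_real_field) (auto intro!: derivative_eq_intros)

text \<open>A chord is no longer than its arc: the modulus of \<open>cis t - 1\<close> is 2 |sin
  (t/2)|.\<close>

lemma ei_lipschitz: "cmod (ei x - ei y) \<le> \<bar>x - y\<bar>"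
proof -
  have "cmod (ei x - ei y) = cmod (ei y * (ei (x - y) - 1))"
    by (simp add: algebra_simps flip: ei_add)
  also have "\<dots> = cmod (cis (x - y) - 1)"
    by (simp add: norm_mult ei_cis)
  also have "\<dots> = 2 * \<bar>sin ((x - y) / 2)\<bar>"
  proof -
    have "(cmod (cis t - 1))\<^sup>2 = (2 * sin (t / 2))\<^sup>2" for t
    proof -
      have "(cmod (cis t - 1))\<^sup>2 = (cos t - 1)\<^sup>2 + (sin t)\<^sup>2"
        by (simp add: cmod_power2)
      also have "\<dots> = 2 - 2 * cos t"
        using sin_cos_squared_add[of t] by (simp add: power2_eq_square algebra_simps)
      also have "\<dots> = (2 * sin (t / 2))\<^sup>2"
        using cos_double_sin[of "t / 2"] by (simp add: power_mult_distrib)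
      finally show ?thesis .
    qed
    from this[of "x - y"] have "cmod (cis (x - y) - 1) = \<bar>2 * sin ((x - y) / 2)\<bar>"
      by (metis abs_norm_cancel power2_eq_iff_nonneg abs_ge_zero power2_abs)
    then show ?thesis by (simp add: abs_mult)
  qed
  also have "\<dots> \<le> 2 * \<bar>(x - y) / 2\<bar>"
    using abs_sin_x_le_abs_x[of "(x - y) / 2"] by simp
  finally show ?thesis by simp
qed

lemma wt_ge_1: "1 \<le> wt a b l"
  by (simp add: wt_def)

lemma wt_pos [simp]: "0 < wt a b l" "0 \<le> wt a b l"
  using wt_ge_1[of a b l] by linarith+

lemma mu_minus [simp]: "mu a b (- l) = - mu a b l"
  by (simp add: mu_def)

lemma wn_nonneg [simp]: "0 \<le> wn a b A s c"
  by (simp add: wn_def)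

lemma wn_sq: "(wn a b A s c)\<^sup>2 = (\<Sum>l\<in>A. wt a b l ^ s * (cmod (c l))\<^sup>2)"
  unfolding wn_def L2_set_def
  by (subst real_sqrt_pow2) (auto simp: sum_nonneg power_mult_distrib)

lemma wn_cong: "(\<And>l. l \<in> A \<Longrightarrow> c l = d l) \<Longrightarrow> wn a b A s c = wn a b A s d"
  unfolding wn_def by (rule L2_set_cong) auto

lemma wn_le_cmod:
  assumes "\<And>l. l \<in> A \<Longrightarrow> cmod (c l) * sqrt (wt a b l ^ s) \<le> B * (cmod (d l) * sqrt (wt a b l ^ s'))"
    and "0 \<le> B"
  shows "wn a b A s c \<le> B * wn a b A s' d"
  unfolding wn_def L2_set_right_distrib[OF assms(2)]
  by (rule L2_set_mono) (use assms in \<open>auto simp: mult_ac\<close>)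

lemma wn_add: "wn a b A s (\<lambda>l. c l + d l) \<le> wn a b A s c + wn a b A s d"
  unfolding wn_def
  by (rule order_trans[OF L2_set_mono L2_set_triangle_ineq])
     (auto simp: norm_triangle_ineq mult_left_mono simp flip: distrib_left)

lemma wn_scale: "wn a b A s (\<lambda>l. k * c l) = cmod k * wn a b A s c"
  unfolding wn_def by (simp add: L2_set_right_distrib norm_mult mult_ac)

lemma wn_minus [simp]: "wn a b A s (\<lambda>l. - c l) = wn a b A s c"
  by (simp add: wn_def)

lemma wn_diff: "wn a b A s (\<lambda>l. c l - d l) \<le> wn a b A s c + wn a b A s d"
  using wn_add[of a b A s c "\<lambda>l. - d l"] by simp

text \<open>Fourier multiplier estimate: a symbol of size B times the power (s' - s) / 2 of the
  weight costs s' - s derivatives. The squared hypothesis lets odd differences be expressed with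
  natural exponents.\<close>

lemma wn_mult:
  assumes "\<And>l. l \<in> A \<Longrightarrow> (cmod (m l))\<^sup>2 * wt a b l ^ s \<le> B\<^sup>2 * wt a b l ^ s'" and B: "0 \<le> B"
  shows "wn a b A s (\<lambda>l. m l * c l) \<le> B * wn a b A s' c"
proof (rule wn_le_cmod[OF _ B])
  fix l assume "l \<in> A"
  have "cmod (m l) * sqrt (wt a b l ^ s) = sqrt ((cmod (m l))\<^sup>2 * wt a b l ^ s)"
    by (simp add: real_sqrt_mult)
  also have "\<dots> \<le> sqrt (B\<^sup>2 * wt a b l ^ s')"
    using assms(1)[OF \<open>l \<in> A\<close>] by simp
  also have "\<dots> = B * sqrt (wt a b l ^ s')"
    using B by (simp add: real_sqrt_mult)
  finally have "cmod (m l) * sqrt (wt a b l ^ s) * cmod (c l) \<le> B * sqrt (wt a b l ^ s') * cmod (c l)"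
    by (rule mult_right_mono) auto
  then show "cmod (m l * c l) * sqrt (wt a b l ^ s) \<le> B * (cmod (c l) * sqrt (wt a b l ^ s'))"
    by (simp add: norm_mult mult_ac)
qed

lemma wn_mult_bd:
  assumes "\<And>l. l \<in> A \<Longrightarrow> cmod (m l) \<le> B" and "0 \<le> B"
  shows "wn a b A s (\<lambda>l. m l * c l) \<le> B * wn a b A s c"
  by (rule wn_mult) (use assms in \<open>auto intro!: mult_right_mono power_mono\<close>)

lemma wn_mono_exp: "s \<le> s' \<Longrightarrow> wn a b A s c \<le> wn a b A s' c"
proof -
  assume "s \<le> s'"
  then have "wn a b A s c \<le> 1 * wn a b A s' c"
    by (intro wn_le_cmod) (auto intro!: mult_left_mono power_increasing wt_ge_1)
  then show ?thesis by simp
qed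

lemma wn_member: "finite A \<Longrightarrow> l \<in> A \<Longrightarrow> cmod (c l) \<le> wn a b A s c"
proof -
  assume "finite A" "l \<in> A"
  then have "sqrt (wt a b l ^ s) * cmod (c l) \<le> wn a b A s c"
    unfolding wn_def by (intro member_le_L2_set)
  moreover have "1 * cmod (c l) \<le> sqrt (wt a b l ^ s) * cmod (c l)"
    by (intro mult_right_mono) (auto simp: one_le_power wt_ge_1)
  ultimately show ?thesis by simp
qed

lemma wn_mono_set: "finite B \<Longrightarrow> A \<subseteq> B \<Longrightarrow> wn a b A s c \<le> wn a b B s c"
  unfolding wn_def L2_set_def by (auto intro!: sum_mono2)

text \<open>The bound follows by testing the integral against itself.\<close>

lemma wn_has_integral:
  assumes A: "finite A" and t: "0 \<le> t"
    and int: "\<And>l. l \<in> A \<Longrightarrow> ((\<lambda>s. phi l s) has_integral I l) {0..t}"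
    and bd: "\<And>s. s \<in> {0..t} \<Longrightarrow> wn a b A m (\<lambda>l. phi l s) \<le> B"
  shows "wn a b A m I \<le> t * B"
proof -
  let ?w = "\<lambda>l. wt a b l ^ m"
  let ?n = "wn a b A m I"
  have "((\<lambda>s. \<Sum>l\<in>A. Re (complex_of_real (?w l) * cnj (I l) * phi l s)) has_integral
         (\<Sum>l\<in>A. Re (complex_of_real (?w l) * cnj (I l) * I l))) {0..t}"
    by (intro has_integral_sum A has_integral_linear[OF _ bounded_linear_Re, unfolded o_def]
        has_integral_mult_right int)
  moreover have "(\<Sum>l\<in>A. Re (complex_of_real (?w l) * cnj (I l) * I l)) = ?n\<^sup>2"
    unfolding wn_sq cmod_power2
    by (intro sum.cong refl) (simp add: algebra_simps power2_eq_square)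
  ultimately have "((\<lambda>s. \<Sum>l\<in>A. Re (complex_of_real (?w l) * cnj (I l) * phi l s))
         has_integral ?n\<^sup>2) {0..t}" by simp
  moreover have "((\<lambda>s::real. ?n * B) has_integral (t * (?n * B))) {0..t}"
    using has_integral_const_real[of "?n * B" 0 t] t by simp
  ultimately have "?n\<^sup>2 \<le> t * (?n * B)"
  proof (rule has_integral_le)
    fix s assume s: "s \<in> {0..t}"
    have "(\<Sum>l\<in>A. Re (complex_of_real (?w l) * cnj (I l) * phi l s))
        \<le> (\<Sum>l\<in>A. \<bar>sqrt (?w l) * cmod (I l)\<bar> * \<bar>sqrt (?w l) * cmod (phi l s)\<bar>)"
    proof (rule sum_mono)
      fix l
      have "Re (complex_of_real (?w l) * cnj (I l) * phi l s)
          \<le> cmod (complex_of_real (?w l) * cnj (I l) * phi l s)"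
        by (rule complex_Re_le_cmod)
      also have "\<dots> = ?w l * cmod (I l) * cmod (phi l s)"
        by (simp add: norm_mult norm_power)
      also have "\<dots> = (sqrt (?w l) * sqrt (?w l)) * cmod (I l) * cmod (phi l s)"
        by simp
      also have "\<dots> = \<bar>sqrt (?w l) * cmod (I l)\<bar> * \<bar>sqrt (?w l) * cmod (phi l s)\<bar>"
        by (simp add: abs_mult)
      finally show "Re (complex_of_real (?w l) * cnj (I l) * phi l s)
          \<le> \<bar>sqrt (?w l) * cmod (I l)\<bar> * \<bar>sqrt (?w l) * cmod (phi l s)\<bar>" .
    qed
    also have "\<dots> \<le> wn a b A m I * wn a b A m (\<lambda>l. phi l s)"
      unfolding wn_def by (rule L2_set_mult_ineq)
    also have "\<dots> \<le> ?n * B"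
      using bd[OF s] by (simp add: mult_left_mono)
    finally show "(\<Sum>l\<in>A. Re (complex_of_real (?w l) * cnj (I l) * phi l s)) \<le> ?n * B" .
  qed
  then have "?n * ?n \<le> ?n * (t * B)"
    by (simp add: power2_eq_square mult_ac)
  moreover have "0 \<le> B"
    using bd[of 0] t wn_nonneg[of a b A m "\<lambda>l. phi l 0"] by (simp del: wn_nonneg)
  ultimately show ?thesis
    using t wn_nonneg[of a b A m I]
    by (cases "?n = 0") auto
qed

text \<open>Derivatives are required only inside the interval, because the wave equation yields the
  derivative of the velocity modes only at interior times.\<close>

lemma wn_mean_value:
  assumes A: "finite A" and t: "0 \<le> t"
    and cont: "\<And>l. l \<in> A \<Longrightarrow> continuous_on {0..t} (phi l)"
    and der: "\<And>l s. l \<in> A \<Longrightarrow> s \<in> {0<..<t} \<Longrightarrow> (phi l has_vector_derivative phi' l s) (at s)"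
    and bd: "\<And>s. s \<in> {0..t} \<Longrightarrow> wn a b A m (\<lambda>l. phi' l s) \<le> B"
  shows "wn a b A m (\<lambda>l. phi l t - phi l 0) \<le> t * B"
proof (rule wn_has_integral[OF A t _ bd])
  fix l assume "l \<in> A"
  then show "(phi' l has_integral phi l t - phi l 0) {0..t}"
    by (intro fundamental_theorem_of_calculus_interior t cont der) auto
qed

text \<open>Comparison with a telescoping series: since pi >= 1, the term at l \<noteq> 0 is at most
  L^2 / (4 l^2) with L = b - a, and symmetric sums are bounded by induction. Only uniformity in
  \<open>A\<close> matters for the embedding below.\<close>

lemma sum_inverse_wt:
  assumes "a < b" "finite A"
  shows "(\<Sum>l\<in>A. 1 / wt a b l) \<le> 1 + (b - a)\<^sup>2"
proof -
  let ?L = "b - a"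
  have L: "0 < ?L" using assms by simp
  have step: "1 / wt a b l \<le> ?L\<^sup>2 / (4 * (real_of_int l)\<^sup>2)" if "l \<noteq> 0" for l
  proof -
    have "4 * (real_of_int l)\<^sup>2 / ?L\<^sup>2 \<le> (mu a b l)\<^sup>2"
    proof -
      have "1 \<le> pi\<^sup>2" using pi_ge_two by (simp add: one_le_power)
      then have "4 * (real_of_int l)\<^sup>2 * 1 \<le> 4 * (real_of_int l)\<^sup>2 * pi\<^sup>2"
        by (intro mult_left_mono) auto
      then have "4 * (real_of_int l)\<^sup>2 / ?L\<^sup>2 \<le> 4 * (real_of_int l)\<^sup>2 * pi\<^sup>2 / ?L\<^sup>2"
        by (simp add: divide_right_mono)
      also have "\<dots> = (mu a b l)\<^sup>2"
        by (simp add: mu_def power_mult_distrib power_divide)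
      finally show ?thesis .
    qed
    then have "4 * (real_of_int l)\<^sup>2 / ?L\<^sup>2 \<le> wt a b l" by (simp add: wt_def)
    moreover have "0 < 4 * (real_of_int l)\<^sup>2 / ?L\<^sup>2" using that L by simp
    ultimately have "1 / wt a b l \<le> 1 / (4 * (real_of_int l)\<^sup>2 / ?L\<^sup>2)"
      by (intro divide_left_mono mult_pos_pos wt_pos) auto
    then show ?thesis by simp
  qed
  have sym: "(\<Sum>l\<in>{- int n..int n}. 1 / wt a b l) \<le> 1 + ?L\<^sup>2 * (1 - 1 / (real n + 1))" for n
  proof (induction n)
    case 0
    then show ?case by (simp add: wt_def mu_def)
  next
    case (Suc n)
    have "{- int (Suc n)..int (Suc n)} = insert (- int (Suc n)) (insert (int (Suc n)) {- int n..int n})"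
      by auto
    then have "(\<Sum>l\<in>{- int (Suc n)..int (Suc n)}. 1 / wt a b l)
        = 1 / wt a b (- int (Suc n)) + (1 / wt a b (int (Suc n)) + (\<Sum>l\<in>{- int n..int n}. 1 / wt a b l))"
      by simp
    also have "\<dots> \<le> ?L\<^sup>2 / (4 * (real n + 1)\<^sup>2) + (?L\<^sup>2 / (4 * (real n + 1)\<^sup>2) + (1 + ?L\<^sup>2 * (1 - 1 / (real n + 1))))"
      using step[of "- int (Suc n)"] step[of "int (Suc n)"] Suc
      by (intro add_mono) (auto simp: algebra_simps power2_eq_square)
    also have "\<dots> = 1 + ?L\<^sup>2 * (1 - 1 / (real n + 1) + 1 / (2 * (real n + 1)\<^sup>2))"
    proof -
      have "L / (4 * y) + (L / (4 * y) + (1 + L * (1 - 1 / x))) = 1 + L * (1 - 1 / x + 1 / (2 * y))"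
        for L x y :: real
        by (simp add: distrib_left right_diff_distrib)
      then show ?thesis by blast
    qed
    also have "\<dots> \<le> 1 + ?L\<^sup>2 * (1 - 1 / (real (Suc n) + 1))"
    proof -
      have "1 / (2 * (real n + 1)\<^sup>2) \<le> 1 / (real n + 1) - 1 / (real n + 2)"
        by (simp add: divide_simps power2_eq_square)
      then have "1 - 1 / (real n + 1) + 1 / (2 * (real n + 1)\<^sup>2) \<le> 1 - 1 / (real (Suc n) + 1)"
        by (simp add: add.commute)
      then show ?thesis by (intro add_left_mono mult_left_mono) auto
    qed
    finally show ?case .
  qed
  obtain n where n: "A \<subseteq> {- int n..int n}"
  proof -
    have "finite (abs ` A)" using assms by simp
    then obtain M where "\<And>x. x \<in> abs ` A \<Longrightarrow> x \<le> M"
      using bdd_above_finite[of "abs ` A"] unfolding bdd_above_def by blast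
    then have "A \<subseteq> {- int (nat M)..int (nat M)}" by (force simp: abs_le_iff)
    then show ?thesis using that by blast
  qed
  have "(\<Sum>l\<in>A. 1 / wt a b l) \<le> (\<Sum>l\<in>{- int n..int n}. 1 / wt a b l)"
    by (rule sum_mono2) (use n in \<open>auto simp: less_imp_le\<close>)
  also have "\<dots> \<le> 1 + ?L\<^sup>2 * (1 - 1 / (real n + 1))" by (rule sym)
  also have "\<dots> \<le> 1 + ?L\<^sup>2 * 1" by (intro add_left_mono mult_left_mono) auto
  finally show ?thesis by simp
qed

text \<open>Sobolev embedding: Cauchy-Schwarz against the summable weight \<open>1 / wt\<close>.
  Order one suffices, so every order s >= 1 controls the l1 norm of the coefficients.\<close>

lemma sum_cmod_le_wn:
  assumes "a < b" "finite A" "1 \<le> s"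
  shows "(\<Sum>l\<in>A. cmod (c l)) \<le> sqrt (1 + (b - a)\<^sup>2) * wn a b A s c"
proof -
  have "(\<Sum>l\<in>A. cmod (c l)) = (\<Sum>l\<in>A. \<bar>1 / sqrt (wt a b l ^ s)\<bar> * \<bar>sqrt (wt a b l ^ s) * cmod (c l)\<bar>)"
    by (intro sum.cong refl) (simp add: abs_mult less_imp_neq[symmetric])
  also have "\<dots> \<le> L2_set (\<lambda>l. 1 / sqrt (wt a b l ^ s)) A * wn a b A s c"
    unfolding wn_def by (rule L2_set_mult_ineq)
  also have "L2_set (\<lambda>l. 1 / sqrt (wt a b l ^ s)) A \<le> sqrt (1 + (b - a)\<^sup>2)"
    unfolding L2_set_def
  proof (rule real_sqrt_le_mono)
    have "(\<Sum>l\<in>A. (1 / sqrt (wt a b l ^ s))\<^sup>2) \<le> (\<Sum>l\<in>A. 1 / wt a b l)"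
    proof (rule sum_mono)
      fix l
      have "wt a b l ^ 1 \<le> wt a b l ^ s"
        by (rule power_increasing[OF assms(3) wt_ge_1])
      then show "(1 / sqrt (wt a b l ^ s))\<^sup>2 \<le> 1 / wt a b l"
        by (simp add: power_divide frac_le)
    qed
    then show "(\<Sum>l\<in>A. (1 / sqrt (wt a b l ^ s))\<^sup>2) \<le> 1 + (b - a)\<^sup>2"
      using sum_inverse_wt[OF assms(1,2)] by linarith
  qed
  finally show ?thesis by (simp add: mult_right_mono)
qed

section \<open>The discrete Fourier transform\<close>

text \<open>Any \<open>N\<close> consecutive integers meet each residue class once. This lets the
  window \<open>modes\<close> be shifted or reflected inside sums of periodic functions.\<close>

lemma sum_residues:
  fixes g :: "int \<Rightarrow> 'a :: comm_monoid_add"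
  assumes N: "0 < N" and per: "\<And>l. g (l mod int N) = g l"
  shows "(\<Sum>l\<in>{A..<A + int N}. g l) = (\<Sum>i<N. g (int i))"
proof -
  have "bij_betw (\<lambda>l. l mod int N) {A..<A + int N} {0..<int N}"
  proof (rule bij_betw_byWitness[where f' = "\<lambda>r. A + (r - A) mod int N"])
    show "\<forall>l\<in>{A..<A + int N}. A + (l mod int N - A) mod int N = l"
      using N by (auto simp: mod_diff_left_eq)
    show "\<forall>r\<in>{0..<int N}. (A + (r - A) mod int N) mod int N = r"
      using N by (auto simp: mod_add_right_eq)
  qed (use N in auto)
  then have "(\<Sum>l\<in>{A..<A + int N}. g (l mod int N)) = (\<Sum>l\<in>{0..<int N}. g l)"
    by (rule sum.reindex_bij_betw)
  also have "\<dots> = (\<Sum>i<N. g (int i))"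
    by (rule sum.reindex_bij_witness[where i = int and j = nat]) auto
  finally show ?thesis by (simp add: per)
qed

locale grid =
  fixes a b :: real and N :: nat
  assumes ab: "a < b" and evN: "even N" and N0: "0 < N"
begin

abbreviation D :: "(nat \<Rightarrow> complex) \<Rightarrow> int \<Rightarrow> complex" where "D \<equiv> dft a b N"
abbreviation ID :: "(int \<Rightarrow> complex) \<Rightarrow> nat \<Rightarrow> complex" where "ID \<equiv> idft a b N"
abbreviation M :: "int set" where "M \<equiv> modes N"

lemma modes_eq: "M = {- (int N div 2)..<- (int N div 2) + int N}"
  using evN N0 by (auto simp: modes_def)

lemma finite_modes [simp]: "finite M"
  by (simp add: modes_def)

lemma sum_modes_shift:
  fixes g :: "int \<Rightarrow> 'a :: comm_monoid_add"
  assumes per: "\<And>l. g (l mod int N) = g l"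
  shows "(\<Sum>l\<in>M. g (l + m)) = (\<Sum>l\<in>M. g l)"
proof -
  have "(\<Sum>l\<in>M. g (l + m)) = (\<Sum>l\<in>{- (int N div 2) + m..<- (int N div 2) + m + int N}. g l)"
    unfolding modes_eq
    by (rule sum.reindex_bij_witness[where i = "\<lambda>l. l - m" and j = "\<lambda>l. l + m"]) auto
  also have "\<dots> = (\<Sum>l\<in>M. g l)"
    unfolding modes_eq by (simp only: sum_residues[where g = g, OF N0 per])
  finally show ?thesis .
qed

lemma mu_gridx: "mu a b l * (gridx a b N j - a) = 2 * pi * real_of_int l * real j / real N"
  using ab by (simp add: mu_def gridx_def)

lemma dft_alt: "D v l = (\<Sum>j<N. v j * ei (- (2 * pi * real_of_int l * real j / real N))) / of_nat N"
  by (simp add: dft_def mu_gridx)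

lemma idft_alt: "ID c j = (\<Sum>l\<in>M. c l * ei (2 * pi * real_of_int l * real j / real N))"
  by (simp add: idft_def mu_gridx)

lemma ei_mod: "ei (2 * pi * real_of_int (l mod int N) * real j / real N)
    = ei (2 * pi * real_of_int l * real j / real N)"
proof -
  have "real_of_int l = real N * real_of_int (l div int N) + real_of_int (l mod int N)"
    by (metis mult_div_mod_eq of_int_add of_int_mult of_int_of_nat_eq)
  then have "2 * pi * real_of_int l * real j / real N
      = 2 * pi * real_of_int (l mod int N) * real j / real N
        + 2 * pi * real_of_int (l div int N * int j)"
    using N0 by (simp add: field_simps)
  then show ?thesis by (simp only: ei_add ei_int_period mult_1_right)
qed

lemma ei_mod_minus: "ei (- (2 * pi * real_of_int (l mod int N) * real j / real N))
    = ei (- (2 * pi * real_of_int l * real j / real N))"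
  using arg_cong[OF ei_mod[of l j], of cnj] by simp

lemma dft_mod: "D v (l mod int N) = D v l"
  by (simp add: dft_alt ei_mod_minus)

lemma dft_cong_mod: "l mod int N = k mod int N \<Longrightarrow> D v l = D v k"
  using dft_mod[of v l] dft_mod[of v k] by simp

lemma sum_ei:
  "(\<Sum>j<N. ei (2 * pi * real_of_int m * real j / real N)) = (if int N dvd m then of_nat N else 0)"
proof -
  define z where "z = ei (2 * pi * real_of_int m / real N)"
  have zj: "ei (2 * pi * real_of_int m * real j / real N) = z ^ j" for j
    unfolding z_def ei_power by (simp add: mult_ac)
  show ?thesis
  proof (cases "int N dvd m")
    case True
    then obtain k where k: "m = int N * k" by auto
    have "z = ei (2 * pi * of_int k)"
      unfolding z_def k using N0 by (simp add: mult.assoc)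
    then have "z = 1" by (simp add: ei_int_period)
    then show ?thesis using True by (simp add: zj)
  next
    case False
    have "z \<noteq> 1"
    proof
      assume "z = 1"
      then obtain k where "2 * pi * real_of_int m / real N = 2 * pi * real_of_int k"
        unfolding z_def ei_eq_1_iff by auto
      then have "real_of_int m = real_of_int (int N * k)"
        using N0 by (simp add: field_simps)
      then have "m = int N * k" by linarith
      then show False using False by simp
    qed
    moreover have "z ^ N = 1"
      using zj[of N] N0 ei_int_period[of m] by simp
    ultimately show ?thesis
      using False by (simp add: zj sum_gp_strict)
  qed
qed

lemma modes_diff_dvd: "l \<in> M \<Longrightarrow> k \<in> M \<Longrightarrow> int N dvd k - l \<longleftrightarrow> k = l"
proof
  assume lk: "l \<in> M" "k \<in> M" and d: "int N dvd k - l"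
  then have "\<bar>k - l\<bar> < int N" by (auto simp: modes_eq)
  then show "k = l" using d dvd_imp_le_int[of "k - l" "int N"] by auto
qed simp

lemma dft_idft: "l \<in> M \<Longrightarrow> D (ID c) l = c l"
proof -
  assume l: "l \<in> M"
  have "D (ID c) l * of_nat N = (\<Sum>j<N. ID c j * ei (- (2 * pi * real_of_int l * real j / real N)))"
    using N0 by (simp add: dft_alt)
  also have "\<dots> = (\<Sum>j<N. \<Sum>k\<in>M. c k * ei (2 * pi * real_of_int (k - l) * real j / real N))"
    by (simp add: idft_alt sum_distrib_right mult.assoc ring_distribs diff_divide_distrib
        flip: ei_add)
  also have "\<dots> = (\<Sum>k\<in>M. c k * (\<Sum>j<N. ei (2 * pi * real_of_int (k - l) * real j / real N)))"
    by (subst sum.swap) (simp add: sum_distrib_left)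
  also have "\<dots> = (\<Sum>k\<in>M. if k = l then c k * of_nat N else 0)"
    unfolding sum_ei by (intro sum.cong refl) (simp add: l modes_diff_dvd)
  also have "\<dots> = c l * of_nat N" using l by simp
  finally show ?thesis using N0 by simp
qed

lemma idft_dft: "j < N \<Longrightarrow> ID (D v) j = v j"
proof -
  assume j: "j < N"
  have *: "(\<Sum>l\<in>M. ei (2 * pi * real_of_int l * (real j - real i) / real N))
      = (if i = j then of_nat N else 0)" if "i < N" for i
  proof -
    have "(\<Sum>l\<in>M. ei (2 * pi * real_of_int l * (real j - real i) / real N))
      = (\<Sum>n<N. ei (2 * pi * real_of_int (int n) * (real j - real i) / real N))"
      unfolding modes_eq
    proof (rule sum_residues[OF N0])
      fix l
      show "ei (2 * pi * real_of_int (l mod int N) * (real j - real i) / real N)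
          = ei (2 * pi * real_of_int l * (real j - real i) / real N)"
        using arg_cong2[OF ei_mod[of l j] ei_mod_minus[of l i], of "(*)"]
        by (simp add: ring_distribs diff_divide_distrib flip: ei_add)
    qed
    also have "\<dots> = (\<Sum>n<N. ei (2 * pi * real_of_int (int j - int i) * real n / real N))"
      by (simp add: mult_ac)
    also have "\<dots> = (if i = j then of_nat N else 0)"
    proof -
      have "int N dvd int j - int i \<longleftrightarrow> i = j"
      proof
        assume d: "int N dvd int j - int i"
        have "\<bar>int j - int i\<bar> < int N" using j that by linarith
        then have "int j - int i = 0"
          using dvd_imp_le_int[OF _ d] by linarith
        then show "i = j" by simp
      qed simp
      then show ?thesis by (simp only: sum_ei)
    qed
    finally show ?thesis .
  qed
  have "ID (D v) j * of_nat N
      = (\<Sum>l\<in>M. \<Sum>i<N. v i * ei (2 * pi * real_of_int l * (real j - real i) / real N))"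
  proof -
    have "ID (D v) j * of_nat N
        = (\<Sum>l\<in>M. (D v l * of_nat N) * ei (2 * pi * real_of_int l * real j / real N))"
      unfolding idft_alt sum_distrib_right by (simp add: mult_ac)
    also have "\<dots> = (\<Sum>l\<in>M. (\<Sum>i<N. v i * ei (- (2 * pi * real_of_int l * real i / real N)))
        * ei (2 * pi * real_of_int l * real j / real N))"
      using N0 by (simp add: dft_alt)
    also have "\<dots> = (\<Sum>l\<in>M. \<Sum>i<N. v i * ei (2 * pi * real_of_int l * (real j - real i) / real N))"
      unfolding sum_distrib_right
      by (intro sum.cong refl)
         (simp add: mult.assoc ring_distribs diff_divide_distrib flip: ei_add)
    finally show ?thesis .
  qed
  also have "\<dots> = (\<Sum>i<N. v i * (\<Sum>l\<in>M. ei (2 * pi * real_of_int l * (real j - real i) / real N)))"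
    by (subst sum.swap) (simp add: sum_distrib_left)
  also have "\<dots> = (\<Sum>i<N. if i = j then v i * of_nat N else 0)"
    by (intro sum.cong refl) (auto simp: *)
  also have "\<dots> = v j * of_nat N" using j by simp
  finally show ?thesis using N0 by simp
qed

lemma dft_add: "D (\<lambda>j. v j + w j) l = D v l + D w l"
  by (simp add: dft_def sum.distrib ring_distribs add_divide_distrib)

lemma dft_minus: "D (\<lambda>j. - v j) l = - D v l"
  by (simp add: dft_def sum_negf)

lemma dft_diff: "D (\<lambda>j. v j - w j) l = D v l - D w l"
  by (simp add: dft_def sum_subtractf ring_distribs diff_divide_distrib)

lemma dft_scale: "D (\<lambda>j. c * v j) l = c * D v l"
  by (simp add: dft_def sum_distrib_left mult_ac)

lemma dft_cong: "(\<And>j. j < N \<Longrightarrow> v j = w j) \<Longrightarrow> D v l = D w l"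
  by (simp add: dft_def)

lemma dft_cnj: "D (\<lambda>j. cnj (v j)) l = cnj (D v (- l))"
  by (simp add: dft_alt)

text \<open>Products become cyclic convolutions. The index \<open>l - k\<close> may leave
  \<open>M\<close>; \<open>dft\<close> is \<open>N\<close>-periodic in its index, and this
  periodicity is where the aliasing of products is hidden.\<close>

lemma dft_mult: "D (\<lambda>j. v j * w j) l = (\<Sum>k\<in>M. D v k * D w (l - k))"
proof -
  have "D (\<lambda>j. v j * w j) l = D (\<lambda>j. ID (D v) j * w j) l"
    by (rule dft_cong) (simp add: idft_dft)
  also have "\<dots> = (\<Sum>j<N. \<Sum>k\<in>M. D v k * (w j * ei (- (2 * pi * real_of_int (l - k) * real j / real N)))) / of_nat N"
    unfolding dft_alt[of "\<lambda>j. ID (D v) j * w j"] unfolding idft_alt sum_distrib_right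
    by (intro arg_cong2[where f = "(/)"] sum.cong refl)
       (simp add: mult.assoc mult.left_commute ring_distribs diff_divide_distrib flip: ei_add)
  also have "\<dots> = (\<Sum>k\<in>M. D v k * D w (l - k))"
    unfolding dft_alt[of w]
    by (subst sum.swap) (simp add: sum_distrib_left sum_divide_distrib mult_ac)
  finally show ?thesis .
qed

section \<open>Representatives modulo N and their weights\<close>

definition red :: "int \<Rightarrow> int" where
  "red l = (l + int N div 2) mod int N - int N div 2"

lemma red_in: "red l \<in> M"
proof -
  have "0 \<le> (l + int N div 2) mod int N" "(l + int N div 2) mod int N < int N"
    using N0 by auto
  then show ?thesis by (simp add: modes_eq red_def)
qed

lemma red_mod: "red l mod int N = l mod int N"
  unfolding red_def by (simp add: mod_diff_left_eq)

lemma red_id: "l \<in> M \<Longrightarrow> red l = l"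
  by (auto simp: red_def modes_eq)

lemma red_mod_arg: "red (l mod int N) = red l"
  unfolding red_def by (simp add: mod_add_left_eq)

lemma dft_red: "D v (red l) = D v l"
  by (rule dft_cong_mod) (rule red_mod)

text \<open>Two distinct members of a residue class differ by at least \<open>N\<close>, while |l|
  <= N/2. The class of N/2 has two members of least modulus, hence only a weak inequality.\<close>

lemma modes_abs_minimal:
  assumes l: "l \<in> M" and k: "k mod int N = l mod int N"
  shows "\<bar>l\<bar> \<le> \<bar>k\<bar>"
proof (cases "k = l")
  case False
  from k have "int N dvd k - l" by (simp add: mod_eq_dvd_iff)
  then have "int N \<le> \<bar>k - l\<bar>" using False dvd_imp_le_int[of "k - l" "int N"] by auto
  moreover have "\<bar>l\<bar> \<le> int N div 2" "2 * (int N div 2) = int N"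
    using l evN by (auto simp: modes_eq)
  ultimately show ?thesis by linarith
qed simp

text \<open>Reflection does not preserve \<open>M\<close>: -N/2 goes to N/2, whose representative is
  -N/2 again. The weight is even and does not notice this, which makes conjugation an isometry
  below.\<close>

lemma wt_red: "wt a b (red (- l)) = wt a b l" if "l \<in> M"
proof -
  have "\<bar>red (- l)\<bar> = \<bar>l\<bar>"
  proof (rule antisym)
    show "\<bar>red (- l)\<bar> \<le> \<bar>l\<bar>"
      using modes_abs_minimal[OF red_in, of "- l"] red_mod[of "- l"] by simp
    have "- red (- l) mod int N = l mod int N"
      using red_mod[of "- l"] mod_minus_cong[of "red (- l)" "int N" "- l"] by simp
    then show "\<bar>l\<bar> \<le> \<bar>red (- l)\<bar>"
      using modes_abs_minimal[OF that, of "- red (- l)"] by simp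
  qed
  then have "red (- l) = l \<or> red (- l) = - l" by linarith
  then show ?thesis by (auto simp: wt_def)
qed

text \<open>The number \<open>l\<close> is congruent to \<open>red k + red (l - k)\<close> and has
  least modulus in its class, so aliasing can only lower a frequency. The rest is (x + y)^2 <= 2 x^2
  + 2 y^2; the factor 4 comes from passing to the maximum.\<close>

lemma wt_subadd:
  assumes l: "l \<in> M"
  shows "wt a b l ^ s \<le> 4 ^ s * (wt a b (red k) ^ s + wt a b (red (l - k)) ^ s)"
proof -
  let ?x = "red k" and ?y = "red (l - k)"
  have "(?x + ?y) mod int N = l mod int N"
    by (metis add_diff_cancel_left' add_diff_eq mod_add_eq red_mod)
  then have "\<bar>l\<bar> \<le> \<bar>?x + ?y\<bar>" by (rule modes_abs_minimal[OF l])
  then have "real_of_int \<bar>l\<bar> \<le> real_of_int \<bar>?x + ?y\<bar>" by (simp only: of_int_le_iff)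
  then have "\<bar>real_of_int l\<bar> \<le> \<bar>real_of_int (?x + ?y)\<bar>" by simp
  then have "\<bar>mu a b l\<bar> \<le> \<bar>mu a b (?x + ?y)\<bar>"
    using ab by (simp add: mu_def abs_mult divide_right_mono)
  then have "(mu a b l)\<^sup>2 \<le> (mu a b (?x + ?y))\<^sup>2" by (simp add: abs_le_square_iff)
  also have "mu a b (?x + ?y) = mu a b ?x + mu a b ?y"
    by (simp add: mu_def algebra_simps add_divide_distrib)
  also have "(mu a b ?x + mu a b ?y)\<^sup>2 \<le> 2 * (mu a b ?x)\<^sup>2 + 2 * (mu a b ?y)\<^sup>2"
    using sum_squares_bound[of "mu a b ?x" "mu a b ?y"] by (simp add: power2_sum)
  finally have "wt a b l \<le> 2 * (wt a b ?x + wt a b ?y)"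
    by (simp add: wt_def)
  also have "\<dots> \<le> 4 * max (wt a b ?x) (wt a b ?y)" by simp
  finally have "wt a b l ^ s \<le> (4 * max (wt a b ?x) (wt a b ?y)) ^ s"
    by (rule power_mono) simp
  also have "\<dots> = 4 ^ s * max (wt a b ?x) (wt a b ?y) ^ s" by (simp add: power_mult_distrib)
  also have "\<dots> \<le> 4 ^ s * (wt a b ?x ^ s + wt a b ?y ^ s)"
    by (intro mult_left_mono) (auto simp: max_def)
  finally show ?thesis .
qed

end

lemma L2_set_sum_le:
  "finite B \<Longrightarrow> (\<And>i k. 0 \<le> f i k) \<Longrightarrow> L2_set (\<lambda>i. \<Sum>k\<in>B. f i k) A \<le> (\<Sum>k\<in>B. L2_set (\<lambda>i. f i k) A)"
proof (induction B rule: finite_induct)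
  case (insert x B)
  have "L2_set (\<lambda>i. f i x + (\<Sum>k\<in>B. f i k)) A \<le> L2_set (\<lambda>i. f i x) A + L2_set (\<lambda>i. \<Sum>k\<in>B. f i k) A"
    by (rule L2_set_triangle_ineq)
  then show ?case using insert by simp
qed (simp add: L2_set_0')

context grid
begin

text \<open>Young's inequality for an l2 and an l1 factor: Minkowski, then invariance of the l2 norm
  under cyclic shifts.\<close>

lemma L2_set_cyclic_convolution:
  assumes p: "\<And>l. p (l mod int N) = p l" "\<And>l. 0 \<le> p l" and q: "\<And>l. 0 \<le> q l"
  shows "L2_set (\<lambda>l. \<Sum>k\<in>M. p (l - k) * q k) M \<le> L2_set p M * (\<Sum>k\<in>M. q k)"
proof -
  have "L2_set (\<lambda>l. \<Sum>k\<in>M. p (l - k) * q k) M \<le> (\<Sum>k\<in>M. L2_set (\<lambda>l. p (l - k) * q k) M)"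
    by (rule L2_set_sum_le) (use p q in auto)
  also have "\<dots> = (\<Sum>k\<in>M. L2_set p M * q k)"
  proof (rule sum.cong[OF refl])
    fix k
    have "L2_set (\<lambda>l. p (l + (- k))) M = L2_set p M"
      unfolding L2_set_def
      using sum_modes_shift[of "\<lambda>l. (p l)\<^sup>2" "- k"] p by simp
    then show "L2_set (\<lambda>l. p (l - k) * q k) M = L2_set p M * q k"
      using q[of k] by (simp flip: L2_set_left_distrib)
  qed
  finally show ?thesis by (simp add: sum_distrib_left)
qed

definition Kalg :: "nat \<Rightarrow> real" where
  "Kalg s = 2 ^ (s + 1) * sqrt (1 + (b - a)\<^sup>2)"

text \<open>By \<open>wt_subadd\<close> the weight at \<open>l\<close> falls on one of the two
  factors; that factor is measured in weighted l2 and the other in l1, where the embedding applies.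
  The two placements give the additional factor 2 in \<open>Kalg\<close>, and nothing depends on
  \<open>N\<close>.\<close>

lemma wn_dft_mult:
  assumes s: "1 \<le> s"
  shows "wn a b M s (D (\<lambda>j. v j * w j)) \<le> Kalg s * (wn a b M s (D v) * wn a b M s (D w))"
proof -
  let ?p = "\<lambda>v l. sqrt (wt a b (red l) ^ s) * cmod (D v l)"
  let ?S = "\<lambda>v. \<Sum>k\<in>M. cmod (D v k)"
  have p_mod: "?p v (l mod int N) = ?p v l" for v l
    by (simp add: red_mod_arg dft_mod)
  have Lp: "L2_set (?p v) M = wn a b M s (D v)" for v
    unfolding wn_def by (rule L2_set_cong) (auto simp: red_id)
  have pt: "sqrt (wt a b l ^ s) * cmod (D (\<lambda>j. v j * w j) l)
      \<le> 2 ^ s * (\<Sum>k\<in>M. ?p w (l - k) * cmod (D v k)) + 2 ^ s * (\<Sum>k\<in>M. ?p v (l - k) * cmod (D w k))"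
    if l: "l \<in> M" for l
  proof -
    have sub: "sqrt (wt a b l ^ s) \<le> 2 ^ s * (sqrt (wt a b (red k) ^ s) + sqrt (wt a b (red (l - k)) ^ s))" for k
    proof -
      have "sqrt (wt a b l ^ s) \<le> sqrt (4 ^ s * (wt a b (red k) ^ s + wt a b (red (l - k)) ^ s))"
        by (rule real_sqrt_le_mono[OF wt_subadd[OF l]])
      also have "\<dots> = 2 ^ s * sqrt (wt a b (red k) ^ s + wt a b (red (l - k)) ^ s)"
        by (simp add: real_sqrt_mult real_sqrt_power)
      also have "\<dots> \<le> 2 ^ s * (sqrt (wt a b (red k) ^ s) + sqrt (wt a b (red (l - k)) ^ s))"
        by (intro mult_left_mono sqrt_add_le_add_sqrt) auto
      finally show ?thesis .
    qed
    have "sqrt (wt a b l ^ s) * cmod (D (\<lambda>j. v j * w j) l)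
        \<le> sqrt (wt a b l ^ s) * (\<Sum>k\<in>M. cmod (D v k) * cmod (D w (l - k)))"
      unfolding dft_mult
      by (intro mult_left_mono order_trans[OF norm_sum]) (auto simp: norm_mult)
    also have "\<dots> = (\<Sum>k\<in>M. sqrt (wt a b l ^ s) * (cmod (D v k) * cmod (D w (l - k))))"
      by (simp add: sum_distrib_left)
    also have "\<dots> \<le> (\<Sum>k\<in>M. 2 ^ s * (?p w (l - k) * cmod (D v k)) + 2 ^ s * (?p v k * cmod (D w (l - k))))"
    proof (rule sum_mono)
      fix k
      show "sqrt (wt a b l ^ s) * (cmod (D v k) * cmod (D w (l - k)))
        \<le> 2 ^ s * (?p w (l - k) * cmod (D v k)) + 2 ^ s * (?p v k * cmod (D w (l - k)))"
        using mult_right_mono[OF sub[of k], of "cmod (D v k) * cmod (D w (l - k))"]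
        by (simp add: algebra_simps)
    qed
    also have "\<dots> = 2 ^ s * (\<Sum>k\<in>M. ?p w (l - k) * cmod (D v k))
        + 2 ^ s * (\<Sum>k\<in>M. ?p v k * cmod (D w (l - k)))"
      by (simp add: sum.distrib sum_distrib_left)
    \<comment> \<open>Reflecting the summation index makes the weighted factor the shifted one in
      both sums. The set \<open>M\<close> is not symmetric, so the reflection has to pass through
      periodicity.\<close>
    also have "(\<Sum>k\<in>M. ?p v k * cmod (D w (l - k))) = (\<Sum>k\<in>M. ?p v (l - k) * cmod (D w k))"
    proof -
      let ?g = "\<lambda>k. ?p v k * cmod (D w (l - k))"
      have g: "?g (k mod int N) = ?g k" for k
      proof -
        have "D w (l - k mod int N) = D w (l - k)"
          by (rule dft_cong_mod) (simp add: mod_diff_right_eq)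
        then show ?thesis by (simp add: p_mod red_mod_arg dft_mod)
      qed
      let ?h = "\<lambda>k. ?g (l - k)"
      have h: "?h (k mod int N) = ?h k" for k
        by (metis (no_types, lifting) g mod_diff_right_eq)
      have "(\<Sum>k\<in>M. ?g k) = (\<Sum>i<N. ?g (int i))"
        unfolding modes_eq by (rule sum_residues[where g = ?g, OF N0 g])
      also have "\<dots> = (\<Sum>k\<in>{0..<int N}. ?g k)"
        using sum_residues[where g = ?g, OF N0 g, of 0] by simp
      also have "\<dots> = (\<Sum>k\<in>{l - int N + 1..<l - int N + 1 + int N}. ?h k)"
        by (rule sum.reindex_bij_witness[where i = "\<lambda>k. l - k" and j = "\<lambda>k. l - k"]) auto
      also have "\<dots> = (\<Sum>k\<in>M. ?h k)"
        unfolding modes_eq by (simp only: sum_residues[where g = ?h, OF N0 h])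
      finally show ?thesis by simp
    qed
    finally show ?thesis .
  qed
  have "wn a b M s (D (\<lambda>j. v j * w j)) \<le> L2_set (\<lambda>l. 2 ^ s * (\<Sum>k\<in>M. ?p w (l - k) * cmod (D v k))
        + 2 ^ s * (\<Sum>k\<in>M. ?p v (l - k) * cmod (D w k))) M"
    unfolding wn_def by (rule L2_set_mono) (use pt in auto)
  also have "\<dots> \<le> L2_set (\<lambda>l. 2 ^ s * (\<Sum>k\<in>M. ?p w (l - k) * cmod (D v k))) M
        + L2_set (\<lambda>l. 2 ^ s * (\<Sum>k\<in>M. ?p v (l - k) * cmod (D w k))) M"
    by (rule L2_set_triangle_ineq)
  also have "\<dots> = 2 ^ s * (L2_set (\<lambda>l. \<Sum>k\<in>M. ?p w (l - k) * cmod (D v k)) M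
        + L2_set (\<lambda>l. \<Sum>k\<in>M. ?p v (l - k) * cmod (D w k)) M)"
    by (simp add: ring_distribs flip: L2_set_right_distrib)
  also have "\<dots> \<le> 2 ^ s * (wn a b M s (D w) * ?S v + wn a b M s (D v) * ?S w)"
    unfolding Lp[symmetric]
    by (intro mult_left_mono add_mono L2_set_cyclic_convolution p_mod) auto
  also have "\<dots> \<le> 2 ^ s * (wn a b M s (D w) * (sqrt (1 + (b - a)\<^sup>2) * wn a b M s (D v))
      + wn a b M s (D v) * (sqrt (1 + (b - a)\<^sup>2) * wn a b M s (D w)))"
    by (intro mult_left_mono add_mono sum_cmod_le_wn ab s) auto
  also have "\<dots> = Kalg s * (wn a b M s (D v) * wn a b M s (D w))"
    by (simp add: Kalg_def algebra_simps)
  finally show ?thesis .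
qed

text \<open>Conjugation reflects the coefficients. With the weight taken at the representative the
  summand is periodic, so a reflected window of length \<open>N\<close> gives the same sum.\<close>

lemma wn_dft_cnj: "wn a b M s (D (\<lambda>j. cnj (v j))) = wn a b M s (D v)"
proof -
  let ?g = "\<lambda>l. wt a b (red l) ^ s * (cmod (D v l))\<^sup>2"
  have g: "?g (k mod int N) = ?g k" for k
    by (simp add: red_mod_arg dft_mod)
  have h: "?g (- (k mod int N)) = ?g (- k)" for k
    by (metis (no_types, lifting) g mod_minus_eq)
  have "(wn a b M s (D (\<lambda>j. cnj (v j))))\<^sup>2 = (\<Sum>l\<in>M. ?g (- l))"
    unfolding wn_sq by (intro sum.cong refl) (simp add: dft_cnj wt_red)
  also have "\<dots> = (\<Sum>i<N. ?g (- int i))"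
    unfolding modes_eq by (rule sum_residues[where g = "\<lambda>k. ?g (- k)", OF N0 h])
  also have "\<dots> = (\<Sum>k\<in>{0..<int N}. ?g (- k))"
    using sum_residues[where g = "\<lambda>k. ?g (- k)", OF N0 h, of 0] by simp
  also have "\<dots> = (\<Sum>k\<in>{- int N + 1..<- int N + 1 + int N}. ?g k)"
    by (rule sum.reindex_bij_witness[where i = uminus and j = uminus]) auto
  also have "\<dots> = (\<Sum>k\<in>M. ?g k)"
    unfolding modes_eq by (simp only: sum_residues[where g = ?g, OF N0 g])
  also have "\<dots> = (wn a b M s (D v))\<^sup>2"
    unfolding wn_sq by (intro sum.cong refl) (simp add: red_id)
  finally show ?thesis by simp
qed

end

section \<open>Cubic nonlinearities\<close>

text \<open>The only nonlinearity that is ever estimated: the cubic term, its resonant and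
  non-resonant parts and all their derivatives are sums of values of \<open>T3\<close>, complex
  linear in two slots and conjugate linear in the third.\<close>

definition T3 :: "real \<Rightarrow> (nat \<Rightarrow> complex) \<Rightarrow> (nat \<Rightarrow> complex) \<Rightarrow> (nat \<Rightarrow> complex) \<Rightarrow> nat \<Rightarrow> complex" where
  "T3 lam x y z j = complex_of_real lam * x j * y j * cnj (z j)"

definition fN :: "real \<Rightarrow> (nat \<Rightarrow> complex) \<Rightarrow> nat \<Rightarrow> complex" where
  "fN lam v j = fnl lam (v j)"

text \<open>The derivative of the cubic map at \<open>v\<close> in direction \<open>d\<close>. It is
  linear over the reals only, because \<open>d\<close> also enters conjugated.\<close>

definition DfN :: "real \<Rightarrow> (nat \<Rightarrow> complex) \<Rightarrow> (nat \<Rightarrow> complex) \<Rightarrow> nat \<Rightarrow> complex" where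
  "DfN lam v d j = 2 * T3 lam v d v j + T3 lam v v d j"

text \<open>Here \<open>p\<close> stands for z_+ and \<open>q\<close> for the conjugate of z_-. Then
  \<open>FF lam p q\<close> is f_+ and \<open>FF lam q p\<close> the conjugate of f_-;
  \<open>GG\<close> plays the same part for g. \<open>DFF\<close> and \<open>DGG\<close> are their
  derivatives along \<open>(x, y)\<close>.\<close>

definition FF :: "real \<Rightarrow> (nat \<Rightarrow> complex) \<Rightarrow> (nat \<Rightarrow> complex) \<Rightarrow> nat \<Rightarrow> complex" where
  "FF lam p q j = T3 lam p p p j + 2 * T3 lam p q q j"

definition GG :: "real \<Rightarrow> (nat \<Rightarrow> complex) \<Rightarrow> (nat \<Rightarrow> complex) \<Rightarrow> nat \<Rightarrow> complex" where
  "GG lam p q j = T3 lam p p q j"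

definition DFF where
  "DFF lam p q x y j = 2 * T3 lam p x p j + T3 lam p p x j
     + 2 * (T3 lam x q q j + T3 lam p y q j + T3 lam p q y j)"

definition DGG where
  "DGG lam p q x y j = 2 * T3 lam p x q j + T3 lam p p y j"

text \<open>The resonant and the non-resonant part of the cubic term, linearised at \<open>e p + cnj e q\<close> in
  the direction \<open>e x + cnj e y\<close>.\<close>

definition F1 :: "real \<Rightarrow> complex \<Rightarrow> (nat \<Rightarrow> complex) \<Rightarrow> (nat \<Rightarrow> complex) \<Rightarrow> (nat \<Rightarrow> complex) \<Rightarrow> (nat \<Rightarrow> complex)
    \<Rightarrow> nat \<Rightarrow> complex" where
  "F1 lam e p q x y j = e * (FF lam p q j + DFF lam p q x y j)
     + cnj e * (FF lam q p j + DFF lam q p y x j)"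

definition F3 :: "real \<Rightarrow> complex \<Rightarrow> (nat \<Rightarrow> complex) \<Rightarrow> (nat \<Rightarrow> complex) \<Rightarrow> (nat \<Rightarrow> complex) \<Rightarrow> (nat \<Rightarrow> complex)
    \<Rightarrow> nat \<Rightarrow> complex" where
  "F3 lam e p q x y j = e ^ 3 * (GG lam p q j + DGG lam p q x y j)
     + cnj e ^ 3 * (GG lam q p j + DGG lam q p y x j)"

lemma fN_T3: "fN lam v = T3 lam v v v"
  by (simp add: fun_eq_iff fN_def fnl_def T3_def complex_norm_square mult_ac flip: of_real_power)

lemma T3_minus [simp]: "T3 lam (\<lambda>j. - x j) y z j = - T3 lam x y z j"
  "T3 lam x (\<lambda>j. - y j) z j = - T3 lam x y z j" "T3 lam x y (\<lambda>j. - z j) j = - T3 lam x y z j"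
  by (simp_all add: T3_def)

lemma unit_cnj: "cmod e = 1 \<Longrightarrow> e * cnj e = 1"
  by (simp add: complex_norm_square[symmetric])

text \<open>Expanding the cube of a two-phase wave and using \<open>e * cnj e = 1\<close> leaves
  exactly the harmonics e, 1/e, e^3 and 1/e^3. Conjugates are treated as independent variables, so
  that the identity is purely algebraic.\<close>

lemma fN_phases:
  assumes "cmod e = 1"
  shows "fN lam (\<lambda>j. e * p j + cnj e * q j) j
    = e * FF lam p q j + cnj e * FF lam q p j + e ^ 3 * GG lam p q j + cnj e ^ 3 * GG lam q p j"
proof -
  have *: "(e * p + f * q) * (e * p + f * q) * (f * P + e * Q)
      = e * (p * p * P + 2 * (p * q * Q)) + f * (q * q * Q + 2 * (q * p * P))
        + e ^ 3 * (p * p * Q) + f ^ 3 * (q * q * P)"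
    if "e * f = 1" for e f p q P Q :: complex
    using that by algebra
  have "complex_of_real lam * ((e * p j + cnj e * q j) * (e * p j + cnj e * q j) * (cnj e * cnj (p j) + e * cnj (q j)))
    = e * FF lam p q j + cnj e * FF lam q p j + e ^ 3 * GG lam p q j + cnj e ^ 3 * GG lam q p j"
    unfolding *[OF unit_cnj[OF assms]]
    by (simp add: T3_def FF_def GG_def algebra_simps)
  then show ?thesis
    by (simp add: fN_T3 T3_def algebra_simps)
qed

lemma DfN_phases:
  assumes "cmod e = 1"
  shows "DfN lam (\<lambda>j. e * p j + cnj e * q j) (\<lambda>j. e * x j + cnj e * y j) j
    = e * DFF lam p q x y j + cnj e * DFF lam q p y x j
      + e ^ 3 * DGG lam p q x y j + cnj e ^ 3 * DGG lam q p y x j"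
proof -
  have *: "2 * ((e * p + f * q) * (e * x + f * y) * (f * P + e * Q))
      + (e * p + f * q) * (e * p + f * q) * (f * X + e * Y)
      = e * (2 * (p * x * P) + p * p * X + 2 * (x * q * Q + p * y * Q + p * q * Y))
        + f * (2 * (q * y * Q) + q * q * Y + 2 * (y * p * P + q * x * P + q * p * X))
        + e ^ 3 * (2 * (p * x * Q) + p * p * Y) + f ^ 3 * (2 * (q * y * P) + q * q * X)"
    if "e * f = 1" for e f p q P Q x y X Y :: complex
    using that by algebra
  have "complex_of_real lam * (2 * ((e * p j + cnj e * q j) * (e * x j + cnj e * y j) * (cnj e * cnj (p j) + e * cnj (q j)))
      + (e * p j + cnj e * q j) * (e * p j + cnj e * q j) * (cnj e * cnj (x j) + e * cnj (y j)))
    = e * DFF lam p q x y j + cnj e * DFF lam q p y x j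
      + e ^ 3 * DGG lam p q x y j + cnj e ^ 3 * DGG lam q p y x j"
    unfolding *[OF unit_cnj[OF assms]]
    by (simp add: DFF_def DGG_def T3_def algebra_simps)
  then show ?thesis
    by (simp add: DfN_def T3_def algebra_simps)
qed

text \<open>The link between scheme and solution: the two nonlinear parts of the scheme together
  form the first Taylor polynomial of the full cubic term at a two-phase wave.\<close>

lemma F1_F3_eq:
  assumes "cmod e = 1"
  shows "F1 lam e p q x y j + F3 lam e p q x y j
    = fN lam (\<lambda>j. e * p j + cnj e * q j) j
      + DfN lam (\<lambda>j. e * p j + cnj e * q j) (\<lambda>j. e * x j + cnj e * y j) j"
  unfolding fN_phases[OF assms] DfN_phases[OF assms] F1_def F3_def
  by (simp add: algebra_simps)

text \<open>Abstracts the discrete norms of order 2, 3 and 4. The constant one in the trilinear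
  bound keeps all later constants polynomials in the size of the data.\<close>

locale cubic_seminorm =
  fixes lam :: real and nm :: "(nat \<Rightarrow> complex) \<Rightarrow> real"
  assumes nm_nonneg [simp]: "0 \<le> nm x"
    and nm_add: "nm (\<lambda>j. x j + y j) \<le> nm x + nm y"
    and nm_scale: "nm (\<lambda>j. c * x j) = cmod c * nm x"
    and nm_T3: "nm (T3 lam x y z) \<le> nm x * nm y * nm z"
begin

lemma nm_minus: "nm (\<lambda>j. - x j) = nm x"
  using nm_scale[of "-1" x] by simp

lemma nm_diff: "nm (\<lambda>j. x j - y j) \<le> nm x + nm y"
  using nm_add[of x "\<lambda>j. - y j"] by (simp add: nm_minus)

lemma nm_T3_le:
  assumes "nm x \<le> A" "nm y \<le> B" "nm z \<le> C"
  shows "nm (T3 lam x y z) \<le> A * B * C"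
  by (rule order_trans[OF nm_T3]) (use assms nm_nonneg[of x] nm_nonneg[of y] in \<open>intro mult_mono mult_nonneg_nonneg; linarith?\<close>, auto)

text \<open>Bundles a bound for two grid functions with one for their difference, so that
  boundedness and Lipschitz continuity of a composite expression are derived in a single pass.
  Distance 0 recovers plain bounds.\<close>

definition close :: "real \<Rightarrow> real \<Rightarrow> (nat \<Rightarrow> complex) \<Rightarrow> (nat \<Rightarrow> complex) \<Rightarrow> bool" where
  "close B d x y \<longleftrightarrow> nm x \<le> B \<and> nm y \<le> B \<and> nm (\<lambda>j. x j - y j) \<le> d"

lemma close_refl: "nm x \<le> B \<Longrightarrow> close B 0 x x"
  using nm_scale[of 0 x] by (simp add: close_def)

lemma close_mono: "close B d x y \<Longrightarrow> B \<le> B' \<Longrightarrow> d \<le> d' \<Longrightarrow> close B' d' x y"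
  by (auto simp: close_def)

lemma close_nonneg: "close B d x y \<Longrightarrow> 0 \<le> B \<and> 0 \<le> d"
  unfolding close_def using nm_nonneg order_trans by blast

lemma close_add:
  assumes "close B d x y" "close B' d' x' y'"
  shows "close (B + B') (d + d') (\<lambda>j. x j + x' j) (\<lambda>j. y j + y' j)"
proof -
  have "nm (\<lambda>j. (x j - y j) + (x' j - y' j)) \<le> d + d'"
    using nm_add[of "\<lambda>j. x j - y j" "\<lambda>j. x' j - y' j"] assms by (auto simp: close_def)
  then show ?thesis
    using nm_add[of x x'] nm_add[of y y'] assms by (auto simp: close_def algebra_simps)
qed

lemma close_scale:
  assumes "close B d x y"
  shows "close (cmod c * B) (cmod c * d) (\<lambda>j. c * x j) (\<lambda>j. c * y j)"
proof -
  have "nm (\<lambda>j. c * (x j - y j)) \<le> cmod c * d"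
    using assms by (auto simp: close_def nm_scale mult_left_mono)
  then show ?thesis
    using assms by (auto simp: close_def nm_scale mult_left_mono right_diff_distrib)
qed

lemma close_scale_unit:
  assumes "close B d x y" "cmod c = 1"
  shows "close B d (\<lambda>j. c * x j) (\<lambda>j. c * y j)"
  using close_scale[OF assms(1), of c] assms(2) by simp

lemma close_double:
  assumes "close B d x y"
  shows "close (2 * B) (2 * d) (\<lambda>j. 2 * x j) (\<lambda>j. 2 * y j)"
  using close_scale[OF assms, of 2] by simp

text \<open>The arguments are exchanged one at a time; each of the three differences is at most B^2
  d.\<close>

lemma close_T3:
  assumes x: "close B d x x'" and y: "close B d y y'" and z: "close B d z z'"
  shows "close (B ^ 3) (3 * (B\<^sup>2 * d)) (T3 lam x y z) (T3 lam x' y' z')"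
proof -
  let ?m = "\<lambda>x y j. x j - y j :: complex"
  have eq: "(\<lambda>j. T3 lam x y z j - T3 lam x' y' z' j)
    = (\<lambda>j. (T3 lam (?m x x') y z j + T3 lam x' (?m y y') z j) + T3 lam x' y' (?m z z') j)"
    by (simp add: fun_eq_iff T3_def algebra_simps)
  have "nm (\<lambda>j. T3 lam x y z j - T3 lam x' y' z' j) \<le> (d * B * B + B * d * B) + B * B * d"
    unfolding eq
    by (intro order_trans[OF nm_add] add_mono nm_T3_le order_trans[OF nm_add])
       (use x y z in \<open>auto simp: close_def\<close>)
  moreover have "nm (T3 lam x y z) \<le> B * B * B" "nm (T3 lam x' y' z') \<le> B * B * B"
    by (intro nm_T3_le; use x y z in \<open>auto simp: close_def\<close>)+
  ultimately show ?thesis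
    by (simp add: close_def power2_eq_square power3_eq_cube algebra_simps)
qed

lemma close_FF:
  assumes "close B d p p'" "close B d q q'"
  shows "close (3 * B ^ 3) (9 * (B\<^sup>2 * d)) (FF lam p q) (FF lam p' q')"
proof -
  have "close (B ^ 3 + 2 * B ^ 3) (3 * (B\<^sup>2 * d) + 2 * (3 * (B\<^sup>2 * d))) (FF lam p q) (FF lam p' q')"
    unfolding FF_def[abs_def] by (intro close_add close_double close_T3 assms)
  then show ?thesis by (simp add: mult_ac)
qed

lemma close_DFF:
  assumes "close B d p p'" "close B d q q'" "close B d x x'" "close B d y y'"
  shows "close (9 * B ^ 3) (27 * (B\<^sup>2 * d)) (DFF lam p q x y) (DFF lam p' q' x' y')"
proof -
  have "close (2 * B ^ 3 + B ^ 3 + 2 * (B ^ 3 + B ^ 3 + B ^ 3))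
    (2 * (3 * (B\<^sup>2 * d)) + 3 * (B\<^sup>2 * d) + 2 * (3 * (B\<^sup>2 * d) + 3 * (B\<^sup>2 * d) + 3 * (B\<^sup>2 * d)))
    (DFF lam p q x y) (DFF lam p' q' x' y')"
    unfolding DFF_def[abs_def] by (intro close_add close_double close_T3 assms)
  then show ?thesis by (simp add: mult_ac)
qed

lemma close_GG:
  assumes "close B d p p'" "close B d q q'"
  shows "close (B ^ 3) (3 * (B\<^sup>2 * d)) (GG lam p q) (GG lam p' q')"
  unfolding GG_def[abs_def] by (intro close_T3 assms)

lemma close_DGG:
  assumes "close B d p p'" "close B d q q'" "close B d x x'" "close B d y y'"
  shows "close (3 * B ^ 3) (9 * (B\<^sup>2 * d)) (DGG lam p q x y) (DGG lam p' q' x' y')"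
proof -
  have "close (2 * B ^ 3 + B ^ 3) (2 * (3 * (B\<^sup>2 * d)) + 3 * (B\<^sup>2 * d))
    (DGG lam p q x y) (DGG lam p' q' x' y')"
    unfolding DGG_def[abs_def] by (intro close_add close_double close_T3 assms)
  then show ?thesis by (simp add: mult_ac)
qed

lemma close_F1:
  assumes "cmod e = 1" "close B d p p'" "close B d q q'" "close B d x x'" "close B d y y'"
  shows "close (24 * B ^ 3) (72 * (B\<^sup>2 * d)) (F1 lam e p q x y) (F1 lam e p' q' x' y')"
proof -
  have "close ((3 * B ^ 3 + 9 * B ^ 3) + (3 * B ^ 3 + 9 * B ^ 3))
    ((9 * (B\<^sup>2 * d) + 27 * (B\<^sup>2 * d)) + (9 * (B\<^sup>2 * d) + 27 * (B\<^sup>2 * d)))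
    (F1 lam e p q x y) (F1 lam e p' q' x' y')"
    unfolding F1_def[abs_def]
    by (intro close_add close_scale_unit close_FF close_DFF assms) (simp_all add: assms)
  then show ?thesis by (simp add: mult_ac)
qed

lemma close_F3:
  assumes "cmod e = 1" "close B d p p'" "close B d q q'" "close B d x x'" "close B d y y'"
  shows "close (8 * B ^ 3) (24 * (B\<^sup>2 * d)) (F3 lam e p q x y) (F3 lam e p' q' x' y')"
proof -
  have "close ((B ^ 3 + 3 * B ^ 3) + (B ^ 3 + 3 * B ^ 3))
    ((3 * (B\<^sup>2 * d) + 9 * (B\<^sup>2 * d)) + (3 * (B\<^sup>2 * d) + 9 * (B\<^sup>2 * d)))
    (F3 lam e p q x y) (F3 lam e p' q' x' y')"
    unfolding F3_def[abs_def]
    by (intro close_add close_scale_unit close_GG close_DGG assms) (simp_all add: assms norm_power)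
  then show ?thesis by (simp add: mult_ac)
qed

lemma close_fN:
  "close B d v v' \<Longrightarrow> close (B ^ 3) (3 * (B\<^sup>2 * d)) (fN lam v) (fN lam v')"
  unfolding fN_T3 by (intro close_T3)

lemma nm_DfN:
  assumes "nm v \<le> B" "nm d \<le> C"
  shows "nm (DfN lam v d) \<le> 3 * B\<^sup>2 * C"
proof -
  have "nm (DfN lam v d) \<le> 2 * (B * C * B) + B * B * C"
    unfolding DfN_def[abs_def]
    by (intro order_trans[OF nm_add] add_mono order_trans[OF eq_refl[OF nm_scale]])
       (use assms nm_T3_le in \<open>auto\<close>)
  then show ?thesis by (simp add: power2_eq_square algebra_simps)
qed

text \<open>The base point is exchanged slot by slot, which gives four terms; the two directions are
  then compared at the second base point.\<close>

lemma nm_DfN_diff: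
  assumes "close B e v v'" "nm d \<le> C" "nm (\<lambda>j. d j - d' j) \<le> g"
  shows "nm (\<lambda>j. DfN lam v d j - DfN lam v' d' j) \<le> 6 * B * C * e + 3 * B\<^sup>2 * g"
proof -
  let ?m = "\<lambda>x y j. x j - y j :: complex"
  have eq: "(\<lambda>j. DfN lam v d j - DfN lam v' d' j)
    = (\<lambda>j. (2 * (T3 lam (?m v v') d v j + T3 lam v' d (?m v v') j)
        + (T3 lam (?m v v') v d j + T3 lam v' (?m v v') d j)) + DfN lam v' (?m d d') j)"
    by (simp add: fun_eq_iff T3_def DfN_def algebra_simps)
  have "nm (\<lambda>j. DfN lam v d j - DfN lam v' d' j)
    \<le> (2 * (e * C * B + B * C * e) + (e * B * C + B * e * C)) + 3 * B\<^sup>2 * g"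
  proof -
    have m: "nm (?m v v') \<le> e" "nm v \<le> B" "nm v' \<le> B" using assms by (auto simp: close_def)
    have 1: "nm (\<lambda>j. 2 * (T3 lam (?m v v') d v j + T3 lam v' d (?m v v') j)) \<le> 2 * (e * C * B + B * C * e)"
      unfolding nm_scale
      using order_trans[OF nm_add add_mono[OF nm_T3_le[OF m(1) assms(2) m(2)] nm_T3_le[OF m(3) assms(2) m(1)]]]
      by simp
    have 2: "nm (\<lambda>j. T3 lam (?m v v') v d j + T3 lam v' (?m v v') d j) \<le> e * B * C + B * e * C"
      by (rule order_trans[OF nm_add add_mono[OF nm_T3_le[OF m(1) m(2) assms(2)] nm_T3_le[OF m(3) m(1) assms(2)]]])
    have 3: "nm (DfN lam v' (?m d d')) \<le> 3 * B\<^sup>2 * g"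
      by (rule nm_DfN[OF m(3) assms(3)])
    show ?thesis unfolding eq
      by (intro order_trans[OF nm_add add_mono[OF order_trans[OF nm_add add_mono[OF 1 2]] 3]] order_refl)
  qed
  then show ?thesis by (simp add: algebra_simps)
qed

text \<open>The Taylor expansion of a cubic is finite, so the remainder is explicit. The derivative
  is evaluated at the approximation \<open>d'\<close>, whose error \<open>g\<close> enters linearly;
  the quadratic and cubic terms need only the size \<open>r\<close> of the true increment.\<close>

lemma taylor_fN:
  assumes v: "nm v \<le> B" and d: "nm d \<le> r" and g: "nm (\<lambda>j. d j - d' j) \<le> g"
  shows "nm (\<lambda>j. fN lam (\<lambda>j. v j + d j) j - fN lam v j - DfN lam v d' j)
    \<le> 3 * B\<^sup>2 * g + (3 * B * r\<^sup>2 + r ^ 3)"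
proof -
  have eq: "(\<lambda>j. fN lam (\<lambda>j. v j + d j) j - fN lam v j - DfN lam v d' j)
    = (\<lambda>j. DfN lam v (\<lambda>j. d j - d' j) j + ((T3 lam d d v j + 2 * T3 lam v d d j) + T3 lam d d d j))"
    by (simp add: fun_eq_iff T3_def DfN_def fN_T3 algebra_simps)
  have "nm (\<lambda>j. 2 * T3 lam v d d j) \<le> 2 * (B * r * r)"
    using nm_T3_le[OF v d d] by (simp add: nm_scale)
  then have "nm (\<lambda>j. fN lam (\<lambda>j. v j + d j) j - fN lam v j - DfN lam v d' j)
    \<le> 3 * B\<^sup>2 * g + ((r * r * B + 2 * (B * r * r)) + r * r * r)"
    unfolding eq
    by (intro order_trans[OF nm_add] add_mono nm_DfN order_trans[OF nm_add] nm_T3_le assms)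
  then show ?thesis by (simp add: algebra_simps power2_eq_square power3_eq_cube)
qed

end

section \<open>One step as a discrete variation of constants formula\<close>

lemma derivative_terms:
  "fd_pl lam (p j) (cnj (q j)) (x j) (cnj (y j)) = DFF lam p q x y j"
  "cnj (fd_mi lam (p j) (cnj (q j)) (x j) (cnj (y j))) = DFF lam q p y x j"
  "gd_pl lam (p j) (cnj (q j)) (x j) (cnj (y j)) = DGG lam p q x y j"
  "cnj (gd_mi lam (p j) (cnj (q j)) (x j) (cnj (y j))) = DGG lam q p y x j"
proof -
  have re: "complex_of_real (Re w) = (w + cnj w) / 2" for w
    by (simp add: complex_eq_iff)
  have sqn: "(complex_of_real (cmod z))\<^sup>2 = z * cnj z" for z
    by (simp add: complex_norm_square[symmetric])
  show "fd_pl lam (p j) (cnj (q j)) (x j) (cnj (y j)) = DFF lam p q x y j"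
    unfolding fd_pl_def DFF_def T3_def re by (simp add: sqn field_simps)
  show "cnj (fd_mi lam (p j) (cnj (q j)) (x j) (cnj (y j))) = DFF lam q p y x j"
    unfolding fd_mi_def DFF_def T3_def re by (simp add: sqn field_simps)
  show "gd_pl lam (p j) (cnj (q j)) (x j) (cnj (y j)) = DGG lam p q x y j"
    "cnj (gd_mi lam (p j) (cnj (q j)) (x j) (cnj (y j))) = DGG lam q p y x j"
    by (simp_all add: gd_pl_def gd_mi_def DGG_def T3_def power2_eq_square)
qed

context grid begin

lemma idft_cong: "(\<And>l. l \<in> M \<Longrightarrow> c l = d l) \<Longrightarrow> ID c j = ID d j"
  by (simp add: idft_def)

lemma eq_idftI: "j < N \<Longrightarrow> (\<And>l. l \<in> M \<Longrightarrow> D v l = c l) \<Longrightarrow> v j = ID c j"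
  using idft_dft[of j v] idft_cong[of "D v" c j] by simp

lemma mu_red_sq: "l \<in> M \<Longrightarrow> (mu a b (red (- l)))\<^sup>2 = (mu a b l)\<^sup>2"
  using wt_red[of l] by (simp add: wt_def)

lemma dft_cnj_idft: "l \<in> M \<Longrightarrow> D (\<lambda>j. cnj (ID c j)) l = cnj (c (red (- l)))"
  using dft_red[of "ID c" "- l"] dft_idft[OF red_in, of c "- l"] by (simp add: dft_cnj)

lemma dft_cnj_red: "cnj (D v (red (- l))) = D (\<lambda>j. cnj (v j)) l"
  by (simp add: dft_cnj dft_red)

end

locale mti_scheme = grid +
  fixes lam eps tau :: real
  assumes eps: "0 < eps" and tau: "0 < tau"
begin

section \<open>Phase-shifted coefficients of the linear flow\<close>

definition kap :: real where "kap = 1 / eps\<^sup>2"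
definition rt :: "int \<Rightarrow> real" where "rt l = sqrt (1 + (mu a b l)\<^sup>2 * eps\<^sup>2)"
abbreviation om :: "int \<Rightarrow> real" where "om l \<equiv> omg a b eps l"

lemma om_eq: "om l = kap * rt l"
  by (simp add: omg_def kap_def rt_def)

lemma kap_pos: "0 < kap" and eps_kap: "eps\<^sup>2 * kap = 1" "kap * eps\<^sup>2 = 1"
  using eps by (simp_all add: kap_def)

lemma rt_ge_1: "1 \<le> rt l"
  by (simp add: rt_def)

lemma om_pos: "0 < om l"
  using kap_pos rt_ge_1[of l] by (simp add: om_eq)

lemma eps_om: "eps\<^sup>2 * om l = rt l"
  using eps_kap by (simp add: om_eq flip: mult.assoc)

lemma lmi_eq: "lmi a b eps l = om l - kap" and lpl_eq: "lpl a b eps l = - om l - kap"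
  by (simp_all add: lmi_def lpl_def om_eq rt_def kap_def divide_simps)

text \<open>The kernels of the variation of constants formula for the position and the velocity:
  since eps^2 om = rt, they are sin (om (tau - th)) / (eps^2 om) and cos (om (tau - th)) /
  eps^2.\<close>

definition ks :: "int \<Rightarrow> real \<Rightarrow> real" where "ks l th = sin (om l * (tau - th)) / rt l"
definition kc :: "int \<Rightarrow> real \<Rightarrow> real" where "kc l th = cos (om l * (tau - th)) * kap"

lemma ei_sum_cos: "ei x + ei (- x) = of_real (2 * cos x)"
  and ei_diff_sin: "ei x - ei (- x) = \<i> * of_real (2 * sin x)"
  by (simp_all add: ei_cis complex_eq_iff)

text \<open>The carrier shifts the characteristic exponents \<open>lmi\<close> and
  \<open>lpl\<close> of the amplitude equation to om and -om, those of the Klein-Gordon mode. All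
  identities for the coefficients rest on this.\<close>

lemma phase_exp: "ei (kap * s) * ei (s * lmi a b eps l) = ei (om l * s)"
  "ei (kap * s) * ei (s * lpl a b eps l) = ei (- (om l * s))"
  by (simp_all add: lmi_eq lpl_eq algebra_simps flip: ei_add)

lemma lpl_lmi: "lpl a b eps l - lmi a b eps l = - 2 * om l"
  by (simp add: lmi_eq lpl_eq)

lemma phase_a: "ei (kap * s) * acf a b eps l s = of_real (cos (om l * s)) + \<i> * of_real (kap * (sin (om l * s) / om l))"
proof -
  have "ei (kap * s) * acf a b eps l s * of_real (2 * om l)
      = of_real (lmi a b eps l) * (ei (kap * s) * ei (s * lpl a b eps l))
        - of_real (lpl a b eps l) * (ei (kap * s) * ei (s * lmi a b eps l))"
    using om_pos[of l] unfolding acf_def lpl_lmi by (simp add: field_simps)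
  also have "\<dots> = of_real (om l) * (ei (om l * s) + ei (- (om l * s))) + of_real kap * (ei (om l * s) - ei (- (om l * s)))"
    unfolding phase_exp unfolding lmi_eq lpl_eq by (simp add: algebra_simps)
  also have "\<dots> = (of_real (cos (om l * s)) + \<i> * of_real (kap * (sin (om l * s) / om l))) * of_real (2 * om l)"
    unfolding ei_sum_cos ei_diff_sin using om_pos[of l] by (simp add: field_simps)
  finally show ?thesis
    using om_pos[of l] by simp
qed

lemma bcf_eq: "bcf a b eps l s = \<i> * (ei (s * lpl a b eps l) - ei (s * lmi a b eps l)) / of_real (2 * rt l)"
  "bcf' a b eps l s = (of_real (lmi a b eps l) * ei (s * lmi a b eps l) - of_real (lpl a b eps l) * ei (s * lpl a b eps l)) / of_real (2 * rt l)"
proof -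
  have "eps\<^sup>2 * (lmi a b eps l - lpl a b eps l) = 2 * rt l" "eps\<^sup>2 * (lpl a b eps l - lmi a b eps l) = - (2 * rt l)"
    unfolding lmi_eq lpl_eq using eps_om[of l] by (simp_all add: algebra_simps)
  then show "bcf a b eps l s = \<i> * (ei (s * lpl a b eps l) - ei (s * lmi a b eps l)) / of_real (2 * rt l)"
   "bcf' a b eps l s = (of_real (lmi a b eps l) * ei (s * lmi a b eps l) - of_real (lpl a b eps l) * ei (s * lpl a b eps l)) / of_real (2 * rt l)"
    unfolding bcf_def bcf'_def by (simp_all only: of_real_minus divide_minus_right minus_divide_left minus_diff_eq)
qed

lemma phase_b: "ei (kap * s) * bcf a b eps l s = of_real (sin (om l * s) / rt l)"
proof -
  have rt: "complex_of_real (rt l) \<noteq> 0" using rt_ge_1[of l] by auto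
  have "ei (kap * s) * bcf a b eps l s * of_real (2 * rt l)
      = - \<i> * (ei (kap * s) * ei (s * lmi a b eps l) - ei (kap * s) * ei (s * lpl a b eps l))"
    using rt unfolding bcf_eq by (simp add: field_simps)
  also have "\<dots> = of_real (sin (om l * s) / rt l) * of_real (2 * rt l)"
    unfolding phase_exp ei_diff_sin using rt by (simp add: field_simps)
  finally show ?thesis
    using rt by (subst (asm) mult_right_cancel) simp_all
qed

text \<open>Differentiating the product of carrier and amplitude produces the combination on the
  left; the scheme forms it when it assembles the new velocity.\<close>

lemma phase_a': "ei (kap * s) * (acf' a b eps l s + \<i> * of_real kap * acf a b eps l s)
    = of_real (- om l * sin (om l * s)) + \<i> * of_real (kap * cos (om l * s))"
proof -
  have "ei (kap * s) * (acf' a b eps l s + \<i> * of_real kap * acf a b eps l s) * of_real (2 * om l)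
      = \<i> * of_real (lpl a b eps l * lmi a b eps l) * (ei (kap * s) * ei (s * lpl a b eps l) - ei (kap * s) * ei (s * lmi a b eps l))
        + \<i> * of_real kap * (of_real (lmi a b eps l) * (ei (kap * s) * ei (s * lpl a b eps l))
        - of_real (lpl a b eps l) * (ei (kap * s) * ei (s * lmi a b eps l)))"
    using om_pos[of l] unfolding acf_def acf'_def lpl_lmi by (simp add: field_simps)
  also have "\<dots> = \<i> * of_real (om l * kap) * (ei (om l * s) + ei (- (om l * s)))
        + \<i> * of_real (om l * om l) * (ei (om l * s) - ei (- (om l * s)))"
    unfolding phase_exp unfolding lmi_eq lpl_eq by (simp add: algebra_simps)
  also have "\<dots> = (of_real (- om l * sin (om l * s)) + \<i> * of_real (kap * cos (om l * s))) * of_real (2 * om l)"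
    unfolding ei_sum_cos ei_diff_sin by (simp add: algebra_simps)
  finally show ?thesis
    using om_pos[of l] by simp
qed

lemma phase_b': "ei (kap * s) * (bcf' a b eps l s + \<i> * of_real kap * bcf a b eps l s)
    = of_real (cos (om l * s) * kap)"
proof -
  have rt: "complex_of_real (rt l) \<noteq> 0" using rt_ge_1[of l] by auto
  have "ei (kap * s) * (bcf' a b eps l s + \<i> * of_real kap * bcf a b eps l s) * of_real (2 * rt l)
      = of_real (lmi a b eps l + kap) * (ei (kap * s) * ei (s * lmi a b eps l))
        - of_real (lpl a b eps l + kap) * (ei (kap * s) * ei (s * lpl a b eps l))"
    using rt unfolding bcf_eq by (simp add: field_simps)
  also have "\<dots> = of_real (om l) * (ei (om l * s) + ei (- (om l * s)))"
    unfolding phase_exp unfolding lmi_eq lpl_eq by (simp add: algebra_simps)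
  also have "\<dots> = of_real (cos (om l * s) * kap) * of_real (2 * rt l)"
    unfolding ei_sum_cos by (simp add: om_eq)
  finally show ?thesis
    using rt by (subst (asm) mult_right_cancel) simp_all
qed

lemma phase_shift: "ei (kap * tau) = ei (kap * th) * ei (kap * (tau - th))"
  by (simp add: algebra_simps flip: ei_add)

lemma phase_c: "ei (kap * tau) * ccf a b eps l tau = integral {0..tau} (\<lambda>th. of_real (ks l th) * ei (kap * th))"
  unfolding ccf_def integral_mult_right[symmetric]
proof (rule integral_cong)
  fix th
  show "ei (kap * tau) * bcf a b eps l (tau - th) = of_real (ks l th) * ei (kap * th)"
    unfolding phase_shift[of th] mult.assoc phase_b ks_def by (simp add: mult.commute)
qed

lemma phase_d: "ei (kap * tau) * dcf a b eps l tau
    = integral {0..tau} (\<lambda>th. of_real (ks l th) * (ei (kap * th) * of_real th))"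
  unfolding dcf_def integral_mult_right[symmetric]
proof (rule integral_cong)
  fix th
  show "ei (kap * tau) * (bcf a b eps l (tau - th) * of_real th) = of_real (ks l th) * (ei (kap * th) * of_real th)"
    unfolding phase_shift[of th] using phase_b[of "tau - th" l] by (simp add: ks_def mult_ac)
qed

lemma continuous_bcf: "continuous_on {0..tau} (\<lambda>th. bcf a b eps l (tau - th))"
  "continuous_on {0..tau} (\<lambda>th. bcf' a b eps l (tau - th))"
  unfolding bcf_eq using rt_ge_1[of l]
  by (auto intro!: continuous_intros)

lemma phase_c': "ei (kap * tau) * (ccf' a b eps l tau + \<i> * of_real kap * ccf a b eps l tau)
    = integral {0..tau} (\<lambda>th. of_real (kc l th) * ei (kap * th))"
proof -
  have "ccf' a b eps l tau + \<i> * of_real kap * ccf a b eps l tau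
      = integral {0..tau} (\<lambda>th. bcf' a b eps l (tau - th) + \<i> * of_real kap * bcf a b eps l (tau - th))"
    unfolding ccf_def ccf'_def integral_mult_right[symmetric]
    by (intro integral_add[symmetric] integrable_continuous_real continuous_intros continuous_bcf)
  then have "ei (kap * tau) * (ccf' a b eps l tau + \<i> * of_real kap * ccf a b eps l tau)
      = integral {0..tau} (\<lambda>th. ei (kap * tau) * (bcf' a b eps l (tau - th) + \<i> * of_real kap * bcf a b eps l (tau - th)))"
    by (simp add: integral_mult_right)
  also have "\<dots> = integral {0..tau} (\<lambda>th. of_real (kc l th) * ei (kap * th))"
  proof (rule integral_cong)
    fix th
    show "ei (kap * tau) * (bcf' a b eps l (tau - th) + \<i> * of_real kap * bcf a b eps l (tau - th))
      = of_real (kc l th) * ei (kap * th)"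
      unfolding phase_shift[of th]
      using arg_cong[OF phase_b'[of "tau - th" l], of "\<lambda>z. ei (kap * th) * z"]
      by (simp add: kc_def algebra_simps)
  qed
  finally show ?thesis .
qed

lemma phase_d': "ei (kap * tau) * (dcf' a b eps l tau + \<i> * of_real kap * dcf a b eps l tau)
    = integral {0..tau} (\<lambda>th. of_real (kc l th) * (ei (kap * th) * of_real th))"
proof -
  have "dcf' a b eps l tau + \<i> * of_real kap * dcf a b eps l tau
      = integral {0..tau} (\<lambda>th. bcf' a b eps l (tau - th) * of_real th + \<i> * of_real kap * (bcf a b eps l (tau - th) * of_real th))"
    unfolding dcf_def dcf'_def integral_mult_right[symmetric]
    by (intro integral_add[symmetric] integrable_continuous_real continuous_intros continuous_bcf)
  then have "ei (kap * tau) * (dcf' a b eps l tau + \<i> * of_real kap * dcf a b eps l tau)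
      = integral {0..tau} (\<lambda>th. ei (kap * tau) * (bcf' a b eps l (tau - th) * of_real th + \<i> * of_real kap * (bcf a b eps l (tau - th) * of_real th)))"
    by (simp add: integral_mult_right)
  also have "\<dots> = integral {0..tau} (\<lambda>th. of_real (kc l th) * (ei (kap * th) * of_real th))"
  proof (rule integral_cong)
    fix th
    show "ei (kap * tau) * (bcf' a b eps l (tau - th) * of_real th + \<i> * of_real kap * (bcf a b eps l (tau - th) * of_real th))
      = of_real (kc l th) * (ei (kap * th) * of_real th)"
      unfolding phase_shift[of th]
      using arg_cong[OF phase_b'[of "tau - th" l], of "\<lambda>z. ei (kap * th) * z * of_real th"]
      by (simp add: kc_def algebra_simps)
  qed
  finally show ?thesis .
qed

lemma phase_3: "ei (kap * th) ^ 3 = ei (3 * th / eps\<^sup>2)"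
  unfolding ei_power by (simp add: kap_def)

lemma pcf_eq: "pcf a b eps l tau = integral {0..tau} (\<lambda>th. of_real (ks l th) * ei (kap * th) ^ 3)"
  "qcf a b eps l tau = integral {0..tau} (\<lambda>th. of_real (ks l th) * (ei (kap * th) ^ 3 * of_real th))"
  "pcf' a b eps l tau = integral {0..tau} (\<lambda>th. of_real (kc l th) * ei (kap * th) ^ 3)"
  "qcf' a b eps l tau = integral {0..tau} (\<lambda>th. of_real (kc l th) * (ei (kap * th) ^ 3 * of_real th))"
  unfolding phase_3
  by (simp_all add: pcf_def qcf_def pcf'_def qcf'_def ks_def kc_def eps_om kap_def mult.assoc)

lemma continuous_ks [continuous_intros]:
  fixes A :: "real set"
  shows "continuous_on A f \<Longrightarrow> continuous_on A (\<lambda>x. ks l (f x))"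
  "continuous_on A f \<Longrightarrow> continuous_on A (\<lambda>x. kc l (f x))"
  using rt_ge_1[of l] unfolding ks_def kc_def by (auto intro!: continuous_intros)

text \<open>Since \<open>k\<close> is real, conjugation falls on the phase alone. Read from right to
  left, four coefficients of the scheme collapse into one integral whose integrand is, up to phases,
  affine in \<open>th\<close>.\<close>

lemma integral_phases:
  assumes k: "continuous_on {0..tau} k" and E: "continuous_on {0..tau} E"
  shows "integral {0..tau} (\<lambda>th. of_real (k th) * (E th * (A + of_real th * B) + cnj (E th) * (A' + of_real th * B')))
    = integral {0..tau} (\<lambda>th. of_real (k th) * E th) * A
      + integral {0..tau} (\<lambda>th. of_real (k th) * (E th * of_real th)) * B
      + cnj (integral {0..tau} (\<lambda>th. of_real (k th) * E th)) * A'
      + cnj (integral {0..tau} (\<lambda>th. of_real (k th) * (E th * of_real th))) * B'"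
proof -
  let ?I = "integral {0..tau} (\<lambda>th. of_real (k th) * E th)"
  let ?J = "integral {0..tau} (\<lambda>th. of_real (k th) * (E th * of_real th))"
  have I: "((\<lambda>th. of_real (k th) * E th) has_integral ?I) {0..tau}"
    by (intro integrable_integral integrable_continuous_real continuous_intros k E)
  have J: "((\<lambda>th. of_real (k th) * (E th * of_real th)) has_integral ?J) {0..tau}"
    by (intro integrable_integral integrable_continuous_real continuous_intros k E)
  have cI: "((\<lambda>th. cnj (of_real (k th) * E th)) has_integral cnj ?I) {0..tau}"
    using I by (rule has_integral_linear[OF _ bounded_linear_cnj, unfolded o_def])
  have cJ: "((\<lambda>th. cnj (of_real (k th) * (E th * of_real th))) has_integral cnj ?J) {0..tau}"
    using J by (rule has_integral_linear[OF _ bounded_linear_cnj, unfolded o_def])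
  have "((\<lambda>th. of_real (k th) * E th * A + of_real (k th) * (E th * of_real th) * B
      + cnj (of_real (k th) * E th) * A' + cnj (of_real (k th) * (E th * of_real th)) * B')
      has_integral (?I * A + ?J * B + cnj ?I * A' + cnj ?J * B')) {0..tau}"
    by (intro has_integral_add has_integral_mult_left I J cI cJ)
  then have "integral {0..tau} (\<lambda>th. of_real (k th) * E th * A + of_real (k th) * (E th * of_real th) * B
      + cnj (of_real (k th) * E th) * A' + cnj (of_real (k th) * (E th * of_real th)) * B')
      = ?I * A + ?J * B + cnj ?I * A' + cnj ?J * B'" by (rule integral_unique)
  then show ?thesis by (simp add: algebra_simps)
qed

section \<open>One step in terms of the two carrier amplitudes\<close>

definition ZP :: "(nat \<Rightarrow> complex) \<Rightarrow> (nat \<Rightarrow> complex) \<Rightarrow> nat \<Rightarrow> complex" where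
  "ZP x y j = (x j - \<i> * of_real (eps\<^sup>2) * y j) / 2"
definition ZQ :: "(nat \<Rightarrow> complex) \<Rightarrow> (nat \<Rightarrow> complex) \<Rightarrow> nat \<Rightarrow> complex" where
  "ZQ x y j = (x j + \<i> * of_real (eps\<^sup>2) * y j) / 2"
definition sg :: "int \<Rightarrow> real" where
  "sg l = 2 / tau * sin ((mu a b l)\<^sup>2 * tau / 2)"
definition ZD :: "(nat \<Rightarrow> complex) \<Rightarrow> (nat \<Rightarrow> complex) \<Rightarrow> nat \<Rightarrow> complex" where
  "ZD p q = ID (\<lambda>l. \<i> / 2 * (of_real (sg l) * D p l + D (FF lam p q) l))"

text \<open>\<open>PD\<close> and \<open>QD\<close> are \<open>zdot_+\<close> and the conjugate of \<open>zdot_-\<close>; all quantities below are written in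
  terms of \<open>z_+\<close> and the conjugate of \<open>z_-\<close>, which evolve with opposite phases.\<close>

definition PD where "PD x y = ZD (ZP x y) (ZQ x y)"
definition QD where "QD x y j = - ZD (ZQ x y) (ZP x y) j"
definition N1 where
  "N1 x y th = F1 lam (ei (kap * th)) (ZP x y) (ZQ x y) (\<lambda>j. of_real th * PD x y j) (\<lambda>j. of_real th * QD x y j)"
definition N3 where
  "N3 x y th = F3 lam (ei (kap * th)) (ZP x y) (ZQ x y) (\<lambda>j. of_real th * PD x y j) (\<lambda>j. of_real th * QD x y j)"
text \<open>The new value is split into the carrier wave \<open>V1\<close> and the remainder
  \<open>R1\<close>. Outside the integrals \<open>PD\<close> and \<open>QD\<close> cancel in the
  sum, yet the parts are kept separate because the correction \<open>W1\<close> depends on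
  \<open>V1\<close> alone.\<close>

definition V1 where
  "V1 x y = ID (\<lambda>l. of_real (cos (om l * tau)) * D x l + of_real (sin (om l * tau) / om l) * D y l
     + of_real (sin (om l * tau) / om l) * (D (PD x y) l + D (QD x y) l)
     - integral {0..tau} (\<lambda>th. of_real (ks l th) * D (N1 x y th) l))"
definition R1 where
  "R1 x y = ID (\<lambda>l. - of_real (sin (om l * tau) / om l) * (D (PD x y) l + D (QD x y) l)
     - integral {0..tau} (\<lambda>th. of_real (ks l th) * D (N3 x y th) l))"
definition W1 where
  "W1 x y j = fN lam (\<lambda>j. V1 x y j + R1 x y j) j - fN lam (V1 x y) j"
definition UD1 where
  "UD1 x y = ID (\<lambda>l. - of_real (om l * sin (om l * tau)) * D x l + of_real (cos (om l * tau)) * D y l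
     - integral {0..tau} (\<lambda>th. of_real (kc l th) * (D (N1 x y th) l + D (N3 x y th) l))
     - of_real (tau / (2 * eps\<^sup>2)) * D (W1 x y) l)"

lemma DFF_scale: "DFF lam p q (\<lambda>j. of_real th * x j) (\<lambda>j. of_real th * y j) j = of_real th * DFF lam p q x y j"
  "DGG lam p q (\<lambda>j. of_real th * x j) (\<lambda>j. of_real th * y j) j = of_real th * DGG lam p q x y j"
  by (simp_all add: DFF_def DGG_def T3_def algebra_simps)

lemma dft_N1: "D (N1 x y th) l
   = ei (kap * th) * (D (FF lam (ZP x y) (ZQ x y)) l + of_real th * D (DFF lam (ZP x y) (ZQ x y) (PD x y) (QD x y)) l)
   + cnj (ei (kap * th)) * (D (FF lam (ZQ x y) (ZP x y)) l + of_real th * D (DFF lam (ZQ x y) (ZP x y) (QD x y) (PD x y)) l)"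
  unfolding N1_def F1_def[abs_def] DFF_scale dft_add dft_scale by simp

lemma dft_N3: "D (N3 x y th) l
   = ei (kap * th) ^ 3 * (D (GG lam (ZP x y) (ZQ x y)) l + of_real th * D (DGG lam (ZP x y) (ZQ x y) (PD x y) (QD x y)) l)
   + cnj (ei (kap * th) ^ 3) * (D (GG lam (ZQ x y) (ZP x y)) l + of_real th * D (DGG lam (ZQ x y) (ZP x y) (QD x y) (PD x y)) l)"
  unfolding N3_def F3_def[abs_def] DFF_scale dft_add dft_scale by simp

lemma continuous_N1 [continuous_intros]: "continuous_on A (\<lambda>th. D (N1 x y th) l)"
  and continuous_N3 [continuous_intros]: "continuous_on A (\<lambda>th. D (N3 x y th) l)"
  unfolding dft_N1 dft_N3 by (intro continuous_intros)+


text \<open>The conjugate of z_- obeys the conjugate coefficients at the same mode, so the two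
  carrier parts add up to real trigonometric kernels. Equality is claimed at the nodes j < N, where
  a grid function is recovered from its coefficients.\<close>

lemma mti_step_eq:
  assumes j: "j < N"
  shows "fst (mti_step lam a b N eps tau (x, y)) j = V1 x y j + R1 x y j"
    and "snd (mti_step lam a b N eps tau (x, y)) j = UD1 x y j"
proof -
  \<comment> \<open>The local definitions repeat the bindings of the scheme one by one, so that
    unfolding \<open>mti_step\<close> ends in reflexivity.\<close>
  define e2 where "e2 = complex_of_real (eps\<^sup>2)"
  define cv :: "(nat \<Rightarrow> complex) \<Rightarrow> nat \<Rightarrow> complex" where "cv = (\<lambda>v j. cnj (v j))"
  define zp0 where "zp0 = (\<lambda>j. (x j - \<i> * e2 * y j) / 2)"
  define zm0 where "zm0 = (\<lambda>j. (cnj (x j) - \<i> * e2 * cnj (y j)) / 2)"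
  define fp0 where "fp0 = (\<lambda>j. f_pl lam (zp0 j) (zm0 j))"
  define fm0 where "fm0 = (\<lambda>j. f_mi lam (zp0 j) (zm0 j))"
  define Zdp where "Zdp = (\<lambda>l. \<i> / 2 * (complex_of_real (2 / tau * sin ((mu a b l)^2 * tau / 2)) * D zp0 l + D fp0 l))"
  define Zdm where "Zdm = (\<lambda>l. \<i> / 2 * (complex_of_real (2 / tau * sin ((mu a b l)^2 * tau / 2)) * D zm0 l + D fm0 l))"
  define zdp0 where "zdp0 = ID Zdp"
  define zdm0 where "zdm0 = ID Zdm"
  define Rd0 where "Rd0 = (\<lambda>l. - Zdp l - D (cv zdm0) l)"
  define dfp0 where "dfp0 = (\<lambda>j. fd_pl lam (zp0 j) (zm0 j) (zdp0 j) (zdm0 j))"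
  define dfm0 where "dfm0 = (\<lambda>j. fd_mi lam (zp0 j) (zm0 j) (zdp0 j) (zdm0 j))"
  define gp0 where "gp0 = (\<lambda>j. g_pl lam (zp0 j) (zm0 j))"
  define gm0 where "gm0 = (\<lambda>j. g_mi lam (zp0 j) (zm0 j))"
  define dgp0 where "dgp0 = (\<lambda>j. gd_pl lam (zp0 j) (zm0 j) (zdp0 j) (zdm0 j))"
  define dgm0 where "dgm0 = (\<lambda>j. gd_mi lam (zp0 j) (zm0 j) (zdp0 j) (zdm0 j))"
  define czp where "czp = (\<lambda>l. acf a b eps l tau * D zp0 l + e2 * bcf a b eps l tau * Zdp l
                     - ccf a b eps l tau * D fp0 l - dcf a b eps l tau * D dfp0 l)"
  define czm where "czm = (\<lambda>l. acf a b eps l tau * D zm0 l + e2 * bcf a b eps l tau * Zdm l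
                     - ccf a b eps l tau * D fm0 l - dcf a b eps l tau * D dfm0 l)"
  define czdp where "czdp = (\<lambda>l. acf' a b eps l tau * D zp0 l + e2 * bcf' a b eps l tau * Zdp l
                     - ccf' a b eps l tau * D fp0 l - dcf' a b eps l tau * D dfp0 l)"
  define czdm where "czdm = (\<lambda>l. acf' a b eps l tau * D zm0 l + e2 * bcf' a b eps l tau * Zdm l
                     - ccf' a b eps l tau * D fm0 l - dcf' a b eps l tau * D dfm0 l)"
  define cr where "cr = (\<lambda>l. complex_of_real (sin (omg a b eps l * tau) / omg a b eps l) * Rd0 l
                   - pcf a b eps l tau * D gp0 l - qcf a b eps l tau * D dgp0 l
                   - cnj (pcf a b eps l tau) * D (cv gm0) l
                   - cnj (qcf a b eps l tau) * D (cv dgm0) l)"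
  define v1 where "v1 = (\<lambda>j. ei (tau / eps^2) * ID czp j + ei (- tau / eps^2) * cnj (ID czm j))"
  define u1 where "u1 = (\<lambda>j. v1 j + ID cr j)"
  define w1 where "w1 = (\<lambda>j. fnl lam (u1 j) - fnl lam (v1 j))"
  define crd where "crd = (\<lambda>l. complex_of_real (cos (omg a b eps l * tau)) * Rd0 l
                   - pcf' a b eps l tau * D gp0 l - qcf' a b eps l tau * D dgp0 l
                   - cnj (pcf' a b eps l tau) * D (cv gm0) l
                   - cnj (qcf' a b eps l tau) * D (cv dgm0) l
                   - complex_of_real (tau / (2 * eps^2)) * D w1 l)"
  define ud1 where "ud1 = (\<lambda>j. ei (tau / eps^2) * (ID czdp j + \<i> / e2 * ID czp j)
                  + ei (- tau / eps^2) * (cnj (ID czdm j) - \<i> / e2 * cnj (ID czm j)) + ID crd j)"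
  have step: "mti_step lam a b N eps tau (x, y) = (u1, ud1)"
    unfolding mti_step_def Let_def fst_conv snd_conv
    unfolding ud1_def crd_def w1_def u1_def v1_def cr_def czdm_def czdp_def czm_def czp_def
      dgm0_def dgp0_def gm0_def gp0_def dfm0_def dfp0_def Rd0_def zdm0_def zdp0_def Zdm_def Zdp_def
      fm0_def fp0_def zm0_def zp0_def cv_def e2_def
    by (rule refl)
  let ?p = "ZP x y" and ?q = "ZQ x y" and ?x = "PD x y" and ?y = "QD x y"
  have e2r: "\<i> / e2 = \<i> * of_real kap" by (simp add: e2_def kap_def field_simps)
  have zp: "zp0 = ?p" by (simp add: zp0_def ZP_def fun_eq_iff e2_def)
  have zm: "cnj (zm0 j) = ?q j" "zm0 j = cnj (?q j)" for j
    by (simp_all add: zm0_def ZQ_def e2_def)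
  have sqn: "(complex_of_real (cmod z))\<^sup>2 = z * cnj z" for z
    by (simp add: complex_norm_square[symmetric])
  have fp: "fp0 j = FF lam ?p ?q j" and fm: "cnj (fm0 j) = FF lam ?q ?p j"
    and gp: "gp0 j = GG lam ?p ?q j" and gm: "cnj (gm0 j) = GG lam ?q ?p j" for j
    by (simp_all add: fp0_def fm0_def gp0_def gm0_def f_pl_def f_mi_def g_pl_def g_mi_def FF_def GG_def
       T3_def zp zm sqn) (simp_all add: power2_eq_square algebra_simps)
  have Zdp: "Zdp l = D ?x l" if "l \<in> M" for l
    unfolding PD_def ZD_def dft_idft[OF that]
    by (simp add: Zdp_def zp fp[abs_def] sg_def)
  have zdp: "zdp0 = ?x"
    unfolding zdp0_def PD_def ZD_def Zdp_def by (simp add: zp fp[abs_def] sg_def)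
  have cnj_zm: "cnj (D zm0 (red (- l))) = D ?q l" "cnj (D fm0 (red (- l))) = D (FF lam ?q ?p) l" for l
    unfolding dft_cnj_red by (simp_all add: zm fm[abs_def])
  \<comment> \<open>Conjugation turns the factor \<i> / 2 of the amplitude equation into its
    negative, which is the sign in \<open>QD\<close>.\<close>
  have cZdm: "cnj (Zdm (red (- l))) = D ?y l" if l: "l \<in> M" for l
  proof -
    have "D ?y l = - (\<i> / 2 * (of_real (sg l) * D ?q l + D (FF lam ?q ?p) l))"
      unfolding QD_def[abs_def] dft_minus ZD_def dft_idft[OF l] ..
    also have "\<dots> = cnj (Zdm (red (- l)))"
      by (simp add: Zdm_def cnj_zm mu_red_sq[OF l] sg_def algebra_simps)
    finally show ?thesis by simp
  qed
  have zdm: "cnj (zdm0 j) = ?y j" "zdm0 j = cnj (?y j)" if "j < N" for j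
  proof -
    have "cnj (zdm0 j) = ID (D ?y) j"
      by (rule eq_idftI[OF that]) (simp add: zdm0_def dft_cnj_idft cZdm)
    then show "cnj (zdm0 j) = ?y j" by (simp add: idft_dft that)
    then show "zdm0 j = cnj (?y j)" by (metis complex_cnj_cnj)
  qed
  have Rd: "Rd0 l = - (D ?x l + D ?y l)" if "l \<in> M" for l
  proof -
    have "D (cv zdm0) l = D ?y l" by (rule dft_cong) (simp add: cv_def zdm)
    then show ?thesis by (simp add: Rd0_def Zdp that)
  qed
  have dfp: "D dfp0 l = D (DFF lam ?p ?q ?x ?y) l"
   and dfm: "D (\<lambda>j. cnj (dfm0 j)) l = D (DFF lam ?q ?p ?y ?x) l"
   and dgp: "D dgp0 l = D (DGG lam ?p ?q ?x ?y) l"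
   and dgm: "D (\<lambda>j. cnj (dgm0 j)) l = D (DGG lam ?q ?p ?y ?x) l" for l
    by (rule dft_cong; simp add: dfp0_def dfm0_def dgp0_def dgm0_def zp zm zdp zdm derivative_terms)+
  \<comment> \<open>Every coefficient sees \<open>l\<close> only through the square of
    \<open>mu\<close>, which \<open>red (- l)\<close> leaves unchanged.\<close>
  have coef_red: "acf a b eps (red (- l)) s = acf a b eps l s" "bcf a b eps (red (- l)) s = bcf a b eps l s"
     "acf' a b eps (red (- l)) s = acf' a b eps l s" "bcf' a b eps (red (- l)) s = bcf' a b eps l s"
     "ccf a b eps (red (- l)) s = ccf a b eps l s" "dcf a b eps (red (- l)) s = dcf a b eps l s"
     "ccf' a b eps (red (- l)) s = ccf' a b eps l s" "dcf' a b eps (red (- l)) s = dcf' a b eps l s"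
    if "l \<in> M" for l s
    by (simp_all add: acf_def bcf_def acf'_def bcf'_def ccf_def dcf_def ccf'_def dcf'_def lpl_def lmi_def
        mu_red_sq[OF that])
  have e: "ei (tau / eps\<^sup>2) = ei (kap * tau)" "ei (- tau / eps\<^sup>2) = cnj (ei (kap * tau))"
    by (simp_all add: kap_def)
  have Dpq: "D ?p l = (D x l - \<i> * e2 * D y l) / 2" "D ?q l = (D x l + \<i> * e2 * D y l) / 2" for l
    using dft_scale[of "1/2" "\<lambda>j. x j - \<i> * e2 * y j" l] dft_scale[of "1/2" "\<lambda>j. x j + \<i> * e2 * y j" l]
    by (simp_all add: ZP_def[abs_def] ZQ_def[abs_def] e2_def dft_diff dft_add dft_scale)
  have cczm: "cnj (czm (red (- l))) = cnj (acf a b eps l tau) * D ?q l + e2 * cnj (bcf a b eps l tau) * D ?y l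
      - cnj (ccf a b eps l tau) * D (FF lam ?q ?p) l - cnj (dcf a b eps l tau) * D (DFF lam ?q ?p ?y ?x) l"
   and cczdm: "cnj (czdm (red (- l))) = cnj (acf' a b eps l tau) * D ?q l + e2 * cnj (bcf' a b eps l tau) * D ?y l
      - cnj (ccf' a b eps l tau) * D (FF lam ?q ?p) l - cnj (dcf' a b eps l tau) * D (DFF lam ?q ?p ?y ?x) l"
   if l: "l \<in> M" for l
    by (simp_all add: czm_def czdm_def coef_red[OF l] cZdm[OF l] dft_cnj_red dfm e2_def zm(1) fm)
  let ?e = "ei (kap * tau)"
  \<comment> \<open>A multiplier on \<open>p\<close> and its conjugate on \<open>q\<close>: the real
    part acts on the position and the imaginary part on the velocity. The factor
    \<open>kap * e2\<close> equals one.\<close>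
  have lin: "(of_real c + \<i> * of_real (kap * s)) * ((X - \<i> * e2 * Y) / 2)
      + cnj (of_real c + \<i> * of_real (kap * s)) * ((X + \<i> * e2 * Y) / 2)
      = of_real c * X + of_real s * Y * (of_real kap * e2)" for c s X Y
    by (simp add: field_simps)
  have ks: "continuous_on {0..tau} (ks l)" "continuous_on {0..tau} (kc l)" for l
    by (intro continuous_ks continuous_on_id)+
  have E: "continuous_on {0..tau} (\<lambda>th. ei (kap * th))" "continuous_on {0..tau} (\<lambda>th. ei (kap * th) ^ 3)"
    by (intro continuous_intros)+
  have e2k: "e2 * of_real kap = 1" "of_real kap * e2 = 1"
    unfolding e2_def of_real_mult[symmetric] by (simp_all add: eps_kap)
  have v1: "v1 j = V1 x y j" if j: "j < N" for j
    unfolding V1_def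
  proof (rule eq_idftI[OF j])
    fix l assume l: "l \<in> M"
    have "D v1 l = ?e * czp l + cnj ?e * cnj (czm (red (- l)))"
      unfolding v1_def e dft_add dft_scale dft_idft[OF l] dft_cnj_idft[OF l] ..
    also have "\<dots> = (?e * acf a b eps l tau) * D ?p l + cnj (?e * acf a b eps l tau) * D ?q l
        + e2 * (?e * bcf a b eps l tau) * D ?x l + e2 * cnj (?e * bcf a b eps l tau) * D ?y l
        - ((?e * ccf a b eps l tau) * D (FF lam ?p ?q) l + (?e * dcf a b eps l tau) * D (DFF lam ?p ?q ?x ?y) l
        + cnj (?e * ccf a b eps l tau) * D (FF lam ?q ?p) l + cnj (?e * dcf a b eps l tau) * D (DFF lam ?q ?p ?y ?x) l)"
      unfolding cczm[OF l] unfolding czp_def Zdp[OF l] zp fp[abs_def] dfp by (simp add: algebra_simps)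
    also have "\<dots> = (?e * acf a b eps l tau) * D ?p l + cnj (?e * acf a b eps l tau) * D ?q l
        + e2 * (?e * bcf a b eps l tau) * D ?x l + e2 * cnj (?e * bcf a b eps l tau) * D ?y l
        - integral {0..tau} (\<lambda>th. of_real (ks l th) * D (N1 x y th) l)"
      unfolding phase_c phase_d integral_phases[OF ks(1) E(1), symmetric] dft_N1 ..
    also have "(?e * acf a b eps l tau) * D ?p l + cnj (?e * acf a b eps l tau) * D ?q l
      = of_real (cos (om l * tau)) * D x l + of_real (sin (om l * tau) / om l) * D y l * (of_real kap * e2)"
      unfolding phase_a Dpq by (rule lin)
    also have "e2 * (?e * bcf a b eps l tau) = of_real (sin (om l * tau) / om l)"
      unfolding phase_b e2_def using om_pos[of l] rt_ge_1[of l] eps by (simp flip: eps_om)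
    also have "e2 * cnj (?e * bcf a b eps l tau) = of_real (sin (om l * tau) / om l)"
      unfolding phase_b e2_def using om_pos[of l] rt_ge_1[of l] eps by (simp flip: eps_om)
    finally show "D v1 l = of_real (cos (om l * tau)) * D x l + of_real (sin (om l * tau) / om l) * D y l
      + of_real (sin (om l * tau) / om l) * (D ?x l + D ?y l)
      - integral {0..tau} (\<lambda>th. of_real (ks l th) * D (N1 x y th) l)"
      unfolding e2k by (simp add: algebra_simps)
  qed
  have r1: "ID cr j = R1 x y j" for j
    unfolding R1_def
  proof (rule idft_cong)
    fix l assume l: "l \<in> M"
    have "cr l = - of_real (sin (om l * tau) / om l) * (D ?x l + D ?y l)
      - (pcf a b eps l tau * D (GG lam ?p ?q) l + qcf a b eps l tau * D (DGG lam ?p ?q ?x ?y) l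
         + cnj (pcf a b eps l tau) * D (GG lam ?q ?p) l + cnj (qcf a b eps l tau) * D (DGG lam ?q ?p ?y ?x) l)"
      unfolding cr_def Rd[OF l] gp[abs_def] dgp cv_def gm dgm by (simp add: algebra_simps)
    then show "cr l = - of_real (sin (om l * tau) / om l) * (D ?x l + D ?y l)
      - integral {0..tau} (\<lambda>th. of_real (ks l th) * D (N3 x y th) l)"
      unfolding pcf_eq integral_phases[OF ks(1) E(2), symmetric] dft_N3 .
  qed
  have u1: "u1 j = V1 x y j + R1 x y j" if "j < N" for j
    using that by (simp add: u1_def v1 r1)
  show "fst (mti_step lam a b N eps tau (x, y)) j = V1 x y j + R1 x y j"
    unfolding step using u1[OF j] by simp
  have w1: "D w1 l = D (W1 x y) l" for l
    by (rule dft_cong) (simp add: w1_def W1_def fN_def u1 v1)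
  show "snd (mti_step lam a b N eps tau (x, y)) j = UD1 x y j"
    unfolding step snd_conv UD1_def
  proof (rule eq_idftI[OF j])
    fix l assume l: "l \<in> M"
    let ?I = "\<lambda>f. integral {0..tau} (\<lambda>th. of_real (kc l th) * f th)"
    have split: "?I (\<lambda>th. D (N1 x y th) l + D (N3 x y th) l) = ?I (\<lambda>th. D (N1 x y th) l) + ?I (\<lambda>th. D (N3 x y th) l)"
      unfolding distrib_left
      by (intro integral_add integrable_continuous_real continuous_intros)
    have "D ud1 l = ?e * (czdp l + \<i> * of_real kap * czp l)
        + cnj ?e * cnj (czdm (red (- l)) + \<i> * of_real kap * czm (red (- l))) + crd l"
      unfolding ud1_def e e2r
      by (simp only: dft_add dft_diff dft_scale dft_idft[OF l] dft_cnj_idft[OF l] complex_cnj_add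
          complex_cnj_mult complex_cnj_i complex_cnj_complex_of_real) (simp add: algebra_simps)
    also have "\<dots> = (?e * (acf' a b eps l tau + \<i> * of_real kap * acf a b eps l tau)) * D ?p l
        + cnj (?e * (acf' a b eps l tau + \<i> * of_real kap * acf a b eps l tau)) * D ?q l
        + e2 * (?e * (bcf' a b eps l tau + \<i> * of_real kap * bcf a b eps l tau)) * D ?x l
        + e2 * cnj (?e * (bcf' a b eps l tau + \<i> * of_real kap * bcf a b eps l tau)) * D ?y l
        - ((?e * (ccf' a b eps l tau + \<i> * of_real kap * ccf a b eps l tau)) * D (FF lam ?p ?q) l
           + (?e * (dcf' a b eps l tau + \<i> * of_real kap * dcf a b eps l tau)) * D (DFF lam ?p ?q ?x ?y) l
        + cnj (?e * (ccf' a b eps l tau + \<i> * of_real kap * ccf a b eps l tau)) * D (FF lam ?q ?p) l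
        + cnj (?e * (dcf' a b eps l tau + \<i> * of_real kap * dcf a b eps l tau)) * D (DFF lam ?q ?p ?y ?x) l) + crd l"
      unfolding complex_cnj_add complex_cnj_mult cczm[OF l] cczdm[OF l]
      unfolding czp_def czdp_def Zdp[OF l] zp fp[abs_def] dfp by (simp add: algebra_simps)
    also have "\<dots> = (?e * (acf' a b eps l tau + \<i> * of_real kap * acf a b eps l tau)) * D ?p l
        + cnj (?e * (acf' a b eps l tau + \<i> * of_real kap * acf a b eps l tau)) * D ?q l
        + e2 * (?e * (bcf' a b eps l tau + \<i> * of_real kap * bcf a b eps l tau)) * D ?x l
        + e2 * cnj (?e * (bcf' a b eps l tau + \<i> * of_real kap * bcf a b eps l tau)) * D ?y l
        - ?I (\<lambda>th. D (N1 x y th) l) + crd l"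
      unfolding phase_c' phase_d' integral_phases[OF ks(2) E(1), symmetric] dft_N1 ..
    also have "(?e * (acf' a b eps l tau + \<i> * of_real kap * acf a b eps l tau)) * D ?p l
        + cnj (?e * (acf' a b eps l tau + \<i> * of_real kap * acf a b eps l tau)) * D ?q l
      = - of_real (om l * sin (om l * tau)) * D x l + of_real (cos (om l * tau)) * D y l * (of_real kap * e2)"
      unfolding phase_a' Dpq using lin[of "- om l * sin (om l * tau)"] by simp
    also have "e2 * (?e * (bcf' a b eps l tau + \<i> * of_real kap * bcf a b eps l tau)) = of_real (cos (om l * tau)) * (of_real kap * e2)"
      unfolding phase_b' by simp
    also have "e2 * cnj (?e * (bcf' a b eps l tau + \<i> * of_real kap * bcf a b eps l tau)) = of_real (cos (om l * tau)) * (of_real kap * e2)"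
      unfolding phase_b' by simp
    \<comment> \<open>The summand with \<open>?x\<close> and \<open>?y\<close> cancels the equal one
      coming from the b-coefficients, so outside the integrals and the correction no amplitude
      derivative is left in \<open>UD1\<close>.\<close>
    also have "crd l = - of_real (cos (om l * tau)) * (D ?x l + D ?y l)
        - (pcf' a b eps l tau * D (GG lam ?p ?q) l + qcf' a b eps l tau * D (DGG lam ?p ?q ?x ?y) l
         + cnj (pcf' a b eps l tau) * D (GG lam ?q ?p) l + cnj (qcf' a b eps l tau) * D (DGG lam ?q ?p ?y ?x) l)
        - of_real (tau / (2 * eps\<^sup>2)) * D (W1 x y) l"
      unfolding crd_def Rd[OF l] gp[abs_def] dgp cv_def gm dgm w1 by (simp add: algebra_simps)
    also have "pcf' a b eps l tau * D (GG lam ?p ?q) l + qcf' a b eps l tau * D (DGG lam ?p ?q ?x ?y) l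
         + cnj (pcf' a b eps l tau) * D (GG lam ?q ?p) l + cnj (qcf' a b eps l tau) * D (DGG lam ?q ?p ?y ?x) l
       = ?I (\<lambda>th. D (N3 x y th) l)"
      unfolding pcf_eq integral_phases[OF ks(2) E(2), symmetric] dft_N3 ..
    finally show "D ud1 l = - of_real (om l * sin (om l * tau)) * D x l + of_real (cos (om l * tau)) * D y l
     - ?I (\<lambda>th. D (N1 x y th) l + D (N3 x y th) l) - of_real (tau / (2 * eps\<^sup>2)) * D (W1 x y) l"
      unfolding e2k split by (simp add: algebra_simps)
  qed
qed

end

section \<open>Bounds for one step\<close>

locale mti_small = mti_scheme +
  assumes eps1: "eps \<le> 1" and tau1: "tau \<le> 1"
begin

text \<open>The factor \<open>rho\<close> makes the cubic nonlinearity submultiplicative with constant one.\<close>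

definition rho :: real where "rho = sqrt (\<bar>lam\<bar> * (Kalg 4)\<^sup>2 + 1)"
definition cn :: "nat \<Rightarrow> (int \<Rightarrow> complex) \<Rightarrow> real" where "cn s c = rho * wn a b M s c"
definition nm :: "nat \<Rightarrow> (nat \<Rightarrow> complex) \<Rightarrow> real" where "nm s v = cn s (D v)"

lemma rho_ge_1: "1 \<le> rho"
  by (simp add: rho_def)

lemma rho_pos [simp]: "0 < rho" "0 \<le> rho"
  using rho_ge_1 by linarith+

lemma cn_nonneg [simp]: "0 \<le> cn s c"
  by (simp add: cn_def)

lemma cn_cong: "(\<And>l. l \<in> M \<Longrightarrow> c l = d l) \<Longrightarrow> cn s c = cn s d"
  unfolding cn_def using wn_cong[of M c d] by simp

lemma cn_add: "cn s (\<lambda>l. c l + d l) \<le> cn s c + cn s d"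
  unfolding cn_def using wn_add[of a b M s c d] by (simp flip: distrib_left)

lemma cn_diff: "cn s (\<lambda>l. c l - d l) \<le> cn s c + cn s d"
  unfolding cn_def using wn_diff[of a b M s c d] by (simp flip: distrib_left)

lemma cn_add_le: "cn s c \<le> A \<Longrightarrow> cn s d \<le> B \<Longrightarrow> cn s (\<lambda>l. c l + d l) \<le> A + B"
  using cn_add[of s c d] by linarith

lemma cn_diff_le: "cn s c \<le> A \<Longrightarrow> cn s d \<le> B \<Longrightarrow> cn s (\<lambda>l. c l - d l) \<le> A + B"
  using cn_diff[of s c d] by linarith

lemma cn_minus [simp]: "cn s (\<lambda>l. - c l) = cn s c"
  by (simp add: cn_def)

lemma cn_scale: "cn s (\<lambda>l. k * c l) = cmod k * cn s c"
  by (simp add: cn_def wn_scale)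

lemma cn_mono_exp: "s \<le> s' \<Longrightarrow> cn s c \<le> cn s' c"
  unfolding cn_def by (intro mult_left_mono wn_mono_exp) auto

lemma cn_mult:
  assumes "\<And>l. l \<in> M \<Longrightarrow> (cmod (m l))\<^sup>2 * wt a b l ^ s \<le> B\<^sup>2 * wt a b l ^ s'" and "0 \<le> B"
  shows "cn s (\<lambda>l. m l * c l) \<le> B * cn s' c"
proof -
  have "wn a b M s (\<lambda>l. m l * c l) \<le> B * wn a b M s' c"
    by (rule wn_mult) (use assms in auto)
  then show ?thesis
    unfolding cn_def mult.left_commute[of B] by (rule mult_left_mono) simp
qed

lemma cn_mult_bd:
  assumes "\<And>l. l \<in> M \<Longrightarrow> cmod (m l) \<le> B" and "0 \<le> B"
  shows "cn s (\<lambda>l. m l * c l) \<le> B * cn s c"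
proof -
  have "wn a b M s (\<lambda>l. m l * c l) \<le> B * wn a b M s c"
    by (rule wn_mult_bd) (use assms in auto)
  then show ?thesis
    unfolding cn_def mult.left_commute[of B] by (rule mult_left_mono) simp
qed

lemma cn_integral:
  assumes int: "\<And>l. l \<in> M \<Longrightarrow> phi l integrable_on {0..t}" and t: "0 \<le> t"
    and bd: "\<And>s. s \<in> {0..t} \<Longrightarrow> cn m (\<lambda>l. phi l s) \<le> C"
  shows "cn m (\<lambda>l. integral {0..t} (phi l)) \<le> t * C"
proof -
  have "wn a b M m (\<lambda>l. integral {0..t} (phi l)) \<le> t * (C / rho)"
  proof (rule wn_has_integral[OF finite_modes t])
    show "((\<lambda>s. phi l s) has_integral integral {0..t} (phi l)) {0..t}" if "l \<in> M" for l
      by (rule integrable_integral[OF int[OF that]])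
    show "wn a b M m (\<lambda>l. phi l s) \<le> C / rho" if "s \<in> {0..t}" for s
      using bd[OF that] by (simp add: cn_def pos_le_divide_eq mult.commute)
  qed
  then show ?thesis by (simp add: cn_def field_simps)
qed

lemma cn_mean_value:
  assumes t: "0 \<le> t"
    and cont: "\<And>l. l \<in> M \<Longrightarrow> continuous_on {0..t} (phi l)"
    and der: "\<And>l s. l \<in> M \<Longrightarrow> s \<in> {0<..<t} \<Longrightarrow> (phi l has_vector_derivative phi' l s) (at s)"
    and bd: "\<And>s. s \<in> {0..t} \<Longrightarrow> cn m (\<lambda>l. phi' l s) \<le> C"
  shows "cn m (\<lambda>l. phi l t - phi l 0) \<le> t * C"
proof -
  have "wn a b M m (\<lambda>l. phi l t - phi l 0) \<le> t * (C / rho)"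
  proof (rule wn_mean_value[OF finite_modes t cont der])
    show "wn a b M m (\<lambda>l. phi' l s) \<le> C / rho" if "s \<in> {0..t}" for s
      using bd[OF that] by (simp add: cn_def pos_le_divide_eq mult.commute)
  qed
  then show ?thesis by (simp add: cn_def field_simps)
qed

lemma nm_idft: "nm s (ID c) = cn s c"
  unfolding nm_def by (rule cn_cong) (simp add: dft_idft)

lemma nm_mono_exp: "s \<le> s' \<Longrightarrow> nm s c \<le> nm s' c"
  unfolding nm_def by (rule cn_mono_exp)

text \<open>One factor \<open>rho\<close> serves all orders from 1 to 4, because \<open>Kalg\<close>
  increases with the order.\<close>

lemma cubic_seminorm_nm:
  assumes s: "1 \<le> s" "s \<le> 4"
  shows "cubic_seminorm lam (nm s)"
proof
  fix x y z :: "nat \<Rightarrow> complex"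
  let ?w = "\<lambda>x. wn a b M s (D x)"
  show "0 \<le> nm s x" by (simp add: nm_def)
  show "nm s (\<lambda>j. x j + y j) \<le> nm s x + nm s y"
    by (simp add: nm_def dft_add[abs_def] cn_add)
  show "nm s (\<lambda>j. c * x j) = cmod c * nm s x" for c
    by (simp add: nm_def dft_scale[abs_def] cn_scale)
  have K: "0 \<le> Kalg s" "Kalg s \<le> Kalg 4"
    using s power_increasing[of s 4 "2::real"] by (auto simp: Kalg_def intro!: mult_right_mono)
  have T: "T3 lam x y z = (\<lambda>j. of_real lam * (x j * (y j * cnj (z j))))"
    by (simp add: T3_def fun_eq_iff)
  have "nm s (T3 lam x y z) = rho * (\<bar>lam\<bar> * ?w (\<lambda>j. x j * (y j * cnj (z j))))"
    unfolding T by (simp add: nm_def cn_def dft_scale[abs_def] wn_scale)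
  also have "\<dots> \<le> rho * (\<bar>lam\<bar> * (Kalg s * (?w x * (Kalg s * (?w y * ?w z)))))"
    by (intro mult_left_mono order_trans[OF wn_dft_mult[OF s(1)]]
          order_trans[OF wn_dft_mult[OF s(1), of y "\<lambda>j. cnj (z j)", unfolded wn_dft_cnj]] K) auto
  also have "\<dots> = rho * (\<bar>lam\<bar> * (Kalg s)\<^sup>2 * (?w x * ?w y * ?w z))"
    by (simp add: power2_eq_square mult_ac)
  also have "\<dots> \<le> rho * (rho\<^sup>2 * (?w x * ?w y * ?w z))"
  proof (intro mult_left_mono mult_right_mono)
    have "\<bar>lam\<bar> * (Kalg s)\<^sup>2 \<le> \<bar>lam\<bar> * (Kalg 4)\<^sup>2"
      by (intro mult_left_mono power_mono K) auto
    then show "\<bar>lam\<bar> * (Kalg s)\<^sup>2 \<le> rho\<^sup>2"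
      unfolding rho_def by (subst real_sqrt_pow2) (auto intro: order_trans)
  qed auto
  also have "\<dots> = nm s x * nm s y * nm s z"
    by (simp add: nm_def cn_def power2_eq_square mult_ac)
  finally show "nm s (T3 lam x y z) \<le> nm s x * nm s y * nm s z" .
qed

sublocale n2: cubic_seminorm lam "nm 2" by (rule cubic_seminorm_nm) auto
sublocale n3: cubic_seminorm lam "nm 3" by (rule cubic_seminorm_nm) auto
sublocale n4: cubic_seminorm lam "nm 4" by (rule cubic_seminorm_nm) auto

lemma eps2_le_1: "eps\<^sup>2 \<le> 1"
  using eps eps1 by (simp add: power_le_one)

lemma kap_ge_1: "1 \<le> kap"
  using eps2_le_1 eps by (simp add: kap_def)

text \<open>Two bounds for one multiplier. The factor eps^2 absorbs velocities, which are controlled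
  only after multiplication by eps^2; the factor t absorbs the amplitude derivatives, whose filtered
  symbol can be of size 1 / tau.\<close>

lemma sin_om_le: "\<bar>sin (om l * t) / om l\<bar> \<le> eps\<^sup>2" "0 \<le> t \<Longrightarrow> \<bar>sin (om l * t) / om l\<bar> \<le> t"
proof -
  have "1 \<le> eps\<^sup>2 * om l" by (simp add: eps_om rt_ge_1)
  then have "\<bar>sin (om l * t)\<bar> \<le> eps\<^sup>2 * om l" using abs_sin_le_one[of "om l * t"] by linarith
  then show "\<bar>sin (om l * t) / om l\<bar> \<le> eps\<^sup>2"
    using om_pos[of l] by (simp add: abs_div pos_divide_le_eq)
  assume "0 \<le> t"
  then have "\<bar>sin (om l * t)\<bar> \<le> t * om l"
    using abs_sin_x_le_abs_x[of "om l * t"] om_pos[of l] by (simp add: abs_mult mult.commute)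
  then show "\<bar>sin (om l * t) / om l\<bar> \<le> t"
    using om_pos[of l] by (simp add: abs_div pos_divide_le_eq)
qed

lemma ks_le_1: "\<bar>ks l th\<bar> \<le> 1"
proof -
  have "\<bar>sin (om l * (tau - th))\<bar> \<le> 1 * rt l"
    using rt_ge_1[of l] abs_sin_le_one[of "om l * (tau - th)"] by linarith
  then have "\<bar>sin (om l * (tau - th))\<bar> / rt l \<le> 1"
    using rt_ge_1[of l] by (subst pos_divide_le_eq) auto
  moreover have "\<bar>ks l th\<bar> = \<bar>sin (om l * (tau - th))\<bar> / rt l"
    unfolding ks_def abs_divide using rt_ge_1[of l] by simp
  ultimately show ?thesis by simp
qed

lemma cn_integral_ks:
  assumes cont: "\<And>l. continuous_on {0..tau} (phi l)"
    and bd: "\<And>th. th \<in> {0..tau} \<Longrightarrow> cn s (\<lambda>l. phi l th) \<le> C"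
  shows "cn s (\<lambda>l. integral {0..tau} (\<lambda>th. of_real (ks l th) * phi l th)) \<le> tau * C"
proof (rule cn_integral)
  fix th assume th: "th \<in> {0..tau}"
  have "cn s (\<lambda>l. of_real (ks l th) * phi l th) \<le> 1 * cn s (\<lambda>l. phi l th)"
    by (rule cn_mult_bd) (simp_all add: ks_le_1)
  then show "cn s (\<lambda>l. of_real (ks l th) * phi l th) \<le> C" using bd[OF th] by simp
qed (use tau in \<open>auto intro!: integrable_continuous_real continuous_intros cont\<close>)

lemma sg_le: "tau * \<bar>sg l\<bar> \<le> 2"
  using tau abs_sin_le_one[of "(mu a b l)\<^sup>2 * tau / 2"] by (simp add: sg_def abs_mult)

lemma dft_ZD: "l \<in> M \<Longrightarrow> D (ZD p q) l = \<i> / 2 * (of_real (sg l) * D p l + D (FF lam p q) l)"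
  unfolding ZD_def by (rule dft_idft)

section \<open>Lipschitz bounds for the stages of a step\<close>

lemma close_ZPQ:
  assumes "n2.close B d x x'" "n2.close B d (\<lambda>j. of_real (eps\<^sup>2) * y j) (\<lambda>j. of_real (eps\<^sup>2) * y' j)"
  shows "n2.close B d (ZP x y) (ZP x' y')" "n2.close B d (ZQ x y) (ZQ x' y')"
proof -
  have "n2.close (1/2 * (B + B)) (1/2 * (d + d)) (\<lambda>j. 1/2 * (x j + (- \<i>) * (of_real (eps\<^sup>2) * y j)))
     (\<lambda>j. 1/2 * (x' j + (- \<i>) * (of_real (eps\<^sup>2) * y' j)))"
    using n2.close_scale[OF n2.close_add[OF assms(1) n2.close_scale_unit[OF assms(2), of "- \<i>"]], of "1/2"] by simp
  then show "n2.close B d (ZP x y) (ZP x' y')"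
    by (simp add: ZP_def[abs_def] mult.assoc)
  have "n2.close (1/2 * (B + B)) (1/2 * (d + d)) (\<lambda>j. 1/2 * (x j + \<i> * (of_real (eps\<^sup>2) * y j)))
     (\<lambda>j. 1/2 * (x' j + \<i> * (of_real (eps\<^sup>2) * y' j)))"
    using n2.close_scale[OF n2.close_add[OF assms(1) n2.close_scale_unit[OF assms(2), of "\<i>"]], of "1/2"] by simp
  then show "n2.close B d (ZQ x y) (ZQ x' y')"
    by (simp add: ZQ_def[abs_def] mult.assoc)
qed

text \<open>Although the filtered Laplacian \<open>sg\<close> has size \<open>1 / tau\<close>, the corrections enter only
  multiplied by \<open>th \<le> tau\<close>.\<close>

lemma close_ZD:
  assumes B: "1 \<le> B" and p: "n2.close B d p p'" and q: "n2.close B d q q'" and th: "0 \<le> th" "th \<le> tau"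
  shows "n2.close (3 * B ^ 3) (6 * (B\<^sup>2 * d)) (\<lambda>j. of_real th * ZD p q j) (\<lambda>j. of_real th * ZD p' q' j)"
proof -
  note F = n2.close_FF[OF p q]
  have d: "0 \<le> d" using n2.close_nonneg[OF p] by simp
  have ths: "th * \<bar>sg l\<bar> \<le> 2" for l
    by (rule order_trans[OF mult_right_mono[OF th(2)] sg_le]) auto
  have *: "cn 2 (\<lambda>l. of_real th * (\<i> / 2 * (of_real (sg l) * c l + e l))) \<le> A + E / 2"
    if "cn 2 c \<le> A" "cn 2 e \<le> E" for c e A E
  proof -
    have 1: "cn 2 (\<lambda>l. (of_real th * (\<i> / 2 * of_real (sg l))) * c l) \<le> 1 * cn 2 c"
      by (rule cn_mult_bd) (use ths th in \<open>auto simp: norm_mult norm_divide\<close>)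
    have 2: "cn 2 (\<lambda>l. (of_real th * (\<i> / 2)) * e l) \<le> (1/2) * cn 2 e"
      by (rule cn_mult_bd) (use th tau1 in \<open>auto simp: norm_mult norm_divide\<close>)
    have "cn 2 (\<lambda>l. (of_real th * (\<i> / 2 * of_real (sg l))) * c l + (of_real th * (\<i> / 2)) * e l) \<le> A + E / 2"
      by (rule cn_add_le) (use 1 2 that in auto)
    then show ?thesis by (simp add: algebra_simps)
  qed
  have nm: "nm 2 (\<lambda>j. of_real th * ZD p q j) = cn 2 (\<lambda>l. of_real th * (\<i> / 2 * (of_real (sg l) * D p l + D (FF lam p q) l)))"
    for p q unfolding nm_def by (rule cn_cong) (simp add: dft_scale dft_ZD)
  have nmd: "nm 2 (\<lambda>j. of_real th * ZD p q j - of_real th * ZD p' q' j)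
     = cn 2 (\<lambda>l. of_real th * (\<i> / 2 * (of_real (sg l) * D (\<lambda>j. p j - p' j) l + D (\<lambda>j. FF lam p q j - FF lam p' q' j) l)))"
    unfolding nm_def by (rule cn_cong) (simp add: dft_diff dft_scale dft_ZD algebra_simps)
  have B13: "B \<le> B ^ 3" "d \<le> B\<^sup>2 * d"
    using B self_le_power[of B 3] mult_right_mono[of 1 "B\<^sup>2" d] d by auto
  have "nm 2 (\<lambda>j. of_real th * ZD p q j) \<le> B + 3 * B ^ 3 / 2"
    unfolding nm by (rule *) (use p F in \<open>auto simp: n2.close_def nm_def[symmetric]\<close>)
  moreover have "nm 2 (\<lambda>j. of_real th * ZD p' q' j) \<le> B + 3 * B ^ 3 / 2"
    unfolding nm by (rule *) (use p F in \<open>auto simp: n2.close_def nm_def[symmetric]\<close>)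
  moreover have "nm 2 (\<lambda>j. of_real th * ZD p q j - of_real th * ZD p' q' j) \<le> d + 9 * (B\<^sup>2 * d) / 2"
    unfolding nmd by (rule *) (use p F in \<open>auto simp: n2.close_def nm_def[symmetric]\<close>)
  ultimately show ?thesis
    using B13 d B unfolding n2.close_def by (intro conjI; linarith)
qed

lemma close_minus: "n2.close B d x y \<Longrightarrow> n2.close B d (\<lambda>j. - x j) (\<lambda>j. - y j)"
  using n2.close_scale_unit[of B d x y "-1"] by simp

lemma close_step:
  assumes B: "1 \<le> B" and x: "n2.close B d x x'"
    and y: "n2.close B d (\<lambda>j. of_real (eps\<^sup>2) * y j) (\<lambda>j. of_real (eps\<^sup>2) * y' j)"
    and th: "0 \<le> th" "th \<le> tau"
  defines "Mb \<equiv> 3 * B ^ 3" and "d' \<equiv> 6 * (B\<^sup>2 * d)"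
  shows "n2.close Mb d' (\<lambda>j. of_real th * PD x y j) (\<lambda>j. of_real th * PD x' y' j)"
    "n2.close Mb d' (\<lambda>j. of_real th * QD x y j) (\<lambda>j. of_real th * QD x' y' j)"
    "n2.close (24 * Mb ^ 3) (72 * (Mb\<^sup>2 * d')) (N1 x y th) (N1 x' y' th)"
    "n2.close (8 * Mb ^ 3) (24 * (Mb\<^sup>2 * d')) (N3 x y th) (N3 x' y' th)"
proof -
  note pq = close_ZPQ[OF x y]
  have d: "0 \<le> d" using n2.close_nonneg[OF x] by simp
  show P: "n2.close Mb d' (\<lambda>j. of_real th * PD x y j) (\<lambda>j. of_real th * PD x' y' j)"
    unfolding PD_def Mb_def d'_def by (rule close_ZD[OF B pq th])
  show Q: "n2.close Mb d' (\<lambda>j. of_real th * QD x y j) (\<lambda>j. of_real th * QD x' y' j)"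
    using close_minus[OF close_ZD[OF B pq(2,1) th]] unfolding QD_def Mb_def d'_def by simp
  have le: "B \<le> Mb" "d \<le> d'"
    using B self_le_power[of B 3] mult_right_mono[of 1 "B\<^sup>2" d] d by (auto simp: Mb_def d'_def)
  note pq' = pq[THEN n2.close_mono[OF _ le]]
  show "n2.close (24 * Mb ^ 3) (72 * (Mb\<^sup>2 * d')) (N1 x y th) (N1 x' y' th)"
    unfolding N1_def by (rule n2.close_F1[OF _ pq' P Q]) simp
  show "n2.close (8 * Mb ^ 3) (24 * (Mb\<^sup>2 * d')) (N3 x y th) (N3 x' y' th)"
    unfolding N3_def by (rule n2.close_F3[OF _ pq' P Q]) simp
qed

lemma n2_zero: "nm 2 (\<lambda>j. 0) = 0"
  using n2.nm_scale[of 0 "\<lambda>j. 0"] by simp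

lemma close_idft:
  assumes "cn 2 c \<le> B" "cn 2 c' \<le> B" "cn 2 (\<lambda>l. c l - c' l) \<le> d"
  shows "n2.close B d (ID c) (ID c')"
proof -
  have "nm 2 (\<lambda>j. ID c j - ID c' j) = cn 2 (\<lambda>l. c l - c' l)"
    unfolding nm_def by (rule cn_cong) (simp add: dft_diff dft_idft)
  then show ?thesis using assms by (simp add: n2.close_def nm_idft)
qed

lemma close_cn: "n2.close B d x y \<Longrightarrow> cn 2 (D x) \<le> B \<and> cn 2 (D y) \<le> B \<and> cn 2 (\<lambda>l. D x l - D y l) \<le> d"
  by (simp add: n2.close_def nm_def dft_diff[abs_def])

text \<open>Of the two bounds for sin (om tau) / om, the one by eps^2 is used on \<open>y\<close>
  and the one by tau on \<open>PD + QD\<close>; the other choice would leave a negative power of eps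
  or tau. These estimates without energy weights serve the correction \<open>W1\<close>, which needs
  \<open>V1\<close> and \<open>R1\<close> separately.\<close>

lemma close_VR:
  assumes B: "1 \<le> B" and x: "n2.close B d x x'"
    and y: "n2.close B d (\<lambda>j. of_real (eps\<^sup>2) * y j) (\<lambda>j. of_real (eps\<^sup>2) * y' j)"
  defines "Mb \<equiv> 3 * B ^ 3" and "d' \<equiv> 6 * (B\<^sup>2 * d)"
  shows "n2.close (B + B + (Mb + Mb) + 24 * Mb ^ 3) (d + d + (d' + d') + 72 * (Mb\<^sup>2 * d')) (V1 x y) (V1 x' y')"
    "n2.close ((Mb + Mb) + 8 * Mb ^ 3) ((d' + d') + 24 * (Mb\<^sup>2 * d')) (R1 x y) (R1 x' y')"
proof -
  note st = close_step[OF B x y, folded Mb_def d'_def]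
  have tau0: "0 \<le> tau" using tau by simp
  note s0 = st[OF tau0 order_refl]
  have N1: "cn 2 (D (N1 x y th)) \<le> 24 * Mb ^ 3 \<and> cn 2 (D (N1 x' y' th)) \<le> 24 * Mb ^ 3
     \<and> cn 2 (\<lambda>l. D (N1 x y th) l - D (N1 x' y' th) l) \<le> 72 * (Mb\<^sup>2 * d')" if "th \<in> {0..tau}" for th
    using close_cn[OF st(3)[of th]] that by auto
  have N3: "cn 2 (D (N3 x y th)) \<le> 8 * Mb ^ 3 \<and> cn 2 (D (N3 x' y' th)) \<le> 8 * Mb ^ 3
     \<and> cn 2 (\<lambda>l. D (N3 x y th) l - D (N3 x' y' th) l) \<le> 24 * (Mb\<^sup>2 * d')" if "th \<in> {0..tau}" for th
    using close_cn[OF st(4)[of th]] that by auto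
  have le_tau: "tau * C \<le> C" if "0 \<le> C" for C using that tau tau1 by (simp add: mult_left_le_one_le)
  have intd: "integral {0..tau} (\<lambda>th. of_real (ks l th) * f th) - integral {0..tau} (\<lambda>th. of_real (ks l th) * g th)
      = integral {0..tau} (\<lambda>th. of_real (ks l th) * (f th - g th))"
    if "continuous_on {0..tau} f" "continuous_on {0..tau} g" for l and f g :: "real \<Rightarrow> complex"
    unfolding right_diff_distrib
    by (intro integral_diff[symmetric] integrable_continuous_real continuous_intros that)
  have alg1: "C * (x - x') + S * (y - y') + S * (z - z') - (w - w')
      = (C * x + S * y + S * z - w) - (C * x' + S * y' + S * z' - w')"
    and alg3: "- (S * (z - z')) - (w - w') = (- (S * z) - w) - (- (S * z') - w')"
    for C S x x' y y' z z' w w' :: complex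
    by (simp_all add: algebra_simps)
  have I: "cn 2 (\<lambda>l. integral {0..tau} (\<lambda>th. of_real (ks l th) * phi l th)) \<le> C"
    if "\<And>l. continuous_on {0..tau} (phi l)" "\<And>th. th \<in> {0..tau} \<Longrightarrow> cn 2 (\<lambda>l. phi l th) \<le> C" for phi C
  proof -
    have "0 \<le> C" using that(2)[of 0] tau0 cn_nonneg[of 2 "\<lambda>l. phi l 0"] by (simp del: cn_nonneg)
    then show ?thesis using cn_integral_ks[OF that] le_tau[of C] by linarith
  qed
  have I1: "cn 2 (\<lambda>l. integral {0..tau} (\<lambda>th. of_real (ks l th) * D (N1 x y th) l)) \<le> 24 * Mb ^ 3"
    "cn 2 (\<lambda>l. integral {0..tau} (\<lambda>th. of_real (ks l th) * D (N1 x' y' th) l)) \<le> 24 * Mb ^ 3"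
    "cn 2 (\<lambda>l. integral {0..tau} (\<lambda>th. of_real (ks l th) * (D (N1 x y th) l - D (N1 x' y' th) l))) \<le> 72 * (Mb\<^sup>2 * d')"
    by (rule I, (intro continuous_intros)[1], use N1 in blast)+
  have I3: "cn 2 (\<lambda>l. integral {0..tau} (\<lambda>th. of_real (ks l th) * D (N3 x y th) l)) \<le> 8 * Mb ^ 3"
    "cn 2 (\<lambda>l. integral {0..tau} (\<lambda>th. of_real (ks l th) * D (N3 x' y' th) l)) \<le> 8 * Mb ^ 3"
    "cn 2 (\<lambda>l. integral {0..tau} (\<lambda>th. of_real (ks l th) * (D (N3 x y th) l - D (N3 x' y' th) l))) \<le> 24 * (Mb\<^sup>2 * d')"
    by (rule I, (intro continuous_intros)[1], use N3 in blast)+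
  have cos: "cn 2 (\<lambda>l. of_real (cos (om l * tau)) * c l) \<le> cn 2 c" for c
    by (rule order_trans[OF cn_mult_bd[where B = 1]]) (simp_all only: norm_of_real abs_cos_le_one mult_1_left zero_le_one)
  have sin1: "cn 2 (\<lambda>l. of_real (sin (om l * tau) / om l) * c l) \<le> cn 2 (\<lambda>l. of_real (eps\<^sup>2) * c l)" for c
    unfolding cn_scale norm_of_real abs_power2
    by (rule cn_mult_bd) (simp_all only: norm_of_real sin_om_le zero_le_power2)
  have sin2: "cn 2 (\<lambda>l. of_real (sin (om l * tau) / om l) * c l) \<le> cn 2 (\<lambda>l. of_real tau * c l)" for c
    unfolding cn_scale norm_of_real abs_of_nonneg[OF tau0]
    by (rule cn_mult_bd) (simp_all only: norm_of_real sin_om_le(2)[OF tau0] tau0)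
  have X: "cn 2 (D x) \<le> B" "cn 2 (D x') \<le> B" "cn 2 (\<lambda>l. D x l - D x' l) \<le> d"
    using close_cn[OF x] by auto
  have Y: "cn 2 (\<lambda>l. of_real (eps\<^sup>2) * D y l) \<le> B" "cn 2 (\<lambda>l. of_real (eps\<^sup>2) * D y' l) \<le> B"
      "cn 2 (\<lambda>l. of_real (eps\<^sup>2) * (D y l - D y' l)) \<le> d"
    using close_cn[OF y] unfolding dft_scale[abs_def] right_diff_distrib by auto
  have Z: "cn 2 (\<lambda>l. of_real tau * (D (PD x y) l + D (QD x y) l)) \<le> Mb + Mb"
      "cn 2 (\<lambda>l. of_real tau * (D (PD x' y') l + D (QD x' y') l)) \<le> Mb + Mb"
      "cn 2 (\<lambda>l. of_real tau * (D (PD x y) l + D (QD x y) l - (D (PD x' y') l + D (QD x' y') l))) \<le> d' + d'"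
    using close_cn[OF n2.close_add[OF s0(1,2)]]
    unfolding dft_scale[abs_def] dft_add[abs_def] dft_diff[abs_def]
    by (auto simp: algebra_simps)
  show "n2.close (B + B + (Mb + Mb) + 24 * Mb ^ 3) (d + d + (d' + d') + 72 * (Mb\<^sup>2 * d')) (V1 x y) (V1 x' y')"
    unfolding V1_def
  proof (rule close_idft)
    show "cn 2 (\<lambda>l. of_real (cos (om l * tau)) * D x l + of_real (sin (om l * tau) / om l) * D y l
     + of_real (sin (om l * tau) / om l) * (D (PD x y) l + D (QD x y) l)
     - integral {0..tau} (\<lambda>th. of_real (ks l th) * D (N1 x y th) l)) \<le> B + B + (Mb + Mb) + 24 * Mb ^ 3"
      by (rule cn_diff_le[OF cn_add_le[OF cn_add_le[OF order_trans[OF cos X(1)] order_trans[OF sin1 Y(1)]]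
         order_trans[OF sin2 Z(1)]] I1(1)])
    show "cn 2 (\<lambda>l. of_real (cos (om l * tau)) * D x' l + of_real (sin (om l * tau) / om l) * D y' l
     + of_real (sin (om l * tau) / om l) * (D (PD x' y') l + D (QD x' y') l)
     - integral {0..tau} (\<lambda>th. of_real (ks l th) * D (N1 x' y' th) l)) \<le> B + B + (Mb + Mb) + 24 * Mb ^ 3"
      by (rule cn_diff_le[OF cn_add_le[OF cn_add_le[OF order_trans[OF cos X(2)] order_trans[OF sin1 Y(2)]]
         order_trans[OF sin2 Z(2)]] I1(2)])
    have "cn 2 (\<lambda>l. of_real (cos (om l * tau)) * (D x l - D x' l) + of_real (sin (om l * tau) / om l) * (D y l - D y' l)
     + of_real (sin (om l * tau) / om l) * (D (PD x y) l + D (QD x y) l - (D (PD x' y') l + D (QD x' y') l))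
     - integral {0..tau} (\<lambda>th. of_real (ks l th) * (D (N1 x y th) l - D (N1 x' y' th) l)))
       \<le> d + d + (d' + d') + 72 * (Mb\<^sup>2 * d')"
      by (rule cn_diff_le[OF cn_add_le[OF cn_add_le[OF order_trans[OF cos X(3)] order_trans[OF sin1 Y(3)]]
         order_trans[OF sin2 Z(3)]] I1(3)])
    then show "cn 2 (\<lambda>l. (of_real (cos (om l * tau)) * D x l + of_real (sin (om l * tau) / om l) * D y l
     + of_real (sin (om l * tau) / om l) * (D (PD x y) l + D (QD x y) l)
     - integral {0..tau} (\<lambda>th. of_real (ks l th) * D (N1 x y th) l)) -
      (of_real (cos (om l * tau)) * D x' l + of_real (sin (om l * tau) / om l) * D y' l
     + of_real (sin (om l * tau) / om l) * (D (PD x' y') l + D (QD x' y') l)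
     - integral {0..tau} (\<lambda>th. of_real (ks l th) * D (N1 x' y' th) l))) \<le> d + d + (d' + d') + 72 * (Mb\<^sup>2 * d')"
      unfolding intd[OF continuous_N1 continuous_N1, symmetric] alg1 .
  qed
  show "n2.close ((Mb + Mb) + 8 * Mb ^ 3) ((d' + d') + 24 * (Mb\<^sup>2 * d')) (R1 x y) (R1 x' y')"
    unfolding R1_def mult_minus_left
  proof (rule close_idft)
    show "cn 2 (\<lambda>l. - (of_real (sin (om l * tau) / om l) * (D (PD x y) l + D (QD x y) l))
     - integral {0..tau} (\<lambda>th. of_real (ks l th) * D (N3 x y th) l)) \<le> (Mb + Mb) + 8 * Mb ^ 3"
      by (rule cn_diff_le[OF order_trans[OF eq_refl[OF cn_minus] order_trans[OF sin2 Z(1)]] I3(1)])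
    show "cn 2 (\<lambda>l. - (of_real (sin (om l * tau) / om l) * (D (PD x' y') l + D (QD x' y') l))
     - integral {0..tau} (\<lambda>th. of_real (ks l th) * D (N3 x' y' th) l)) \<le> (Mb + Mb) + 8 * Mb ^ 3"
      by (rule cn_diff_le[OF order_trans[OF eq_refl[OF cn_minus] order_trans[OF sin2 Z(2)]] I3(2)])
    have "cn 2 (\<lambda>l. - (of_real (sin (om l * tau) / om l) * (D (PD x y) l + D (QD x y) l - (D (PD x' y') l + D (QD x' y') l)))
     - integral {0..tau} (\<lambda>th. of_real (ks l th) * (D (N3 x y th) l - D (N3 x' y' th) l)))
       \<le> (d' + d') + 24 * (Mb\<^sup>2 * d')"
      by (rule cn_diff_le[OF order_trans[OF eq_refl[OF cn_minus] order_trans[OF sin2 Z(3)]] I3(3)])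
    then show "cn 2 (\<lambda>l. (- (of_real (sin (om l * tau) / om l) * (D (PD x y) l + D (QD x y) l))
     - integral {0..tau} (\<lambda>th. of_real (ks l th) * D (N3 x y th) l)) -
      (- (of_real (sin (om l * tau) / om l) * (D (PD x' y') l + D (QD x' y') l))
     - integral {0..tau} (\<lambda>th. of_real (ks l th) * D (N3 x' y' th) l))) \<le> (d' + d') + 24 * (Mb\<^sup>2 * d')"
      unfolding intd[OF continuous_N3 continuous_N3, symmetric] alg3 .
  qed
qed

end

section \<open>Stability in the energy norm\<close>

text \<open>The growth rate of errors per unit time. \<open>Mb\<close> bounds the stages of a step
  and \<open>B1\<close> both \<open>V1\<close> and \<open>V1 + R1\<close>; the first summand
  collects the two kernel integrals, the second the correction \<open>W1\<close>.\<close>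

definition stab_const :: "real \<Rightarrow> real" where
  "stab_const B = (let Mb = 3 * B ^ 3; B1 = 2 * B + 4 * Mb + 32 * Mb ^ 3 in
     2 * (96 * (Mb\<^sup>2 * (6 * B\<^sup>2))) + 3 * (B1\<^sup>2 * (2 + 4 * (6 * B\<^sup>2) + 96 * (Mb\<^sup>2 * (6 * B\<^sup>2)))))"

lemma stab_const_nonneg: "0 \<le> B \<Longrightarrow> 0 \<le> stab_const B"
  unfolding stab_const_def Let_def by (intro add_nonneg_nonneg mult_nonneg_nonneg) auto

context mti_small begin

text \<open>A Euclidean instead of an additive combination, so that the rotation of each mode is an
  exact isometry. A constant above one at this place would be raised to the number of steps.\<close>

definition ec :: "(int \<Rightarrow> complex) \<Rightarrow> (int \<Rightarrow> complex) \<Rightarrow> real" where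
  "ec A B = sqrt ((cn 2 A)\<^sup>2 + (cn 2 B)\<^sup>2)"

definition en :: "(nat \<Rightarrow> complex) \<Rightarrow> (nat \<Rightarrow> complex) \<Rightarrow> real" where
  "en x y = ec (\<lambda>l. of_real (rt l) * D x l) (\<lambda>l. of_real (eps\<^sup>2) * D y l)"

abbreviation NN :: "(nat \<Rightarrow> complex) \<Rightarrow> (nat \<Rightarrow> complex) \<Rightarrow> int \<Rightarrow> real \<Rightarrow> complex" where
  "NN x y l th \<equiv> D (N1 x y th) l + D (N3 x y th) l"

lemma ec_nonneg [simp]: "0 \<le> ec A B"
  by (simp add: ec_def)

lemma en_nonneg [simp]: "0 \<le> en x y"
  by (simp add: en_def)

lemma ec_ge: "cn 2 A \<le> ec A B" "cn 2 B \<le> ec A B"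
  by (simp_all add: ec_def real_le_rsqrt)

lemma ec_le_add: "ec A B \<le> cn 2 A + cn 2 B"
  unfolding ec_def by (rule sqrt_sum_squares_le_sum) auto

lemma ec_diff: "ec (\<lambda>l. A l - A' l) (\<lambda>l. B l - B' l) \<le> ec A B + ec A' B'"
proof -
  have "ec (\<lambda>l. A l - A' l) (\<lambda>l. B l - B' l) \<le> sqrt ((cn 2 A + cn 2 A')\<^sup>2 + (cn 2 B + cn 2 B')\<^sup>2)"
    unfolding ec_def by (intro real_sqrt_le_mono add_mono power_mono cn_diff) auto
  also have "\<dots> \<le> ec A B + ec A' B'"
    unfolding ec_def by (rule real_sqrt_sum_squares_triangle_ineq)
  finally show ?thesis .
qed

text \<open>The angle may vary with the mode, but both components of a mode carry the same weight,
  so the Pythagorean identity holds mode by mode.\<close>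

lemma ec_rotation:
  "ec (\<lambda>l. of_real (cos (f l)) * A l + of_real (sin (f l)) * B l)
      (\<lambda>l. - of_real (sin (f l)) * A l + of_real (cos (f l)) * B l) = ec A B"
proof -
  have rot: "(cmod (of_real c * z + of_real s * w))\<^sup>2 + (cmod (- of_real s * z + of_real c * w))\<^sup>2
      = (cmod z)\<^sup>2 + (cmod w)\<^sup>2" if "s\<^sup>2 + c\<^sup>2 = 1" for c s z w
  proof -
    have "(c * z1 + s * w1)\<^sup>2 + (c * z2 + s * w2)\<^sup>2 + ((- s * z1 + c * w1)\<^sup>2 + (- s * z2 + c * w2)\<^sup>2)
       = z1\<^sup>2 + z2\<^sup>2 + (w1\<^sup>2 + w2\<^sup>2)" for z1 z2 w1 w2
      using that by algebra
    from this[of "Re z" "Re w" "Im z" "Im w"] show ?thesis by (simp add: cmod_power2)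
  qed
  have sq: "(cn 2 A)\<^sup>2 + (cn 2 B)\<^sup>2 = rho\<^sup>2 * (\<Sum>l\<in>M. wt a b l ^ 2 * ((cmod (A l))\<^sup>2 + (cmod (B l))\<^sup>2))" for A B
    by (simp add: cn_def power_mult_distrib wn_sq distrib_left sum.distrib)
  show ?thesis unfolding ec_def sq rot[OF sin_cos_squared_add] ..
qed

lemma ec_step:
  "ec (\<lambda>l. of_real (cos (f l)) * A l + of_real (sin (f l)) * B l - I l)
      (\<lambda>l. - of_real (sin (f l)) * A l + of_real (cos (f l)) * B l - J l) \<le> ec A B + (cn 2 I + cn 2 J)"
  by (rule order_trans[OF ec_diff add_mono[OF eq_refl[OF ec_rotation] ec_le_add]])

lemma en_ge: "nm 2 x \<le> en x y" "nm 2 (\<lambda>j. of_real (eps\<^sup>2) * y j) \<le> en x y"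
proof -
  have "cn 2 (\<lambda>l. of_real (1 / rt l) * (of_real (rt l) * D x l)) \<le> 1 * cn 2 (\<lambda>l. of_real (rt l) * D x l)"
    by (rule cn_mult_bd)
       (use rt_ge_1 in \<open>auto simp: norm_divide divide_le_eq_1 intro: order_trans[OF _ abs_ge_self]\<close>)
  moreover have "of_real (1 / rt l) * (of_real (rt l) * D x l) = D x l" for l
    using rt_ge_1[of l] by auto
  ultimately have "cn 2 (D x) \<le> cn 2 (\<lambda>l. of_real (rt l) * D x l)" by simp
  then show "nm 2 x \<le> en x y"
    unfolding nm_def en_def using ec_ge(1) order_trans by blast
  show "nm 2 (\<lambda>j. of_real (eps\<^sup>2) * y j) \<le> en x y"
    unfolding nm_def en_def dft_scale[abs_def] by (rule ec_ge(2))
qed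

lemma integrable_phase:
  "continuous_on {0..tau} g \<Longrightarrow> (\<lambda>th. of_real (sin (om l * (tau - th))) * g th) integrable_on {0..tau}"
  "continuous_on {0..tau} g \<Longrightarrow> (\<lambda>th. of_real (cos (om l * (tau - th))) * g th) integrable_on {0..tau}"
  for g :: "real \<Rightarrow> complex"
  by (intro integrable_continuous_real continuous_intros; assumption)+

text \<open>The factors \<open>rt\<close> and eps^2 remove the denominators of \<open>ks\<close> and
  \<open>kc\<close>; a step is then a rotation minus integrals against sine and cosine, and minus
  the correction in the second component.\<close>

lemma step_energy_form:
  assumes l: "l \<in> M"
  shows "of_real (rt l) * D (\<lambda>j. V1 x y j + R1 x y j) l
     = of_real (cos (om l * tau)) * (of_real (rt l) * D x l) + of_real (sin (om l * tau)) * (of_real (eps\<^sup>2) * D y l)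
       - integral {0..tau} (\<lambda>th. of_real (sin (om l * (tau - th))) * NN x y l th)" (is ?A)
   and "of_real (eps\<^sup>2) * D (UD1 x y) l
     = - of_real (sin (om l * tau)) * (of_real (rt l) * D x l) + of_real (cos (om l * tau)) * (of_real (eps\<^sup>2) * D y l)
       - (integral {0..tau} (\<lambda>th. of_real (cos (om l * (tau - th))) * NN x y l th) + of_real (tau / 2) * D (W1 x y) l)" (is ?B)
proof -
  have rt0: "rt l \<noteq> 0" using rt_ge_1[of l] by auto
  have ksrt: "of_real (rt l) * (complex_of_real (ks l th) * z) = of_real (sin (om l * (tau - th))) * z"
    and kce: "of_real (eps\<^sup>2) * (complex_of_real (kc l th) * z) = of_real (cos (om l * (tau - th))) * z" for th z
  proof -
    have "complex_of_real (rt l) * of_real (ks l th) = of_real (sin (om l * (tau - th)))"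
      unfolding of_real_mult[symmetric] using rt0 by (simp add: ks_def)
    then show "of_real (rt l) * (complex_of_real (ks l th) * z) = of_real (sin (om l * (tau - th))) * z"
      by (metis mult.assoc)
    have "complex_of_real (eps\<^sup>2) * of_real (kc l th) = of_real (cos (om l * (tau - th)))"
      unfolding of_real_mult[symmetric] kc_def mult.left_commute[of "eps\<^sup>2"] eps_kap by simp
    then show "of_real (eps\<^sup>2) * (complex_of_real (kc l th) * z) = of_real (cos (om l * (tau - th))) * z"
      by (metis mult.assoc)
  qed
  have s: "complex_of_real (rt l) * of_real (sin (om l * tau) / om l) = of_real (sin (om l * tau)) * of_real (eps\<^sup>2)"
    unfolding of_real_mult[symmetric] using om_pos[of l] by (simp flip: eps_om)
  have split: "integral {0..tau} (\<lambda>th. of_real (sin (om l * (tau - th))) * NN x y l th)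
     = integral {0..tau} (\<lambda>th. of_real (sin (om l * (tau - th))) * D (N1 x y th) l)
       + integral {0..tau} (\<lambda>th. of_real (sin (om l * (tau - th))) * D (N3 x y th) l)"
    unfolding distrib_left by (intro integral_add integrable_phase continuous_intros)
  let ?s = "complex_of_real (sin (om l * tau) / om l)"
  have "D (\<lambda>j. V1 x y j + R1 x y j) l = of_real (cos (om l * tau)) * D x l + ?s * D y l
      - integral {0..tau} (\<lambda>th. of_real (ks l th) * D (N1 x y th) l)
      - integral {0..tau} (\<lambda>th. of_real (ks l th) * D (N3 x y th) l)"
    unfolding V1_def R1_def dft_add dft_idft[OF l] by (simp only: ring_distribs) simp
  then have "of_real (rt l) * D (\<lambda>j. V1 x y j + R1 x y j) l
      = of_real (cos (om l * tau)) * (of_real (rt l) * D x l) + (of_real (rt l) * ?s) * D y l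
      - (of_real (rt l) * integral {0..tau} (\<lambda>th. of_real (ks l th) * D (N1 x y th) l)
      + of_real (rt l) * integral {0..tau} (\<lambda>th. of_real (ks l th) * D (N3 x y th) l))"
    by (simp only:) (simp add: algebra_simps)
  then show ?A
    unfolding s split integral_mult_right[symmetric] ksrt by (simp add: mult_ac)
  have e: "complex_of_real (eps\<^sup>2) * of_real (om l * sin (om l * tau)) = of_real (sin (om l * tau)) * of_real (rt l)"
    unfolding of_real_mult[symmetric] by (simp flip: eps_om)
  have e2: "complex_of_real (eps\<^sup>2) * of_real (tau / (2 * eps\<^sup>2)) = of_real (tau / 2)"
    unfolding of_real_mult[symmetric] using eps by simp
  have "of_real (eps\<^sup>2) * D (UD1 x y) l
     = - ((of_real (eps\<^sup>2) * of_real (om l * sin (om l * tau))) * D x l) + of_real (cos (om l * tau)) * (of_real (eps\<^sup>2) * D y l)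
     - (of_real (eps\<^sup>2) * integral {0..tau} (\<lambda>th. of_real (kc l th) * NN x y l th)
     + (of_real (eps\<^sup>2) * of_real (tau / (2 * eps\<^sup>2))) * D (W1 x y) l)"
    unfolding UD1_def dft_idft[OF l] by (simp only: ring_distribs) (simp add: algebra_simps)
  then show ?B
    unfolding e e2 integral_mult_right[symmetric] kce by (simp add: mult_ac)
qed

lemma cn_integral_phase:
  assumes cont: "\<And>l. continuous_on {0..tau} (phi l)"
    and bd: "\<And>th. th \<in> {0..tau} \<Longrightarrow> cn s (\<lambda>l. phi l th) \<le> C"
  shows "cn s (\<lambda>l. integral {0..tau} (\<lambda>th. of_real (sin (om l * (tau - th))) * phi l th)) \<le> tau * C"
    "cn s (\<lambda>l. integral {0..tau} (\<lambda>th. of_real (cos (om l * (tau - th))) * phi l th)) \<le> tau * C"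
proof -
  have tau0: "0 \<le> tau" using tau by simp
  show "cn s (\<lambda>l. integral {0..tau} (\<lambda>th. of_real (sin (om l * (tau - th))) * phi l th)) \<le> tau * C"
  proof (rule cn_integral[OF integrable_phase(1)[OF cont] tau0])
    fix th assume th: "th \<in> {0..tau}"
    have "cn s (\<lambda>l. of_real (sin (om l * (tau - th))) * phi l th) \<le> 1 * cn s (\<lambda>l. phi l th)"
      by (rule cn_mult_bd) (simp_all only: norm_of_real abs_sin_le_one zero_le_one)
    then show "cn s (\<lambda>l. of_real (sin (om l * (tau - th))) * phi l th) \<le> C" using bd[OF th] by simp
  qed
  show "cn s (\<lambda>l. integral {0..tau} (\<lambda>th. of_real (cos (om l * (tau - th))) * phi l th)) \<le> tau * C"
  proof (rule cn_integral[OF integrable_phase(2)[OF cont] tau0])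
    fix th assume th: "th \<in> {0..tau}"
    have "cn s (\<lambda>l. of_real (cos (om l * (tau - th))) * phi l th) \<le> 1 * cn s (\<lambda>l. phi l th)"
      by (rule cn_mult_bd) (simp_all only: norm_of_real abs_cos_le_one zero_le_one)
    then show "cn s (\<lambda>l. of_real (cos (om l * (tau - th))) * phi l th) \<le> C" using bd[OF th] by simp
  qed
qed

text \<open>The linear part contributes exactly the old distance, and every nonlinear term carries a
  factor tau. Only H^2 bounds enter, since the numerical iterates are controlled in no stronger
  norm.\<close>

theorem stability:
  assumes B: "1 \<le> B" and x: "nm 2 x \<le> B" "nm 2 x' \<le> B"
    and y: "nm 2 (\<lambda>j. of_real (eps\<^sup>2) * y j) \<le> B" "nm 2 (\<lambda>j. of_real (eps\<^sup>2) * y' j) \<le> B"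
  shows "en (\<lambda>j. (V1 x y j + R1 x y j) - (V1 x' y' j + R1 x' y' j)) (\<lambda>j. UD1 x y j - UD1 x' y' j)
    \<le> (1 + stab_const B * tau) * en (\<lambda>j. x j - x' j) (\<lambda>j. y j - y' j)"
proof -
  define d where "d = en (\<lambda>j. x j - x' j) (\<lambda>j. y j - y' j)"
  have x_close: "n2.close B d x x'"
    unfolding n2.close_def d_def using x en_ge(1) by blast
  have "(\<lambda>j. of_real (eps\<^sup>2) * y j - of_real (eps\<^sup>2) * y' j) = (\<lambda>j. of_real (eps\<^sup>2) * (y j - y' j))"
    by (simp add: right_diff_distrib)
  then have y_close: "n2.close B d (\<lambda>j. of_real (eps\<^sup>2) * y j) (\<lambda>j. of_real (eps\<^sup>2) * y' j)"
    unfolding n2.close_def d_def using y en_ge(2)[of "\<lambda>j. y j - y' j"] by simp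
  define Mb where "Mb = 3 * B ^ 3"
  define d' where "d' = 6 * (B\<^sup>2 * d)"
  define B1 where "B1 = 2 * B + 4 * Mb + 32 * Mb ^ 3"
  define d1 where "d1 = 2 * d + 4 * d' + 96 * (Mb\<^sup>2 * d')"
  have d0: "0 \<le> d" by (simp add: d_def)
  have nn: "0 \<le> Mb" "0 \<le> d'" using B d0 by (auto simp: Mb_def d'_def)
  note VR = close_VR[OF B x_close y_close, folded Mb_def d'_def]
  have V: "n2.close B1 d1 (V1 x y) (V1 x' y')"
    by (rule n2.close_mono[OF VR(1)]) (use nn B d0 in \<open>auto simp: B1_def d1_def\<close>)
  have U: "n2.close B1 d1 (\<lambda>j. V1 x y j + R1 x y j) (\<lambda>j. V1 x' y' j + R1 x' y' j)"
    by (rule n2.close_mono[OF n2.close_add[OF VR]]) (use nn B d0 in \<open>auto simp: B1_def d1_def\<close>)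
  have W: "nm 2 (\<lambda>j. W1 x y j - W1 x' y' j) \<le> 6 * (B1\<^sup>2 * d1)"
  proof -
    have "n2.close (B1 ^ 3 + B1 ^ 3) (3 * (B1\<^sup>2 * d1) + 3 * (B1\<^sup>2 * d1)) (W1 x y) (W1 x' y')"
      using n2.close_add[OF n2.close_fN[OF U] close_minus[OF n2.close_fN[OF V]]]
      by (simp add: W1_def[abs_def])
    then show ?thesis by (simp add: n2.close_def mult_ac)
  qed
  define S where "S = 96 * (Mb\<^sup>2 * d')"
  have NNb: "cn 2 (\<lambda>l. NN x y l th - NN x' y' l th) \<le> S" if th: "th \<in> {0..tau}" for th
  proof -
    have "n2.close (24 * Mb ^ 3 + 8 * Mb ^ 3) (72 * (Mb\<^sup>2 * d') + 24 * (Mb\<^sup>2 * d'))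
      (\<lambda>j. N1 x y th j + N3 x y th j) (\<lambda>j. N1 x' y' th j + N3 x' y' th j)"
      using close_step(3,4)[OF B x_close y_close, of th, folded Mb_def d'_def] th
      by (intro n2.close_add) auto
    from close_cn[OF this] show ?thesis by (simp add: dft_add S_def mult_ac)
  qed
  define I where "I = (\<lambda>l. integral {0..tau} (\<lambda>th. of_real (sin (om l * (tau - th))) * (NN x y l th - NN x' y' l th)))"
  define J where "J = (\<lambda>l. integral {0..tau} (\<lambda>th. of_real (cos (om l * (tau - th))) * (NN x y l th - NN x' y' l th)))"
  have I: "cn 2 I \<le> tau * S" and J: "cn 2 J \<le> tau * S"
    unfolding I_def J_def by (rule cn_integral_phase; (intro continuous_intros | rule NNb); assumption?)+
  have Id: "integral {0..tau} (\<lambda>th. of_real (sin (om l * (tau - th))) * NN x y l th)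
      - integral {0..tau} (\<lambda>th. of_real (sin (om l * (tau - th))) * NN x' y' l th) = I l"
   and Jd: "integral {0..tau} (\<lambda>th. of_real (cos (om l * (tau - th))) * NN x y l th)
      - integral {0..tau} (\<lambda>th. of_real (cos (om l * (tau - th))) * NN x' y' l th) = J l" for l
    unfolding I_def J_def right_diff_distrib[of "complex_of_real r" for r]
    by (intro integral_diff[symmetric] integrable_phase continuous_intros)+
  let ?A = "\<lambda>l. of_real (rt l) * D (\<lambda>j. x j - x' j) l"
  let ?B = "\<lambda>l. of_real (eps\<^sup>2) * D (\<lambda>j. y j - y' j) l"
  let ?W = "\<lambda>l. of_real (tau / 2) * D (\<lambda>j. W1 x y j - W1 x' y' j) l"
  have "en (\<lambda>j. (V1 x y j + R1 x y j) - (V1 x' y' j + R1 x' y' j)) (\<lambda>j. UD1 x y j - UD1 x' y' j)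
     = ec (\<lambda>l. of_real (cos (om l * tau)) * ?A l + of_real (sin (om l * tau)) * ?B l - I l)
          (\<lambda>l. - of_real (sin (om l * tau)) * ?A l + of_real (cos (om l * tau)) * ?B l - (J l + ?W l))"
  proof -
    have 1: "of_real (rt l) * D (\<lambda>j. (V1 x y j + R1 x y j) - (V1 x' y' j + R1 x' y' j)) l
        = of_real (cos (om l * tau)) * ?A l + of_real (sin (om l * tau)) * ?B l - I l" if "l \<in> M" for l
      unfolding dft_diff[of "\<lambda>j. V1 x y j + R1 x y j"] right_diff_distrib[of "of_real (rt l)"] step_energy_form[OF that]
        Id[symmetric] dft_diff by (simp add: algebra_simps)
    have 2: "of_real (eps\<^sup>2) * D (\<lambda>j. UD1 x y j - UD1 x' y' j) l
        = - of_real (sin (om l * tau)) * ?A l + of_real (cos (om l * tau)) * ?B l - (J l + ?W l)" if "l \<in> M" for l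
      unfolding dft_diff[of "UD1 x y"] right_diff_distrib[of "of_real (eps\<^sup>2)"] step_energy_form[OF that]
        Jd[symmetric] dft_diff by (simp add: algebra_simps)
    show ?thesis
      unfolding en_def ec_def using cn_cong[OF 1] cn_cong[OF 2] by simp
  qed
  also have "\<dots> \<le> ec ?A ?B + (cn 2 I + cn 2 (\<lambda>l. J l + ?W l))" by (rule ec_step)
  also have "\<dots> \<le> d + (tau * S + (tau * S + tau / 2 * (6 * (B1\<^sup>2 * d1))))"
  proof (intro add_mono I cn_add_le J)
    show "ec ?A ?B \<le> d" by (simp add: d_def en_def)
    have "cn 2 ?W \<le> tau / 2 * nm 2 (\<lambda>j. W1 x y j - W1 x' y' j)"
      using tau unfolding nm_def cn_scale norm_of_real by simp
    also have "\<dots> \<le> tau / 2 * (6 * (B1\<^sup>2 * d1))" using tau W by (intro mult_left_mono) auto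
    finally show "cn 2 ?W \<le> tau / 2 * (6 * (B1\<^sup>2 * d1))" .
  qed
  also have "\<dots> = (1 + stab_const B * tau) * d"
    unfolding stab_const_def Let_def Mb_def[symmetric] B1_def[symmetric] S_def d1_def d'_def
    by (simp add: algebra_simps)
  finally show ?thesis unfolding d_def .
qed

end

section \<open>Amplitude expansion\<close>

text \<open>Monotonicity of x^2 / 2 - x + sin x on the positive half-line: its derivative is
  nonnegative because 1 - cos t <= t.\<close>

lemma sin_approx: "\<bar>sin x - x\<bar> \<le> x\<^sup>2 / 2" for x :: real
proof -
  have pos: "x - sin x \<le> x\<^sup>2 / 2" if "0 \<le> x" for x :: real
  proof -
    have "(\<lambda>x. x\<^sup>2 / 2 - x + sin x) 0 \<le> (\<lambda>x. x\<^sup>2 / 2 - x + sin x) x"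
    proof (rule DERIV_nonneg_imp_nondecreasing[OF that])
      fix t :: real assume t: "0 \<le> t" "t \<le> x"
      have "1 - cos t \<le> t"
      proof -
        have "cmod (ei t - ei 0) \<le> \<bar>t\<bar>" using ei_lipschitz[of t 0] by simp
        moreover have "\<bar>Re (ei t - ei 0)\<bar> \<le> cmod (ei t - ei 0)" by (rule abs_Re_le_cmod)
        ultimately show ?thesis using t by (simp add: ei_cis)
      qed
      moreover have "((\<lambda>x. x\<^sup>2 / 2 - x + sin x) has_real_derivative t - 1 + cos t) (at t)"
        by (auto intro!: derivative_eq_intros)
      ultimately show "\<exists>y. ((\<lambda>x. x\<^sup>2 / 2 - x + sin x) has_real_derivative y) (at t) \<and> 0 \<le> y"
        by (intro exI[of _ "t - 1 + cos t"]) auto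
    qed
    then show ?thesis by simp
  qed
  show ?thesis
  proof (cases "0 \<le> x")
    case True
    then show ?thesis using pos[OF True] sin_x_le_x[OF True] by simp
  next
    case False
    then show ?thesis using pos[of "- x"] sin_x_le_x[of "- x"] by simp
  qed
qed

lemma cos_approx: "\<bar>cos x - 1\<bar> \<le> \<bar>x\<bar>" for x :: real
proof -
  have "cmod (ei x - ei 0) \<le> \<bar>x\<bar>" using ei_lipschitz[of x 0] by simp
  moreover have "\<bar>Re (ei x - ei 0)\<bar> \<le> cmod (ei x - ei 0)" by (rule abs_Re_le_cmod)
  ultimately show ?thesis by (simp add: ei_cis)
qed

text \<open>The antiderivative of e^(i c s) that vanishes at 0. Its bound 2 / |c|, uniform in time,
  is the gain eps^2 of the integration by parts whenever |c| >= 2 kap.\<close>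

definition Eph :: "real \<Rightarrow> real \<Rightarrow> complex" where
  "Eph c s = (ei (c * s) - 1) / (\<i> * of_real c)"

lemma Eph_0 [simp]: "Eph c 0 = 0"
  by (simp add: Eph_def)

lemma has_vector_derivative_Eph:
  "c \<noteq> 0 \<Longrightarrow> (Eph c has_vector_derivative ei (c * s)) (at s within S)"
  unfolding Eph_def[abs_def]
  by (rule derivative_eq_intros has_vector_derivative_ei refl | simp)+

lemma norm_Eph: "c \<noteq> 0 \<Longrightarrow> cmod (Eph c s) \<le> 2 / \<bar>c\<bar>"
  unfolding Eph_def using norm_triangle_ineq4[of "ei (c * s)" 1]
  by (simp add: norm_divide norm_mult divide_right_mono)

context mti_small begin

lemma wt_mult: "\<bar>mu a b l\<bar>\<^sup>2 \<le> wt a b l" "(mu a b l)\<^sup>2 \<le> wt a b l"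
  by (simp_all add: wt_def)

lemma rt_sq_le: "(rt l)\<^sup>2 \<le> wt a b l"
proof -
  have "(mu a b l)\<^sup>2 * eps\<^sup>2 \<le> (mu a b l)\<^sup>2 * 1" by (rule mult_left_mono[OF eps2_le_1]) simp
  then show ?thesis by (simp add: rt_def wt_def)
qed

text \<open>Since eps <= 1, the square of \<open>rt\<close> is at most \<open>wt\<close>. A
  multiplier of size om tau = kap tau rt therefore gains the factor kap tau at the price of one
  derivative.\<close>

lemma cn_mult_rt:
  assumes m: "\<And>l. l \<in> M \<Longrightarrow> cmod (m l) \<le> B * rt l" and B: "0 \<le> B"
  shows "cn 2 (\<lambda>l. m l * c l) \<le> B * cn 3 c"
proof (rule cn_mult[OF _ B])
  fix l assume l: "l \<in> M"
  have "(cmod (m l))\<^sup>2 \<le> (B * rt l)\<^sup>2" using m[OF l] by (rule power_mono) simp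
  also have "\<dots> \<le> B\<^sup>2 * wt a b l" unfolding power_mult_distrib by (intro mult_left_mono rt_sq_le) simp
  finally have "(cmod (m l))\<^sup>2 * wt a b l ^ 2 \<le> (B\<^sup>2 * wt a b l) * wt a b l ^ 2"
    by (rule mult_right_mono) simp
  then show "(cmod (m l))\<^sup>2 * wt a b l ^ 2 \<le> B\<^sup>2 * wt a b l ^ 3"
    by (simp add: power2_eq_square power3_eq_cube mult_ac)
qed

lemma cn_mult_wt:
  assumes m: "\<And>l. l \<in> M \<Longrightarrow> cmod (m l) \<le> B * wt a b l ^ k" and B: "0 \<le> B"
  shows "cn s (\<lambda>l. m l * c l) \<le> B * cn (s + 2 * k) c"
proof (rule cn_mult[OF _ B])
  fix l assume l: "l \<in> M"
  have "(cmod (m l))\<^sup>2 \<le> (B * wt a b l ^ k)\<^sup>2" using m[OF l] by (rule power_mono) simp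
  then have "(cmod (m l))\<^sup>2 * wt a b l ^ s \<le> (B * wt a b l ^ k)\<^sup>2 * wt a b l ^ s"
    by (rule mult_right_mono) simp
  then show "(cmod (m l))\<^sup>2 * wt a b l ^ s \<le> B\<^sup>2 * wt a b l ^ (s + 2 * k)"
    by (simp add: power_mult_distrib power_add power_mult mult_ac flip: power_mult)
qed

text \<open>The filter error is of order tau mu^4, that is four derivatives. Measured in H^2 it
  needs data in H^6, which is the origin of the order 6 in
  \<open>amplitude_expansion\<close>.\<close>

lemma sg_approx: "\<bar>(mu a b l)\<^sup>2 - sg l\<bar> \<le> tau / 4 * wt a b l ^ 2" "\<bar>sg l\<bar> \<le> wt a b l ^ 1"
proof -
  let ?m = "(mu a b l)\<^sup>2"
  have "?m - sg l = 2 / tau * (?m * tau / 2 - sin (?m * tau / 2))"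
    using tau by (simp add: sg_def field_simps)
  then have "\<bar>?m - sg l\<bar> = 2 / tau * \<bar>sin (?m * tau / 2) - ?m * tau / 2\<bar>"
    using tau by (simp only: abs_mult abs_minus_commute[of "sin _"]) simp
  also have "\<dots> \<le> 2 / tau * ((?m * tau / 2)\<^sup>2 / 2)"
    using tau by (intro mult_left_mono sin_approx) auto
  also have "\<dots> = tau / 4 * ?m\<^sup>2"
    using tau by (simp add: power2_eq_square)
  also have "\<dots> \<le> tau / 4 * wt a b l ^ 2"
    using tau wt_mult[of l] by (intro mult_left_mono power_mono) auto
  finally show "\<bar>?m - sg l\<bar> \<le> tau / 4 * wt a b l ^ 2" .
  have "\<bar>sg l\<bar> \<le> 2 / tau * \<bar>?m * tau / 2\<bar>"
    unfolding sg_def abs_mult using tau abs_sin_x_le_abs_x[of "?m * tau / 2"]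
    by (intro mult_mono) auto
  also have "\<dots> = ?m" using tau by (simp add: abs_mult)
  finally show "\<bar>sg l\<bar> \<le> wt a b l ^ 1" using wt_mult(2)[of l] by simp
qed

lemma nm_FF_GG: "nm s (FF lam p q) \<le> 3 * B ^ 3" "nm s (GG lam p q) \<le> B ^ 3"
  if "s \<in> {2, 3, 4}" "nm s p \<le> B" "nm s q \<le> B"
proof -
  interpret n: cubic_seminorm lam "nm s" by (rule cubic_seminorm_nm) (use that(1) in auto)
  show "nm s (FF lam p q) \<le> 3 * B ^ 3" "nm s (GG lam p q) \<le> B ^ 3"
    using n.close_FF[OF n.close_refl[OF that(2)] n.close_refl[OF that(3)]]
      n.close_GG[OF n.close_refl[OF that(2)] n.close_refl[OF that(3)]] by (auto simp: n.close_def)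
qed

lemma nm_ZD:
  assumes "cn 6 (D p) \<le> B" "cn 6 (D q) \<le> B" "1 \<le> B"
  shows "nm 4 (ZD p q) \<le> 2 * B ^ 3"
proof -
  have B: "B \<le> B ^ 3" using assms self_le_power[of B 3] by auto
  have "nm 4 p \<le> B" "nm 4 q \<le> B"
    unfolding nm_def using assms cn_mono_exp[of 4 6 "D p"] cn_mono_exp[of 4 6 "D q"] by auto
  then have F: "cn 4 (D (FF lam p q)) \<le> 3 * B ^ 3" using nm_FF_GG[of 4 p B q] by (simp add: nm_def)
  have "cn 4 (\<lambda>l. of_real (sg l) * D p l) \<le> 1 * cn (4 + 2 * 1) (D p)"
    by (rule cn_mult_wt) (use sg_approx(2) in auto)
  then have "cn 4 (\<lambda>l. of_real (sg l) * D p l + D (FF lam p q) l) \<le> B + 3 * B ^ 3"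
    using assms F by (intro cn_add_le) auto
  then have "cmod (\<i> / 2) * cn 4 (\<lambda>l. of_real (sg l) * D p l + D (FF lam p q) l) \<le> 1 / 2 * (B + 3 * B ^ 3)"
    by (intro mult_mono) (auto simp: norm_divide)
  then show ?thesis
    using B unfolding ZD_def nm_idft cn_scale by simp
qed

text \<open>The slowly varying amplitude of one carrier frequency agrees with its linearisation up to
  quadratic terms and non-resonant oscillations of size \<open>eps^2\<close>.\<close>

lemma amplitude_expansion:
  fixes P G :: "int \<Rightarrow> real \<Rightarrow> complex"
  assumes k: "\<bar>k\<bar> = kap" and sc: "cmod c = 1" and B: "1 \<le> B"
    and cont: "\<And>l. l \<in> M \<Longrightarrow> continuous_on {0..tau} (P l)"
    and der: "\<And>l s. l \<in> M \<Longrightarrow> s \<in> {0<..<tau} \<Longrightarrow>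
       (P l has_vector_derivative c * \<i> / 2 * (ei (- k * s) * G l s)) (at s)"
    and pB: "cn 6 (D p) \<le> B" and qB: "cn 6 (D q) \<le> B"
    and froz: "\<And>s. s \<in> {0..tau} \<Longrightarrow> cn 2 (\<lambda>l. G l s - (of_real ((mu a b l)\<^sup>2) * (ei (k * s) * D p l + cnj (ei (k * s)) * D q l)
         + D (fN lam (\<lambda>j. ei (k * s) * p j + cnj (ei (k * s)) * q j)) l)) \<le> A"
    and P0: "\<And>l. l \<in> M \<Longrightarrow> P l 0 = D p l" and th: "th \<in> {0..tau}"
  shows "cn 2 (\<lambda>l. P l th - P l 0 - of_real th * (c * D (ZD p q) l)) \<le> tau * A + (6 * B ^ 3 * eps\<^sup>2 + tau\<^sup>2 * B)"
proof -
  have k0: "k \<noteq> 0" using k kap_pos by auto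
  have t0: "0 \<le> th" "th \<le> tau" using th by auto
  let ?m = "\<lambda>l. complex_of_real ((mu a b l)\<^sup>2)"
  \<comment> \<open>The explicit integral of the right-hand side with frozen amplitudes. Removing
    the carrier from the harmonics e, 1/e, e^3 and 1/e^3 leaves the frequencies 0, -2k, 2k and -4k:
    the first gives linear growth, the other three stay of size eps^2.\<close>
  define Phi where "Phi = (\<lambda>l s. c * \<i> / 2 * (of_real s * (?m l * D p l + D (FF lam p q) l)
     + Eph (- 2 * k) s * (?m l * D q l + D (FF lam q p) l) + Eph (2 * k) s * D (GG lam p q) l
     + Eph (- 4 * k) s * D (GG lam q p) l))"
  define fr where "fr = (\<lambda>l s. ?m l * (ei (k * s) * D p l + cnj (ei (k * s)) * D q l)
         + D (fN lam (\<lambda>j. ei (k * s) * p j + cnj (ei (k * s)) * q j)) l)"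
  have derPhi: "(Phi l has_vector_derivative c * \<i> / 2 * (ei (- k * s) * fr l s)) (at s)" for l s
  proof -
    have fr: "ei (- k * s) * fr l s = (?m l * D p l + D (FF lam p q) l)
        + ei (- 2 * k * s) * (?m l * D q l + D (FF lam q p) l) + ei (2 * k * s) * D (GG lam p q) l
        + ei (- 4 * k * s) * D (GG lam q p) l"
    proof -
      have "fN lam (\<lambda>j. ei (k * s) * p j + cnj (ei (k * s)) * q j) = (\<lambda>j. ei (k * s) * FF lam p q j
          + ei (- (k * s)) * FF lam q p j + ei (3 * (k * s)) * GG lam p q j + ei (- (3 * (k * s))) * GG lam q p j)"
        using fN_phases[of "ei (k * s)" lam p q] by (simp add: fun_eq_iff ei_power)
      then have "fr l s = ei (k * s) * (?m l * D p l + D (FF lam p q) l) + ei (- (k * s)) * (?m l * D q l + D (FF lam q p) l)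
          + ei (3 * (k * s)) * D (GG lam p q) l + ei (- (3 * (k * s))) * D (GG lam q p) l"
        unfolding fr_def by (simp only: dft_add dft_scale cnj_ei) (simp add: algebra_simps)
      then show ?thesis
        by (simp add: distrib_left mult.assoc[symmetric] flip: ei_add)
    qed
    have "(Phi l has_vector_derivative c * \<i> / 2 * ((?m l * D p l + D (FF lam p q) l)
        + ei (- 2 * k * s) * (?m l * D q l + D (FF lam q p) l) + ei (2 * k * s) * D (GG lam p q) l
        + ei (- 4 * k * s) * D (GG lam q p) l)) (at s)"
    proof -
      have E: "(Eph (- 2 * k) has_vector_derivative ei (- 2 * k * s)) (at s)"
        "(Eph (2 * k) has_vector_derivative ei (2 * k * s)) (at s)"
        "(Eph (- 4 * k) has_vector_derivative ei (- 4 * k * s)) (at s)"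
        using k0 by (intro has_vector_derivative_Eph; simp)+
      have I: "((\<lambda>s. complex_of_real s) has_vector_derivative 1) (at s)"
        by (auto intro!: derivative_eq_intros)
      show ?thesis unfolding Phi_def
        using has_vector_derivative_mult_right[OF has_vector_derivative_add[OF has_vector_derivative_add[OF has_vector_derivative_add[OF
            has_vector_derivative_mult_left[OF I] has_vector_derivative_mult_left[OF E(1)]]
            has_vector_derivative_mult_left[OF E(2)]] has_vector_derivative_mult_left[OF E(3)]]]
        by (rule has_vector_derivative_eq_rhs) simp
    qed
    then show ?thesis unfolding fr .
  qed
  have contPhi: "continuous_on S (Phi l)" for l S
    using derPhi has_vector_derivative_continuous by (blast intro: continuous_at_imp_continuous_on)
  have Phi0: "Phi l 0 = 0" for l by (simp add: Phi_def)
  \<comment> \<open>The difference of true and frozen evolution has as its derivative one half of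
    the defect in \<open>froz\<close>, up to a unimodular factor.\<close>
  have "cn 2 (\<lambda>l. (P l th - Phi l th) - (P l 0 - Phi l 0)) \<le> th * (A / 2)"
  proof (rule cn_mean_value[OF t0(1)])
    fix l assume l: "l \<in> M"
    show "continuous_on {0..th} (\<lambda>s. P l s - Phi l s)"
      using t0 by (intro continuous_intros contPhi continuous_on_subset[OF cont[OF l]]) auto
    fix s assume "s \<in> {0<..<th}"
    then show "((\<lambda>s. P l s - Phi l s) has_vector_derivative c * \<i> / 2 * (ei (- k * s) * G l s) - c * \<i> / 2 * (ei (- k * s) * fr l s)) (at s)"
      using t0 by (intro has_vector_derivative_diff der l derPhi) auto
  next
    fix s assume s: "s \<in> {0..th}"
    have "cn 2 (\<lambda>l. c * \<i> / 2 * (ei (- k * s) * G l s) - c * \<i> / 2 * (ei (- k * s) * fr l s))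
        = cn 2 (\<lambda>l. (c * \<i> / 2 * ei (- k * s)) * (G l s - fr l s))"
      by (rule cn_cong) (simp add: algebra_simps)
    also have "\<dots> = 1 / 2 * cn 2 (\<lambda>l. G l s - fr l s)"
      unfolding cn_scale by (simp add: norm_mult norm_divide sc)
    also have "\<dots> \<le> A / 2" using froz[of s] s t0 unfolding fr_def by auto
    finally show "cn 2 (\<lambda>l. c * \<i> / 2 * (ei (- k * s) * G l s) - c * \<i> / 2 * (ei (- k * s) * fr l s)) \<le> A / 2" .
  qed
  also have "\<dots> \<le> tau * A"
  proof -
    have "0 \<le> A" using froz[of 0] tau cn_nonneg order_trans by (meson atLeastAtMost_iff less_imp_le order_refl)
    then show ?thesis using t0 mult_mono[of th tau "A / 2" A] by simp
  qed
  finally have 1: "cn 2 (\<lambda>l. (P l th - Phi l th) - (P l 0 - Phi l 0)) \<le> tau * A" .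
  have B3: "B \<le> B ^ 3" using B self_le_power[of B 3] by auto
  have p2: "nm 2 p \<le> B" "nm 2 q \<le> B" and pq4: "cn 4 (D q) \<le> B"
    unfolding nm_def using pB qB cn_mono_exp[of 2 6 "D p"] cn_mono_exp[of 2 6 "D q"] cn_mono_exp[of 4 6 "D q"] by auto
  have FG: "cn 2 (D (FF lam q p)) \<le> 3 * B ^ 3" "cn 2 (D (GG lam p q)) \<le> B ^ 3" "cn 2 (D (GG lam q p)) \<le> B ^ 3"
    using nm_FF_GG[of 2 q B p] nm_FF_GG[of 2 p B q] p2 by (auto simp: nm_def)
  have eE: "cmod (Eph (c * k) th) \<le> eps\<^sup>2" if "2 \<le> \<bar>c\<bar>" for c
  proof -
    have c0: "c * k \<noteq> 0" using that k0 by auto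
    have "2 / \<bar>c * k\<bar> \<le> 2 / (2 * kap)"
      using that k kap_pos by (intro divide_left_mono) (auto simp: abs_mult)
    also have "\<dots> = eps\<^sup>2" by (simp add: kap_def)
    finally show ?thesis using norm_Eph[OF c0, of th] by linarith
  qed
  have sE: "cn 2 (\<lambda>l. Eph (c * k) th * d l) \<le> eps\<^sup>2 * C" if "2 \<le> \<bar>c\<bar>" "cn 2 d \<le> C" for c d C
    unfolding cn_scale using eE[OF that(1)] that(2) by (intro mult_mono) auto
  have "cn 2 (\<lambda>l. ?m l * D q l) \<le> 1 * cn (2 + 2 * 1) (D q)"
    by (rule cn_mult_wt) (use wt_mult in \<open>auto simp: norm_power\<close>)
  then have mq: "cn 2 (\<lambda>l. ?m l * D q l + D (FF lam q p) l) \<le> B + 3 * B ^ 3"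
    using pq4 FG by (intro cn_add_le) auto
  have "cn 2 (\<lambda>l. Eph (- 2 * k) th * (?m l * D q l + D (FF lam q p) l) + Eph (2 * k) th * D (GG lam p q) l
     + Eph (- 4 * k) th * D (GG lam q p) l) \<le> eps\<^sup>2 * (B + 3 * B ^ 3) + eps\<^sup>2 * B ^ 3 + eps\<^sup>2 * B ^ 3"
    by (intro cn_add_le sE mq FG) auto
  also have "\<dots> = eps\<^sup>2 * (B + 5 * B ^ 3)" by (simp add: algebra_simps)
  also have "\<dots> \<le> eps\<^sup>2 * (6 * B ^ 3)" using B3 by (intro mult_left_mono) auto
  finally have 2: "cn 2 (\<lambda>l. Eph (- 2 * k) th * (?m l * D q l + D (FF lam q p) l) + Eph (2 * k) th * D (GG lam p q) l
     + Eph (- 4 * k) th * D (GG lam q p) l) \<le> 6 * B ^ 3 * eps\<^sup>2" by (simp add: mult_ac)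
  have "cn 2 (\<lambda>l. of_real ((mu a b l)\<^sup>2 - sg l) * D p l) \<le> tau / 4 * cn (2 + 2 * 2) (D p)"
    by (rule cn_mult_wt) (use sg_approx(1) tau in \<open>auto simp del: of_real_diff\<close>)
  also have "\<dots> \<le> tau * B" using pB tau by (intro mult_mono) auto
  finally have "th * cn 2 (\<lambda>l. of_real ((mu a b l)\<^sup>2 - sg l) * D p l) \<le> tau * (tau * B)"
    using t0 tau by (intro mult_mono) auto
  then have 3: "cn 2 (\<lambda>l. of_real th * (of_real ((mu a b l)\<^sup>2 - sg l) * D p l)) \<le> tau\<^sup>2 * B"
    unfolding cn_scale using t0 by (simp add: power2_eq_square mult.assoc)
  \<comment> \<open>Three contributions: the defect of freezing, the non-resonant oscillations, and
    the filter error multiplied by \<open>th\<close>.\<close>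
  have eq: "P l th - P l 0 - of_real th * (c * D (ZD p q) l)
    = ((P l th - Phi l th) - (P l 0 - Phi l 0)) + c * \<i> / 2 * ((Eph (- 2 * k) th * (?m l * D q l + D (FF lam q p) l) + Eph (2 * k) th * D (GG lam p q) l
     + Eph (- 4 * k) th * D (GG lam q p) l) + of_real th * (of_real ((mu a b l)\<^sup>2 - sg l) * D p l))" if "l \<in> M" for l
    unfolding Phi0 dft_ZD[OF that] unfolding Phi_def by (simp add: algebra_simps)
  have "cn 2 (\<lambda>l. c * \<i> / 2 * ((Eph (- 2 * k) th * (?m l * D q l + D (FF lam q p) l) + Eph (2 * k) th * D (GG lam p q) l
     + Eph (- 4 * k) th * D (GG lam q p) l) + of_real th * (of_real ((mu a b l)\<^sup>2 - sg l) * D p l)))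
     \<le> 1 / 2 * (6 * B ^ 3 * eps\<^sup>2 + tau\<^sup>2 * B)"
    unfolding cn_scale using cn_add_le[OF 2 3] by (intro mult_mono) (auto simp: norm_mult norm_divide sc)
  also have "\<dots> \<le> 6 * B ^ 3 * eps\<^sup>2 + tau\<^sup>2 * B"
    using B tau eps by (simp add: add_nonneg_nonneg)
  finally show ?thesis
    by (intro order_trans[OF eq_refl[OF cn_cong] cn_add_le[OF 1]]) (rule eq)
qed

end

text \<open>One step seen from its left end, for modes that solve the equation with a forcing
  \<open>F\<close> which the grid nonlinearity matches up to \<open>dh\<close>. Order 6 serves the
  filter error; order 4 for \<open>F\<close> lets the amplitudes drift boundedly in H^4.\<close>

locale mti_exact = mti_small +
  fixes U V F :: "int \<Rightarrow> real \<Rightarrow> complex" and R dh :: real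
  assumes R: "1 \<le> R" and dh: "0 \<le> dh"
    and contU: "l \<in> modes N \<Longrightarrow> continuous_on {0..tau} (U l)"
    and contV: "l \<in> modes N \<Longrightarrow> continuous_on {0..tau} (V l)"
    and derU: "l \<in> modes N \<Longrightarrow> s \<in> {0<..<tau} \<Longrightarrow> (U l has_vector_derivative V l s) (at s)"
    and derV: "l \<in> modes N \<Longrightarrow> s \<in> {0<..<tau} \<Longrightarrow> (V l has_vector_derivative
       - of_real kap * (of_real ((mu a b l)\<^sup>2 + kap) * U l s + F l s)) (at s)"
    and bU: "s \<in> {0..tau} \<Longrightarrow> cn 6 (\<lambda>l. U l s) \<le> R"
    and bV: "s \<in> {0..tau} \<Longrightarrow> cn 6 (\<lambda>l. of_real (eps\<^sup>2) * V l s) \<le> R"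
    and bF: "s \<in> {0..tau} \<Longrightarrow> cn 4 (\<lambda>l. F l s) \<le> R"
    and eta: "s \<in> {0..tau} \<Longrightarrow>
       cn 2 (\<lambda>l. F l s - dft a b N (fN lam (idft a b N (\<lambda>l. U l s))) l) \<le> dh"
begin

definition gu :: "real \<Rightarrow> nat \<Rightarrow> complex" where "gu s = ID (\<lambda>l. U l s)"
definition gv :: "real \<Rightarrow> nat \<Rightarrow> complex" where "gv s = ID (\<lambda>l. V l s)"
definition p where "p = ZP (gu 0) (gv 0)"
definition q where "q = ZQ (gu 0) (gv 0)"
text \<open>The exact amplitudes are fixed by \<open>U_PQ\<close> and \<open>V_PQ\<close> together:
  as in the method of variation of constants, the formula for the velocity contains no derivatives
  of the amplitudes.\<close>

definition PP :: "int \<Rightarrow> real \<Rightarrow> complex" where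
  "PP l s = ei (- kap * s) * ((U l s - \<i> * of_real (eps\<^sup>2) * V l s) / 2)"
definition QQ :: "int \<Rightarrow> real \<Rightarrow> complex" where
  "QQ l s = ei (kap * s) * ((U l s + \<i> * of_real (eps\<^sup>2) * V l s) / 2)"
text \<open>The wave with amplitudes frozen at the beginning of the step; \<open>dd\<close> is the
  change of this wave that the scheme predicts to first order.\<close>

definition v0 :: "real \<Rightarrow> nat \<Rightarrow> complex" where
  "v0 s j = ei (kap * s) * p j + cnj (ei (kap * s)) * q j"
definition pd where "pd = PD (gu 0) (gv 0)"
definition qd where "qd = QD (gu 0) (gv 0)"
definition dd :: "real \<Rightarrow> nat \<Rightarrow> complex" where
  "dd s j = ei (kap * s) * (of_real s * pd j) + cnj (ei (kap * s)) * (of_real s * qd j)"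
definition GU :: "int \<Rightarrow> real \<Rightarrow> complex" where
  "GU l s = of_real ((mu a b l)\<^sup>2) * U l s + F l s"

lemma tau0: "0 \<le> tau" "0 \<in> {0..tau}" using tau by auto

lemma dft_gu: "l \<in> M \<Longrightarrow> D (gu s) l = U l s" and dft_gv: "l \<in> M \<Longrightarrow> D (gv s) l = V l s"
  by (simp_all add: gu_def gv_def dft_idft)

lemma dft_p: "l \<in> M \<Longrightarrow> D p l = PP l 0" and dft_q: "l \<in> M \<Longrightarrow> D q l = QQ l 0"
proof -
  assume l: "l \<in> M"
  have p: "p = (\<lambda>j. 1/2 * (gu 0 j - (\<i> * of_real (eps\<^sup>2)) * gv 0 j))"
   and q: "q = (\<lambda>j. 1/2 * (gu 0 j + (\<i> * of_real (eps\<^sup>2)) * gv 0 j))"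
    by (simp_all add: p_def q_def ZP_def[abs_def] ZQ_def[abs_def])
  show "D p l = PP l 0" "D q l = QQ l 0"
    unfolding p q dft_scale dft_diff dft_add dft_gu[OF l] dft_gv[OF l] by (simp_all add: PP_def QQ_def)
qed

lemma cont_PQ: "l \<in> M \<Longrightarrow> continuous_on {0..tau} (PP l)" "l \<in> M \<Longrightarrow> continuous_on {0..tau} (QQ l)"
  unfolding PP_def[abs_def] QQ_def[abs_def] by (intro continuous_intros contU contV; simp)+

lemma kap_eps_c: "complex_of_real kap * of_real (eps\<^sup>2) = 1" "complex_of_real (eps\<^sup>2) * of_real kap = 1"
  unfolding of_real_mult[symmetric] eps_kap by simp_all

text \<open>The terms of size kap cancel between the phase and the equation. What remains is mu^2 U
  + F, which is bounded independently of eps at the price of two derivatives.\<close>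

lemma der_PQ:
  assumes l: "l \<in> M" and s: "s \<in> {0<..<tau}"
  shows "(PP l has_vector_derivative 1 * \<i> / 2 * (ei (- kap * s) * GU l s)) (at s)"
    "(QQ l has_vector_derivative - 1 * \<i> / 2 * (ei (- (- kap) * s) * GU l s)) (at s)"
proof -
  let ?V = "- of_real kap * (of_real ((mu a b l)\<^sup>2 + kap) * U l s + F l s)"
  have V: "of_real (eps\<^sup>2) * ?V = - (GU l s + of_real kap * U l s)"
    by (simp only: mult_minus_left mult_minus_right mult.assoc[symmetric] kap_eps_c)
       (simp add: GU_def algebra_simps)
  have iV: "\<i> * of_real (eps\<^sup>2) * ?V = - \<i> * (GU l s + of_real kap * U l s)"
    using arg_cong[OF V, of "\<lambda>z. \<i> * z"] by (simp only: mult.assoc mult_minus_left mult_minus_right)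
  have kV: "complex_of_real kap * (of_real eps)\<^sup>2 = 1"
    using kap_eps_c by simp
  have "(PP l has_vector_derivative ei (- kap * s) * ((V l s - \<i> * of_real (eps\<^sup>2) * ?V) / 2)
      + \<i> * of_real (- kap) * ei (- kap * s) * ((U l s - \<i> * of_real (eps\<^sup>2) * V l s) / 2)) (at s)"
    unfolding PP_def[abs_def]
    by (intro has_vector_derivative_mult has_vector_derivative_ei has_vector_derivative_divide
        has_vector_derivative_diff has_vector_derivative_mult_right derU derV l s)
  then show "(PP l has_vector_derivative 1 * \<i> / 2 * (ei (- kap * s) * GU l s)) (at s)"
    by (rule has_vector_derivative_eq_rhs) (use kV in \<open>unfold iV; simp add: field_simps\<close>)
  have "(QQ l has_vector_derivative ei (kap * s) * ((V l s + \<i> * of_real (eps\<^sup>2) * ?V) / 2)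
      + \<i> * of_real kap * ei (kap * s) * ((U l s + \<i> * of_real (eps\<^sup>2) * V l s) / 2)) (at s)"
    unfolding QQ_def[abs_def]
    by (intro has_vector_derivative_mult has_vector_derivative_ei has_vector_derivative_divide
        has_vector_derivative_add has_vector_derivative_mult_right derU derV l s)
  then show "(QQ l has_vector_derivative - 1 * \<i> / 2 * (ei (- (- kap) * s) * GU l s)) (at s)"
    by (rule has_vector_derivative_eq_rhs) (use kV in \<open>unfold iV; simp add: field_simps\<close>)
qed

lemma U_PQ: "U l s = ei (kap * s) * PP l s + cnj (ei (kap * s)) * QQ l s"
  and V_PQ: "V l s = \<i> * of_real kap * (ei (kap * s) * PP l s - cnj (ei (kap * s)) * QQ l s)"
proof -
  have e: "ei (kap * s) * PP l s = (U l s - \<i> * of_real (eps\<^sup>2) * V l s) / 2"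
    "cnj (ei (kap * s)) * QQ l s = (U l s + \<i> * of_real (eps\<^sup>2) * V l s) / 2"
    by (simp_all add: PP_def QQ_def flip: mult.assoc)
  show "U l s = ei (kap * s) * PP l s + cnj (ei (kap * s)) * QQ l s"
    unfolding e by (simp add: field_simps)
  have "V l s = (complex_of_real kap * of_real (eps\<^sup>2)) * V l s" by (simp only: kap_eps_c mult_1_left)
  then show "V l s = \<i> * of_real kap * (ei (kap * s) * PP l s - cnj (ei (kap * s)) * QQ l s)"
    unfolding e by (simp add: field_simps)
qed

lemma bp: "cn 6 (D p) \<le> R" and bq: "cn 6 (D q) \<le> R"
proof -
  have *: "cn 6 (\<lambda>l. (c / 2) * (of_real (eps\<^sup>2) * V l 0) + (1 / 2) * U l 0) \<le> 1/2 * R + 1/2 * R" if "cmod c = 1" for c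
  proof (rule cn_add_le)
    show "cn 6 (\<lambda>l. (c / 2) * (of_real (eps\<^sup>2) * V l 0)) \<le> 1/2 * R"
      unfolding cn_scale[of _ "c / 2"] using bV[OF tau0(2)] that by (simp add: norm_divide)
    show "cn 6 (\<lambda>l. (1/2) * U l 0) \<le> 1/2 * R"
      unfolding cn_scale using bU[OF tau0(2)] by (simp add: norm_divide)
  qed
  have "cn 6 (D p) = cn 6 (\<lambda>l. (- \<i> / 2) * (of_real (eps\<^sup>2) * V l 0) + (1 / 2) * U l 0)"
    by (rule cn_cong) (simp add: dft_p PP_def field_simps)
  then show "cn 6 (D p) \<le> R" using *[of "- \<i>"] by simp
  have "cn 6 (D q) = cn 6 (\<lambda>l. (\<i> / 2) * (of_real (eps\<^sup>2) * V l 0) + (1 / 2) * U l 0)"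
    by (rule cn_cong) (simp add: dft_q QQ_def field_simps)
  then show "cn 6 (D q) \<le> R" using *[of \<i>] by simp
qed

lemma R_pow: "R \<le> R ^ 3" "R ^ 3 \<le> R ^ 5" "R ^ 5 \<le> R ^ 9" "R ^ 3 \<le> R ^ 9" "0 \<le> R" "1 \<le> R ^ 3" "0 \<le> R ^ 9" "0 \<le> R ^ 5"
  using R power_increasing[of 1 3 R] power_increasing[of 3 5 R] power_increasing[of 5 9 R]
    power_increasing[of 3 9 R] one_le_power[of R 3] by auto

lemma b_pq: "nm s p \<le> R" "nm s q \<le> R" if "s \<le> 6"
  using bp bq cn_mono_exp[OF that, of "D p"] cn_mono_exp[OF that, of "D q"] by (auto simp: nm_def)

lemma b_gu: "th \<in> {0..tau} \<Longrightarrow> s \<le> 6 \<Longrightarrow> nm s (gu th) \<le> R"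
  using bU[of th] cn_mono_exp[of s 6 "\<lambda>l. U l th"] by (simp add: gu_def nm_idft)

lemma b_pd: "nm 4 pd \<le> 2 * R ^ 3" "nm 4 qd \<le> 2 * R ^ 3"
proof -
  show "nm 4 pd \<le> 2 * R ^ 3"
    unfolding pd_def PD_def p_def[symmetric] q_def[symmetric] by (rule nm_ZD[OF bp bq R])
  show "nm 4 qd \<le> 2 * R ^ 3"
    unfolding qd_def QD_def[abs_def] p_def[symmetric] q_def[symmetric] n4.nm_minus by (rule nm_ZD[OF bq bp R])
qed

lemma b_comb: "nm s (\<lambda>j. e * x j + cnj e * y j) \<le> A + B" if "cmod e = 1" "nm s x \<le> A" "nm s y \<le> B" "s \<in> {2,3,4}"
proof -
  interpret n: cubic_seminorm lam "nm s" by (rule cubic_seminorm_nm) (use that in auto)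
  show ?thesis using n.nm_add[of "\<lambda>j. e * x j" "\<lambda>j. cnj e * y j"] that by (simp add: n.nm_scale)
qed

lemma b_v0: "nm 4 (v0 s) \<le> 2 * R"
  unfolding v0_def[abs_def] using b_comb[of "ei (kap * s)" 4 p R q R] b_pq[of 4] by simp

lemma b_dd: "0 \<le> s \<Longrightarrow> nm 4 (dd s) \<le> 4 * R ^ 3 * s"
proof -
  assume s: "0 \<le> s"
  have "nm 4 (\<lambda>j. of_real s * pd j) \<le> s * (2 * R ^ 3)" "nm 4 (\<lambda>j. of_real s * qd j) \<le> s * (2 * R ^ 3)"
    unfolding n4.nm_scale using s b_pd by (auto intro: mult_left_mono)
  from b_comb[OF _ this, of "ei (kap * s)"] show ?thesis
    unfolding dd_def[abs_def] by (simp add: mult_ac)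
qed

lemma NN_eq: "NN (gu 0) (gv 0) l s = D (\<lambda>j. fN lam (v0 s) j + DfN lam (v0 s) (dd s) j) l"
proof -
  have "N1 (gu 0) (gv 0) s j + N3 (gu 0) (gv 0) s j = fN lam (v0 s) j + DfN lam (v0 s) (dd s) j" for j
    unfolding N1_def N3_def p_def[symmetric] q_def[symmetric] pd_def[symmetric] qd_def[symmetric]
    using F1_F3_eq[of "ei (kap * s)"] by (simp add: v0_def[abs_def] dd_def[abs_def])
  then show ?thesis by (simp flip: dft_add)
qed

text \<open>The speed of the amplitudes is bounded in H^4: the factor mu^2 takes \<open>U\<close>
  from order 6 to order 4, in which \<open>F\<close> is bounded as well.\<close>

lemma drift_PQ:
  assumes s: "s \<in> {0..tau}"
  shows "cn 4 (\<lambda>l. PP l s - PP l 0) \<le> s * R" "cn 4 (\<lambda>l. QQ l s - QQ l 0) \<le> s * R"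
proof -
  have s0: "0 \<le> s" "s \<le> tau" using s by auto
  have G: "cn 4 (\<lambda>l. GU l s) \<le> 2 * R" if "s \<in> {0..tau}" for s
  proof -
    have "cn 4 (\<lambda>l. of_real ((mu a b l)\<^sup>2) * U l s) \<le> 1 * cn (4 + 2 * 1) (\<lambda>l. U l s)"
      by (rule cn_mult_wt) (use wt_mult in \<open>auto simp: norm_power\<close>)
    then have "cn 4 (\<lambda>l. GU l s) \<le> R + R"
      unfolding GU_def using bU[OF that] bF[OF that] by (intro cn_add_le) auto
    then show ?thesis by simp
  qed
  have *: "cn 4 (\<lambda>l. c * \<i> / 2 * (ei x * GU l s)) \<le> R" if "cmod c = 1" "s \<in> {0..tau}" for c x s
  proof -
    have "cn 4 (\<lambda>l. c * \<i> / 2 * (ei x * GU l s)) = 1/2 * cn 4 (\<lambda>l. GU l s)"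
      unfolding cn_scale using that by (simp add: norm_mult norm_divide)
    then show ?thesis using G[OF that(2)] by simp
  qed
  show "cn 4 (\<lambda>l. PP l s - PP l 0) \<le> s * R"
  proof (rule cn_mean_value[OF s0(1)])
    show "continuous_on {0..s} (PP l)" if "l \<in> M" for l
      by (rule continuous_on_subset[OF cont_PQ(1)[OF that]]) (use s0 in auto)
    show "(PP l has_vector_derivative 1 * \<i> / 2 * (ei (- kap * r) * GU l r)) (at r)" if "l \<in> M" "r \<in> {0<..<s}" for l r
      by (rule der_PQ) (use that s0 in auto)
    show "cn 4 (\<lambda>l. 1 * \<i> / 2 * (ei (- kap * r) * GU l r)) \<le> R" if "r \<in> {0..s}" for r
      by (rule *) (use that s0 in auto)
  qed
  show "cn 4 (\<lambda>l. QQ l s - QQ l 0) \<le> s * R"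
  proof (rule cn_mean_value[OF s0(1)])
    show "continuous_on {0..s} (QQ l)" if "l \<in> M" for l
      by (rule continuous_on_subset[OF cont_PQ(2)[OF that]]) (use s0 in auto)
    show "(QQ l has_vector_derivative - 1 * \<i> / 2 * (ei (- (- kap) * r) * GU l r)) (at r)" if "l \<in> M" "r \<in> {0<..<s}" for l r
      by (rule der_PQ) (use that s0 in auto)
    show "cn 4 (\<lambda>l. - 1 * \<i> / 2 * (ei (- (- kap) * r) * GU l r)) \<le> R" if "r \<in> {0..s}" for r
      by (rule *) (use that s0 in auto)
  qed
qed

lemma dft_v0: "l \<in> M \<Longrightarrow> D (v0 s) l = ei (kap * s) * PP l 0 + cnj (ei (kap * s)) * QQ l 0"
  unfolding v0_def[abs_def] dft_add dft_scale by (simp add: dft_p dft_q)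

lemma cn_phase_pair:
  assumes "cn m x \<le> A" "cn m y \<le> B" "cmod e = 1"
  shows "cn m (\<lambda>l. e * x l + cnj e * y l) \<le> A + B"
  by (rule cn_add_le) (use assms in \<open>auto simp: cn_scale\<close>)

lemma gu_v0: "l \<in> M \<Longrightarrow> U l s - D (v0 s) l = ei (kap * s) * (PP l s - PP l 0) + cnj (ei (kap * s)) * (QQ l s - QQ l 0)"
  unfolding dft_v0 U_PQ[of l s] by (simp add: algebra_simps)

lemma delta_bound:
  assumes s: "s \<in> {0..tau}"
  shows "nm 4 (\<lambda>j. gu s j - v0 s j) \<le> 2 * R * s"
    "nm 4 (\<lambda>j. gu s j - v0 s j) \<le> 2 * R * (kap * s\<^sup>2)"
proof -
  have s0: "0 \<le> s" "s \<le> tau" using s by auto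
  have eq: "nm 4 (\<lambda>j. gu s j - v0 s j) = cn 4 (\<lambda>l. U l s - D (v0 s) l)" for s
    unfolding nm_def by (rule cn_cong) (simp add: dft_diff dft_gu)
  have "cn 4 (\<lambda>l. U l s - D (v0 s) l) = cn 4 (\<lambda>l. ei (kap * s) * (PP l s - PP l 0) + cnj (ei (kap * s)) * (QQ l s - QQ l 0))"
    by (rule cn_cong) (rule gu_v0)
  also have "\<dots> \<le> s * R + s * R" by (rule cn_phase_pair[OF drift_PQ[OF s]]) simp
  finally show "nm 4 (\<lambda>j. gu s j - v0 s j) \<le> 2 * R * s" unfolding eq by (simp add: mult_ac)
  let ?phi = "\<lambda>l r. U l r - (ei (kap * r) * PP l 0 + ei (- kap * r) * QQ l 0)"
  let ?phi' = "\<lambda>l r. \<i> * of_real kap * (ei (kap * r) * (PP l r - PP l 0) - cnj (ei (kap * r)) * (QQ l r - QQ l 0))"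
  have "cn 4 (\<lambda>l. ?phi l s - ?phi l 0) \<le> s * (kap * (2 * R * s))"
  proof (rule cn_mean_value[OF s0(1)])
    fix l assume l: "l \<in> M"
    show "continuous_on {0..s} (?phi l)"
      by (intro continuous_intros continuous_on_subset[OF contU[OF l]]) (use s0 in auto)
    fix r assume r: "r \<in> {0<..<s}"
    have "(?phi l has_vector_derivative V l r - (\<i> * of_real kap * ei (kap * r) * PP l 0 + \<i> * of_real (- kap) * ei (- kap * r) * QQ l 0)) (at r)"
      by (intro has_vector_derivative_diff has_vector_derivative_add has_vector_derivative_mult_left
          has_vector_derivative_ei derU l) (use r s0 in auto)
    then show "(?phi l has_vector_derivative ?phi' l r) (at r)"
      by (rule has_vector_derivative_eq_rhs) (simp add: V_PQ[of l r] algebra_simps)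
  next
    fix r assume r: "r \<in> {0..s}"
    have r': "r \<in> {0..tau}" using r s0 by auto
    have m: "cn 4 (\<lambda>l. - (QQ l r - QQ l 0)) \<le> r * R" unfolding cn_minus by (rule drift_PQ(2)[OF r'])
    have "cn 4 (\<lambda>l. ei (kap * r) * (PP l r - PP l 0) + cnj (ei (kap * r)) * (- (QQ l r - QQ l 0))) \<le> r * R + r * R"
      by (rule cn_phase_pair[OF drift_PQ(1)[OF r'] m]) simp
    then have "cn 4 (\<lambda>l. ei (kap * r) * (PP l r - PP l 0) - cnj (ei (kap * r)) * (QQ l r - QQ l 0)) \<le> 2 * R * r"
      by (simp add: algebra_simps)
    also have "\<dots> \<le> 2 * R * s" using r R by (intro mult_left_mono) auto
    finally show "cn 4 (\<lambda>l. ?phi' l r) \<le> kap * (2 * R * s)"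
      unfolding cn_scale using kap_pos by (simp add: norm_mult)
  qed
  also have "cn 4 (\<lambda>l. ?phi l s - ?phi l 0) = cn 4 (\<lambda>l. U l s - D (v0 s) l)"
    by (rule cn_cong) (use U_PQ[of _ 0] in \<open>simp add: dft_v0\<close>)
  finally show "nm 4 (\<lambda>j. gu s j - v0 s j) \<le> 2 * R * (kap * s\<^sup>2)"
    unfolding eq by (simp add: power2_eq_square mult_ac)
qed

definition sig :: real where "sig = tau\<^sup>2 + eps\<^sup>2 + dh"

text \<open>First order in tau is enough, because \<open>amplitude_expansion\<close> integrates this
  defect over a step and so gains another factor tau.\<close>

lemma frozen_defect:
  assumes s: "s \<in> {0..tau}"
  shows "cn 2 (\<lambda>l. GU l s - (of_real ((mu a b l)\<^sup>2) * D (v0 s) l + D (fN lam (v0 s)) l)) \<le> 26 * R ^ 3 * tau + dh"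
proof -
  have s0: "0 \<le> s" "s \<le> tau" using s by auto
  have dl: "cn 4 (\<lambda>l. U l s - D (v0 s) l) \<le> 2 * R * s"
    using delta_bound(1)[OF s] unfolding nm_def using cn_cong[of "D (\<lambda>j. gu s j - v0 s j)" "\<lambda>l. U l s - D (v0 s) l" 4]
    by (simp add: dft_diff dft_gu)
  have "cn 2 (\<lambda>l. of_real ((mu a b l)\<^sup>2) * (U l s - D (v0 s) l)) \<le> 1 * cn (2 + 2 * 1) (\<lambda>l. U l s - D (v0 s) l)"
    by (rule cn_mult_wt) (use wt_mult in \<open>auto simp: norm_power\<close>)
  then have 1: "cn 2 (\<lambda>l. of_real ((mu a b l)\<^sup>2) * (U l s - D (v0 s) l)) \<le> 2 * R * s" using dl by simp
  have "n2.close (2 * R) (2 * R * s) (gu s) (v0 s)"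
    unfolding n2.close_def
    using b_gu[OF s, of 2] b_v0[of s] nm_mono_exp[of 2 4 "v0 s"] delta_bound(1)[OF s]
      nm_mono_exp[of 2 4 "\<lambda>j. gu s j - v0 s j"] R by auto
  from n2.close_fN[OF this]
  have 2: "cn 2 (\<lambda>l. D (fN lam (gu s)) l - D (fN lam (v0 s)) l) \<le> 24 * R ^ 3 * s"
    by (simp add: n2.close_def nm_def dft_diff[abs_def] power2_eq_square power3_eq_cube mult_ac)
  have "cn 2 (\<lambda>l. (F l s - D (fN lam (gu s)) l) + (of_real ((mu a b l)\<^sup>2) * (U l s - D (v0 s) l)
      + (D (fN lam (gu s)) l - D (fN lam (v0 s)) l))) \<le> dh + (2 * R * s + 24 * R ^ 3 * s)"
    by (intro cn_add_le 1 2) (use eta[OF s] in \<open>simp add: gu_def\<close>)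
  then have "cn 2 (\<lambda>l. GU l s - (of_real ((mu a b l)\<^sup>2) * D (v0 s) l + D (fN lam (v0 s)) l)) \<le> dh + (2 * R * s + 24 * R ^ 3 * s)"
    by (simp add: GU_def algebra_simps)
  also have "2 * R * s + 24 * R ^ 3 * s \<le> 2 * R ^ 3 * tau + 24 * R ^ 3 * tau"
    using s0 R_pow by (intro add_mono mult_mono) auto
  finally show ?thesis by (simp add: mult_ac)
qed

text \<open>For the second amplitude the expansion is applied with \<open>c = -1\<close>,
  \<open>k = - kap\<close> and with \<open>p\<close> and \<open>q\<close> exchanged, under which the
  wave \<open>v0\<close> is unchanged.\<close>

lemma amplitude_bounds:
  assumes th: "th \<in> {0..tau}"
  shows "cn 2 (\<lambda>l. PP l th - PP l 0 - of_real th * D pd l) \<le> 33 * R ^ 3 * sig"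
    "cn 2 (\<lambda>l. QQ l th - QQ l 0 - of_real th * D qd l) \<le> 33 * R ^ 3 * sig"
proof -
  let ?A = "26 * R ^ 3 * tau + dh"
  have pd: "1 * D (ZD p q) l = D pd l" and qd: "- 1 * D (ZD q p) l = D qd l" for l
    by (simp_all add: pd_def PD_def qd_def QD_def[abs_def] p_def q_def dft_minus)
  have bound: "tau * ?A + (6 * R ^ 3 * eps\<^sup>2 + tau\<^sup>2 * R) \<le> 33 * R ^ 3 * sig"
  proof -
    have "tau * ?A = 26 * (R ^ 3 * tau\<^sup>2) + tau * dh" by (simp add: power2_eq_square algebra_simps)
    moreover have "tau * dh \<le> R ^ 3 * dh"
      using tau1 R_pow dh by (intro mult_right_mono) auto
    moreover have "tau\<^sup>2 * R \<le> R ^ 3 * tau\<^sup>2" unfolding mult.commute[of "tau\<^sup>2"] using R_pow by (intro mult_right_mono) auto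
    moreover have "0 \<le> R ^ 3 * eps\<^sup>2" "0 \<le> R ^ 3 * tau\<^sup>2" "0 \<le> R ^ 3 * dh" using R_pow dh by auto
    moreover have "33 * R ^ 3 * sig = 33 * (R ^ 3 * tau\<^sup>2) + 33 * (R ^ 3 * eps\<^sup>2) + 33 * (R ^ 3 * dh)"
      by (simp add: sig_def algebra_simps)
    ultimately show ?thesis by linarith
  qed
  have v0p: "(\<lambda>j. ei (kap * s) * p j + cnj (ei (kap * s)) * q j) = v0 s"
   and v0q: "(\<lambda>j. ei (- kap * s) * q j + cnj (ei (- kap * s)) * p j) = v0 s" for s
    by (simp_all add: v0_def fun_eq_iff)
  have Dv0p: "ei (kap * s) * D p l + cnj (ei (kap * s)) * D q l = D (v0 s) l"
   and Dv0q: "ei (- kap * s) * D q l + cnj (ei (- kap * s)) * D p l = D (v0 s) l" for s l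
    unfolding v0_def[abs_def] dft_add dft_scale by simp_all
  have "cn 2 (\<lambda>l. PP l th - PP l 0 - of_real th * (1 * D (ZD p q) l)) \<le> tau * ?A + (6 * R ^ 3 * eps\<^sup>2 + tau\<^sup>2 * R)"
  proof (rule amplitude_expansion[where k = kap and G = GU])
    show "cn 2 (\<lambda>l. GU l s - (of_real ((mu a b l)\<^sup>2) * (ei (kap * s) * D p l + cnj (ei (kap * s)) * D q l)
         + D (fN lam (\<lambda>j. ei (kap * s) * p j + cnj (ei (kap * s)) * q j)) l)) \<le> ?A" if "s \<in> {0..tau}" for s
      unfolding v0p Dv0p by (rule frozen_defect[OF that])
  qed (use kap_pos R bp bq th cont_PQ der_PQ(1) dft_p in auto)
  then show "cn 2 (\<lambda>l. PP l th - PP l 0 - of_real th * D pd l) \<le> 33 * R ^ 3 * sig"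
    unfolding pd using bound by linarith
  have "cn 2 (\<lambda>l. QQ l th - QQ l 0 - of_real th * (- 1 * D (ZD q p) l)) \<le> tau * ?A + (6 * R ^ 3 * eps\<^sup>2 + tau\<^sup>2 * R)"
  proof (rule amplitude_expansion[where k = "- kap" and G = GU])
    show "cn 2 (\<lambda>l. GU l s - (of_real ((mu a b l)\<^sup>2) * (ei (- kap * s) * D q l + cnj (ei (- kap * s)) * D p l)
         + D (fN lam (\<lambda>j. ei (- kap * s) * q j + cnj (ei (- kap * s)) * p j)) l)) \<le> ?A" if "s \<in> {0..tau}" for s
      unfolding v0q Dv0q by (rule frozen_defect[OF that])
    show "(QQ l has_vector_derivative - 1 * \<i> / 2 * (ei (- (- kap) * s) * GU l s)) (at s)" if "l \<in> M" "s \<in> {0<..<tau}" for l s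
      by (rule der_PQ(2)[OF that])
  qed (use kap_pos R bp bq th cont_PQ dft_q in auto)
  then show "cn 2 (\<lambda>l. QQ l th - QQ l 0 - of_real th * D qd l) \<le> 33 * R ^ 3 * sig"
    unfolding qd using bound by linarith
qed

end

section \<open>Local error\<close>

text \<open>The bound \<open>B1\<close> of \<open>stab_const\<close> at \<open>B = R\<close>: it
  controls \<open>V1\<close> and \<open>V1 + R1\<close> when the step starts from the exact
  solution.\<close>

definition B1c :: "real \<Rightarrow> real" where
  "B1c R = 2 * R + 4 * (3 * R ^ 3) + 32 * (3 * R ^ 3) ^ 3"

definition cW1 :: "real \<Rightarrow> real" where
  "cW1 R = 3 * (B1c R)\<^sup>2 * (66 * R ^ 9) + (3 * B1c R * (70 * R ^ 9)\<^sup>2 + (70 * R ^ 9) ^ 3)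
     + 6 * B1c R * (4 * R ^ 3) * (198 * R ^ 9)"

context mti_exact begin

abbreviation gx :: "nat \<Rightarrow> complex" where "gx \<equiv> gu 0"
abbreviation gy :: "nat \<Rightarrow> complex" where "gy \<equiv> gv 0"

text \<open>The rotated pair formed from rt U and eps^2 V has derivative -F times the kernel,
  because om rt = mu^2 + kap. Integrals are used since the modes are differentiable only inside the
  interval.\<close>

lemma exact_energy_form:
  assumes l: "l \<in> M"
  shows "((\<lambda>th. of_real (sin (om l * (tau - th))) * F l th) has_integral
     (of_real (cos (om l * tau)) * (of_real (rt l) * U l 0) + of_real (sin (om l * tau)) * (of_real (eps\<^sup>2) * V l 0)
       - of_real (rt l) * U l tau)) {0..tau}"
   and "((\<lambda>th. of_real (cos (om l * (tau - th))) * F l th) has_integral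
     (- of_real (sin (om l * tau)) * (of_real (rt l) * U l 0) + of_real (cos (om l * tau)) * (of_real (eps\<^sup>2) * V l 0)
       - of_real (eps\<^sup>2) * V l tau)) {0..tau}"
proof -
  let ?s = "\<lambda>th. complex_of_real (sin (om l * (tau - th)))" and ?c = "\<lambda>th. complex_of_real (cos (om l * (tau - th)))"
  let ?o = "complex_of_real (om l)" and ?r = "complex_of_real (rt l)" and ?e = "complex_of_real (eps\<^sup>2)" and ?k = "complex_of_real kap"
  have ds: "(?s has_vector_derivative - (?o * ?c th)) (at th)"
   and dc: "(?c has_vector_derivative ?o * ?s th) (at th)" for th
    by (auto intro!: derivative_eq_intros has_vector_derivative_of_real
        simp: has_real_derivative_iff_has_vector_derivative[symmetric])
  have eo: "?e * ?o = ?r" unfolding of_real_mult[symmetric] eps_om ..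
  have okr: "?o = ?k * ?r" unfolding of_real_mult[symmetric] om_eq ..
  have rr: "?k * (?r * ?r) = of_real ((mu a b l)\<^sup>2 + kap)"
  proof -
    have "rt l * rt l = 1 + (mu a b l)\<^sup>2 * eps\<^sup>2" by (simp add: rt_def)
    then have "kap * (rt l * rt l) = (mu a b l)\<^sup>2 + kap"
      using eps_kap by (simp add: distrib_left mult.left_commute[of kap])
    then show ?thesis unfolding of_real_mult[symmetric] by simp
  qed
  have eV: "?e * (- ?k * (of_real ((mu a b l)\<^sup>2 + kap) * U l th + F l th)) = - (?o * ?r * U l th + F l th)" for th
    unfolding rr[symmetric] okr using kap_eps_c by (simp only: mult_minus_left mult_minus_right mult.assoc[symmetric] mult_1_left)
  have oe: "?o * (?e * z) = ?r * z" for z unfolding eo[symmetric] by (simp only: mult_ac)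
  have "((\<lambda>th. - (?s th * F l th)) has_integral
     (?c tau * (?r * U l tau) + ?s tau * (?e * V l tau) - (?c 0 * (?r * U l 0) + ?s 0 * (?e * V l 0)))) {0..tau}"
  proof (rule fundamental_theorem_of_calculus_interior[OF tau0(1)])
    show "continuous_on {0..tau} (\<lambda>th. ?c th * (?r * U l th) + ?s th * (?e * V l th))"
      by (intro continuous_intros contU contV l)
    fix th assume th: "th \<in> {0<..<tau}"
    have "((\<lambda>th. ?c th * (?r * U l th) + ?s th * (?e * V l th)) has_vector_derivative
       (?c th * (?r * V l th) + (?o * ?s th) * (?r * U l th))
        + (?s th * (?e * (- ?k * (of_real ((mu a b l)\<^sup>2 + kap) * U l th + F l th))) + (- (?o * ?c th)) * (?e * V l th))) (at th)"
      by (intro has_vector_derivative_add has_vector_derivative_mult has_vector_derivative_mult_right ds dc derU derV l th)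
    then show "((\<lambda>th. ?c th * (?r * U l th) + ?s th * (?e * V l th)) has_vector_derivative - (?s th * F l th)) (at th)"
    proof (rule has_vector_derivative_eq_rhs)
      have "?c th * (?r * V l th) = ?c th * (?o * (?e * V l th))" by (simp only: oe)
      then show "?c th * (?r * V l th) + ?o * ?s th * (?r * U l th)
        + (?s th * (?e * (- ?k * (of_real ((mu a b l)\<^sup>2 + kap) * U l th + F l th))) + (- (?o * ?c th)) * (?e * V l th)) = - (?s th * F l th)"
        unfolding eV by (simp add: algebra_simps)
    qed
  qed
  from has_integral_neg[OF this]
  show "((\<lambda>th. ?s th * F l th) has_integral
     (of_real (cos (om l * tau)) * (?r * U l 0) + of_real (sin (om l * tau)) * (?e * V l 0) - ?r * U l tau)) {0..tau}"
    by (simp add: algebra_simps)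
  have "((\<lambda>th. - (?c th * F l th)) has_integral
     (- ?s tau * (?r * U l tau) + ?c tau * (?e * V l tau) - (- ?s 0 * (?r * U l 0) + ?c 0 * (?e * V l 0)))) {0..tau}"
  proof (rule fundamental_theorem_of_calculus_interior[OF tau0(1)])
    show "continuous_on {0..tau} (\<lambda>th. - ?s th * (?r * U l th) + ?c th * (?e * V l th))"
      by (intro continuous_intros contU contV l)
    fix th assume th: "th \<in> {0<..<tau}"
    have "((\<lambda>th. - ?s th * (?r * U l th) + ?c th * (?e * V l th)) has_vector_derivative
       (- ?s th * (?r * V l th) + (- (- (?o * ?c th))) * (?r * U l th))
        + (?c th * (?e * (- ?k * (of_real ((mu a b l)\<^sup>2 + kap) * U l th + F l th))) + (?o * ?s th) * (?e * V l th))) (at th)"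
      by (intro has_vector_derivative_add has_vector_derivative_mult has_vector_derivative_minus has_vector_derivative_mult_right ds dc derU derV l th)
    then show "((\<lambda>th. - ?s th * (?r * U l th) + ?c th * (?e * V l th)) has_vector_derivative - (?c th * F l th)) (at th)"
    proof (rule has_vector_derivative_eq_rhs)
      have "?s th * (?r * V l th) = ?s th * (?o * (?e * V l th))" by (simp only: oe)
      then show "- ?s th * (?r * V l th) + (- (- (?o * ?c th))) * (?r * U l th)
        + (?c th * (?e * (- ?k * (of_real ((mu a b l)\<^sup>2 + kap) * U l th + F l th))) + (?o * ?s th) * (?e * V l th)) = - (?c th * F l th)"
        unfolding eV using eo by (simp add: algebra_simps)
    qed
  qed
  from has_integral_neg[OF this]
  show "((\<lambda>th. ?c th * F l th) has_integral
     (- of_real (sin (om l * tau)) * (?r * U l 0) + of_real (cos (om l * tau)) * (?e * V l 0) - ?e * V l tau)) {0..tau}"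
    by (simp add: algebra_simps)
qed

text \<open>Scheme and solution start from the same data, so the linear parts cancel and the local
  error is the kernel integral of the nonlinear defect; the second component contains the correction
  in addition.\<close>

lemma step_defect:
  assumes l: "l \<in> M"
  shows "((\<lambda>th. of_real (sin (om l * (tau - th))) * (F l th - NN gx gy l th)) has_integral
      - (of_real (rt l) * D (\<lambda>j. gu tau j - (V1 gx gy j + R1 gx gy j)) l)) {0..tau}"
    "((\<lambda>th. of_real (cos (om l * (tau - th))) * (F l th - NN gx gy l th)) has_integral
      (- (of_real (eps\<^sup>2) * D (\<lambda>j. gv tau j - UD1 gx gy j) l) + of_real (tau / 2) * D (W1 gx gy) l)) {0..tau}"
proof -
  have N: "((\<lambda>th. of_real (sin (om l * (tau - th))) * NN gx gy l th) has_integral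
        integral {0..tau} (\<lambda>th. of_real (sin (om l * (tau - th))) * NN gx gy l th)) {0..tau}"
      "((\<lambda>th. of_real (cos (om l * (tau - th))) * NN gx gy l th) has_integral
        integral {0..tau} (\<lambda>th. of_real (cos (om l * (tau - th))) * NN gx gy l th)) {0..tau}"
    by (intro integrable_integral integrable_phase continuous_intros)+
  show "((\<lambda>th. of_real (sin (om l * (tau - th))) * (F l th - NN gx gy l th)) has_integral
      - (of_real (rt l) * D (\<lambda>j. gu tau j - (V1 gx gy j + R1 gx gy j)) l)) {0..tau}"
    using has_integral_diff[OF exact_energy_form(1)[OF l] N(1)]
    unfolding dft_diff[of "gu tau"] right_diff_distrib[of "complex_of_real r" for r] step_energy_form(1)[OF l]
    by (simp add: dft_gu[OF l] dft_gv[OF l] algebra_simps)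
  show "((\<lambda>th. of_real (cos (om l * (tau - th))) * (F l th - NN gx gy l th)) has_integral
      (- (of_real (eps\<^sup>2) * D (\<lambda>j. gv tau j - UD1 gx gy j) l) + of_real (tau / 2) * D (W1 gx gy) l)) {0..tau}"
    using has_integral_diff[OF exact_energy_form(2)[OF l] N(2)]
    unfolding dft_diff[of "gv tau"] right_diff_distrib[of "complex_of_real r" for r] step_energy_form(2)[OF l]
    by (simp add: dft_gu[OF l] dft_gv[OF l] algebra_simps)
qed

lemma cn_has_integral:
  assumes t: "0 \<le> t" and int: "\<And>l. l \<in> M \<Longrightarrow> (phi l has_integral I l) {0..t}"
    and bd: "\<And>s. s \<in> {0..t} \<Longrightarrow> cn m (\<lambda>l. phi l s) \<le> C"
  shows "cn m I \<le> t * C"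
proof -
  have "cn m (\<lambda>l. integral {0..t} (phi l)) \<le> t * C"
    by (rule cn_integral[OF _ t bd]) (use int in blast)
  moreover have "cn m I = cn m (\<lambda>l. integral {0..t} (phi l))"
    by (rule cn_cong) (simp add: integral_unique[OF int])
  ultimately show ?thesis by simp
qed

lemma nm2_le: "nm 4 x \<le> A \<Longrightarrow> nm 2 x \<le> A" "nm 4 x \<le> A \<Longrightarrow> nm 3 x \<le> A" "nm 3 x \<le> A \<Longrightarrow> nm 2 x \<le> A"
  using nm_mono_exp[of 2 4 x] nm_mono_exp[of 3 4 x] nm_mono_exp[of 2 3 x] by auto

lemma F_split: "F l th - NN gx gy l th = (F l th - D (fN lam (gu th)) l)
    + D (\<lambda>j. fN lam (gu th) j - fN lam (v0 th) j - DfN lam (v0 th) (dd th) j) l"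
  unfolding NN_eq by (simp add: dft_diff dft_add algebra_simps)

lemma gu_v0_eq: "fN lam (\<lambda>j. v0 th j + (gu th j - v0 th j)) = fN lam (gu th)"
  by simp

lemma b_V1: "nm 2 (V1 gx gy) \<le> B1c R" "nm 2 (\<lambda>j. V1 gx gy j + R1 gx gy j) \<le> B1c R"
  and B1c_ge: "R \<le> B1c R" "1 \<le> B1c R" "0 \<le> B1c R"
proof -
  have R9: "0 \<le> (3 * R ^ 3) ^ 3" using R_pow by auto
  show *: "R \<le> B1c R" "1 \<le> B1c R" "0 \<le> B1c R"
    using R R_pow R9 by (auto simp: B1c_def)
  have x: "n2.close R 0 gx gx"
    using n2.close_refl b_gu[OF tau0(2), of 2] by auto
  have y: "n2.close R 0 (\<lambda>j. of_real (eps\<^sup>2) * gy j) (\<lambda>j. of_real (eps\<^sup>2) * gy j)"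
  proof (rule n2.close_refl)
    have "nm 2 (\<lambda>j. of_real (eps\<^sup>2) * gy j) = cn 2 (\<lambda>l. of_real (eps\<^sup>2) * V l 0)"
      unfolding nm_def by (rule cn_cong) (simp add: dft_scale dft_gv)
    then show "nm 2 (\<lambda>j. of_real (eps\<^sup>2) * gy j) \<le> R"
      using bV[OF tau0(2)] cn_mono_exp[of 2 6 "\<lambda>l. of_real (eps\<^sup>2) * V l 0"] by simp
  qed
  note VR = close_VR[OF R x y]
  show "nm 2 (V1 gx gy) \<le> B1c R"
    using VR(1) R_pow R9 unfolding n2.close_def B1c_def by auto
  show "nm 2 (\<lambda>j. V1 gx gy j + R1 gx gy j) \<le> B1c R"
    using n2.close_add[OF VR] R_pow R9 unfolding n2.close_def B1c_def by auto
qed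

text \<open>The frequency \<open>om l\<close> can resonate with the third harmonic, but only if \<open>mu^2\<close> is of size
  \<open>1 / eps^2\<close>; replacing \<open>om l\<close> by \<open>kap\<close> costs two derivatives.\<close>

lemma third_harmonic_bound:
  "cmod (integral {0..tau} (\<lambda>th. of_real (ks l th) * ei (kap * th) ^ 3)) \<le> (eps\<^sup>2 + tau\<^sup>2) * wt a b l ^ 1"
proof -
  let ?d = "\<lambda>th. (sin (om l * (tau - th)) - sin (kap * (tau - th))) / rt l"
  have rt0: "0 < rt l" using rt_ge_1[of l] by simp
  have sd: "\<bar>sin x - sin y\<bar> \<le> \<bar>x - y\<bar>" for x y :: real
  proof -
    have "\<bar>Im (ei x - ei y)\<bar> \<le> cmod (ei x - ei y)" by (rule abs_Im_le_cmod)
    then show ?thesis using ei_lipschitz[of x y] by (simp add: ei_cis)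
  qed
  have omk: "om l - kap \<le> (mu a b l)\<^sup>2" "0 \<le> om l - kap"
  proof -
    have "rt l * rt l - 1 = (mu a b l)\<^sup>2 * eps\<^sup>2" by (simp add: rt_def)
    then have "(rt l - 1) * (rt l + 1) = (mu a b l)\<^sup>2 * eps\<^sup>2" by (simp add: algebra_simps)
    moreover have "(rt l - 1) * 1 \<le> (rt l - 1) * (rt l + 1)" using rt_ge_1[of l] by (intro mult_left_mono) auto
    ultimately have "kap * (rt l - 1) \<le> kap * ((mu a b l)\<^sup>2 * eps\<^sup>2)" using kap_pos by (intro mult_left_mono) auto
    also have "\<dots> = (mu a b l)\<^sup>2" using eps_kap by (simp add: mult.left_commute)
    finally show "om l - kap \<le> (mu a b l)\<^sup>2" by (simp add: om_eq algebra_simps)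
    show "0 \<le> om l - kap" using rt_ge_1[of l] kap_pos by (simp add: om_eq)
  qed
  have "cmod (integral {0..tau} (\<lambda>th. of_real (?d th) * ei (kap * th) ^ 3)) \<le> tau * (mu a b l)\<^sup>2 * (tau - 0)"
  proof (rule integral_bound[OF tau0(1)])
    show "continuous_on {0..tau} (\<lambda>th. of_real (?d th) * ei (kap * th) ^ 3)"
      using rt0 by (intro continuous_intros) auto
    fix th assume th: "th \<in> {0..tau}"
    have "\<bar>?d th\<bar> \<le> \<bar>sin (om l * (tau - th)) - sin (kap * (tau - th))\<bar>"
      unfolding abs_divide using rt_ge_1[of l] divide_left_mono[of 1 "rt l" "\<bar>sin (om l * (tau - th)) - sin (kap * (tau - th))\<bar>"]
      by simp
    also have "\<dots> \<le> \<bar>om l * (tau - th) - kap * (tau - th)\<bar>" by (rule sd)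
    also have "\<dots> = (om l - kap) * (tau - th)" using omk th by (simp add: abs_mult flip: left_diff_distrib)
    also have "\<dots> \<le> (mu a b l)\<^sup>2 * tau" using omk th by (intro mult_mono) auto
    finally show "cmod (of_real (?d th) * ei (kap * th) ^ 3) \<le> tau * (mu a b l)\<^sup>2"
      by (simp add: norm_mult norm_power mult.commute del: of_real_divide of_real_diff)
  qed
  then have 1: "cmod (integral {0..tau} (\<lambda>th. of_real (?d th) * ei (kap * th) ^ 3)) \<le> tau\<^sup>2 * (mu a b l)\<^sup>2"
    by (simp add: power2_eq_square mult_ac)
  let ?g = "\<lambda>th. of_real (sin (kap * (tau - th))) * ei (kap * th) ^ 3"
  \<comment> \<open>With \<open>kap\<close> in place of \<open>om\<close> the frequencies are 2 kap
    and 4 kap, both away from zero, so the integral has size eps^2.\<close>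
  have g: "?g th = (1 / (2 * \<i>)) * (ei (kap * tau) * ei (2 * kap * th) - ei (- (kap * tau)) * ei (4 * kap * th))" for th
  proof -
    have sn: "of_real (sin (kap * (tau - th))) = (1 / (2 * \<i>)) * (ei (kap * (tau - th)) - ei (- (kap * (tau - th))))"
      unfolding ei_diff_sin by simp
    have gen: "c * (x - y) * e = c * (X - Y)" if "e * x = X" "e * y = Y" for c x y e X Y :: complex
      unfolding that[symmetric] by (simp add: algebra_simps)
    show ?thesis
      unfolding sn ei_power by (rule gen) (simp_all add: algebra_simps flip: ei_add)
  qed
  have k0: "2 * kap \<noteq> 0" "4 * kap \<noteq> 0" using kap_pos by auto
  have "(?g has_integral (1 / (2 * \<i>)) * (ei (kap * tau) * (Eph (2 * kap) tau - Eph (2 * kap) 0)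
      - ei (- (kap * tau)) * (Eph (4 * kap) tau - Eph (4 * kap) 0))) {0..tau}"
    unfolding g
    by (intro has_integral_mult_right has_integral_diff fundamental_theorem_of_calculus tau0
        has_vector_derivative_Eph k0)
  then have "integral {0..tau} ?g = (1 / (2 * \<i>)) * (ei (kap * tau) * Eph (2 * kap) tau - ei (- (kap * tau)) * Eph (4 * kap) tau)"
    by (simp add: integral_unique)
  also have "cmod \<dots> \<le> 1 / 2 * (cmod (Eph (2 * kap) tau) + cmod (Eph (4 * kap) tau))"
    unfolding norm_mult[of "1 / (2 * \<i>)"]
    by (intro mult_mono order_trans[OF norm_triangle_ineq4]) (auto simp: norm_mult norm_divide)
  also have "\<dots> \<le> 1 / 2 * (eps\<^sup>2 + eps\<^sup>2)"
  proof (intro mult_left_mono add_mono)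
    show "cmod (Eph (2 * kap) tau) \<le> eps\<^sup>2"
      using norm_Eph[OF k0(1), of tau] kap_pos by (simp add: kap_def)
    have "2 / (4 * kap) \<le> eps\<^sup>2" using eps by (simp add: kap_def)
    then show "cmod (Eph (4 * kap) tau) \<le> eps\<^sup>2"
      using norm_Eph[OF k0(2), of tau] kap_pos by simp
  qed simp
  finally have 2: "cmod (integral {0..tau} ?g) \<le> eps\<^sup>2" by simp
  have gi: "(\<lambda>th. of_real (?d th) * ei (kap * th) ^ 3) integrable_on {0..tau}" "?g integrable_on {0..tau}"
    using rt0 by (intro integrable_continuous_real continuous_intros; auto)+
  have "integral {0..tau} (\<lambda>th. of_real (ks l th) * ei (kap * th) ^ 3)
     = integral {0..tau} (\<lambda>th. of_real (?d th) * ei (kap * th) ^ 3 + of_real (1 / rt l) * ?g th)"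
    by (rule integral_cong) (use rt0 in \<open>simp add: ks_def field_simps\<close>)
  also have "\<dots> = integral {0..tau} (\<lambda>th. of_real (?d th) * ei (kap * th) ^ 3) + of_real (1 / rt l) * integral {0..tau} ?g"
    using integral_add[OF gi(1) integrable_on_mult_right[OF gi(2), of "of_real (1 / rt l)"]]
    by (simp only: integral_mult_right)
  also have "cmod \<dots> \<le> tau\<^sup>2 * (mu a b l)\<^sup>2 + 1 * eps\<^sup>2"
  proof (intro order_trans[OF norm_triangle_ineq] add_mono 1)
    show "cmod (of_real (1 / rt l) * integral {0..tau} ?g) \<le> 1 * eps\<^sup>2"
      unfolding norm_mult norm_of_real using 2 rt_ge_1[of l] by (intro mult_mono) auto
  qed
  also have "\<dots> \<le> (eps\<^sup>2 + tau\<^sup>2) * wt a b l ^ 1"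
    using mult_left_mono[OF wt_ge_1[of a b l], of "eps\<^sup>2"] by (simp add: wt_def algebra_simps)
  finally show ?thesis .
qed

lemma b_DGG: "nm 2 (DGG lam p q pd qd) \<le> 24 * R ^ 9" "nm 2 (DGG lam q p qd pd) \<le> 24 * R ^ 9"
  and b_N: "th \<in> {0..tau} \<Longrightarrow> nm 2 (N1 gx gy th) \<le> 192 * R ^ 9" "th \<in> {0..tau} \<Longrightarrow> nm 2 (N3 gx gy th) \<le> 64 * R ^ 9"
proof -
  have pq: "n2.close (2 * R ^ 3) 0 p p" "n2.close (2 * R ^ 3) 0 q q"
    using b_pq[of 2] R_pow by (auto intro!: n2.close_refl intro: order_trans)
  have xy: "n2.close (2 * R ^ 3) 0 pd pd" "n2.close (2 * R ^ 3) 0 qd qd"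
    using b_pd nm2_le by (auto intro!: n2.close_refl)
  have R9: "(2 * R ^ 3) ^ 3 = 8 * R ^ 9" by (simp add: power_mult_distrib flip: power_mult)
  show "nm 2 (DGG lam p q pd qd) \<le> 24 * R ^ 9" "nm 2 (DGG lam q p qd pd) \<le> 24 * R ^ 9"
    using n2.close_DGG[OF pq xy] n2.close_DGG[OF pq(2,1) xy(2,1)] unfolding n2.close_def R9 by auto
  assume th: "th \<in> {0..tau}"
  have th1: "cmod (of_real th) \<le> 1" using th tau1 by auto
  have "nm 2 (\<lambda>j. of_real th * pd j) \<le> 1 * (2 * R ^ 3)" "nm 2 (\<lambda>j. of_real th * qd j) \<le> 1 * (2 * R ^ 3)"
    unfolding n2.nm_scale using xy th1 by (intro mult_mono; auto simp: n2.close_def)+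
  then have xy': "n2.close (2 * R ^ 3) 0 (\<lambda>j. of_real th * pd j) (\<lambda>j. of_real th * pd j)"
     "n2.close (2 * R ^ 3) 0 (\<lambda>j. of_real th * qd j) (\<lambda>j. of_real th * qd j)"
    by (auto intro!: n2.close_refl)
  show "nm 2 (N1 gx gy th) \<le> 192 * R ^ 9"
    using n2.close_F1[OF norm_ei pq xy', of "kap * th"]
    unfolding N1_def p_def[symmetric] q_def[symmetric] pd_def[symmetric] qd_def[symmetric] n2.close_def R9 by auto
  show "nm 2 (N3 gx gy th) \<le> 64 * R ^ 9"
    using n2.close_F3[OF norm_ei pq xy', of "kap * th"]
    unfolding N3_def p_def[symmetric] q_def[symmetric] pd_def[symmetric] qd_def[symmetric] n2.close_def R9 by auto
qed

lemma b_pqd: "cn 3 (\<lambda>l. D pd l + D qd l) \<le> 4 * R ^ 3" "cn 2 (\<lambda>l. D pd l + D qd l) \<le> 4 * R ^ 3"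
    "nm 4 (\<lambda>j. pd j + qd j) \<le> 4 * R ^ 3"
proof -
  show *: "nm 4 (\<lambda>j. pd j + qd j) \<le> 4 * R ^ 3"
    using n4.nm_add[of pd qd] b_pd by linarith
  show "cn 3 (\<lambda>l. D pd l + D qd l) \<le> 4 * R ^ 3" "cn 2 (\<lambda>l. D pd l + D qd l) \<le> 4 * R ^ 3"
    using nm2_le(1,2)[OF *] by (simp_all add: nm_def dft_add[abs_def])
qed

lemma R1_eq: "nm 2 (R1 gx gy) = cn 2 (\<lambda>l. of_real (sin (om l * tau) / om l) * (D pd l + D qd l)
    + integral {0..tau} (\<lambda>th. of_real (ks l th) * D (N3 gx gy th) l))"
proof -
  have "nm 2 (R1 gx gy) = cn 2 (\<lambda>l. - (of_real (sin (om l * tau) / om l) * (D pd l + D qd l)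
    + integral {0..tau} (\<lambda>th. of_real (ks l th) * D (N3 gx gy th) l)))"
    unfolding R1_def nm_idft by (rule cn_cong) (simp add: pd_def qd_def algebra_simps)
  then show ?thesis unfolding cn_minus .
qed

text \<open>Three sources: the initial velocity, multiplied by sin (om tau) / om, which is at most
  eps^2; the third harmonic frozen at the start, handled by \<open>third_harmonic_bound\<close> with
  data in H^4; and its part linear in \<open>th\<close>, which is trivially of order tau^2.\<close>

lemma R1_bound: "nm 2 (R1 gx gy) \<le> 54 * R ^ 9 * sig"
proof -
  let ?I = "\<lambda>l. integral {0..tau} (\<lambda>th. of_real (ks l th) * ei (kap * th) ^ 3)"
  let ?J = "\<lambda>l. integral {0..tau} (\<lambda>th. of_real (ks l th) * (ei (kap * th) ^ 3 * of_real th))"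
  have J: "cmod (?J l) \<le> tau\<^sup>2" for l
  proof -
    have "cmod (?J l) \<le> tau * (tau - 0)"
    proof (rule integral_bound[OF tau0(1)])
      show "continuous_on {0..tau} (\<lambda>th. complex_of_real (ks l th) * (ei (kap * th) ^ 3 * of_real th))"
        by (intro continuous_intros)
      fix th assume th: "th \<in> {0..tau}"
      have "\<bar>ks l th\<bar> * \<bar>th\<bar> \<le> 1 * tau" using ks_le_1[of l th] th by (intro mult_mono) auto
      then show "cmod (complex_of_real (ks l th) * (ei (kap * th) ^ 3 * of_real th)) \<le> tau"
        by (simp add: norm_mult norm_power)
    qed
    then show ?thesis by (simp add: power2_eq_square)
  qed
  have Id: "cn 2 (\<lambda>l. ?I l * D x l) \<le> (eps\<^sup>2 + tau\<^sup>2) * R ^ 3" "cn 2 (\<lambda>l. cnj (?I l) * D x l) \<le> (eps\<^sup>2 + tau\<^sup>2) * R ^ 3"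
    if "nm 4 x \<le> R ^ 3" for x
  proof -
    have "cn 2 (\<lambda>l. ?I l * D x l) \<le> (eps\<^sup>2 + tau\<^sup>2) * cn (2 + 2 * 1) (D x)"
      by (rule cn_mult_wt[OF third_harmonic_bound]) simp
    also have "\<dots> \<le> (eps\<^sup>2 + tau\<^sup>2) * R ^ 3" using that by (intro mult_left_mono) (auto simp: nm_def)
    finally show "cn 2 (\<lambda>l. ?I l * D x l) \<le> (eps\<^sup>2 + tau\<^sup>2) * R ^ 3" .
    have "cn 2 (\<lambda>l. cnj (?I l) * D x l) \<le> (eps\<^sup>2 + tau\<^sup>2) * cn (2 + 2 * 1) (D x)"
      by (rule cn_mult_wt) (use third_harmonic_bound in \<open>simp_all\<close>)
    also have "\<dots> \<le> (eps\<^sup>2 + tau\<^sup>2) * R ^ 3" using that by (intro mult_left_mono) (auto simp: nm_def)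
    finally show "cn 2 (\<lambda>l. cnj (?I l) * D x l) \<le> (eps\<^sup>2 + tau\<^sup>2) * R ^ 3" .
  qed
  have Jd: "cn 2 (\<lambda>l. ?J l * D x l) \<le> tau\<^sup>2 * (24 * R ^ 9)" "cn 2 (\<lambda>l. cnj (?J l) * D x l) \<le> tau\<^sup>2 * (24 * R ^ 9)"
    if "nm 2 x \<le> 24 * R ^ 9" for x
  proof -
    have "cn 2 (\<lambda>l. ?J l * D x l) \<le> tau\<^sup>2 * cn 2 (D x)" "cn 2 (\<lambda>l. cnj (?J l) * D x l) \<le> tau\<^sup>2 * cn 2 (D x)"
      by (rule cn_mult_bd; use J in simp)+
    moreover have "tau\<^sup>2 * cn 2 (D x) \<le> tau\<^sup>2 * (24 * R ^ 9)" using that by (intro mult_left_mono) (auto simp: nm_def)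
    ultimately show "cn 2 (\<lambda>l. ?J l * D x l) \<le> tau\<^sup>2 * (24 * R ^ 9)" "cn 2 (\<lambda>l. cnj (?J l) * D x l) \<le> tau\<^sup>2 * (24 * R ^ 9)"
      by linarith+
  qed
  have ks: "continuous_on {0..tau} (ks l)" for l by (intro continuous_ks continuous_on_id)
  have E: "continuous_on {0..tau} (\<lambda>th. ei (kap * th) ^ 3)" by (intro continuous_intros)
  have GG: "nm 4 (GG lam p q) \<le> R ^ 3" "nm 4 (GG lam q p) \<le> R ^ 3"
    using nm_FF_GG(2)[of 4 p R q] nm_FF_GG(2)[of 4 q R p] b_pq[of 4] by auto
  have N3i: "integral {0..tau} (\<lambda>th. of_real (ks l th) * D (N3 gx gy th) l)
     = ?I l * D (GG lam p q) l + ?J l * D (DGG lam p q pd qd) l + cnj (?I l) * D (GG lam q p) l + cnj (?J l) * D (DGG lam q p qd pd) l" for l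
    unfolding dft_N3 p_def[symmetric] q_def[symmetric] pd_def[symmetric] qd_def[symmetric]
    by (rule integral_phases[OF ks E])
  have "cn 2 (\<lambda>l. of_real (sin (om l * tau) / om l) * (D pd l + D qd l)) \<le> eps\<^sup>2 * cn 2 (\<lambda>l. D pd l + D qd l)"
    by (rule cn_mult_bd) (simp_all only: norm_of_real sin_om_le zero_le_power2)
  also have "\<dots> \<le> eps\<^sup>2 * (4 * R ^ 3)" using b_pqd(2) by (intro mult_left_mono) auto
  finally have "nm 2 (R1 gx gy) \<le> eps\<^sup>2 * (4 * R ^ 3) + ((eps\<^sup>2 + tau\<^sup>2) * R ^ 3 + tau\<^sup>2 * (24 * R ^ 9) + (eps\<^sup>2 + tau\<^sup>2) * R ^ 3 + tau\<^sup>2 * (24 * R ^ 9))"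
    unfolding R1_eq N3i by (intro cn_add_le Id Jd GG b_DGG)
  also have "\<dots> = 6 * (R ^ 3 * eps\<^sup>2) + 2 * (R ^ 3 * tau\<^sup>2) + 48 * (R ^ 9 * tau\<^sup>2)" by (simp add: algebra_simps)
  also have "\<dots> \<le> 6 * (R ^ 9 * eps\<^sup>2) + 2 * (R ^ 9 * tau\<^sup>2) + 48 * (R ^ 9 * tau\<^sup>2)"
    using R_pow by (intro add_mono mult_left_mono mult_right_mono) auto
  also have "\<dots> \<le> 54 * R ^ 9 * sig"
  proof -
    have "0 \<le> R ^ 9 * eps\<^sup>2" "0 \<le> R ^ 9 * tau\<^sup>2" "0 \<le> R ^ 9 * dh" using R_pow dh by auto
    moreover have "54 * R ^ 9 * sig = 54 * (R ^ 9 * tau\<^sup>2) + 54 * (R ^ 9 * eps\<^sup>2) + 54 * (R ^ 9 * dh)"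
      by (simp add: sig_def algebra_simps)
    ultimately show ?thesis by linarith
  qed
  finally show ?thesis .
qed

lemma nonlinear_defect:
  assumes th: "th \<in> {0..tau}"
  shows "cn 2 (\<lambda>l. F l th - NN gx gy l th) \<le> dh + 824 * R ^ 5 * sig"
proof -
  have th0: "0 \<le> th" "th \<le> tau" using th by auto
  let ?del = "\<lambda>j. gu th j - v0 th j"
  have g: "nm 2 (\<lambda>j. ?del j - dd th j) \<le> 66 * R ^ 3 * sig"
  proof -
    have "nm 2 (\<lambda>j. ?del j - dd th j) = cn 2 (\<lambda>l. ei (kap * th) * (PP l th - PP l 0 - of_real th * D pd l)
        + cnj (ei (kap * th)) * (QQ l th - QQ l 0 - of_real th * D qd l))"
      unfolding nm_def
    proof (rule cn_cong)
      fix l assume l: "l \<in> M"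
      have "D (\<lambda>j. ?del j - dd th j) l = (U l th - D (v0 th) l) - (ei (kap * th) * (of_real th * D pd l) + cnj (ei (kap * th)) * (of_real th * D qd l))"
        unfolding dd_def[abs_def] dft_diff dft_add dft_scale dft_gu[OF l] ..
      then show "D (\<lambda>j. ?del j - dd th j) l = ei (kap * th) * (PP l th - PP l 0 - of_real th * D pd l)
        + cnj (ei (kap * th)) * (QQ l th - QQ l 0 - of_real th * D qd l)"
        unfolding gu_v0[OF l] by (simp add: algebra_simps)
    qed
    also have "\<dots> \<le> 33 * R ^ 3 * sig + 33 * R ^ 3 * sig"
      by (rule cn_phase_pair[OF amplitude_bounds[OF th]]) simp
    finally show ?thesis by (simp add: mult_ac)
  qed
  have "nm 2 ?del \<le> 2 * R * th" by (rule nm2_le(1)[OF delta_bound(1)[OF th]])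
  also have "\<dots> \<le> 2 * R * tau" using th0 R by (intro mult_left_mono) auto
  finally have r: "nm 2 ?del \<le> 2 * R * tau" .
  have "nm 2 (\<lambda>j. fN lam (gu th) j - fN lam (v0 th) j - DfN lam (v0 th) (dd th) j)
     \<le> 3 * (2 * R)\<^sup>2 * (66 * R ^ 3 * sig) + (3 * (2 * R) * (2 * R * tau)\<^sup>2 + (2 * R * tau) ^ 3)"
    using n2.taylor_fN[OF nm2_le(1)[OF b_v0[of th]] r g] unfolding gu_v0_eq .
  also have "\<dots> = 792 * R ^ 5 * sig + (24 * R ^ 3 * tau\<^sup>2 + 8 * R ^ 3 * tau ^ 3)"
    by (simp add: power2_eq_square power3_eq_cube eval_nat_numeral algebra_simps)
  also have "\<dots> \<le> 792 * R ^ 5 * sig + (24 * R ^ 5 * sig + 8 * R ^ 5 * sig)"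
  proof -
    have s: "tau\<^sup>2 \<le> sig" "tau ^ 3 \<le> sig"
      using dh tau tau1 power_decreasing[of 2 3 tau] zero_le_power2[of eps] unfolding sig_def by linarith+
    show ?thesis using s R_pow tau0 by (intro add_mono order_refl mult_mono) auto
  qed
  finally have "cn 2 (D (\<lambda>j. fN lam (gu th) j - fN lam (v0 th) j - DfN lam (v0 th) (dd th) j)) \<le> 824 * R ^ 5 * sig"
    by (simp add: nm_def mult_ac)
  then show ?thesis
    unfolding F_split by (intro cn_add_le) (use eta[OF th] in \<open>simp_all add: gu_def\<close>)
qed

text \<open>No cancellation is sought here: the correction \<open>W1\<close> is Lipschitz in
  \<open>R1\<close>, hence of size \<open>sig\<close>, and enters with the factor tau / 2.\<close>

theorem local_error_uniform:
  "en (\<lambda>j. gu tau j - (V1 gx gy j + R1 gx gy j)) (\<lambda>j. gv tau j - UD1 gx gy j)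
    \<le> tau * ((2 + 1648 * R ^ 5 + 81 * (B1c R)\<^sup>2 * R ^ 9) * sig)"
proof -
  have W: "nm 2 (W1 gx gy) \<le> 3 * ((B1c R)\<^sup>2 * (54 * R ^ 9 * sig))"
  proof -
    have "n2.close (B1c R) (54 * R ^ 9 * sig) (\<lambda>j. V1 gx gy j + R1 gx gy j) (V1 gx gy)"
      unfolding n2.close_def using b_V1 R1_bound by simp
    from n2.close_fN[OF this] show ?thesis by (simp add: n2.close_def W1_def[abs_def])
  qed
  let ?A = "\<lambda>l. of_real (rt l) * D (\<lambda>j. gu tau j - (V1 gx gy j + R1 gx gy j)) l"
  let ?B = "\<lambda>l. of_real (eps\<^sup>2) * D (\<lambda>j. gv tau j - UD1 gx gy j) l"
  have ph: "cn 2 (\<lambda>l. of_real (sin (om l * (tau - th))) * (F l th - NN gx gy l th)) \<le> dh + 824 * R ^ 5 * sig"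
    "cn 2 (\<lambda>l. of_real (cos (om l * (tau - th))) * (F l th - NN gx gy l th)) \<le> dh + 824 * R ^ 5 * sig"
    if "th \<in> {0..tau}" for th
  proof -
    have "cn 2 (\<lambda>l. of_real (sin (om l * (tau - th))) * (F l th - NN gx gy l th)) \<le> 1 * cn 2 (\<lambda>l. F l th - NN gx gy l th)"
      by (rule cn_mult_bd) (simp_all only: norm_of_real abs_sin_le_one zero_le_one)
    then show "cn 2 (\<lambda>l. of_real (sin (om l * (tau - th))) * (F l th - NN gx gy l th)) \<le> dh + 824 * R ^ 5 * sig"
      using nonlinear_defect[OF that] by simp
    have "cn 2 (\<lambda>l. of_real (cos (om l * (tau - th))) * (F l th - NN gx gy l th)) \<le> 1 * cn 2 (\<lambda>l. F l th - NN gx gy l th)"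
      by (rule cn_mult_bd) (simp_all only: norm_of_real abs_cos_le_one zero_le_one)
    then show "cn 2 (\<lambda>l. of_real (cos (om l * (tau - th))) * (F l th - NN gx gy l th)) \<le> dh + 824 * R ^ 5 * sig"
      using nonlinear_defect[OF that] by simp
  qed
  let ?E = "dh + 824 * R ^ 5 * sig"
  have A: "cn 2 ?A \<le> tau * ?E"
    using cn_has_integral[OF tau0(1) step_defect(1) ph(1)] unfolding cn_minus .
  have WD: "cn 2 (\<lambda>l. of_real (tau / 2) * D (W1 gx gy) l) \<le> tau / 2 * (3 * ((B1c R)\<^sup>2 * (54 * R ^ 9 * sig)))"
    unfolding cn_scale norm_of_real using tau W by (intro mult_mono) (auto simp: nm_def)
  have "cn 2 (\<lambda>l. - ?B l + of_real (tau / 2) * D (W1 gx gy) l) \<le> tau * ?E"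
    by (rule cn_has_integral[OF tau0(1) step_defect(2) ph(2)])
  from cn_diff_le[OF WD this]
  have B: "cn 2 ?B \<le> tau / 2 * (3 * ((B1c R)\<^sup>2 * (54 * R ^ 9 * sig))) + tau * ?E"
    by simp
  have "en (\<lambda>j. gu tau j - (V1 gx gy j + R1 gx gy j)) (\<lambda>j. gv tau j - UD1 gx gy j) \<le> cn 2 ?A + cn 2 ?B"
    unfolding en_def by (rule ec_le_add)
  also have "\<dots> \<le> tau * ?E + (tau / 2 * (3 * ((B1c R)\<^sup>2 * (54 * R ^ 9 * sig))) + tau * ?E)"
    by (rule add_mono[OF A B])
  also have "\<dots> = tau * (2 * dh + (1648 * R ^ 5 + 81 * (B1c R)\<^sup>2 * R ^ 9) * sig)"
    by (simp add: algebra_simps)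
  also have "\<dots> \<le> tau * (2 * sig + (1648 * R ^ 5 + 81 * (B1c R)\<^sup>2 * R ^ 9) * sig)"
    using tau R_pow by (intro mult_left_mono add_mono add_nonneg_nonneg mult_nonneg_nonneg) (auto simp: sig_def)
  finally show ?thesis by (simp add: algebra_simps)
qed

section \<open>Local error for tau at most eps^2\<close>

definition Wg :: "nat \<Rightarrow> complex" where "Wg = DfN lam gx (\<lambda>j. - (pd j + qd j))"

definition defect :: "real \<Rightarrow> nat \<Rightarrow> complex" where
  "defect th j = fN lam (gu th) j - fN lam (v0 th) j - DfN lam (v0 th) (dd th) j"

lemma defect_split: "F l th - NN gx gy l th = (F l th - D (fN lam (gu th)) l) + D (defect th) l"
  unfolding F_split defect_def[abs_def] ..

lemma gx_pq: "gx j = p j + q j"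
  by (simp add: p_def q_def ZP_def ZQ_def field_simps)

lemma b_Wg: "nm 4 Wg \<le> 12 * R ^ 5"
proof -
  have "nm 4 (\<lambda>j. - (pd j + qd j)) \<le> 4 * R ^ 3"
    unfolding n4.nm_minus by (rule b_pqd(3))
  from n4.nm_DfN[OF b_gu[OF tau0(2), of 4] this]
  show ?thesis by (simp add: Wg_def eval_nat_numeral algebra_simps)
qed

lemma phase_drift: "cmod (ei (kap * th) - 1) \<le> kap * th" "cmod (cnj (ei (kap * th)) - 1) \<le> kap * th" if "0 \<le> th"
  using ei_lipschitz[of "kap * th" 0] ei_lipschitz[of "- (kap * th)" 0] that kap_pos by auto

lemma nm4_drift:
  assumes "nm 4 x \<le> A" "nm 4 y \<le> A" "0 \<le> th"
  shows "nm 4 (\<lambda>j. (ei (kap * th) * x j + cnj (ei (kap * th)) * y j) - (x j + y j)) \<le> 2 * A * (kap * th)"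
proof -
  have "nm 4 (\<lambda>j. (ei (kap * th) - 1) * x j + (cnj (ei (kap * th)) - 1) * y j) \<le> kap * th * A + kap * th * A"
    using assms phase_drift[OF assms(3)] kap_pos
    by (intro order_trans[OF n4.nm_add] add_mono; unfold n4.nm_scale; intro mult_mono; auto)
  then show ?thesis by (simp add: algebra_simps)
qed

text \<open>The true increment is of order kap th^2, so to leading order only minus the derivative
  along \<open>dd\<close> survives, which is \<open>th * Wg\<close>. This is the linear defect
  caused by leaving the remainder out of the linearisation.\<close>

lemma defect_expansion:
  assumes th: "th \<in> {0..tau}"
  shows "nm 4 (\<lambda>j. defect th j - of_real th * Wg j) \<le> 168 * R ^ 5 * (kap * th\<^sup>2)"
proof -
  have th0: "0 \<le> th" "th \<le> tau" using th by auto
  have "n4.close (2 * R) (2 * R * (kap * th\<^sup>2)) (gu th) (v0 th)"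
    unfolding n4.close_def using b_gu[OF th, of 4] b_v0[of th] delta_bound(2)[OF th] R by auto
  from n4.close_fN[OF this]
  have 1: "nm 4 (\<lambda>j. fN lam (gu th) j - fN lam (v0 th) j) \<le> 3 * ((2 * R)\<^sup>2 * (2 * R * (kap * th\<^sup>2)))"
    by (simp add: n4.close_def)
  have vx: "n4.close (2 * R) (2 * R * (kap * th)) (v0 th) gx"
    unfolding n4.close_def using b_v0[of th] b_gu[OF tau0(2), of 4] R nm4_drift[OF b_pq[of 4] th0(1)]
    by (simp add: v0_def[abs_def] gx_pq)
  have t: "nm 4 (\<lambda>j. of_real th * pd j) \<le> th * (2 * R ^ 3)" "nm 4 (\<lambda>j. of_real th * qd j) \<le> th * (2 * R ^ 3)"
    unfolding n4.nm_scale using th0 b_pd by (auto intro: mult_left_mono)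
  have dv: "nm 4 (\<lambda>j. dd th j - of_real th * (pd j + qd j)) \<le> 2 * (th * (2 * R ^ 3)) * (kap * th)"
    using nm4_drift[OF t th0(1)] by (simp add: dd_def[abs_def] distrib_left)
  have 2: "nm 4 (\<lambda>j. DfN lam (v0 th) (dd th) j - DfN lam gx (\<lambda>j. of_real th * (pd j + qd j)) j)
     \<le> 6 * (2 * R) * (4 * R ^ 3 * th) * (2 * R * (kap * th)) + 3 * (2 * R)\<^sup>2 * (2 * (th * (2 * R ^ 3)) * (kap * th))"
    by (rule n4.nm_DfN_diff[OF vx b_dd[OF th0(1)] dv])
  have Wg: "DfN lam gx (\<lambda>j. of_real th * (pd j + qd j)) j = - (of_real th * Wg j)" for j
    by (simp add: Wg_def DfN_def T3_def algebra_simps)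
  have "nm 4 (\<lambda>j. (fN lam (gu th) j - fN lam (v0 th) j) - (DfN lam (v0 th) (dd th) j - DfN lam gx (\<lambda>j. of_real th * (pd j + qd j)) j))
     \<le> 3 * ((2 * R)\<^sup>2 * (2 * R * (kap * th\<^sup>2))) + (6 * (2 * R) * (4 * R ^ 3 * th) * (2 * R * (kap * th)) + 3 * (2 * R)\<^sup>2 * (2 * (th * (2 * R ^ 3)) * (kap * th)))"
    by (rule order_trans[OF n4.nm_diff add_mono[OF 1 2]])
  also have "\<dots> = 24 * (R ^ 3 * (kap * th\<^sup>2)) + 144 * (R ^ 5 * (kap * th\<^sup>2))"
    by (simp add: eval_nat_numeral algebra_simps)
  also have "\<dots> \<le> 24 * (R ^ 5 * (kap * th\<^sup>2)) + 144 * (R ^ 5 * (kap * th\<^sup>2))"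
    using R_pow kap_pos by (intro add_mono mult_left_mono mult_right_mono) auto
  finally show ?thesis unfolding Wg by (simp add: defect_def[abs_def] algebra_simps)
qed

lemma sin_om_approx: "\<bar>sin (om l * tau) / om l - tau\<bar> \<le> kap * tau\<^sup>2 / 2 * rt l"
proof -
  have "sin (om l * tau) / om l - tau = (sin (om l * tau) - om l * tau) / om l"
    using om_pos[of l] by (simp add: field_simps)
  then have "\<bar>sin (om l * tau) / om l - tau\<bar> = \<bar>sin (om l * tau) - om l * tau\<bar> / om l"
    using om_pos[of l] by (simp add: abs_div)
  also have "\<dots> \<le> ((om l * tau)\<^sup>2 / 2) / om l"
    using om_pos[of l] by (intro divide_right_mono sin_approx) auto
  also have "\<dots> = kap * tau\<^sup>2 / 2 * rt l"
    using om_pos[of l] by (simp add: power2_eq_square) (simp add: om_eq)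
  finally show ?thesis .
qed

lemma ks_small: "th \<in> {0..tau} \<Longrightarrow> \<bar>ks l th\<bar> \<le> kap * tau"
proof -
  assume th: "th \<in> {0..tau}"
  have "\<bar>sin (om l * (tau - th))\<bar> \<le> \<bar>om l * (tau - th)\<bar>" by (rule abs_sin_x_le_abs_x)
  also have "\<dots> \<le> om l * tau" using th om_pos[of l] by (simp add: abs_mult)
  finally show ?thesis
    unfolding ks_def abs_divide using rt_ge_1[of l] by (simp add: pos_divide_le_eq om_eq mult_ac)
qed

lemma integral_ks_small:
  assumes cont: "\<And>l. continuous_on {0..tau} (phi l)" and bd: "\<And>th. th \<in> {0..tau} \<Longrightarrow> cn 2 (\<lambda>l. phi l th) \<le> C"
  shows "cn 2 (\<lambda>l. integral {0..tau} (\<lambda>th. of_real (ks l th) * phi l th)) \<le> tau * (kap * tau * C)"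
proof (rule cn_integral)
  fix th assume th: "th \<in> {0..tau}"
  have "cn 2 (\<lambda>l. of_real (ks l th) * phi l th) \<le> kap * tau * cn 2 (\<lambda>l. phi l th)"
    by (rule cn_mult_bd) (use ks_small[OF th] kap_pos tau0 in auto)
  also have "\<dots> \<le> kap * tau * C" using bd[OF th] kap_pos tau0 by (intro mult_left_mono) auto
  finally show "cn 2 (\<lambda>l. of_real (ks l th) * phi l th) \<le> kap * tau * C" .
qed (use tau in \<open>auto intro!: integrable_continuous_real continuous_intros cont\<close>)

text \<open>The remainder starts at zero with velocity minus \<open>pd + qd\<close>. Replacing sin
  (om tau) / om by tau costs one derivative and kap tau^2; in the integral the kernel
  \<open>ks\<close> is itself of size kap tau.\<close>

lemma R1_expansion: "nm 2 (\<lambda>j. R1 gx gy j - of_real tau * (- (pd j + qd j))) \<le> 66 * R ^ 9 * (kap * tau\<^sup>2)"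
proof -
  let ?I = "\<lambda>l. integral {0..tau} (\<lambda>th. of_real (ks l th) * D (N3 gx gy th) l)"
  have "nm 2 (\<lambda>j. R1 gx gy j - of_real tau * (- (pd j + qd j)))
    = cn 2 (\<lambda>l. - (of_real (sin (om l * tau) / om l - tau) * (D pd l + D qd l) + ?I l))"
    unfolding nm_def dft_diff dft_scale dft_minus dft_add
    by (rule cn_cong) (simp add: R1_def dft_idft pd_def qd_def algebra_simps)
  also have "\<dots> \<le> kap * tau\<^sup>2 / 2 * (4 * R ^ 3) + tau * (kap * tau * (64 * R ^ 9))"
    unfolding cn_minus
  proof (rule cn_add_le)
    have "cn 2 (\<lambda>l. of_real (sin (om l * tau) / om l - tau) * (D pd l + D qd l)) \<le> kap * tau\<^sup>2 / 2 * cn 3 (\<lambda>l. D pd l + D qd l)"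
      by (rule cn_mult_rt) (use sin_om_approx kap_pos in \<open>auto simp del: of_real_diff of_real_divide\<close>)
    also have "\<dots> \<le> kap * tau\<^sup>2 / 2 * (4 * R ^ 3)" using b_pqd(1) kap_pos by (intro mult_left_mono) auto
    finally show "cn 2 (\<lambda>l. of_real (sin (om l * tau) / om l - tau) * (D pd l + D qd l)) \<le> kap * tau\<^sup>2 / 2 * (4 * R ^ 3)" .
    show "cn 2 ?I \<le> tau * (kap * tau * (64 * R ^ 9))"
      by (rule integral_ks_small) (auto intro!: continuous_intros simp: nm_def[symmetric] b_N)
  qed
  also have "\<dots> = 2 * (R ^ 3 * (kap * tau\<^sup>2)) + 64 * (R ^ 9 * (kap * tau\<^sup>2))"
    by (simp add: power2_eq_square algebra_simps)
  also have "\<dots> \<le> 2 * (R ^ 9 * (kap * tau\<^sup>2)) + 64 * (R ^ 9 * (kap * tau\<^sup>2))"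
    using R_pow kap_pos by (intro add_mono mult_left_mono mult_right_mono) auto
  finally show ?thesis by (simp add: mult_ac)
qed

text \<open>Only first order in kap tau can hold, as the carrier phase itself turns by this angle
  during the step.\<close>

lemma V1_drift: "nm 2 (\<lambda>j. V1 gx gy j - gx j) \<le> 198 * R ^ 9 * (kap * tau)"
proof -
  let ?I = "\<lambda>l. integral {0..tau} (\<lambda>th. of_real (ks l th) * D (N1 gx gy th) l)"
  let ?s = "\<lambda>l. complex_of_real (sin (om l * tau) / om l)"
  have "nm 2 (\<lambda>j. V1 gx gy j - gx j)
    = cn 2 (\<lambda>l. of_real (cos (om l * tau) - 1) * D gx l + ?s l * D gy l + ?s l * (D pd l + D qd l) - ?I l)"
    unfolding nm_def dft_diff
    by (rule cn_cong) (simp add: V1_def dft_idft pd_def qd_def algebra_simps)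
  also have "\<dots> \<le> kap * tau * R + tau * (kap * R) + tau * (4 * R ^ 3) + tau * (kap * tau * (192 * R ^ 9))"
  proof (intro cn_diff_le cn_add_le)
    have c: "\<bar>cos (om l * tau) - 1\<bar> \<le> kap * tau * rt l" for l
      using cos_approx[of "om l * tau"] om_pos[of l] tau0 by (simp add: abs_mult) (simp add: om_eq mult_ac)
    have "cn 2 (\<lambda>l. of_real (cos (om l * tau) - 1) * D gx l) \<le> kap * tau * cn 3 (D gx)"
      by (rule cn_mult_rt) (use c kap_pos tau0 in \<open>auto simp del: of_real_diff\<close>)
    also have "\<dots> \<le> kap * tau * R"
      using b_gu[OF tau0(2), of 3] kap_pos tau0 by (intro mult_left_mono) (auto simp: nm_def)
    finally show "cn 2 (\<lambda>l. of_real (cos (om l * tau) - 1) * D gx l) \<le> kap * tau * R" .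
    have s: "cn 2 (\<lambda>l. ?s l * c l) \<le> tau * cn 2 c" for c
      by (rule cn_mult_bd) (simp_all only: norm_of_real sin_om_le(2)[OF tau0(1)] tau0)
    have "cn 2 (D gy) = cn 2 (\<lambda>l. of_real kap * (of_real (eps\<^sup>2) * V l 0))"
      by (rule cn_cong) (simp only: mult.assoc[symmetric] kap_eps_c mult_1_left dft_gv)
    also have "\<dots> = kap * cn 2 (\<lambda>l. of_real (eps\<^sup>2) * V l 0)"
      unfolding cn_scale[of _ "of_real kap"] using kap_pos by simp
    also have "\<dots> \<le> kap * R"
      using bV[OF tau0(2)] cn_mono_exp[of 2 6 "\<lambda>l. of_real (eps\<^sup>2) * V l 0"] kap_pos by (intro mult_left_mono) auto
    finally have "cn 2 (D gy) \<le> kap * R" .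
    then show "cn 2 (\<lambda>l. ?s l * D gy l) \<le> tau * (kap * R)"
      by (intro order_trans[OF s] mult_left_mono tau0)
    show "cn 2 (\<lambda>l. ?s l * (D pd l + D qd l)) \<le> tau * (4 * R ^ 3)"
      by (intro order_trans[OF s] mult_left_mono tau0 b_pqd)
    show "cn 2 ?I \<le> tau * (kap * tau * (192 * R ^ 9))"
      by (rule integral_ks_small) (auto intro!: continuous_intros simp: nm_def[symmetric] b_N)
  qed
  also have "\<dots> \<le> R ^ 9 * (kap * tau) + R ^ 9 * (kap * tau) + 4 * R ^ 9 * (kap * tau) + 192 * R ^ 9 * (kap * tau)"
  proof (intro add_mono)
    have kt: "0 \<le> kap * tau" "tau \<le> kap * tau" using kap_pos tau0 kap_ge_1 mult_right_mono[of 1 kap tau] by auto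
    have "R * (kap * tau) \<le> R ^ 9 * (kap * tau)" using R_pow kt by (intro mult_right_mono) linarith+
    then show "kap * tau * R \<le> R ^ 9 * (kap * tau)" "tau * (kap * R) \<le> R ^ 9 * (kap * tau)" by (simp_all add: mult_ac)
    have "tau * R ^ 3 \<le> (kap * tau) * R ^ 9" using R_pow kt tau0 by (intro mult_mono) auto
    then show "tau * (4 * R ^ 3) \<le> 4 * R ^ 9 * (kap * tau)" by (simp add: mult_ac)
    have "tau * (R ^ 9 * (kap * tau)) \<le> 1 * (R ^ 9 * (kap * tau))" using R_pow kt tau1 by (intro mult_right_mono) auto
    then show "tau * (kap * tau * (192 * R ^ 9)) \<le> 192 * R ^ 9 * (kap * tau)" by (simp add: mult_ac)
  qed
  finally show ?thesis by (simp add: mult_ac)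
qed

text \<open>Combines the expansion of \<open>R1\<close> with the drift of \<open>V1\<close>: to
  leading order the correction is the derivative of the cubic term along the remainder.\<close>

lemma W1_expansion:
  assumes kt: "kap * tau \<le> 1"
  shows "nm 2 (\<lambda>j. W1 gx gy j - of_real tau * Wg j) \<le> cW1 R * (kap * tau\<^sup>2)"
proof -
  let ?K = "kap * tau\<^sup>2"
  have K: "?K = (kap * tau) * tau" "0 \<le> ?K" "tau\<^sup>2 \<le> ?K" "tau ^ 3 \<le> ?K" "?K \<le> tau"
  proof -
    show "?K = (kap * tau) * tau" "0 \<le> ?K" using kap_pos by (simp_all add: power2_eq_square)
    show "?K \<le> tau" using mult_right_mono[OF kt tau0(1)] by (simp add: power2_eq_square mult_ac)
    show 2: "tau\<^sup>2 \<le> ?K" using mult_right_mono[OF kap_ge_1, of "tau\<^sup>2"] by simp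
    show "tau ^ 3 \<le> ?K" using 2 power_decreasing[of 2 3 tau] tau0 tau1 by simp
  qed
  define R0 where "R0 j = - (pd j + qd j)" for j
  have R0: "nm 4 R0 \<le> 4 * R ^ 3" unfolding R0_def[abs_def] n4.nm_minus by (rule b_pqd(3))
  have tR0: "nm 2 (\<lambda>j. of_real tau * R0 j) \<le> 4 * R ^ 3 * tau"
    unfolding n2.nm_scale using mult_left_mono[OF nm2_le(1)[OF R0] tau0(1)] tau0 by (simp add: mult_ac)
  have g: "nm 2 (\<lambda>j. R1 gx gy j - of_real tau * R0 j) \<le> 66 * R ^ 9 * ?K"
    using R1_expansion by (simp add: R0_def)
  have r: "nm 2 (R1 gx gy) \<le> 70 * R ^ 9 * tau"
  proof -
    have "nm 2 (\<lambda>j. (R1 gx gy j - of_real tau * R0 j) + of_real tau * R0 j) \<le> 66 * R ^ 9 * ?K + 4 * R ^ 3 * tau"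
      by (rule order_trans[OF n2.nm_add add_mono[OF g tR0]])
    also have "\<dots> \<le> 66 * R ^ 9 * tau + 4 * R ^ 9 * tau"
      using K R_pow tau0 by (intro add_mono mult_mono) auto
    finally show ?thesis by (simp add: mult_ac)
  qed
  have 1: "nm 2 (\<lambda>j. fN lam (\<lambda>j. V1 gx gy j + R1 gx gy j) j - fN lam (V1 gx gy) j - DfN lam (V1 gx gy) (\<lambda>j. of_real tau * R0 j) j)
     \<le> 3 * (B1c R)\<^sup>2 * (66 * R ^ 9 * ?K) + (3 * B1c R * (70 * R ^ 9 * tau)\<^sup>2 + (70 * R ^ 9 * tau) ^ 3)"
    by (rule n2.taylor_fN[OF b_V1(1) r g])
  have cl: "n2.close (B1c R) (198 * R ^ 9 * (kap * tau)) (V1 gx gy) gx"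
    unfolding n2.close_def using b_V1(1) V1_drift b_gu[OF tau0(2), of 2] B1c_ge by auto
  have zero: "nm 2 (\<lambda>j. of_real tau * R0 j - of_real tau * R0 j) \<le> 0" using n2_zero by simp
  have 2: "nm 2 (\<lambda>j. DfN lam (V1 gx gy) (\<lambda>j. of_real tau * R0 j) j - DfN lam gx (\<lambda>j. of_real tau * R0 j) j)
     \<le> 6 * B1c R * (4 * R ^ 3 * tau) * (198 * R ^ 9 * (kap * tau)) + 3 * (B1c R)\<^sup>2 * 0"
    by (rule n2.nm_DfN_diff[OF cl tR0 zero])
  have Wg: "DfN lam gx (\<lambda>j. of_real tau * R0 j) j = of_real tau * Wg j" for j
    by (simp add: Wg_def R0_def DfN_def T3_def algebra_simps)
  have "nm 2 (\<lambda>j. (fN lam (\<lambda>j. V1 gx gy j + R1 gx gy j) j - fN lam (V1 gx gy) j - DfN lam (V1 gx gy) (\<lambda>j. of_real tau * R0 j) j)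
      + (DfN lam (V1 gx gy) (\<lambda>j. of_real tau * R0 j) j - DfN lam gx (\<lambda>j. of_real tau * R0 j) j))
     \<le> (3 * (B1c R)\<^sup>2 * (66 * R ^ 9 * ?K) + (3 * B1c R * (70 * R ^ 9 * tau)\<^sup>2 + (70 * R ^ 9 * tau) ^ 3))
      + (6 * B1c R * (4 * R ^ 3 * tau) * (198 * R ^ 9 * (kap * tau)) + 3 * (B1c R)\<^sup>2 * 0)"
    by (rule order_trans[OF n2.nm_add add_mono[OF 1 2]])
  also have "\<dots> = (3 * (B1c R)\<^sup>2 * (66 * R ^ 9)) * ?K + ((3 * B1c R * (70 * R ^ 9)\<^sup>2) * tau\<^sup>2 + (70 * R ^ 9) ^ 3 * tau ^ 3)
      + (6 * B1c R * (4 * R ^ 3) * (198 * R ^ 9)) * ?K"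
    unfolding K(1) by (simp add: power_mult_distrib algebra_simps)
  also have "\<dots> \<le> (3 * (B1c R)\<^sup>2 * (66 * R ^ 9)) * ?K + ((3 * B1c R * (70 * R ^ 9)\<^sup>2) * ?K + (70 * R ^ 9) ^ 3 * ?K)
      + (6 * B1c R * (4 * R ^ 3) * (198 * R ^ 9)) * ?K"
    using K B1c_ge R_pow by (intro add_mono order_refl mult_left_mono mult_nonneg_nonneg) auto
  also have "\<dots> = cW1 R * ?K" by (simp add: cW1_def algebra_simps)
  finally show ?thesis unfolding Wg by (simp add: W1_def[abs_def] algebra_simps)
qed

text \<open>The defect \<open>th * Wg\<close> is treated differently in the two components. The sine
  kernel is at most kap tau rt and turns it into second order. The cosine kernel is close to one,
  and the integral, tau^2 / 2 times \<open>Wg\<close>, is matched by tau / 2 times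
  \<open>W1\<close>.\<close>

theorem local_error_small_step:
  assumes kt: "kap * tau \<le> 1"
  shows "en (\<lambda>j. gu tau j - (V1 gx gy j + R1 gx gy j)) (\<lambda>j. gv tau j - UD1 gx gy j)
    \<le> tau * ((2 + 360 * R ^ 5 + cW1 R) * (dh + kap * tau\<^sup>2))"
proof -
  let ?K = "kap * tau\<^sup>2"
  let ?A = "\<lambda>l. of_real (rt l) * D (\<lambda>j. gu tau j - (V1 gx gy j + R1 gx gy j)) l"
  let ?B = "\<lambda>l. of_real (eps\<^sup>2) * D (\<lambda>j. gv tau j - UD1 gx gy j) l"
  have K0: "0 \<le> ?K" using kap_pos by simp
  have Ks: "kap * th\<^sup>2 \<le> ?K" "th \<le> tau" "0 \<le> th" "kap * th\<^sup>2 \<le> tau" if "th \<in> {0..tau}" for th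
  proof -
    show a: "kap * th\<^sup>2 \<le> ?K" "th \<le> tau" "0 \<le> th" using that kap_pos by (auto intro!: mult_left_mono power_mono)
    have "?K \<le> tau" using mult_right_mono[OF kt tau0(1)] by (simp add: power2_eq_square mult_ac)
    then show "kap * th\<^sup>2 \<le> tau" using a by linarith
  qed
  have eta': "cn 2 (\<lambda>l. m l * (F l th - D (fN lam (gu th)) l)) \<le> dh"
    if th: "th \<in> {0..tau}" and m: "\<And>l. cmod (m l) \<le> 1" for m th
  proof -
    have "cn 2 (\<lambda>l. m l * (F l th - D (fN lam (gu th)) l)) \<le> 1 * cn 2 (\<lambda>l. F l th - D (fN lam (gu th)) l)"
      by (rule cn_mult_bd) (use m in auto)
    then show ?thesis using eta[OF th] by (simp add: gu_def)
  qed
  have rtb: "cn 2 (\<lambda>l. of_real (m l) * c l) \<le> kap * tau * cn 3 c" if "\<And>l. \<bar>m l\<bar> \<le> om l * tau" for m c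
    by (rule cn_mult_rt) (use that kap_pos tau0 in \<open>auto simp: om_eq mult_ac\<close>)
  have dfb: "nm 4 (defect th) \<le> 180 * R ^ 5 * tau" if th: "th \<in> {0..tau}" for th
  proof -
    have "nm 4 (\<lambda>j. of_real th * Wg j) \<le> tau * (12 * R ^ 5)"
      unfolding n4.nm_scale using Ks[OF th] b_Wg by (intro mult_mono) auto
    moreover have "nm 4 (\<lambda>j. defect th j - of_real th * Wg j) \<le> 168 * R ^ 5 * tau"
      by (rule order_trans[OF defect_expansion[OF th]]) (use Ks[OF th] R_pow in \<open>intro mult_left_mono, auto\<close>)
    ultimately have "nm 4 (\<lambda>j. (defect th j - of_real th * Wg j) + of_real th * Wg j) \<le> 168 * R ^ 5 * tau + tau * (12 * R ^ 5)"
      by (intro order_trans[OF n4.nm_add] add_mono)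
    then show ?thesis by (simp add: algebra_simps)
  qed
  have omt: "\<bar>om l * (tau - th)\<bar> \<le> om l * tau" if "th \<in> {0..tau}" for l th
    using om_pos[of l] that by (simp add: abs_mult)
  have A: "cn 2 ?A \<le> tau * (dh + 180 * R ^ 5 * ?K)"
    unfolding cn_minus[symmetric, of 2 ?A]
  proof (rule cn_has_integral[OF tau0(1) step_defect(1)])
    fix th assume th: "th \<in> {0..tau}"
    let ?s = "\<lambda>l. complex_of_real (sin (om l * (tau - th)))"
    have "\<bar>sin (om l * (tau - th))\<bar> \<le> om l * tau" for l
      using abs_sin_x_le_abs_x[of "om l * (tau - th)"] omt[OF th, of l] by linarith
    from rtb[OF this] have "cn 2 (\<lambda>l. ?s l * D (defect th) l) \<le> kap * tau * cn 3 (D (defect th))" .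
    also have "\<dots> \<le> kap * tau * (180 * R ^ 5 * tau)"
      using nm2_le(2)[OF dfb[OF th]] kap_pos tau0 by (intro mult_left_mono) (auto simp: nm_def)
    also have "\<dots> = 180 * R ^ 5 * ?K" by (simp add: power2_eq_square)
    finally have "cn 2 (\<lambda>l. ?s l * (F l th - D (fN lam (gu th)) l) + ?s l * D (defect th) l) \<le> dh + 180 * R ^ 5 * ?K"
      by (intro cn_add_le eta' th) simp_all
    then show "cn 2 (\<lambda>l. ?s l * (F l th - NN gx gy l th)) \<le> dh + 180 * R ^ 5 * ?K"
      unfolding defect_split distrib_left[of "?s l" for l] .
  qed
  \<comment> \<open>Removing the integral of \<open>th * Wg\<close> leaves an integrand of order kap
    tau^2. Adding \<open>?B\<close> back gives tau / 2 times \<open>W1 - tau * Wg\<close>, which is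
    controlled by \<open>W1_expansion\<close>.\<close>
  let ?I = "\<lambda>l. - ?B l + of_real (tau / 2) * D (W1 gx gy) l - of_real (tau\<^sup>2 / 2) * D Wg l"
  have B: "cn 2 ?I \<le> tau * (dh + 180 * R ^ 5 * ?K)"
  proof (rule cn_has_integral[OF tau0(1)])
    fix l assume l: "l \<in> M"
    have I1: "((\<lambda>th. th) has_integral (tau\<^sup>2 / 2 - 0\<^sup>2 / 2)) {0..tau}"
      by (rule fundamental_theorem_of_calculus[OF tau0(1)])
         (auto intro!: derivative_eq_intros simp: has_real_derivative_iff_has_vector_derivative[symmetric])
    have "((\<lambda>th. complex_of_real th) has_integral of_real (tau\<^sup>2 / 2)) {0..tau}"
      using has_integral_linear[OF I1 bounded_linear_of_real[where 'a = complex]] by (simp add: o_def)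
    from has_integral_mult_left[OF this, of "D Wg l"]
    show "((\<lambda>th. of_real (cos (om l * (tau - th))) * (F l th - NN gx gy l th) - of_real th * D Wg l) has_integral ?I l) {0..tau}"
      by (rule has_integral_diff[OF step_defect(2)[OF l]])
  next
    fix th assume th: "th \<in> {0..tau}"
    let ?c = "\<lambda>l. complex_of_real (cos (om l * (tau - th)))"
    let ?d = "\<lambda>j. defect th j - of_real th * Wg j"
    have "cn 2 (\<lambda>l. ?c l * D ?d l) \<le> 1 * cn 2 (D ?d)" by (rule cn_mult_bd) auto
    also have "\<dots> \<le> 168 * R ^ 5 * (kap * th\<^sup>2)"
      using nm2_le(1)[OF defect_expansion[OF th]] by (simp add: nm_def)
    also have "\<dots> \<le> 168 * R ^ 5 * ?K" using Ks[OF th] R_pow kap_pos by (intro mult_left_mono) auto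
    finally have 1: "cn 2 (\<lambda>l. ?c l * D ?d l) \<le> 168 * R ^ 5 * ?K" .
    have "\<bar>cos (om l * (tau - th)) - 1\<bar> \<le> om l * tau" for l
      using cos_approx[of "om l * (tau - th)"] omt[OF th, of l] by linarith
    from rtb[OF this] have "cn 2 (\<lambda>l. of_real (cos (om l * (tau - th)) - 1) * D (\<lambda>j. of_real th * Wg j) l)
       \<le> kap * tau * nm 3 (\<lambda>j. of_real th * Wg j)" unfolding nm_def .
    also have "\<dots> \<le> kap * tau * (tau * (12 * R ^ 5))"
      unfolding n3.nm_scale using Ks[OF th] nm2_le(2)[OF b_Wg] kap_pos tau0 by (intro mult_mono mult_nonneg_nonneg) auto
    also have "\<dots> = 12 * R ^ 5 * ?K" by (simp add: power2_eq_square)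
    finally have 2: "cn 2 (\<lambda>l. of_real (cos (om l * (tau - th)) - 1) * D (\<lambda>j. of_real th * Wg j) l) \<le> 12 * R ^ 5 * ?K" .
    have eq: "?c l * (F l th - NN gx gy l th) - of_real th * D Wg l
      = ?c l * (F l th - D (fN lam (gu th)) l) + (?c l * D ?d l + of_real (cos (om l * (tau - th)) - 1) * D (\<lambda>j. of_real th * Wg j) l)" for l
      unfolding defect_split dft_diff[of "defect th"] dft_scale of_real_diff of_real_1
      by (simp only: ring_distribs mult_1_left mult.left_commute) simp
    have "cn 2 (\<lambda>l. ?c l * (F l th - NN gx gy l th) - of_real th * D Wg l) \<le> dh + (168 * R ^ 5 * ?K + 12 * R ^ 5 * ?K)"
      unfolding eq by (intro cn_add_le eta' th 1 2) simp
    then show "cn 2 (\<lambda>l. ?c l * (F l th - NN gx gy l th) - of_real th * D Wg l) \<le> dh + 180 * R ^ 5 * ?K" by (simp add: mult_ac)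
  qed
  have W: "cn 2 (\<lambda>l. of_real (tau / 2) * D (\<lambda>j. W1 gx gy j - of_real tau * Wg j) l) \<le> tau / 2 * (cW1 R * ?K)"
    unfolding cn_scale norm_of_real using tau W1_expansion[OF kt] by (intro mult_mono) (auto simp: nm_def)
  have eqB: "of_real (tau / 2) * D (\<lambda>j. W1 gx gy j - of_real tau * Wg j) l - ?I l = ?B l" for l
    unfolding dft_diff[of "W1 gx gy"] dft_scale by (simp add: power2_eq_square algebra_simps)
  have B': "cn 2 ?B \<le> tau / 2 * (cW1 R * ?K) + tau * (dh + 180 * R ^ 5 * ?K)"
    using cn_diff_le[OF W B] unfolding eqB .
  have cW: "0 \<le> cW1 R" unfolding cW1_def using B1c_ge R_pow by (intro add_nonneg_nonneg mult_nonneg_nonneg) auto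
  have "en (\<lambda>j. gu tau j - (V1 gx gy j + R1 gx gy j)) (\<lambda>j. gv tau j - UD1 gx gy j) \<le> cn 2 ?A + cn 2 ?B"
    unfolding en_def by (rule ec_le_add)
  also have "\<dots> \<le> tau * (dh + 180 * R ^ 5 * ?K) + (tau / 2 * (cW1 R * ?K) + tau * (dh + 180 * R ^ 5 * ?K))"
    by (rule add_mono[OF A B'])
  also have "\<dots> = tau * (2 * dh + (360 * R ^ 5 + cW1 R / 2) * ?K)"
    by (simp add: algebra_simps)
  also have "\<dots> \<le> tau * ((2 + 360 * R ^ 5 + cW1 R) * dh + (2 + 360 * R ^ 5 + cW1 R) * ?K)"
    using tau cW R_pow dh K0 by (intro mult_left_mono add_mono mult_right_mono) auto
  finally show ?thesis by (simp add: algebra_simps)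
qed

end

section \<open>Fourier series of periodic functions\<close>

definition ef :: "real \<Rightarrow> real \<Rightarrow> int \<Rightarrow> real \<Rightarrow> complex" where
  "ef a b l x = ei (mu a b l * (x - a))"

lemma norm_ef [simp]: "cmod (ef a b l x) = 1"
  by (simp add: ef_def)

lemma ef_add: "ef a b (l + k) x = ef a b l x * ef a b k x"
proof -
  have "mu a b (l + k) = mu a b l + mu a b k" by (simp add: mu_def distrib_left add_divide_distrib)
  then show ?thesis unfolding ef_def by (simp only: distrib_right ei_add)
qed

lemma ef_0 [simp]: "ef a b 0 x = 1"
  by (simp add: ef_def mu_def)

lemma continuous_on_ef [continuous_intros]: "continuous_on S (ef a b l)"
  unfolding ef_def[abs_def] by (intro continuous_intros)

lemma ef_endpoints: "a < b \<Longrightarrow> ef a b l b = ef a b l a"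
  using ei_int_period[of l] by (simp add: ef_def mu_def)

lemma ef_derivative: "(ef a b l has_vector_derivative \<i> * of_real (mu a b l) * ef a b l x) (at x within S)"
proof -
  have "((\<lambda>x. ei (mu a b l * x) * ei (- (mu a b l * a))) has_vector_derivative
     \<i> * of_real (mu a b l) * ei (mu a b l * x) * ei (- (mu a b l * a))) (at x within S)"
    by (intro has_vector_derivative_mult_left has_vector_derivative_ei)
  moreover have "ef a b l x = ei (mu a b l * x) * ei (- (mu a b l * a))" for x
    by (simp add: ef_def algebra_simps flip: ei_add)
  ultimately show ?thesis unfolding ef_def[abs_def]
    by (simp add: algebra_simps flip: ei_add)
qed

lemma fcoef_ef: "fcoef a b phi l = integral {a..b} (\<lambda>x. phi x * ef a b (- l) x) / of_real (b - a)"
  by (simp add: fcoef_def ef_def)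

lemma integral_ef:
  assumes "a < b"
  shows "integral {a..b} (ef a b l) = (if l = 0 then of_real (b - a) else 0)"
proof (cases "l = 0")
  case True
  then have "ef a b l = (\<lambda>x. 1)" by (simp add: fun_eq_iff)
  then show ?thesis using assms True by (simp add: scaleR_conv_of_real)
next
  case False
  let ?c = "\<i> * complex_of_real (mu a b l)"
  have c: "?c \<noteq> 0" using False assms by (simp add: mu_def)
  have "((\<lambda>x. ?c * ef a b l x) has_integral (ef a b l b - ef a b l a)) {a..b}"
    using assms by (intro fundamental_theorem_of_calculus ef_derivative) auto
  then have "((\<lambda>x. ?c * ef a b l x) has_integral 0) {a..b}" using ef_endpoints[OF assms] by simp
  from has_integral_mult_right[OF this, of "1 / ?c"] c have "(ef a b l has_integral 0) {a..b}" by simp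
  then show ?thesis using False by (simp add: integral_unique)
qed

text \<open>Trigonometric polynomials in the angle t = 2 pi (x - a) / (b - a). Generating them
  inductively makes closure under products and orthogonality plain inductions.\<close>

inductive trig :: "(real \<Rightarrow> complex) \<Rightarrow> bool" where
  mono: "trig (\<lambda>t. c * ei (of_int l * t))"
| add: "trig p \<Longrightarrow> trig q \<Longrightarrow> trig (\<lambda>t. p t + q t)"

lemma trig_mult: "trig p \<Longrightarrow> trig q \<Longrightarrow> trig (\<lambda>t. p t * q t)"
proof (induction rule: trig.induct)
  case (mono c l)
  from mono(1) show ?case
  proof (induction rule: trig.induct)
    case (mono d k)
    have "c * ei (of_int l * t) * (d * ei (of_int k * t)) = c * d * ei (of_int (l + k) * t)" for t
      by (simp only: of_int_add distrib_right distrib_left ei_add mult_ac)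
    then show ?case using trig.mono[of "c * d" "l + k"] by (simp only:)
  next
    case (add p q)
    then show ?case using trig.add by (simp add: distrib_left)
  qed
next
  case (add p q')
  then show ?case using trig.add by (simp add: distrib_right)
qed

lemma trig_const: "trig (\<lambda>t. c)"
  using trig.mono[of c 0] by simp

text \<open>On the unit circle a real linear functional is a combination of cos t and sin t, hence
  of e^(it) and e^(-it); sums and products stay trigonometric.\<close>

lemma trig_real_polynomial: "real_polynomial_function p \<Longrightarrow> trig (\<lambda>t. complex_of_real (p (ei t)))"
  for p :: "complex \<Rightarrow> real"
proof (induction rule: real_polynomial_function.induct)
  case (linear f)
  interpret f: bounded_linear f by fact
  have 1: "f (ei t) = cos t * f 1 + sin t * f \<i>" for t
  proof -
    have "ei t = cos t *\<^sub>R 1 + sin t *\<^sub>R \<i>" by (simp add: ei_cis complex_eq_iff)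
    then show ?thesis by (simp only: f.add f.scaleR) simp
  qed
  have 2: "complex_of_real (cos t * f 1 + sin t * f \<i>)
      = (of_real (f 1) / 2 - \<i> * of_real (f \<i>) / 2) * ei (of_int 1 * t) + (of_real (f 1) / 2 + \<i> * of_real (f \<i>) / 2) * ei (of_int (- 1) * t)" for t
    by (simp add: ei_cis complex_eq_iff field_simps)
  show ?case unfolding 1 2 by (rule trig.add[OF trig.mono trig.mono])
next
  case (const c)
  then show ?case by (rule trig_const)
next
  case (add f g)
  then show ?case using trig.add by simp
next
  case (mult f g)
  then show ?case using trig_mult by simp
qed

locale period =
  fixes a b :: real
  assumes ab: "a < b"
begin

abbreviation e :: "int \<Rightarrow> real \<Rightarrow> complex" where "e \<equiv> ef a b"
abbreviation fc :: "(real \<Rightarrow> complex) \<Rightarrow> int \<Rightarrow> complex" where "fc \<equiv> fcoef a b"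
abbreviation w :: "int set \<Rightarrow> nat \<Rightarrow> (int \<Rightarrow> complex) \<Rightarrow> real" where "w \<equiv> wn a b"

lemma e_eq: "e l x = ei (of_int l * (mu a b 1 * (x - a)))"
  by (simp add: ef_def mu_def mult_ac)

lemma continuous_integrable: "continuous_on {a..b} g \<Longrightarrow> (\<lambda>x. g x * e l x) integrable_on {a..b}" for g :: "real \<Rightarrow> complex"
  by (intro integrable_continuous_real continuous_intros) auto

lemma orthogonal_trig:
  assumes g: "continuous_on {a..b} g" and z: "\<And>l. fc g l = 0" and p: "trig p"
  shows "((\<lambda>x. g x * p (mu a b 1 * (x - a))) has_integral 0) {a..b}"
  using p
proof (induction rule: trig.induct)
  case (mono c l)
  have "integral {a..b} (\<lambda>x. g x * e l x) = 0"
    using z[of "- l"] ab unfolding fcoef_ef by simp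
  then have "((\<lambda>x. g x * e l x) has_integral 0) {a..b}"
    using integrable_integral[OF continuous_integrable[OF g, of l]] by simp
  from has_integral_mult_right[OF this, of c] show ?case
    by (simp add: e_eq mult_ac)
next
  case (add p q)
  from has_integral_add[OF add.IH] show ?case by (simp add: distrib_left)
qed

text \<open>A continuous periodic function descends to the circle, where real polynomials are dense and
  restrict to trigonometric polynomials.\<close>

lemma trig_approx:
  fixes g :: "real \<Rightarrow> real"
  assumes g: "continuous_on {a..b} g" and per: "g a = g b" and r: "0 < r"
  obtains p where "trig (\<lambda>t. complex_of_real (p t))" "\<And>x. x \<in> {a..b} \<Longrightarrow> \<bar>g x - p (mu a b 1 * (x - a))\<bar> < r"
proof -
  let ?pi = "\<lambda>x. ei (mu a b 1 * (x - a))"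
  define S where "S = ?pi ` {a..b}"
  have cpi: "continuous_on A ?pi" for A by (intro continuous_intros)
  \<comment> \<open>The parametrisation of the circle identifies no two points but the ends, where
    \<open>g\<close> agrees by periodicity; hence \<open>g\<close> factors through the
    circle.\<close>
  have inj: "g x = g y" if "x \<in> {a..b}" "y \<in> {a..b}" "?pi x = ?pi y" for x y
  proof -
    have "ei (mu a b 1 * (x - a) - mu a b 1 * (y - a)) = 1"
      using that(3) by (metis ei_add ei_mult_minus(1) diff_conv_add_uminus)
    then obtain k where k: "mu a b 1 * (x - a) - mu a b 1 * (y - a) = 2 * pi * of_int k"
      unfolding ei_eq_1_iff by blast
    have "mu a b 1 * (x - y) = 2 * pi * of_int k" using k by (simp add: algebra_simps)
    then have "2 * pi * (x - y) / (b - a) = 2 * pi * of_int k" by (simp add: mu_def)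
    then have "2 * pi * (x - y) = 2 * pi * of_int k * (b - a)"
      using ab by (subst (asm) nonzero_divide_eq_eq) auto
    then have xy: "x - y = of_int k * (b - a)" by (simp add: mult.assoc)
    have k1: "\<bar>k\<bar> \<le> 1"
    proof (rule ccontr)
      assume "\<not> \<bar>k\<bar> \<le> 1"
      then have "2 \<le> \<bar>real_of_int k\<bar>" by linarith
      then have "2 * (b - a) \<le> \<bar>real_of_int k\<bar> * (b - a)" using ab by (intro mult_right_mono) auto
      also have "\<dots> = \<bar>x - y\<bar>" using xy ab by (simp add: abs_mult)
      also have "\<dots> \<le> b - a" using that by auto
      finally show False using ab by simp
    qed
    then consider "k = 0" | "k = 1" | "k = - 1" by linarith
    then show ?thesis
    proof cases
      case 1 then show ?thesis using xy by simp
    next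
      case 2 then have "x = b" "y = a" using xy that by auto
      then show ?thesis using per by simp
    next
      case 3 then have "x = a" "y = b" using xy that by auto
      then show ?thesis using per by simp
    qed
  qed
  define G where "G z = g (SOME x. x \<in> {a..b} \<and> ?pi x = z)" for z
  have G: "G (?pi x) = g x" if "x \<in> {a..b}" for x
    unfolding G_def by (rule inj) (use someI[of "\<lambda>y. y \<in> {a..b} \<and> ?pi y = ?pi x" x] that in auto)
  have cS: "compact S" unfolding S_def by (intro compact_continuous_image cpi) simp
  \<comment> \<open>Continuity by closed preimages, which are continuous images of compact subsets
    of the interval.\<close>
  have "continuous_on S G"
    unfolding continuous_on_closed_vimage[OF compact_imp_closed[OF cS]]
  proof (intro allI impI)
    fix B :: "real set" assume B: "closed B"
    have "G -` B \<inter> S = ?pi ` (g -` B \<inter> {a..b})"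
      unfolding S_def using G by auto
    moreover have "closed (g -` B \<inter> {a..b})"
      using g B by (simp add: continuous_on_closed_vimage)
    then have "compact ((g -` B \<inter> {a..b}) \<inter> {a..b})" by (rule closed_Int_compact) simp
    then have "compact (?pi ` (g -` B \<inter> {a..b}))"
      by (intro compact_continuous_image[OF cpi]) (simp add: Int_assoc)
    ultimately show "closed (G -` B \<inter> S)" by (simp add: compact_imp_closed)
  qed
  from Stone_Weierstrass_real_polynomial_function[OF cS this r]
  obtain p where p: "real_polynomial_function p" "\<And>z. z \<in> S \<Longrightarrow> \<bar>G z - p z\<bar> < r" by blast
  show ?thesis
  proof (rule that[of "\<lambda>t. p (ei t)"])
    show "trig (\<lambda>t. complex_of_real (p (ei t)))" by (rule trig_real_polynomial[OF p(1)])
    fix x assume x: "x \<in> {a..b}"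
    then show "\<bar>g x - p (?pi x)\<bar> < r" using p(2)[of "?pi x"] G[OF x] by (simp add: S_def)
  qed
qed

text \<open>Orthogonality to the exponentials extends to trigonometric polynomials, which
  approximate the real and the imaginary part of \<open>g\<close> uniformly. So the integral of
  |g|^2 lies below every positive bound, and continuity gives the pointwise claim.\<close>

lemma fourier_unique:
  assumes g: "continuous_on {a..b} g" and per: "g a = g b" and z: "\<And>l. fc g l = 0" and x: "x \<in> {a..b}"
  shows "g x = 0"
proof -
  obtain K where K: "\<And>x. x \<in> {a..b} \<Longrightarrow> cmod (g x) \<le> K" "0 \<le> K"
  proof -
    have "bounded (g ` {a..b})" by (intro compact_imp_bounded compact_continuous_image g) simp
    then obtain K0 where "\<forall>x\<in>{a..b}. cmod (g x) \<le> K0" unfolding bounded_iff by auto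
    then show ?thesis by (intro that[of "max K0 0"]) (auto simp: le_max_iff_disj)
  qed
  let ?I = "integral {a..b} (\<lambda>x. g x * cnj (g x))"
  have gg: "(\<lambda>x. g x * cnj (g x)) integrable_on {a..b}"
    by (intro integrable_continuous_real continuous_intros g)
  have small: "cmod ?I \<le> 2 * K * r * (b - a)" if r: "0 < r" for r
  proof -
    have "continuous_on {a..b} (\<lambda>x. Re (g x))" "continuous_on {a..b} (\<lambda>x. Im (g x))"
      by (intro continuous_intros g)+
    moreover have "Re (g a) = Re (g b)" "Im (g a) = Im (g b)" using per by auto
    ultimately obtain p q where p: "trig (\<lambda>t. complex_of_real (p t))" "\<And>x. x \<in> {a..b} \<Longrightarrow> \<bar>Re (g x) - p (mu a b 1 * (x - a))\<bar> < r"
       and q: "trig (\<lambda>t. complex_of_real (q t))" "\<And>x. x \<in> {a..b} \<Longrightarrow> \<bar>Im (g x) - q (mu a b 1 * (x - a))\<bar> < r"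
      using trig_approx r by metis
    let ?h = "\<lambda>t. complex_of_real (p t) + - \<i> * complex_of_real (q t)"
    have "trig ?h" by (intro trig.add trig_mult trig_const p q)
    from orthogonal_trig[OF g z this]
    have "((\<lambda>x. g x * cnj (g x) - g x * ?h (mu a b 1 * (x - a))) has_integral ?I - 0) {a..b}"
      by (intro has_integral_diff integrable_integral gg)
    then have hi: "((\<lambda>x. g x * cnj (g x) - g x * ?h (mu a b 1 * (x - a))) has_integral ?I) (cbox a b)" by simp
    have "cmod ?I \<le> K * (2 * r) * measure lborel (cbox a b)"
    proof (rule has_integral_bound[OF _ hi])
      show "0 \<le> K * (2 * r)" using K r by simp
      fix x assume "x \<in> cbox a b"
      then have x: "x \<in> {a..b}" by simp
      let ?t = "mu a b 1 * (x - a)"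
      have "cnj (g x) - ?h ?t = complex_of_real (Re (g x) - p ?t) + - \<i> * complex_of_real (Im (g x) - q ?t)"
        by (simp add: complex_eq_iff)
      also have "cmod \<dots> \<le> \<bar>Re (g x) - p ?t\<bar> + \<bar>Im (g x) - q ?t\<bar>"
        by (rule order_trans[OF norm_triangle_ineq]) (simp only: norm_mult norm_minus_cancel norm_ii norm_of_real mult_1_left order_refl)
      also have "\<dots> \<le> 2 * r" using p(2)[OF x] q(2)[OF x] by simp
      finally have "cmod (g x) * cmod (cnj (g x) - ?h ?t) \<le> K * (2 * r)"
        using K(1)[OF x] K(2) by (intro mult_mono) auto
      then show "cmod (g x * cnj (g x) - g x * ?h ?t) \<le> K * (2 * r)"
        by (simp only: right_diff_distrib[symmetric] norm_mult)
    qed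
    then show ?thesis using ab by (simp add: mult_ac)
  qed
  have "?I = 0"
  proof (rule ccontr)
    assume "?I \<noteq> 0"
    then have pos: "0 < cmod ?I" by simp
    define r where "r = cmod ?I / (2 * (2 * K * (b - a) + 1))"
    have den: "0 < 2 * K * (b - a) + 1" using K ab by (simp add: add_nonneg_pos)
    have "0 < r" unfolding r_def using pos den by simp
    from small[OF this] have "cmod ?I \<le> (2 * K * (b - a)) * r" by (simp add: mult_ac)
    also have "\<dots> \<le> (2 * K * (b - a) + 1) * r" using \<open>0 < r\<close> by (intro mult_right_mono) auto
    also have "\<dots> = cmod ?I / 2" unfolding r_def using den by (simp add: field_simps)
    finally show False using pos by simp
  qed
  then have "((\<lambda>x. g x * cnj (g x)) has_integral 0) {a..b}" using integrable_integral[OF gg] by simp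
  from has_integral_linear[OF this bounded_linear_Re]
  have "((\<lambda>x. (cmod (g x))\<^sup>2) has_integral 0) {a..b}"
    by (simp add: o_def complex_norm_square[symmetric] cmod_power2 power2_eq_square)
  then have "integral {a..b} (\<lambda>x. (cmod (g x))\<^sup>2) = 0" by (rule integral_unique)
  moreover have "continuous_on {a..b} (\<lambda>x. (cmod (g x))\<^sup>2)" by (intro continuous_intros g)
  ultimately have "(cmod (g x))\<^sup>2 = 0" using integral_eq_0_iff[of a b "\<lambda>x. (cmod (g x))\<^sup>2"] ab x by auto
  then show ?thesis by simp
qed

text \<open>The partial sums over finite index sets converge uniformly by the Weierstrass test, so
  continuity passes to the limit and coefficients may be computed term by term.\<close>

lemma abs_series:
  assumes c: "(\<lambda>l. cmod (c l)) summable_on UNIV"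
  defines "S \<equiv> \<lambda>x. \<Sum>\<^sub>\<infinity>l. c l * e l x"
  shows "((\<lambda>l. c l * e l x) has_sum S x) UNIV" "continuous_on {a..b} S" "S a = S b" "fc S l = c l"
proof -
  have sm: "(\<lambda>l. c l * e l x) summable_on UNIV" for x
    by (rule abs_summable_summable) (use c in \<open>simp add: norm_mult\<close>)
  then show "((\<lambda>l. c l * e l x) has_sum S x) UNIV" unfolding S_def by (rule has_sum_infsum)
  show "S a = S b" by (simp add: S_def ef_endpoints[OF ab])
  have ul: "uniform_limit {a..b} (\<lambda>A x. \<Sum>l\<in>A. c l * e l x) S (finite_subsets_at_top UNIV)"
    unfolding S_def by (rule Weierstrass_m_test_general[OF _ c]) (simp add: norm_mult)
  show cS: "continuous_on {a..b} S"
    by (rule uniform_limit_theorem[OF _ ul]) (auto intro!: always_eventually continuous_intros)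
  have ul2: "uniform_limit {a..b} (\<lambda>A x. \<Sum>m\<in>A. (c m * e (- l) x) * e m x) (\<lambda>x. S x * e (- l) x) (finite_subsets_at_top UNIV)"
  proof -
    have "uniform_limit {a..b} (\<lambda>A x. \<Sum>m\<in>A. (c m * e (- l) x) * e m x) (\<lambda>x. \<Sum>\<^sub>\<infinity>m. (c m * e (- l) x) * e m x) (finite_subsets_at_top UNIV)"
      by (rule Weierstrass_m_test_general[OF _ c]) (simp add: norm_mult)
    moreover have "(\<Sum>\<^sub>\<infinity>m. (c m * e (- l) x) * e m x) = S x * e (- l) x" for x
      unfolding S_def infsum_cmult_left'[symmetric] by (simp add: mult_ac)
    ultimately show ?thesis by simp
  qed
  obtain I J where I: "\<And>A. ((\<lambda>x. \<Sum>m\<in>A. (c m * e (- l) x) * e m x) has_integral I A) {a..b}"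
     and J: "((\<lambda>x. S x * e (- l) x) has_integral J) {a..b}" and IJ: "(I \<longlongrightarrow> J) (finite_subsets_at_top UNIV)"
    by (rule uniform_limit_integral[OF ul2]) (auto intro!: continuous_intros)
  have "I A = c l * of_real (b - a)" if "finite A" "l \<in> A" for A
  proof -
    have "integral {a..b} (\<lambda>x. \<Sum>m\<in>A. (c m * e (- l) x) * e m x) = (\<Sum>m\<in>A. integral {a..b} (\<lambda>x. c m * e (m - l) x))"
    proof (subst integral_sum[OF \<open>finite A\<close>, symmetric])
      show "(\<lambda>x. c m * e (m - l) x) integrable_on {a..b}" for m
        by (intro integrable_continuous_real continuous_intros)
      show "integral {a..b} (\<lambda>x. \<Sum>m\<in>A. (c m * e (- l) x) * e m x) = integral {a..b} (\<lambda>x. \<Sum>m\<in>A. c m * e (m - l) x)"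
        using ef_add[of a b _ "- l"] by (simp add: mult_ac)
    qed
    also have "\<dots> = (\<Sum>m\<in>A. if m = l then c l * of_real (b - a) else 0)"
      by (intro sum.cong refl) (simp add: integral_ef[OF ab] integral_mult_right)
    also have "\<dots> = c l * of_real (b - a)" using that by simp
    finally show ?thesis using I[of A] by (simp add: integral_unique)
  qed
  then have "eventually (\<lambda>A. I A = c l * of_real (b - a)) (finite_subsets_at_top UNIV)"
    unfolding eventually_finite_subsets_at_top by (intro exI[of _ "{l}"]) simp
  then have "(I \<longlongrightarrow> c l * of_real (b - a)) (finite_subsets_at_top UNIV)"
    by (rule tendsto_eventually)
  then have "J = c l * of_real (b - a)"
    by (intro tendsto_unique[OF finite_subsets_at_top_neq_bot IJ])
  then show "fc S l = c l"
    unfolding fcoef_ef using J ab by (simp add: integral_unique)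
qed

lemma fc_diff:
  assumes "\<And>l. (\<lambda>x. g x * e l x) integrable_on {a..b}" "\<And>l. (\<lambda>x. h x * e l x) integrable_on {a..b}"
  shows "fc (\<lambda>x. g x - h x) l = fc g l - fc h l"
  unfolding fcoef_ef left_diff_distrib integral_diff[OF assms] diff_divide_distrib ..

lemma fc_cmult: "fc (\<lambda>x. c * g x) l = c * fc g l"
  unfolding fcoef_ef mult.assoc integral_mult_right by simp

text \<open>The difference of \<open>g\<close> and the sum of its series is continuous, takes equal
  values at the ends and has vanishing coefficients.\<close>

lemma fourier_inversion:
  assumes g: "continuous_on {a..b} g" "g a = g b" and s: "(\<lambda>l. cmod (fc g l)) summable_on UNIV" and x: "x \<in> {a..b}"
  shows "((\<lambda>l. fc g l * e l x) has_sum g x) UNIV"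
proof -
  note S = abs_series[OF s]
  let ?S = "\<lambda>x. \<Sum>\<^sub>\<infinity>l. fc g l * e l x"
  have "g x - ?S x = 0"
  proof (rule fourier_unique[of "\<lambda>x. g x - ?S x"])
    show "continuous_on {a..b} (\<lambda>x. g x - ?S x)" by (intro continuous_intros g S)
    show "fc (\<lambda>x. g x - ?S x) l = 0" for l
    proof -
      have "fc (\<lambda>x. g x - ?S x) l = fc g l - fc ?S l"
        by (rule fc_diff; rule continuous_integrable; rule g S(2))
      then show ?thesis by (simp add: S(4))
    qed
  qed (use S(3) g x in auto)
  then show ?thesis using S(1)[of x] by simp
qed

end

section \<open>Aliasing\<close>

context period begin

lemma wn_le_Hnorm:
  assumes "in_Hp a b m phi" "finite A"
  shows "w A m (fc phi) \<le> Hnorm a b m phi"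
proof -
  have "(w A m (fc phi))\<^sup>2 \<le> infsum (\<lambda>l. (1 + (mu a b l)\<^sup>2) ^ m * (cmod (fc phi l))\<^sup>2) UNIV"
    unfolding wn_sq wt_def
    by (rule finite_sum_le_infsum) (use assms in \<open>auto simp: in_Hp_def\<close>)
  then show ?thesis unfolding Hnorm_def by (intro real_le_rsqrt)
qed

lemma Hnorm_le:
  assumes "\<And>A. finite A \<Longrightarrow> w A m (fc phi) \<le> B"
  shows "Hnorm a b m phi \<le> B"
proof -
  have B: "0 \<le> B" using assms[of "{}"] wn_nonneg order_trans by blast
  have fin: "(\<Sum>l\<in>A. (1 + (mu a b l)\<^sup>2) ^ m * (cmod (fc phi l))\<^sup>2) \<le> B\<^sup>2" if "finite A" for A
    using power_mono[OF assms[OF that] wn_nonneg, of 2] unfolding wn_sq wt_def .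
  have "(\<lambda>l. (1 + (mu a b l)\<^sup>2) ^ m * (cmod (fc phi l))\<^sup>2) summable_on UNIV"
    by (rule nonneg_bdd_above_summable_on) (use fin in \<open>auto simp: bdd_above_def\<close>)
  then have "infsum (\<lambda>l. (1 + (mu a b l)\<^sup>2) ^ m * (cmod (fc phi l))\<^sup>2) UNIV \<le> B\<^sup>2"
    by (rule infsum_le_finite_sums) (use fin in auto)
  then show ?thesis unfolding Hnorm_def using B real_sqrt_le_mono by fastforce
qed

lemma Hnorm_nonneg: "0 \<le> Hnorm a b m phi"
  unfolding Hnorm_def by (intro real_sqrt_ge_zero infsum_nonneg) auto

lemma abs_summable_wn:
  assumes "\<And>A. finite A \<Longrightarrow> w A m c \<le> B" "1 \<le> m"
  shows "(\<lambda>l. cmod (c l)) summable_on UNIV"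
    "(\<Sum>\<^sub>\<infinity>l. cmod (c l)) \<le> sqrt (1 + (b - a)\<^sup>2) * B"
proof -
  have fin: "(\<Sum>l\<in>A. cmod (c l)) \<le> sqrt (1 + (b - a)\<^sup>2) * B" if "finite A" for A
    using sum_cmod_le_wn[OF ab that assms(2), of c] mult_left_mono[OF assms(1)[OF that], of "sqrt (1 + (b - a)\<^sup>2)"]
    by simp
  show s: "(\<lambda>l. cmod (c l)) summable_on UNIV"
    by (rule nonneg_bdd_above_summable_on) (use fin in \<open>auto simp: bdd_above_def\<close>)
  show "(\<Sum>\<^sub>\<infinity>l. cmod (c l)) \<le> sqrt (1 + (b - a)\<^sup>2) * B"
    by (rule infsum_le_finite_sums[OF s]) (use fin in auto)
qed

end

sublocale grid \<subseteq> period by standard (rule ab)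

definition alias_const :: "nat \<Rightarrow> real" where
  "alias_const s = sqrt (2 ^ s * (2 * (1 + (2 * pi)\<^sup>2)))"

lemma alias_const_nonneg [simp]: "0 \<le> alias_const s"
  by (simp add: alias_const_def)

context grid begin

abbreviation h :: real where "h \<equiv> (b - a) / real N"
abbreviation xg :: "nat \<Rightarrow> real" where "xg \<equiv> gridx a b N"

lemma h_pos: "0 < h" using ab N0 by simp

lemma xg_in: "j < N \<Longrightarrow> xg j \<in> {a..b}"
proof -
  assume "j < N"
  then have "real j * h \<le> real N * h" using h_pos by (intro mult_right_mono) auto
  moreover have "real N * h = b - a" using N0 by simp
  moreover have "0 \<le> real j * h" using h_pos by (intro mult_nonneg_nonneg) auto
  ultimately show ?thesis by (simp add: gridx_def del: times_divide_eq_right)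
qed

lemma e_grid: "e l (xg j) = ei (2 * pi * real_of_int l * real j / real N)"
  by (simp add: ef_def mu_gridx)

lemma dft_e: "D (\<lambda>j. e m (xg j)) l = (if int N dvd m - l then 1 else 0)"
proof -
  have "D (\<lambda>j. e m (xg j)) l = (\<Sum>j<N. ei (2 * pi * real_of_int (m - l) * real j / real N)) / of_nat N"
    unfolding dft_alt e_grid by (simp add: left_diff_distrib right_diff_distrib diff_divide_distrib flip: ei_add)
  then show ?thesis unfolding sum_ei using N0 by simp
qed

lemma dft_sum: "finite A \<Longrightarrow> D (\<lambda>j. \<Sum>m\<in>A. c m * f m j) l = (\<Sum>m\<in>A. c m * D (f m) l)"
proof (induction A rule: finite_induct)
  case empty
  then show ?case by (simp add: dft_def)
next
  case (insert x A)
  then show ?case by (simp add: dft_add dft_scale)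
qed

text \<open>From |l| <= N/2 comes |mu_l| <= pi / h, and an alias m = l + k N satisfies |m| >= |k| N
  - N/2 >= |k| N/2. Both are expressed through pi / h, the largest resolved frequency.\<close>

lemma mode_bounds:
  assumes l: "l \<in> M" and k: "k \<noteq> 0" and m: "m = l + k * int N"
  shows "(mu a b l)\<^sup>2 \<le> (pi / h)\<^sup>2" "(pi / h)\<^sup>2 * (of_int k)\<^sup>2 \<le> wt a b m"
proof -
  have l2: "2 * \<bar>real_of_int l\<bar> \<le> real N"
  proof -
    have "2 * \<bar>l\<bar> \<le> int N" using l evN by (auto simp: modes_eq)
    then have "real_of_int (2 * \<bar>l\<bar>) \<le> real_of_int (int N)" by (simp only: of_int_le_iff)
    then show ?thesis by simp
  qed
  have "\<bar>mu a b l\<bar> = pi * (2 * \<bar>real_of_int l\<bar>) / (b - a)"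
    using ab by (simp add: mu_def abs_mult)
  also have "\<dots> \<le> pi * real N / (b - a)" using l2 ab by (intro divide_right_mono mult_left_mono) auto
  finally have "\<bar>mu a b l\<bar> \<le> \<bar>pi / h\<bar>" using ab N0 by simp
  then show "(mu a b l)\<^sup>2 \<le> (pi / h)\<^sup>2" by (simp only: abs_le_square_iff)
  have "\<bar>real_of_int k\<bar> * real N \<le> 2 * \<bar>real_of_int m\<bar>"
  proof -
    have "1 \<le> \<bar>real_of_int k\<bar>" using k by linarith
    then have "2 * \<bar>real_of_int l\<bar> \<le> \<bar>real_of_int k\<bar> * real N"
      using l2 mult_right_mono[of 1 "\<bar>real_of_int k\<bar>" "real N"] by simp
    moreover have "\<bar>real_of_int k\<bar> * real N - \<bar>real_of_int l\<bar> \<le> \<bar>real_of_int m\<bar>"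
      unfolding m using abs_triangle_ineq2[of "real_of_int k * real N" "- real_of_int l"]
      by (simp add: abs_mult add.commute)
    ultimately show ?thesis by linarith
  qed
  then have "pi * (\<bar>real_of_int k\<bar> * real N) / (b - a) \<le> pi * (2 * \<bar>real_of_int m\<bar>) / (b - a)"
    using ab by (intro divide_right_mono mult_left_mono) auto
  then have "\<bar>pi / h * real_of_int k\<bar> \<le> \<bar>mu a b m\<bar>"
    using ab N0 by (simp add: mu_def abs_mult mult_ac)
  then have "(pi / h * real_of_int k)\<^sup>2 \<le> (mu a b m)\<^sup>2" by (simp only: abs_le_square_iff)
  then show "(pi / h)\<^sup>2 * (of_int k)\<^sup>2 \<le> wt a b m" unfolding wt_def power_mult_distrib by linarith
qed

text \<open>On the interval (0, 2 pi) the frequency of mode k is k itself, so the bound for sums of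
  inverse weights applies.\<close>

lemma sum_inverse_squares:
  assumes "finite K" "0 \<notin> K"
  shows "(\<Sum>k\<in>K. 1 / (real_of_int k)\<^sup>2) \<le> 2 * (1 + (2 * pi)\<^sup>2)"
proof -
  have "(\<Sum>k\<in>K. 1 / (real_of_int k)\<^sup>2) \<le> (\<Sum>k\<in>K. 2 * (1 / wt 0 (2 * pi) k))"
  proof (rule sum_mono)
    fix k assume "k \<in> K"
    then have "1 \<le> \<bar>real_of_int k\<bar>" using assms(2) by (cases "k = 0") auto
    then have "1 \<le> (real_of_int k)\<^sup>2" by (metis one_le_power power2_abs)
    moreover have "1 / q \<le> 2 * (1 / (1 + q))" if "1 \<le> q" for q :: real
      using that by (simp add: divide_simps)
    ultimately show "1 / (real_of_int k)\<^sup>2 \<le> 2 * (1 / wt 0 (2 * pi) k)"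
      by (simp add: wt_def mu_def)
  qed
  also have "\<dots> \<le> 2 * (1 + (2 * pi - 0)\<^sup>2)"
    unfolding sum_distrib_left[symmetric] by (intro mult_left_mono sum_inverse_wt assms) auto
  finally show ?thesis by simp
qed

text \<open>The coefficient of the sampled function at \<open>l\<close> collects all modes congruent
  to \<open>l\<close>, and the error is the sum over the others. Cauchy-Schwarz against the weight
  of order \<open>s0\<close> gives (h / pi)^(2 s0) times a convergent sum over k, while the weight
  of order \<open>s\<close> on \<open>M\<close> is at most 2^s (pi / h)^(2 s). The alias classes are
  disjoint, so the squares add up.\<close>

lemma alias_bound_finite:
  assumes A: "finite A" and s: "s \<le> s0" "1 \<le> s0" and h1: "h \<le> 1"
  shows "wn a b M s (\<lambda>l. D (\<lambda>j. \<Sum>m\<in>A. c m * e m (xg j)) l - (if l \<in> A then c l else 0))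
    \<le> alias_const s * h ^ (s0 - s) * wn a b A s0 c"
proof -
  define Bl where "Bl l = {m \<in> A. m \<noteq> l \<and> int N dvd m - l}" for l
  have finB: "finite (Bl l)" for l using A by (simp add: Bl_def)
  have eq: "D (\<lambda>j. \<Sum>m\<in>A. c m * e m (xg j)) l - (if l \<in> A then c l else 0) = (\<Sum>m\<in>Bl l. c m)" for l
  proof -
    have "D (\<lambda>j. \<Sum>m\<in>A. c m * e m (xg j)) l = (\<Sum>m\<in>A. if int N dvd m - l then c m else 0)"
      unfolding dft_sum[OF A] dft_e by (intro sum.cong) auto
    also have "\<dots> = (\<Sum>m\<in>{m \<in> A. int N dvd m - l}. c m)" using A by (simp add: sum.inter_filter)
    also have "{m \<in> A. int N dvd m - l} = (if l \<in> A then insert l (Bl l) else Bl l)"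
      by (auto simp: Bl_def)
    finally show ?thesis using finB[of l] by (auto simp: Bl_def)
  qed
  let ?P = "(h / pi) ^ (2 * s0) * (2 * (1 + (2 * pi)\<^sup>2))"
  have ph: "0 < pi / h" by (rule divide_pos_pos[OF pi_gt_zero h_pos])
  have inv: "(\<Sum>m\<in>Bl l. 1 / wt a b m ^ s0) \<le> ?P" if l: "l \<in> M" for l
  proof -
    let ?k = "\<lambda>m. (m - l) div int N"
    have k1: "m = l + ?k m * int N" if "m \<in> Bl l" for m
      using that by (auto simp: Bl_def)
    have k: "m = l + ?k m * int N" "?k m \<noteq> 0" if m: "m \<in> Bl l" for m
    proof -
      show "m = l + ?k m * int N" by (rule k1[OF m])
      have "m \<noteq> l" using m by (simp add: Bl_def)
      then show "?k m \<noteq> 0" using k1[OF m] by auto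
    qed
    have inj: "inj_on ?k (Bl l)"
    proof (rule inj_onI)
      fix m m' assume m: "m \<in> Bl l" "m' \<in> Bl l" "?k m = ?k m'"
      show "m = m'" using k1[OF m(1)] k1[OF m(2)] m(3) by simp
    qed
    have "(\<Sum>m\<in>Bl l. 1 / wt a b m ^ s0) \<le> (\<Sum>m\<in>Bl l. (h / pi) ^ (2 * s0) * (1 / (real_of_int (?k m))\<^sup>2))"
    proof (rule sum_mono)
      fix m assume m: "m \<in> Bl l"
      let ?q = "real_of_int (?k m)"
      have q: "1 \<le> ?q\<^sup>2"
      proof -
        have "1 \<le> \<bar>?q\<bar>" using k(2)[OF m] by linarith
        then show ?thesis by (metis one_le_power power2_abs)
      qed
      have "(pi / h) ^ (2 * s0) * ?q\<^sup>2 \<le> (pi / h) ^ (2 * s0) * (?q\<^sup>2) ^ s0"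
        using self_le_power[OF q, of s0] s ph by (intro mult_left_mono) auto
      also have "\<dots> = ((pi / h)\<^sup>2 * ?q\<^sup>2) ^ s0" by (simp add: power_mult_distrib power_mult)
      also have "\<dots> \<le> wt a b m ^ s0"
        using mode_bounds(2)[OF l k(2)[OF m] k(1)[OF m]] by (intro power_mono) auto
      finally have "1 / wt a b m ^ s0 \<le> 1 / ((pi / h) ^ (2 * s0) * ?q\<^sup>2)"
      proof (rule divide_left_mono)
        have "0 < ?q\<^sup>2" using q by linarith
        then show "0 < wt a b m ^ s0 * ((pi / h) ^ (2 * s0) * ?q\<^sup>2)"
          by (intro mult_pos_pos zero_less_power[OF ph] zero_less_power[OF wt_pos(1)])
      qed simp
      also have "1 / ((x / y) ^ n * z) = (y / x) ^ n * (1 / z)" for x y z :: real and n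
        by (simp add: power_divide)
      finally show "1 / wt a b m ^ s0 \<le> (h / pi) ^ (2 * s0) * (1 / ?q\<^sup>2)" .
    qed
    also have "\<dots> = (h / pi) ^ (2 * s0) * (\<Sum>k\<in>?k ` Bl l. 1 / (real_of_int k)\<^sup>2)"
      unfolding sum.reindex[OF inj] by (simp add: sum_distrib_left)
    also have "\<dots> \<le> ?P"
      using k(2) finB[of l] h_pos by (intro mult_left_mono sum_inverse_squares) auto
    finally show ?thesis .
  qed
  have wl: "wt a b l ^ s \<le> 2 ^ s * (pi / h) ^ (2 * s)" if l: "l \<in> M" for l
  proof -
    have "h \<le> pi" using h1 pi_ge_two by linarith
    then have "1 \<le> pi / h" by (simp only: le_divide_eq_1_pos[OF h_pos])
    then have "1 \<le> (pi / h)\<^sup>2" by (simp only: one_le_power)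
    then have "wt a b l \<le> 2 * (pi / h)\<^sup>2"
      using mode_bounds(1)[OF l, of 1] by (simp add: wt_def)
    then have "wt a b l ^ s \<le> (2 * (pi / h)\<^sup>2) ^ s" by (intro power_mono) auto
    then show ?thesis by (simp add: power_mult_distrib power_mult)
  qed
  let ?C = "2 ^ s * (pi / h) ^ (2 * s) * ?P"
  have tm: "wt a b l ^ s * (cmod (\<Sum>m\<in>Bl l. c m))\<^sup>2 \<le> ?C * (\<Sum>m\<in>Bl l. wt a b m ^ s0 * (cmod (c m))\<^sup>2)"
    if l: "l \<in> M" for l
  proof -
    have "cmod (\<Sum>m\<in>Bl l. c m) \<le> (\<Sum>m\<in>Bl l. \<bar>1 / sqrt (wt a b m ^ s0)\<bar> * \<bar>sqrt (wt a b m ^ s0) * cmod (c m)\<bar>)"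
      by (rule order_trans[OF norm_sum], rule sum_mono) (simp add: abs_mult less_imp_neq[symmetric])
    also have "\<dots> \<le> L2_set (\<lambda>m. 1 / sqrt (wt a b m ^ s0)) (Bl l) * wn a b (Bl l) s0 c"
      unfolding wn_def by (rule L2_set_mult_ineq)
    finally have "(cmod (\<Sum>m\<in>Bl l. c m))\<^sup>2 \<le> (L2_set (\<lambda>m. 1 / sqrt (wt a b m ^ s0)) (Bl l) * wn a b (Bl l) s0 c)\<^sup>2"
      by (rule power_mono) simp
    also have "\<dots> = (\<Sum>m\<in>Bl l. 1 / wt a b m ^ s0) * (wn a b (Bl l) s0 c)\<^sup>2"
      by (simp add: power_mult_distrib L2_set_def sum_nonneg power_divide)
    also have "\<dots> \<le> ?P * (wn a b (Bl l) s0 c)\<^sup>2"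
      by (rule mult_right_mono[OF inv[OF l]]) simp
    finally have "wt a b l ^ s * (cmod (\<Sum>m\<in>Bl l. c m))\<^sup>2 \<le> (2 ^ s * (pi / h) ^ (2 * s)) * (?P * (wn a b (Bl l) s0 c)\<^sup>2)"
      using wl[OF l] ph by (intro mult_mono) auto
    then show ?thesis unfolding wn_sq by (simp only: mult.assoc)
  qed
  have C: "?C \<le> (alias_const s * h ^ (s0 - s))\<^sup>2" "0 \<le> ?C"
  proof -
    have "(pi / h) ^ (2 * s) * (h / pi) ^ (2 * s0) = (h / pi) ^ (2 * (s0 - s))"
    proof -
      have "(h / pi) ^ (2 * s0) = (h / pi) ^ (2 * s) * (h / pi) ^ (2 * (s0 - s))"
        using s by (simp flip: power_add distrib_left)
      moreover have "(pi / h) ^ (2 * s) * (h / pi) ^ (2 * s) = 1"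
      proof -
        have "x / y * (y / x) = 1" if "0 < x" "0 < y" for x y :: real using that by simp
        from this[OF pi_gt_zero h_pos] show ?thesis by (simp only: power_mult_distrib[symmetric] power_one)
      qed
      ultimately show ?thesis by (simp only: mult.assoc[symmetric] mult_1_left)
    qed
    then have "?C = 2 ^ s * (2 * (1 + (2 * pi)\<^sup>2)) * (h / pi) ^ (2 * (s0 - s))"
      by (simp only: mult_ac)
    also have "\<dots> \<le> 2 ^ s * (2 * (1 + (2 * pi)\<^sup>2)) * h ^ (2 * (s0 - s))"
    proof (intro mult_left_mono power_mono)
      have "x / y \<le> x" if "0 < x" "2 \<le> y" for x y :: real using divide_left_mono[of 1 y x] that by simp
      from this[OF h_pos pi_ge_two] show "h / pi \<le> h" .
    qed (use ab in auto)
    also have "\<dots> = (alias_const s * h ^ (s0 - s))\<^sup>2"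
      by (simp add: alias_const_def power_mult_distrib mult.commute flip: power_mult)
    finally show "?C \<le> (alias_const s * h ^ (s0 - s))\<^sup>2" .
    show "0 \<le> ?C" using ab by auto
  qed
  have disj: "Bl l \<inter> Bl k = {}" if "l \<in> M" "k \<in> M" "l \<noteq> k" for l k
  proof (rule ccontr)
    assume "Bl l \<inter> Bl k \<noteq> {}"
    then obtain m where "int N dvd m - l" "int N dvd m - k" by (auto simp: Bl_def)
    then have "int N dvd (m - l) - (m - k)" by (rule dvd_diff)
    then have "int N dvd k - l" by simp
    then show False using modes_diff_dvd[OF that(1,2)] that(3) by simp
  qed
  have "(wn a b M s (\<lambda>l. \<Sum>m\<in>Bl l. c m))\<^sup>2 \<le> (\<Sum>l\<in>M. ?C * (\<Sum>m\<in>Bl l. wt a b m ^ s0 * (cmod (c m))\<^sup>2))"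
    unfolding wn_sq by (rule sum_mono[OF tm])
  also have "\<dots> = ?C * (\<Sum>m\<in>(\<Union>l\<in>M. Bl l). wt a b m ^ s0 * (cmod (c m))\<^sup>2)"
    unfolding sum_distrib_left[symmetric] by (subst sum.UNION_disjoint) (use finB disj in auto)
  also have "\<dots> \<le> ?C * (\<Sum>m\<in>A. wt a b m ^ s0 * (cmod (c m))\<^sup>2)"
    by (intro mult_left_mono sum_mono2 A C) (auto simp: Bl_def)
  also have "\<dots> = ?C * (wn a b A s0 c)\<^sup>2" unfolding wn_sq ..
  also have "\<dots> \<le> (alias_const s * h ^ (s0 - s))\<^sup>2 * (wn a b A s0 c)\<^sup>2"
    by (rule mult_right_mono[OF C(1)]) simp
  finally have "(wn a b M s (\<lambda>l. \<Sum>m\<in>Bl l. c m))\<^sup>2 \<le> (alias_const s * h ^ (s0 - s) * wn a b A s0 c)\<^sup>2"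
    by (simp only: power_mult_distrib)
  then have "wn a b M s (\<lambda>l. \<Sum>m\<in>Bl l. c m) \<le> alias_const s * h ^ (s0 - s) * wn a b A s0 c"
    by (rule power2_le_imp_le) (use ab in auto)
  then show ?thesis unfolding eq .
qed

lemma tendsto_wn:
  assumes "finite A" "\<And>l. l \<in> A \<Longrightarrow> ((\<lambda>x. c x l) \<longlongrightarrow> d l) F"
  shows "((\<lambda>x. wn a b A s (c x)) \<longlongrightarrow> wn a b A s d) F"
  unfolding wn_def L2_set_def by (intro tendsto_intros assms)

lemma tendsto_dft:
  assumes "\<And>j. j < N \<Longrightarrow> ((\<lambda>x. v x j) \<longlongrightarrow> u j) F"
  shows "((\<lambda>x. D (v x) l) \<longlongrightarrow> D u l) F"
  unfolding dft_def using assms N0 by (intro tendsto_intros) auto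

text \<open>Passage to the limit over finite index sets: at each of the finitely many modes the case
  distinction on membership is eventually constant.\<close>

lemma alias_bound:
  assumes c: "\<And>A. finite A \<Longrightarrow> wn a b A s0 c \<le> B" and s: "s \<le> s0" "1 \<le> s0" and h1: "h \<le> 1"
    and g: "\<And>j. j < N \<Longrightarrow> ((\<lambda>l. c l * e l (xg j)) has_sum g j) UNIV"
  shows "wn a b M s (\<lambda>l. D g l - c l) \<le> alias_const s * h ^ (s0 - s) * B"
proof (rule tendsto_upperbound)
  show "((\<lambda>A. wn a b M s (\<lambda>l. D (\<lambda>j. \<Sum>m\<in>A. c m * e m (xg j)) l - (if l \<in> A then c l else 0)))
      \<longlongrightarrow> wn a b M s (\<lambda>l. D g l - c l)) (finite_subsets_at_top UNIV)"
  proof (intro tendsto_wn tendsto_diff tendsto_dft)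
    show "((\<lambda>A. \<Sum>m\<in>A. c m * e m (xg j)) \<longlongrightarrow> g j) (finite_subsets_at_top UNIV)" if "j < N" for j
      using g[OF that] by (simp add: has_sum_def)
    show "((\<lambda>A. if l \<in> A then c l else 0) \<longlongrightarrow> c l) (finite_subsets_at_top UNIV)" for l
      by (rule tendsto_eventually, unfold eventually_finite_subsets_at_top, intro exI[of _ "{l}"]) simp
  qed simp
  have "eventually finite (finite_subsets_at_top (UNIV :: int set))"
    unfolding eventually_finite_subsets_at_top by blast
  then show "\<forall>\<^sub>F A in finite_subsets_at_top UNIV.
      wn a b M s (\<lambda>l. D (\<lambda>j. \<Sum>m\<in>A. c m * e m (xg j)) l - (if l \<in> A then c l else 0)) \<le> alias_const s * h ^ (s0 - s) * B"
  proof eventually_elim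
    case (elim A)
    have "alias_const s * h ^ (s0 - s) * wn a b A s0 c \<le> alias_const s * h ^ (s0 - s) * B"
      using h_pos by (intro mult_left_mono c elim) auto
    then show ?case using alias_bound_finite[OF elim s h1, of c] by linarith
  qed
qed simp

end

section \<open>From the grid to the interval: limits of discrete coefficients\<close>

context period begin

lemma riemann_sum_bound:
  fixes phi :: "real \<Rightarrow> complex"
  assumes phi: "continuous_on {a..b} phi" and N: "0 < N" and r: "0 \<le> r"
    and osc: "\<And>x y. x \<in> {a..b} \<Longrightarrow> y \<in> {a..b} \<Longrightarrow> \<bar>x - y\<bar> \<le> (b - a) / real N \<Longrightarrow> cmod (phi x - phi y) \<le> r"
  shows "cmod (integral {a..b} phi - of_real ((b - a) / real N) * (\<Sum>j<N. phi (gridx a b N j))) \<le> (b - a) * r"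
proof -
  let ?h = "(b - a) / real N" and ?x = "gridx a b N"
  have h: "0 < ?h" using ab N by simp
  have xk: "?x k = a + real k * ?h" for k by (simp add: gridx_def)
  have xb: "?x N = b" using N by (simp add: xk)
  have le: "?x k \<le> b" if "k \<le> N" for k
  proof -
    have "real k * ?h \<le> real N * ?h" using that h by (intro mult_right_mono) auto
    then show ?thesis using xb by (simp add: xk)
  qed
  have "cmod (integral {a..?x k} phi - of_real ?h * (\<Sum>j<k. phi (?x j))) \<le> real k * (?h * r)" if "k \<le> N" for k
    using that
  proof (induction k)
    case 0
    then show ?case by (simp add: xk)
  next
    case (Suc k)
    have s: "a \<le> ?x k" "?x k \<le> ?x (Suc k)" "?x (Suc k) \<le> b" "?x (Suc k) - ?x k = ?h"
    proof -
      have S: "?x (Suc k) = ?x k + ?h"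
        unfolding xk by (simp only: of_nat_Suc distrib_right mult_1_left add_ac)
      show "a \<le> ?x k" unfolding xk using h by (simp only: le_add_same_cancel1 mult_nonneg_nonneg of_nat_0_le_iff less_imp_le)
      show "?x k \<le> ?x (Suc k)" "?x (Suc k) \<le> b" "?x (Suc k) - ?x k = ?h"
        using S h le[OF Suc.prems] by linarith+
    qed
    have c: "continuous_on {?x k..?x (Suc k)} phi" using phi s by (auto intro: continuous_on_subset)
    have I1: "integral {a..?x k} phi + integral {?x k..?x (Suc k)} phi = integral {a..?x (Suc k)} phi"
      using s phi by (intro Henstock_Kurzweil_Integration.integral_combine integrable_continuous_real) (auto intro: continuous_on_subset)
    have "cmod (integral {?x k..?x (Suc k)} (\<lambda>x. phi x - phi (?x k))) \<le> r * (?x (Suc k) - ?x k)"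
      using s by (intro integral_bound osc continuous_intros c) auto
    then have b: "cmod (integral {?x k..?x (Suc k)} (\<lambda>x. phi x - phi (?x k))) \<le> ?h * r"
      unfolding s(4) by (simp only: mult.commute)
    have "integral {?x k..?x (Suc k)} (\<lambda>x. phi x - phi (?x k)) = integral {?x k..?x (Suc k)} phi - integral {?x k..?x (Suc k)} (\<lambda>x. phi (?x k))"
      by (intro integral_diff integrable_continuous_real c continuous_intros)
    also have "integral {?x k..?x (Suc k)} (\<lambda>x. phi (?x k)) = of_real ?h * phi (?x k)"
      using s by (simp only: integral_const_real s(4) content_real scaleR_conv_of_real)
    finally have eq: "integral {a..?x (Suc k)} phi - of_real ?h * (\<Sum>j<Suc k. phi (?x j))
        = (integral {a..?x k} phi - of_real ?h * (\<Sum>j<k. phi (?x j))) + integral {?x k..?x (Suc k)} (\<lambda>x. phi x - phi (?x k))"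
      unfolding I1[symmetric] sum.lessThan_Suc distrib_left by simp
    have "cmod (integral {a..?x (Suc k)} phi - of_real ?h * (\<Sum>j<Suc k. phi (?x j))) \<le> real k * (?h * r) + ?h * r"
      unfolding eq by (rule order_trans[OF norm_triangle_ineq add_mono[OF Suc.IH b]]) (use Suc.prems in simp)
    then show ?case by (simp only: of_nat_Suc distrib_right mult_1_left add.commute)
  qed
  from this[of N] show ?thesis using N by (simp add: xb)
qed

text \<open>The discrete coefficients are Riemann sums of the Fourier integral. Grid sizes
  \<open>2 * Suc n\<close> are even and positive, as \<open>grid\<close> demands.\<close>

lemma dft_tendsto_fcoef:
  assumes g: "continuous_on {a..b} g"
  shows "(\<lambda>n. dft a b (2 * Suc n) (\<lambda>j. g (gridx a b (2 * Suc n) j)) l) \<longlonglongrightarrow> fc g l"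
proof (rule LIMSEQ_I)
  fix r :: real assume r: "0 < r"
  let ?phi = "\<lambda>x. g x * e (- l) x"
  have phi: "continuous_on {a..b} ?phi" by (intro continuous_intros g)
  have "uniformly_continuous_on {a..b} ?phi" by (rule compact_uniformly_continuous[OF phi]) simp
  then obtain d where d0: "0 < d" "\<forall>y\<in>{a..b}. \<forall>x\<in>{a..b}. dist x y < d \<longrightarrow> dist (?phi x) (?phi y) < r / 2"
    unfolding uniformly_continuous_on_def using half_gt_zero[OF r] by blast
  then have d: "0 < d" "\<And>x y. x \<in> {a..b} \<Longrightarrow> y \<in> {a..b} \<Longrightarrow> \<bar>x - y\<bar> < d \<Longrightarrow> cmod (?phi x - ?phi y) < r / 2"
    by (auto simp: dist_norm)
  obtain n0 where n0: "(b - a) / d < real n0" using reals_Archimedean2 by blast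
  show "\<exists>no. \<forall>n\<ge>no. cmod (dft a b (2 * Suc n) (\<lambda>j. g (gridx a b (2 * Suc n) j)) l - fc g l) < r"
  proof (intro exI[of _ n0] allI impI)
    fix n assume "n0 \<le> n"
    let ?N = "2 * Suc n"
    have "(b - a) / d < real ?N" using n0 \<open>n0 \<le> n\<close> by simp
    then have hd: "(b - a) / real ?N < d" using d(1) by (simp add: divide_less_eq mult.commute)
    have "cmod (integral {a..b} ?phi - of_real ((b - a) / real ?N) * (\<Sum>j<?N. ?phi (gridx a b ?N j))) \<le> (b - a) * (r / 2)"
      by (rule riemann_sum_bound[OF phi]) (use r d(2) hd in \<open>auto intro!: less_imp_le\<close>)
    moreover have "integral {a..b} ?phi - of_real ((b - a) / real ?N) * (\<Sum>j<?N. ?phi (gridx a b ?N j))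
        = of_real (b - a) * (fc g l - dft a b ?N (\<lambda>j. g (gridx a b ?N j)) l)"
      using ab unfolding fcoef_ef dft_def by (simp add: ef_def right_diff_distrib)
    ultimately have "(b - a) * cmod (fc g l - dft a b ?N (\<lambda>j. g (gridx a b ?N j)) l) \<le> (b - a) * (r / 2)"
      using ab by (simp add: norm_mult del: of_real_diff)
    then have "cmod (fc g l - dft a b ?N (\<lambda>j. g (gridx a b ?N j)) l) \<le> r / 2" using ab by simp
    then show "cmod (dft a b ?N (\<lambda>j. g (gridx a b ?N j)) l - fc g l) < r" using r by (simp add: norm_minus_commute)
  qed
qed

text \<open>By passing to the limit in the discrete algebra
  inequality, whose constant does not depend on the number of grid points.\<close>

lemma wn_fnl_bound:
  assumes s: "1 \<le> s" and g: "continuous_on {a..b} g" and c: "\<And>A. finite A \<Longrightarrow> w A s (fc g) \<le> B"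
    and sum: "\<And>x. x \<in> {a..b} \<Longrightarrow> ((\<lambda>l. fc g l * e l x) has_sum g x) UNIV" and A: "finite A"
  shows "w A s (fc (\<lambda>x. fnl lam (g x))) \<le> \<bar>lam\<bar> * (grid.Kalg a b s)\<^sup>2 * ((1 + alias_const s) * B) ^ 3"
proof (rule tendsto_upperbound)
  let ?G = "\<lambda>n j. g (gridx a b (2 * Suc n) j)"
  have cf: "continuous_on {a..b} (\<lambda>x. fnl lam (g x))"
    unfolding fnl_def by (intro continuous_intros g)
  show "(\<lambda>n. w A s (dft a b (2 * Suc n) (\<lambda>j. fnl lam (?G n j)))) \<longlonglongrightarrow> w A s (fc (\<lambda>x. fnl lam (g x)))"
    unfolding wn_def L2_set_def using A by (intro tendsto_intros dft_tendsto_fcoef[OF cf])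
  obtain n1 where n1: "b - a < real n1" using reals_Archimedean2 by blast
  obtain n2 where n2: "A \<subseteq> {- int n2..int n2}"
  proof -
    have "\<forall>x\<in>A. \<bar>x\<bar> \<le> Max (insert 0 (abs ` A))" using A by auto
    then have "A \<subseteq> {- int (nat (Max (insert 0 (abs ` A))))..int (nat (Max (insert 0 (abs ` A))))}"
      by (force simp: abs_le_iff)
    then show ?thesis using that by blast
  qed
  show "\<forall>\<^sub>F n in sequentially. w A s (dft a b (2 * Suc n) (\<lambda>j. fnl lam (?G n j)))
      \<le> \<bar>lam\<bar> * (grid.Kalg a b s)\<^sup>2 * ((1 + alias_const s) * B) ^ 3"
    unfolding eventually_sequentially
  proof (intro exI[of _ "max n1 n2"] allI impI)
    \<comment> \<open>Beyond \<open>n1\<close> the mesh width is at most one, and beyond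
      \<open>n2\<close> the modes contain \<open>A\<close>.\<close>
    fix n assume n: "max n1 n2 \<le> n"
    interpret G: grid a b "2 * Suc n" by unfold_locales (use ab in auto)
    have "int (2 * Suc n) div 2 = int n + 1" by simp
    then have "G.M = {- int n - 1..int n}" by (simp add: modes_def)
    moreover have "{- int n2..int n2} \<subseteq> {- int n - 1..int n}" using n by auto
    ultimately have AM: "A \<subseteq> G.M" using n2 by blast
    have h1: "G.h \<le> 1" using n1 n ab by (simp add: divide_le_eq)
    \<comment> \<open>Aliasing between equal orders gives no decay, but a bound uniform in
      \<open>n\<close>, which is all that the limit requires.\<close>
    have "w G.M s (\<lambda>l. G.D (?G n) l - fc g l) \<le> alias_const s * G.h ^ (s - s) * B"
      by (rule G.alias_bound[OF c order_refl s h1]) (use sum G.xg_in in auto)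
    from wn_add[of a b G.M s "\<lambda>l. G.D (?G n) l - fc g l" "fc g"] this c[OF G.finite_modes]
    have gb: "w G.M s (G.D (?G n)) \<le> (1 + alias_const s) * B" by (simp add: algebra_simps)
    have K: "0 \<le> G.Kalg s" using s by (simp add: G.Kalg_def)
    let ?w = "\<lambda>v. w G.M s (G.D v)"
    have f: "fnl lam (?G n j) = of_real lam * (?G n j * (?G n j * cnj (?G n j)))" for j
      by (simp add: fnl_def complex_norm_square mult_ac flip: of_real_power)
    have "w A s (G.D (\<lambda>j. fnl lam (?G n j))) \<le> ?w (\<lambda>j. fnl lam (?G n j))"
      by (rule wn_mono_set[OF G.finite_modes AM])
    also have "\<dots> = \<bar>lam\<bar> * ?w (\<lambda>j. ?G n j * (?G n j * cnj (?G n j)))"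
      unfolding f G.dft_scale[abs_def] wn_scale by simp
    also have "\<dots> \<le> \<bar>lam\<bar> * (G.Kalg s * (?w (?G n) * (G.Kalg s * (?w (?G n) * ?w (?G n)))))"
      by (intro mult_left_mono order_trans[OF G.wn_dft_mult[OF s]]
          order_trans[OF G.wn_dft_mult[OF s, of "?G n" "\<lambda>j. cnj (?G n j)", unfolded G.wn_dft_cnj]] K) auto
    also have "\<dots> = \<bar>lam\<bar> * (G.Kalg s)\<^sup>2 * ?w (?G n) ^ 3"
      by (simp add: power2_eq_square power3_eq_cube mult_ac)
    also have "\<dots> \<le> \<bar>lam\<bar> * (G.Kalg s)\<^sup>2 * ((1 + alias_const s) * B) ^ 3"
      by (intro mult_left_mono power_mono gb) auto
    finally show "w A s (G.D (\<lambda>j. fnl lam (?G n j))) \<le> \<bar>lam\<bar> * (G.Kalg s)\<^sup>2 * ((1 + alias_const s) * B) ^ 3" .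
  qed
qed simp

end

section \<open>Time regularity of the exact solution\<close>

lemma has_sum_diff_complex:
  fixes f g :: "'a \<Rightarrow> complex"
  assumes "(f has_sum x) A" "(g has_sum y) A"
  shows "((\<lambda>l. f l - g l) has_sum (x - y)) A"
  using has_sum_add[OF assms(1) has_sum_cmult_right[OF assms(2), of "-1"]] by simp

text \<open>Derivatives of the modes are obtained from difference quotients in the form in which
  these occur in \<open>C1_Hp\<close>.\<close>

lemma has_vector_derivative_quotient:
  fixes f :: "real \<Rightarrow> complex"
  shows "(f has_vector_derivative D) (at t within S) \<longleftrightarrow>
    ((\<lambda>s. (f s - f t) / of_real (s - t)) \<longlongrightarrow> D) (at t within S)"
proof -
  have eq: "norm (f s - (f t + (s - t) *\<^sub>R D)) / \<bar>s - t\<bar> = norm ((f s - f t) / of_real (s - t) - D)"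
    if "s \<noteq> t" for s
  proof -
    have "(f s - f t) / of_real (s - t) - D = (f s - (f t + (s - t) *\<^sub>R D)) / of_real (s - t)"
      using that by (simp add: scaleR_conv_of_real divide_simps del: of_real_diff)
    then show ?thesis by (simp add: norm_mult norm_inverse divide_inverse mult.commute del: of_real_diff)
  qed
  have "(f has_vector_derivative D) (at t within S) \<longleftrightarrow>
      ((\<lambda>s. norm ((1 / norm (s - t)) *\<^sub>R (f s - (f t + (s - t) *\<^sub>R D)))) \<longlongrightarrow> 0) (at t within S)"
    unfolding has_vector_derivative_def has_derivative_within tendsto_norm_zero_iff
    by (simp add: bounded_linear_scaleR_left)
  also have "\<dots> \<longleftrightarrow> ((\<lambda>s. norm ((f s - f t) / of_real (s - t) - D)) \<longlongrightarrow> 0) (at t within S)"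
    by (rule filterlim_cong[OF refl refl]) (auto simp: eventually_at_filter eq simp del: of_real_diff)
  also have "\<dots> \<longleftrightarrow> ((\<lambda>s. (f s - f t) / of_real (s - t)) \<longlongrightarrow> D) (at t within S)"
    unfolding tendsto_norm_zero_iff by (rule Lim_null[symmetric])
  finally show ?thesis .
qed

context period begin

text \<open>A divergent \<open>infsum\<close> has the value 0, so \<open>Hnorm\<close> dominates the
  finite parts only if these are bounded. Any bound \<open>B\<close> will do; the lemma serves for
  difference quotients, whose membership in the Sobolev space has to be derived.\<close>

lemma wn_le_Hnorm':
  assumes "\<And>A. finite A \<Longrightarrow> w A m (fc phi) \<le> B" "finite A"
  shows "w A m (fc phi) \<le> Hnorm a b m phi"
proof -
  have fin: "(\<Sum>l\<in>A. (1 + (mu a b l)\<^sup>2) ^ m * (cmod (fc phi l))\<^sup>2) \<le> B\<^sup>2" if "finite A" for A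
    using power_mono[OF assms(1)[OF that] wn_nonneg, of 2] unfolding wn_sq wt_def .
  have "(\<lambda>l. (1 + (mu a b l)\<^sup>2) ^ m * (cmod (fc phi l))\<^sup>2) summable_on UNIV"
    by (rule nonneg_bdd_above_summable_on) (use fin in \<open>auto simp: bdd_above_def\<close>)
  then have "(w A m (fc phi))\<^sup>2 \<le> infsum (\<lambda>l. (1 + (mu a b l)\<^sup>2) ^ m * (cmod (fc phi l))\<^sup>2) UNIV"
    unfolding wn_sq wt_def by (rule finite_sum_le_infsum) (use assms in auto)
  then show ?thesis unfolding Hnorm_def by (intro real_le_rsqrt)
qed

lemma abs_integrable_e:
  assumes "phi absolutely_integrable_on {a..b}"
  shows "(\<lambda>x. phi x * e l x) integrable_on {a..b}"
proof -
  have "(\<lambda>x. (\<lambda>(c::complex) d. c * d) (e l x) (phi x)) absolutely_integrable_on {a..b}"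
  proof (rule absolutely_integrable_bounded_measurable_product[where h = "\<lambda>(c::complex) d. c * d" and f = "e l", OF _ _ _ _ assms])
    show "bilinear (\<lambda>(c::complex) d. c * d)"
      using bilinear_conv_bounded_bilinear bounded_bilinear_mult by blast
    show "e l \<in> borel_measurable (lebesgue_on {a..b})"
      by (rule continuous_imp_measurable_on_sets_lebesgue) (auto intro!: continuous_intros)
    show "bounded (e l ` {a..b})" by (rule boundedI[of _ 1]) auto
  qed simp
  then have "(\<lambda>x. e l x * phi x) absolutely_integrable_on {a..b}" by simp
  then show ?thesis by (simp add: set_lebesgue_integral_eq_integral(1) mult.commute)
qed

text \<open>Integration by parts for the gauge integral: \<open>f'\<close> is just a pointwise
  derivative, and integrability of its product with the exponential is part of the
  conclusion.\<close>

lemma fc_derivative: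
  assumes f: "\<And>x. x \<in> {a..b} \<Longrightarrow> (f has_vector_derivative f' x) (at x within {a..b})" and per: "f a = f b"
  shows "((\<lambda>x. f' x * e (- l) x) has_integral of_real (b - a) * (\<i> * of_real (mu a b l) * fc f l)) {a..b}"
    "fc f' l = \<i> * of_real (mu a b l) * fc f l"
proof -
  let ?c = "\<i> * complex_of_real (mu a b (- l))"
  have "((\<lambda>x. f x * (?c * e (- l) x) + f' x * e (- l) x) has_integral f b * e (- l) b - f a * e (- l) a) {a..b}"
    using ab f by (intro fundamental_theorem_of_calculus has_vector_derivative_mult ef_derivative) auto
  then have 1: "((\<lambda>x. f x * (?c * e (- l) x) + f' x * e (- l) x) has_integral 0) {a..b}"
    using per ef_endpoints[OF ab, of "- l"] by simp
  have cf: "continuous_on {a..b} f"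
    using f has_vector_derivative_continuous unfolding continuous_on_eq_continuous_within by blast
  have "((\<lambda>x. ?c * (f x * e (- l) x)) has_integral ?c * (of_real (b - a) * fc f l)) {a..b}"
    using has_integral_mult_right[OF integrable_integral[OF continuous_integrable[OF cf, of "- l"]], of ?c] ab
    unfolding fcoef_ef by simp
  from has_integral_diff[OF 1 this]
  show 2: "((\<lambda>x. f' x * e (- l) x) has_integral of_real (b - a) * (\<i> * of_real (mu a b l) * fc f l)) {a..b}"
    by (simp add: algebra_simps)
  show "fc f' l = \<i> * of_real (mu a b l) * fc f l"
    unfolding fcoef_ef[of a b f'] integral_unique[OF 2] using ab by simp
qed

end

locale kg_solution = period +
  fixes T lam eps C :: real and s0 :: nat and u ut utt ux uxx :: "real \<Rightarrow> real \<Rightarrow> complex"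
  assumes T: "0 < T" and eps: "0 < eps" and s0: "6 \<le> s0"
    and deriv_t: "\<And>x t. x \<in> {a..b} \<Longrightarrow> t \<in> {0..T} \<Longrightarrow>
        ((\<lambda>s. u x s) has_vector_derivative ut x t) (at t within {0..T}) \<and>
        ((\<lambda>s. ut x s) has_vector_derivative utt x t) (at t within {0..T})"
    and deriv_x: "\<And>x t. x \<in> {a..b} \<Longrightarrow> t \<in> {0..T} \<Longrightarrow>
        ((\<lambda>y. u y t) has_vector_derivative ux x t) (at x within {a..b}) \<and>
        ((\<lambda>y. ux y t) has_vector_derivative uxx x t) (at x within {a..b})"
    and pde: "\<And>x t. x \<in> {a<..<b} \<Longrightarrow> t \<in> {0<..T} \<Longrightarrow>
        complex_of_real (eps^2) * utt x t - uxx x t + u x t / complex_of_real (eps^2) + fnl lam (u x t) = 0"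
    and bc: "\<And>t. t \<in> {0..T} \<Longrightarrow> u a t = u b t \<and> ux a t = ux b t"
    and regA: "C1_Hp a b s0 T (\<lambda>t x. u x t) (\<lambda>t x. ut x t)"
    and boundA: "\<And>t s. t \<in> {0..T} \<Longrightarrow> s \<in> {0..T} \<Longrightarrow>
        Hnorm a b s0 (\<lambda>x. u x t) + eps^2 * Hnorm a b s0 (\<lambda>x. ut x s) \<le> C"
begin

definition U :: "int \<Rightarrow> real \<Rightarrow> complex" where "U l t = fc (\<lambda>x. u x t) l"
definition V :: "int \<Rightarrow> real \<Rightarrow> complex" where "V l t = fc (\<lambda>x. ut x t) l"
definition F :: "int \<Rightarrow> real \<Rightarrow> complex" where "F l t = fc (\<lambda>x. fnl lam (u x t)) l"

abbreviation cS :: real where "cS \<equiv> sqrt (1 + (b - a)\<^sup>2)"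

lemma in_H: "t \<in> {0..T} \<Longrightarrow> in_Hp a b s0 (\<lambda>x. u x t)" "t \<in> {0..T} \<Longrightarrow> in_Hp a b s0 (\<lambda>x. ut x t)"
  using regA by (auto simp: C1_Hp_def)

lemma wn_U_H: "t \<in> {0..T} \<Longrightarrow> finite A \<Longrightarrow> w A s0 (\<lambda>l. U l t) \<le> Hnorm a b s0 (\<lambda>x. u x t)"
  and wn_V_H: "t \<in> {0..T} \<Longrightarrow> finite A \<Longrightarrow> w A s0 (\<lambda>l. V l t) \<le> Hnorm a b s0 (\<lambda>x. ut x t)"
  unfolding U_def V_def using wn_le_Hnorm[OF in_H(1)] wn_le_Hnorm[OF in_H(2)] by auto

lemma H_bounds: "t \<in> {0..T} \<Longrightarrow> Hnorm a b s0 (\<lambda>x. u x t) \<le> C" "t \<in> {0..T} \<Longrightarrow> eps\<^sup>2 * Hnorm a b s0 (\<lambda>x. ut x t) \<le> C"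
proof -
  assume t: "t \<in> {0..T}"
  have "0 \<le> eps\<^sup>2 * Hnorm a b s0 (\<lambda>x. ut x t)" by (simp add: Hnorm_nonneg)
  then show "Hnorm a b s0 (\<lambda>x. u x t) \<le> C" "eps\<^sup>2 * Hnorm a b s0 (\<lambda>x. ut x t) \<le> C"
    using boundA[OF t t] Hnorm_nonneg[of s0 "\<lambda>x. u x t"] by linarith+
qed

lemma wn_U: "t \<in> {0..T} \<Longrightarrow> finite A \<Longrightarrow> w A s0 (\<lambda>l. U l t) \<le> C"
  using wn_U_H H_bounds(1) order_trans by blast

lemma wn_V: "t \<in> {0..T} \<Longrightarrow> finite A \<Longrightarrow> w A s0 (\<lambda>l. of_real (eps\<^sup>2) * V l t) \<le> C"
proof -
  assume t: "t \<in> {0..T}" "finite A"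
  have "w A s0 (\<lambda>l. of_real (eps\<^sup>2) * V l t) = eps\<^sup>2 * w A s0 (\<lambda>l. V l t)"
    unfolding wn_scale by (simp add: norm_power)
  also have "\<dots> \<le> eps\<^sup>2 * Hnorm a b s0 (\<lambda>x. ut x t)" by (intro mult_left_mono wn_V_H t) simp
  finally show ?thesis using H_bounds(2)[OF t(1)] by linarith
qed

lemma C_nonneg: "0 \<le> C"
proof -
  have "0 \<le> w {} s0 (\<lambda>l. U l 0)" by (rule wn_nonneg)
  also have "\<dots> \<le> C" by (rule wn_U) (use T in auto)
  finally show ?thesis .
qed

lemma u_cont: "t \<in> {0..T} \<Longrightarrow> continuous_on {a..b} (\<lambda>x. u x t)"
  and ux_cont: "t \<in> {0..T} \<Longrightarrow> continuous_on {a..b} (\<lambda>x. ux x t)"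
  unfolding continuous_on_eq_continuous_within
  using deriv_x has_vector_derivative_continuous by blast+

lemma s0_1: "1 \<le> s0" using s0 by simp

lemma u_series:
  assumes t: "t \<in> {0..T}" and x: "x \<in> {a..b}"
  shows "((\<lambda>l. U l t * e l x) has_sum u x t) UNIV"
  unfolding U_def
proof (rule fourier_inversion[OF u_cont[OF t] _ _ x])
  show "u a t = u b t" using bc[OF t] by simp
  show "(\<lambda>l. cmod (fc (\<lambda>x. u x t) l)) summable_on UNIV"
    using abs_summable_wn(1)[OF _ s0_1, of "\<lambda>l. U l t" C] wn_U[OF t] by (simp add: U_def)
qed

lemma wn_mu_U:
  assumes t: "t \<in> {0..T}" and A: "finite A"
  shows "w A 1 (\<lambda>l. of_real (mu a b l) * U l t) \<le> C" "w A 1 (\<lambda>l. of_real ((mu a b l)\<^sup>2) * U l t) \<le> C"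
proof -
  have m: "(mu a b l)\<^sup>2 \<le> wt a b l" for l by (simp add: wt_def)
  have "w A 1 (\<lambda>l. of_real (mu a b l) * U l t) \<le> 1 * w A 2 (\<lambda>l. U l t)"
    by (rule wn_mult) (use m in \<open>auto simp: power2_eq_square intro!: mult_right_mono\<close>)
  also have "\<dots> \<le> C" using wn_U[OF t A] wn_mono_exp[of 2 s0 a b A "\<lambda>l. U l t"] s0 by simp
  finally show "w A 1 (\<lambda>l. of_real (mu a b l) * U l t) \<le> C" .
  have "w A 1 (\<lambda>l. of_real ((mu a b l)\<^sup>2) * U l t) \<le> 1 * w A 3 (\<lambda>l. U l t)"
  proof (rule wn_mult)
    fix l
    have "(cmod (of_real ((mu a b l)\<^sup>2)))\<^sup>2 * wt a b l ^ 1 = ((mu a b l)\<^sup>2)\<^sup>2 * wt a b l" by (simp add: norm_power)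
    also have "\<dots> \<le> (wt a b l)\<^sup>2 * wt a b l" by (intro mult_right_mono power_mono m) auto
    finally show "(cmod (of_real ((mu a b l)\<^sup>2)))\<^sup>2 * wt a b l ^ 1 \<le> 1\<^sup>2 * wt a b l ^ 3"
      by (simp add: power2_eq_square power3_eq_cube)
  qed simp
  also have "\<dots> \<le> C" using wn_U[OF t A] wn_mono_exp[of 3 s0 a b A "\<lambda>l. U l t"] s0 by simp
  finally show "w A 1 (\<lambda>l. of_real ((mu a b l)\<^sup>2) * U l t) \<le> C" .
qed

lemma fc_ux: "t \<in> {0..T} \<Longrightarrow> fc (\<lambda>x. ux x t) l = \<i> * of_real (mu a b l) * U l t"
  unfolding U_def by (rule fc_derivative(2)) (use deriv_x bc in auto)

lemma uxx_integral: "t \<in> {0..T} \<Longrightarrow> ((\<lambda>x. uxx x t * e (- l) x) has_integral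
    of_real (b - a) * (- of_real ((mu a b l)\<^sup>2) * U l t)) {a..b}"
proof -
  assume t: "t \<in> {0..T}"
  have "((\<lambda>x. uxx x t * e (- l) x) has_integral
    of_real (b - a) * (\<i> * of_real (mu a b l) * fc (\<lambda>x. ux x t) l)) {a..b}"
    by (rule fc_derivative(1)) (use deriv_x bc t in auto)
  moreover have "\<i> * of_real (mu a b l) * fc (\<lambda>x. ux x t) l = - of_real ((mu a b l)\<^sup>2) * U l t"
    unfolding fc_ux[OF t] by (simp add: power2_eq_square algebra_simps)
  ultimately show ?thesis by simp
qed

lemma ux_series:
  assumes t: "t \<in> {0..T}" and x: "x \<in> {a..b}"
  shows "((\<lambda>l. \<i> * of_real (mu a b l) * U l t * e l x) has_sum ux x t) UNIV"
proof -
  have "((\<lambda>l. fc (\<lambda>x. ux x t) l * e l x) has_sum ux x t) UNIV"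
  proof (rule fourier_inversion[OF ux_cont[OF t] _ _ x])
    show "ux a t = ux b t" using bc[OF t] by simp
    have "(\<lambda>l. cmod (of_real (mu a b l) * U l t)) summable_on UNIV"
      by (rule abs_summable_wn(1)[OF wn_mu_U(1)[OF t]]) simp_all
    then show "(\<lambda>l. cmod (fc (\<lambda>x. ux x t) l)) summable_on UNIV"
      by (simp add: fc_ux[OF t] norm_mult)
  qed
  then show ?thesis by (simp add: fc_ux[OF t])
qed

lemma norm_has_sum_le:
  fixes f :: "int \<Rightarrow> complex"
  assumes "(f has_sum S) UNIV" "g summable_on UNIV" "\<And>l. cmod (f l) \<le> g l"
  shows "cmod S \<le> infsum g UNIV"
proof -
  have s: "(\<lambda>l. cmod (f l)) summable_on UNIV"
    by (rule summable_on_comparison_test[OF assms(2)]) (use assms(3) in auto)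
  have "cmod S = cmod (infsum f UNIV)" using assms(1) by (simp add: infsumI)
  also have "\<dots> \<le> infsum (\<lambda>l. cmod (f l)) UNIV" by (rule norm_infsum_bound[OF s])
  also have "\<dots> \<le> infsum g UNIV" by (rule infsum_mono[OF s assms(2)]) (use assms(3) in auto)
  finally show ?thesis .
qed

lemma u_bound: "t \<in> {0..T} \<Longrightarrow> x \<in> {a..b} \<Longrightarrow> cmod (u x t) \<le> cS * C"
proof -
  assume t: "t \<in> {0..T}" and x: "x \<in> {a..b}"
  have "cmod (u x t) \<le> infsum (\<lambda>l. cmod (U l t)) UNIV"
    by (rule norm_has_sum_le[OF u_series[OF t x] abs_summable_wn(1)[OF wn_U[OF t] s0_1]]) (simp_all add: norm_mult)
  also have "\<dots> \<le> cS * C" by (rule abs_summable_wn(2)[OF wn_U[OF t] s0_1])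
  finally show ?thesis .
qed

text \<open>The series of \<open>ux\<close> is Lipschitz in space, with the l1 norm of mu^2 U as its
  constant, and its difference quotients converge to \<open>uxx\<close>. The bound feeds the
  domination argument for \<open>utt\<close>.\<close>

lemma uxx_bound:
  assumes t: "t \<in> {0..T}" and x: "x \<in> {a..b}"
  shows "cmod (uxx x t) \<le> cS * C"
proof (rule tendsto_upperbound)
  have "((\<lambda>y. ux y t) has_vector_derivative uxx x t) (at x within {a..b})" using deriv_x[OF x t] by simp
  then show "((\<lambda>y. cmod ((ux y t - ux x t) / of_real (y - x))) \<longlongrightarrow> cmod (uxx x t)) (at x within {a..b})"
    unfolding has_vector_derivative_quotient by (rule tendsto_norm)
  show "at x within {a..b} \<noteq> bot"
    using x ab trivial_limit_within[of x "{a..b}"] by simp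
  let ?g = "\<lambda>l. cmod (of_real ((mu a b l)\<^sup>2) * U l t)"
  have gs: "?g summable_on UNIV" "infsum ?g UNIV \<le> cS * C"
    by (rule abs_summable_wn[OF wn_mu_U(2)[OF t]]; simp)+
  have "cmod ((ux y t - ux x t) / of_real (y - x)) \<le> cS * C" if y: "y \<in> {a..b}" "y \<noteq> x" for y
  proof -
    have "((\<lambda>l. \<i> * of_real (mu a b l) * U l t * e l y - \<i> * of_real (mu a b l) * U l t * e l x) has_sum (ux y t - ux x t)) UNIV"
      by (intro has_sum_diff_complex ux_series t x y)
    then have "cmod (ux y t - ux x t) \<le> infsum (\<lambda>l. ?g l * \<bar>y - x\<bar>) UNIV"
    proof (rule norm_has_sum_le)
      show "(\<lambda>l. ?g l * \<bar>y - x\<bar>) summable_on UNIV" by (rule summable_on_cmult_left[OF gs(1)])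
      fix l
      have "cmod (e l y - e l x) \<le> \<bar>mu a b l\<bar> * \<bar>y - x\<bar>"
        using ei_lipschitz[of "mu a b l * (y - a)" "mu a b l * (x - a)"]
        by (simp add: ef_def abs_mult[symmetric] right_diff_distrib)
      then have "\<bar>mu a b l\<bar> * cmod (U l t) * cmod (e l y - e l x) \<le> \<bar>mu a b l\<bar> * cmod (U l t) * (\<bar>mu a b l\<bar> * \<bar>y - x\<bar>)"
        by (intro mult_left_mono) auto
      moreover have "cmod (\<i> * of_real (mu a b l) * U l t * e l y - \<i> * of_real (mu a b l) * U l t * e l x)
          = \<bar>mu a b l\<bar> * cmod (U l t) * cmod (e l y - e l x)"
        unfolding right_diff_distrib[symmetric] by (simp add: norm_mult)
      moreover have "\<bar>mu a b l\<bar> * cmod (U l t) * (\<bar>mu a b l\<bar> * \<bar>y - x\<bar>) = ?g l * \<bar>y - x\<bar>"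
        by (simp add: norm_mult norm_power power2_eq_square)
      ultimately show "cmod (\<i> * of_real (mu a b l) * U l t * e l y - \<i> * of_real (mu a b l) * U l t * e l x) \<le> ?g l * \<bar>y - x\<bar>"
        by simp
    qed
    also have "\<dots> = infsum ?g UNIV * \<bar>y - x\<bar>" by (rule infsum_cmult_left) (use gs in simp)
    also have "\<dots> \<le> cS * C * \<bar>y - x\<bar>" by (intro mult_right_mono gs) simp
    finally show ?thesis using y(2) by (simp add: norm_divide pos_divide_le_eq del: of_real_diff)
  qed
  then show "\<forall>\<^sub>F y in at x within {a..b}. cmod ((ux y t - ux x t) / of_real (y - x)) \<le> cS * C"
    by (auto simp: eventually_at_filter)
qed

section \<open>Time derivatives of the Fourier modes\<close>

lemma e_integrable: "t \<in> {0..T} \<Longrightarrow> (\<lambda>x. u x t * e l x) integrable_on {a..b}"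
   "t \<in> {0..T} \<Longrightarrow> (\<lambda>x. ut x t * e l x) integrable_on {a..b}"
  using abs_integrable_e in_H unfolding in_Hp_def by auto

lemma fc_quot:
  assumes "s \<in> {0..T}" "t \<in> {0..T}"
  shows "fc (\<lambda>x. (u x s - u x t) / of_real (s - t) - ut x t) l = (U l s - U l t) / of_real (s - t) - V l t"
    "fc (\<lambda>x. ut x s - ut x t) l = V l s - V l t"
proof -
  have d: "(\<lambda>x. (u x s - u x t) * e l x) integrable_on {a..b}" for l
    unfolding left_diff_distrib by (intro integrable_diff e_integrable assms)
  have "fc (\<lambda>x. (1 / of_real (s - t)) * (u x s - u x t) - ut x t) l = fc (\<lambda>x. (1 / of_real (s - t)) * (u x s - u x t)) l - fc (\<lambda>x. ut x t) l"
    by (rule fc_diff) (simp_all only: mult.assoc integrable_on_mult_right[OF d] e_integrable assms)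
  also have "fc (\<lambda>x. (1 / of_real (s - t)) * (u x s - u x t)) l = (1 / of_real (s - t)) * (fc (\<lambda>x. u x s) l - fc (\<lambda>x. u x t) l)"
    unfolding fc_cmult by (subst fc_diff) (use e_integrable assms in auto)
  finally show "fc (\<lambda>x. (u x s - u x t) / of_real (s - t) - ut x t) l = (U l s - U l t) / of_real (s - t) - V l t"
    by (simp add: U_def V_def del: of_real_diff)
  show "fc (\<lambda>x. ut x s - ut x t) l = V l s - V l t"
    unfolding V_def by (rule fc_diff) (use e_integrable assms in auto)
qed

text \<open>The crude bounds through \<open>C\<close> may blow up as s approaches t; they only
  guarantee that the Sobolev norm on the right is a genuine one.\<close>

lemma wn_quot:
  assumes "s \<in> {0..T}" "t \<in> {0..T}" "finite A"
  shows "w A s0 (\<lambda>l. (U l s - U l t) / of_real (s - t) - V l t)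
      \<le> Hnorm a b s0 (\<lambda>x. (u x s - u x t) / of_real (s - t) - ut x t)"
    "w A s0 (\<lambda>l. V l s - V l t) \<le> Hnorm a b s0 (\<lambda>x. ut x s - ut x t)"
proof -
  have "w A s0 (fc (\<lambda>x. (u x s - u x t) / of_real (s - t) - ut x t))
      \<le> cmod (1 / of_real (s - t)) * (C + C) + Hnorm a b s0 (\<lambda>x. ut x t)" if "finite A" for A
  proof -
    have "w A s0 (\<lambda>l. (1 / of_real (s - t)) * (U l s - U l t) - V l t)
       \<le> cmod (1 / of_real (s - t)) * (C + C) + Hnorm a b s0 (\<lambda>x. ut x t)"
      by (intro order_trans[OF wn_diff] add_mono wn_V_H assms that, unfold wn_scale)
         (intro mult_left_mono order_trans[OF wn_diff] add_mono wn_U assms that norm_ge_zero)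
    then show ?thesis by (simp add: fc_quot(1)[OF assms(1,2), abs_def] del: of_real_diff)
  qed
  from wn_le_Hnorm'[OF this assms(3)]
  show "w A s0 (\<lambda>l. (U l s - U l t) / of_real (s - t) - V l t)
      \<le> Hnorm a b s0 (\<lambda>x. (u x s - u x t) / of_real (s - t) - ut x t)"
    by (simp add: fc_quot(1)[OF assms(1,2), abs_def] del: of_real_diff)
  have "w A s0 (fc (\<lambda>x. ut x s - ut x t)) \<le> Hnorm a b s0 (\<lambda>x. ut x s) + Hnorm a b s0 (\<lambda>x. ut x t)" if "finite A" for A
    unfolding fc_quot(2)[OF assms(1,2), abs_def]
    by (intro order_trans[OF wn_diff] add_mono wn_V_H assms that)
  from wn_le_Hnorm'[OF this assms(3)]
  show "w A s0 (\<lambda>l. V l s - V l t) \<le> Hnorm a b s0 (\<lambda>x. ut x s - ut x t)"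
    by (simp add: fc_quot(2)[OF assms(1,2), abs_def])
qed

lemma regA_lim:
  assumes t: "t \<in> {0..T}"
  shows "((\<lambda>s. Hnorm a b s0 (\<lambda>x. (u x s - u x t) / of_real (s - t) - ut x t)) \<longlongrightarrow> 0) (at t within {0..T})"
    "((\<lambda>s. Hnorm a b s0 (\<lambda>x. ut x s - ut x t)) \<longlongrightarrow> 0) (at t within {0..T})"
  using regA t unfolding C1_Hp_def by auto

lemma U_derivative: "t \<in> {0..T} \<Longrightarrow> (U l has_vector_derivative V l t) (at t within {0..T})"
  unfolding has_vector_derivative_quotient
proof (rule Lim_null[THEN iffD2], rule Lim_null_comparison)
  assume t: "t \<in> {0..T}"
  show "((\<lambda>s. Hnorm a b s0 (\<lambda>x. (u x s - u x t) / of_real (s - t) - ut x t)) \<longlongrightarrow> 0) (at t within {0..T})"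
    by (rule regA_lim(1)[OF t])
  have "cmod ((U l s - U l t) / of_real (s - t) - V l t) \<le> Hnorm a b s0 (\<lambda>x. (u x s - u x t) / of_real (s - t) - ut x t)" if "s \<in> {0..T}" for s
    using wn_member[of "{l}" l "\<lambda>l. (U l s - U l t) / of_real (s - t) - V l t" a b s0] wn_quot(1)[OF that t, of "{l}"] by simp
  then show "\<forall>\<^sub>F s in at t within {0..T}. norm ((U l s - U l t) / of_real (s - t) - V l t) \<le> Hnorm a b s0 (\<lambda>x. (u x s - u x t) / of_real (s - t) - ut x t)"
    by (auto simp: eventually_at_filter)
qed

lemma U_cont: "continuous_on {0..T} (U l)"
  unfolding continuous_on_eq_continuous_within using U_derivative has_vector_derivative_continuous by blast

lemma V_cont: "continuous_on {0..T} (V l)"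
  unfolding continuous_on_def
proof (intro ballI)
  fix t assume t: "t \<in> {0..T}"
  show "(V l \<longlongrightarrow> V l t) (at t within {0..T})"
  proof (rule Lim_null[THEN iffD2], rule Lim_null_comparison[OF _ regA_lim(2)[OF t]])
    have "cmod (V l s - V l t) \<le> Hnorm a b s0 (\<lambda>x. ut x s - ut x t)" if "s \<in> {0..T}" for s
      using wn_member[of "{l}" l "\<lambda>l. V l s - V l t" a b s0] wn_quot(2)[OF that t, of "{l}"] by simp
    then show "\<forall>\<^sub>F s in at t within {0..T}. norm (V l s - V l t) \<le> Hnorm a b s0 (\<lambda>x. ut x s - ut x t)"
      by (auto simp: eventually_at_filter)
  qed
qed

text \<open>Difference quotients of \<open>u\<close>
  converge in a Sobolev norm that controls the supremum norm.\<close>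

lemma ut_series:
  assumes t: "t \<in> {0..T}" and x: "x \<in> {a..b}"
  shows "((\<lambda>l. V l t * e l x) has_sum ut x t) UNIV"
proof -
  have sV: "(\<lambda>l. cmod (V l t)) summable_on UNIV"
    by (rule abs_summable_wn(1)[OF wn_V_H[OF t] s0_1])
  let ?S = "\<Sum>\<^sub>\<infinity>l. V l t * e l x"
  have S: "((\<lambda>l. V l t * e l x) has_sum ?S) UNIV" by (rule abs_series(1)[OF sV])
  have bd: "cmod ((u x s - u x t) / of_real (s - t) - ?S)
      \<le> cS * Hnorm a b s0 (\<lambda>x. (u x s - u x t) / of_real (s - t) - ut x t)" if s: "s \<in> {0..T}" for s
  proof -
    let ?c = "\<lambda>l. (U l s - U l t) / of_real (s - t) - V l t"
    have "((\<lambda>l. (1 / of_real (s - t)) * (U l s * e l x - U l t * e l x) - V l t * e l x) has_sum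
        ((1 / of_real (s - t)) * (u x s - u x t) - ?S)) UNIV"
      by (intro has_sum_diff_complex has_sum_cmult_right u_series s t x S)
    then have hs: "((\<lambda>l. ?c l * e l x) has_sum ((u x s - u x t) / of_real (s - t) - ?S)) UNIV"
    proof -
      have alg: "(1 / z) * (p * y - q * y) - v * y = ((p - q) / z - v) * y" for p q v y z :: complex
        by (simp add: algebra_simps diff_divide_distrib)
      assume "((\<lambda>l. (1 / of_real (s - t)) * (U l s * e l x - U l t * e l x) - V l t * e l x) has_sum
        ((1 / of_real (s - t)) * (u x s - u x t) - ?S)) UNIV"
      then show ?thesis unfolding alg by simp
    qed
    have gs: "(\<lambda>l. cmod (?c l)) summable_on UNIV"
      "infsum (\<lambda>l. cmod (?c l)) UNIV \<le> cS * Hnorm a b s0 (\<lambda>x. (u x s - u x t) / of_real (s - t) - ut x t)"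
      by (rule abs_summable_wn[OF wn_quot(1)[OF s t] s0_1]; assumption)+
    have "cmod ((u x s - u x t) / of_real (s - t) - ?S) \<le> infsum (\<lambda>l. cmod (?c l)) UNIV"
      by (rule norm_has_sum_le[OF hs gs(1)]) (simp add: norm_mult)
    then show ?thesis using gs(2) by linarith
  qed
  have "((\<lambda>s. (u x s - u x t) / of_real (s - t)) \<longlongrightarrow> ?S) (at t within {0..T})"
  proof (rule Lim_null[THEN iffD2], rule Lim_null_comparison)
    show "\<forall>\<^sub>F s in at t within {0..T}. norm ((u x s - u x t) / of_real (s - t) - ?S)
        \<le> cS * Hnorm a b s0 (\<lambda>x. (u x s - u x t) / of_real (s - t) - ut x t)"
      using bd by (auto simp: eventually_at_filter simp del: of_real_diff)
    show "((\<lambda>s. cS * Hnorm a b s0 (\<lambda>x. (u x s - u x t) / of_real (s - t) - ut x t)) \<longlongrightarrow> 0) (at t within {0..T})"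
      using tendsto_mult_right_zero[OF regA_lim(1)[OF t]] .
  qed
  moreover have "((\<lambda>s. (u x s - u x t) / of_real (s - t)) \<longlongrightarrow> ut x t) (at t within {0..T})"
    using deriv_t[OF x t] unfolding has_vector_derivative_quotient by simp
  moreover have "at t within {0..T} \<noteq> bot" using t T trivial_limit_within[of t "{0..T}"] by simp
  ultimately have "?S = ut x t" using tendsto_unique by blast
  then show ?thesis using S by simp
qed

lemma utt_eq: "x \<in> {a<..<b} \<Longrightarrow> t \<in> {0<..T} \<Longrightarrow>
    utt x t = of_real (1 / eps\<^sup>2) * (uxx x t - of_real (1 / eps\<^sup>2) * u x t - fnl lam (u x t))"
  using pde[of x t] eps by (simp add: field_simps)

text \<open>A dominating constant for \<open>utt\<close>, read off from the equation. It depends on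
  eps, which is harmless because it enters no error bound.\<close>

definition Mb :: real where
  "Mb = (1 / eps\<^sup>2) * (cS * C + (1 / eps\<^sup>2) * (cS * C) + \<bar>lam\<bar> * (cS * C) ^ 3)"

lemma utt_bound: "x \<in> {a<..<b} \<Longrightarrow> t \<in> {0<..T} \<Longrightarrow> cmod (utt x t) \<le> Mb"
proof -
  assume x: "x \<in> {a<..<b}" and t: "t \<in> {0<..T}"
  then have x': "x \<in> {a..b}" and t': "t \<in> {0..T}" by auto
  have f: "cmod (fnl lam (u x t)) \<le> \<bar>lam\<bar> * (cS * C) ^ 3"
  proof -
    have "cmod (fnl lam (u x t)) = \<bar>lam\<bar> * cmod (u x t) ^ 3"
      by (simp add: fnl_def norm_mult norm_power power2_eq_square power3_eq_cube)
    also have "\<dots> \<le> \<bar>lam\<bar> * (cS * C) ^ 3" by (intro mult_left_mono power_mono u_bound x' t') auto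
    finally show ?thesis .
  qed
  have "cmod (uxx x t - of_real (1 / eps\<^sup>2) * u x t - fnl lam (u x t)) \<le> cS * C + (1 / eps\<^sup>2) * (cS * C) + \<bar>lam\<bar> * (cS * C) ^ 3"
  proof (intro order_trans[OF norm_triangle_ineq4] add_mono f uxx_bound x' t')
    show "cmod (of_real (1 / eps\<^sup>2) * u x t) \<le> (1 / eps\<^sup>2) * (cS * C)"
      unfolding norm_mult norm_of_real using u_bound[OF t' x'] by (intro mult_mono) auto
  qed
  then show ?thesis
    unfolding utt_eq[OF x t] Mb_def norm_mult norm_of_real by (intro mult_mono) auto
qed

lemma ut_lipschitz:
  assumes x: "x \<in> {a<..<b}" and st: "s \<in> {0<..T}" "t \<in> {0<..T}"
  shows "cmod (ut x s - ut x t) \<le> Mb * \<bar>s - t\<bar>"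
proof -
  have *: "cmod (ut x s - ut x t) \<le> Mb * (s - t)" if "t \<le> s" "0 < t" "s \<le> T" for s t
  proof -
    have "((\<lambda>r. utt x r) has_integral (ut x s - ut x t)) {t..s}"
      using that x by (intro fundamental_theorem_of_calculus has_vector_derivative_within_subset[OF conjunct2[OF deriv_t]]) auto
    then have "((\<lambda>r. utt x r) has_integral (ut x s - ut x t)) (cbox t s)" by simp
    moreover have "0 \<le> Mb" using order_trans[OF norm_ge_zero utt_bound[OF x, of s]] that by simp
    moreover have "cmod (utt x r) \<le> Mb" if "r \<in> cbox t s" for r
      using that \<open>0 < t\<close> \<open>s \<le> T\<close> by (intro utt_bound x) auto
    ultimately have "cmod (ut x s - ut x t) \<le> Mb * measure lborel (cbox t s)"
      by (intro has_integral_bound[of Mb])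
    then show ?thesis using that by simp
  qed
  show ?thesis
  proof (cases "t \<le> s")
    case True
    then show ?thesis using *[of t s] st by simp
  next
    case False
    then show ?thesis using *[of s t] st by (simp add: norm_minus_commute)
  qed
qed

text \<open>Dominated convergence: the difference quotients of \<open>ut\<close> converge pointwise
  and are bounded by \<open>Mb\<close>, so differentiation passes under the integral. The equation
  then expresses the limit through \<open>U\<close> and \<open>F\<close>.\<close>

lemma V_derivative:
  assumes t: "t \<in> {0<..<T}"
  shows "(V l has_vector_derivative
     - of_real (1 / eps\<^sup>2) * (of_real ((mu a b l)\<^sup>2 + 1 / eps\<^sup>2) * U l t + F l t)) (at t)"
proof -
  have t': "t \<in> {0..T}" "t \<in> {0<..T}" using t by auto
  let ?k = "complex_of_real (1 / eps\<^sup>2)"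
  let ?R = "- ?k * (of_real ((mu a b l)\<^sup>2 + 1 / eps\<^sup>2) * U l t + F l t)"
  have "((\<lambda>s. (V l s - V l t) / of_real (s - t)) \<longlongrightarrow> ?R) (at t within {0<..<T})"
    unfolding tendsto_at_iff_sequentially
  proof (intro allI impI)
    fix X :: "nat \<Rightarrow> real" assume X: "\<forall>i. X i \<in> {0<..<T} - {t}" and Xt: "X \<longlonglongrightarrow> t"
    have X': "X i \<in> {0..T}" "X i \<in> {0<..T}" "X i \<noteq> t" for i using X by (auto simp: less_imp_le)
    let ?f = "\<lambda>i x. (1 / of_real (X i - t)) * (ut x (X i) * e (- l) x - ut x t * e (- l) x)"
    let ?g = "\<lambda>x. utt x t * e (- l) x"
    have int: "?f i integrable_on {a<..<b}" for i
      unfolding integrable_on_Icc_iff_Ioo[symmetric]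
      by (intro integrable_on_mult_right integrable_diff e_integrable X' t')
    have fi: "integral {a<..<b} (?f i) / of_real (b - a) = (V l (X i) - V l t) / of_real (X i - t)" for i
    proof -
      have "integral {a<..<b} (?f i) = (1 / of_real (X i - t)) * (integral {a..b} (\<lambda>x. ut x (X i) * e (- l) x) - integral {a..b} (\<lambda>x. ut x t * e (- l) x))"
        unfolding integral_mult_right integral_open_interval_real[symmetric]
        by (subst integral_diff) (use e_integrable X' t' in auto)
      then show ?thesis unfolding V_def fcoef_ef by (simp add: diff_divide_distrib del: of_real_diff) (simp add: field_simps)
    qed
    have "(\<lambda>i. integral {a<..<b} (?f i)) \<longlonglongrightarrow> integral {a<..<b} ?g"
    proof (rule dominated_convergence(2)[OF int, where h = "\<lambda>x. Mb"])
      show "(\<lambda>x. Mb) integrable_on {a<..<b}"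
        unfolding integrable_on_Icc_iff_Ioo[symmetric] by (rule integrable_const_ivl)
      fix i x assume x: "x \<in> {a<..<b}"
      have "cmod (?f i x) = cmod (ut x (X i) - ut x t) / \<bar>X i - t\<bar>"
        unfolding left_diff_distrib[symmetric] norm_mult norm_divide norm_of_real norm_one norm_ef by simp
      also have "\<dots> \<le> Mb"
        using ut_lipschitz[OF x X'(2)[of i] t'(2)] X'(3)[of i] by (simp add: pos_divide_le_eq)
      finally show "norm (?f i x) \<le> Mb" .
    next
      fix x assume x: "x \<in> {a<..<b}"
      have "((\<lambda>s. ut x s) has_vector_derivative utt x t) (at t within {0..T})" using deriv_t[of x t] x t' by simp
      then have "((\<lambda>s. (ut x s - ut x t) / of_real (s - t)) \<longlongrightarrow> utt x t) (at t within {0..T})"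
        unfolding has_vector_derivative_quotient .
      then have "((\<lambda>s. (ut x s - ut x t) / of_real (s - t)) \<circ> X) \<longlonglongrightarrow> utt x t"
        unfolding tendsto_at_iff_sequentially using X' Xt by simp
      from tendsto_mult_right[OF this, of "e (- l) x"]
      show "(\<lambda>i. ?f i x) \<longlonglongrightarrow> ?g x"
        by (simp add: o_def left_diff_distrib[symmetric] del: of_real_diff)
    qed
    then have "(\<lambda>i. integral {a<..<b} (?f i) / of_real (b - a)) \<longlonglongrightarrow> integral {a<..<b} ?g / of_real (b - a)"
      by (rule tendsto_divide) (use ab in auto)
    moreover have "integral {a<..<b} ?g / of_real (b - a) = ?R"
    proof -
      have uI: "((\<lambda>x. u x t * e (- l) x) has_integral of_real (b - a) * U l t) {a..b}"
        using integrable_integral[OF e_integrable(1)[OF t'(1), of "- l"]] ab unfolding U_def fcoef_ef by simp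
      have "continuous_on {a..b} (\<lambda>x. fnl lam (u x t))"
        unfolding fnl_def by (intro continuous_intros u_cont t')
      then have fI: "((\<lambda>x. fnl lam (u x t) * e (- l) x) has_integral of_real (b - a) * F l t) {a..b}"
        using integrable_integral[OF continuous_integrable[of "\<lambda>x. fnl lam (u x t)" "- l"]] ab unfolding F_def fcoef_ef by simp
      have alg: "k * (c * (- m * v) - k * (c * v) - c * f) = c * (- k * ((m + k) * v + f))" for k c m v f :: complex
        by (simp add: algebra_simps)
      have "((\<lambda>x. ?k * (uxx x t * e (- l) x - ?k * (u x t * e (- l) x) - fnl lam (u x t) * e (- l) x)) has_integral
          ?k * (of_real (b - a) * (- of_real ((mu a b l)\<^sup>2) * U l t) - ?k * (of_real (b - a) * U l t) - of_real (b - a) * F l t)) {a..b}"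
        by (intro has_integral_mult_right has_integral_diff uxx_integral uI fI t')
      then have "((\<lambda>x. ?k * (uxx x t * e (- l) x - ?k * (u x t * e (- l) x) - fnl lam (u x t) * e (- l) x)) has_integral
          of_real (b - a) * ?R) {a<..<b}"
        unfolding has_integral_Icc_iff_Ioo of_real_add by (rule has_integral_eq_rhs) (rule alg[symmetric])
      then have "(?g has_integral of_real (b - a) * ?R) {a<..<b}"
      proof (rule has_integral_eq[rotated])
        fix x assume x: "x \<in> {a<..<b}"
        show "?k * (uxx x t * e (- l) x - ?k * (u x t * e (- l) x) - fnl lam (u x t) * e (- l) x) = ?g x"
          unfolding utt_eq[OF x t'(2)] by (simp only: left_diff_distrib mult.assoc)
      qed
      then show ?thesis using ab by (simp add: integral_unique)
    qed
    ultimately show "((\<lambda>s. (V l s - V l t) / of_real (s - t)) \<circ> X) \<longlonglongrightarrow> ?R"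
      unfolding fi by (simp add: o_def)
  qed
  then have "(V l has_vector_derivative ?R) (at t within {0<..<T})"
    unfolding has_vector_derivative_quotient .
  then show ?thesis using at_within_open[OF t open_greaterThanLessThan] by simp
qed

end

section \<open>Error accumulation\<close>

lemma has_vector_derivative_shift_arg:
  assumes "(f has_vector_derivative D) (at (t + s))"
  shows "((\<lambda>r. f (t + r)) has_vector_derivative D) (at s)"
proof -
  have "((\<lambda>r. t + r) has_vector_derivative 1) (at s)"
    by (auto intro!: derivative_eq_intros)
  from vector_diff_chain_at[OF this assms] show ?thesis by (simp add: o_def)
qed

locale mti_kg = kg_solution a b T lam eps C s0 u ut utt ux uxx + mti_small a b N lam eps tau
  for a b T lam eps C :: real and s0 :: nat and u ut utt ux uxx :: "real \<Rightarrow> real \<Rightarrow> complex"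
    and N :: nat and tau :: real +
  assumes h1: "h \<le> 1"
begin

definition CF :: real where "CF = \<bar>lam\<bar> * (Kalg s0)\<^sup>2 * ((1 + alias_const s0) * C) ^ 3"
definition R :: real where "R = 1 + rho * (C + CF)"
text \<open>With s0 = m0 + 4 this is h^m0. Aliasing measured in orders up to 4 gains at least this
  power.\<close>

abbreviation hh :: real where "hh \<equiv> h ^ (s0 - 4)"
definition Bg :: real where "Bg = R + rho * alias_const 2 * C"
definition Keta :: real where
  "Keta = rho * alias_const 2 * CF + 3 * (Bg\<^sup>2 * (rho * alias_const 2 * C))"

lemma CF_nonneg: "0 \<le> CF" using C_nonneg by (simp add: CF_def)

lemma R_bounds: "1 \<le> R" "rho * C \<le> R" "rho * CF \<le> R"
proof -
  have "0 \<le> rho * C" "0 \<le> rho * CF" using C_nonneg CF_nonneg by simp_all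
  then show "1 \<le> R" "rho * C \<le> R" "rho * CF \<le> R" by (simp_all add: R_def distrib_left)
qed

lemma Keta_nonneg: "0 \<le> Keta" using C_nonneg CF_nonneg by (simp add: Keta_def)

lemma hh_pos: "0 < hh" using h_pos by simp

lemma h_power: "k \<ge> s0 - 4 \<Longrightarrow> h ^ k \<le> hh"
  using h1 h_pos by (intro power_decreasing) auto

lemma fnl_cont: "t \<in> {0..T} \<Longrightarrow> continuous_on {a..b} (\<lambda>x. fnl lam (u x t))"
  unfolding fnl_def by (intro continuous_intros u_cont)

lemma wn_F: "t \<in> {0..T} \<Longrightarrow> finite A \<Longrightarrow> w A s0 (\<lambda>l. F l t) \<le> CF"
  unfolding F_def CF_def
  by (rule wn_fnl_bound[OF s0_1 u_cont]) (use wn_U u_series in \<open>simp_all add: U_def\<close>)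

lemma F_series:
  assumes t: "t \<in> {0..T}" and x: "x \<in> {a..b}"
  shows "((\<lambda>l. F l t * e l x) has_sum fnl lam (u x t)) UNIV"
  unfolding F_def
proof (rule fourier_inversion[OF fnl_cont[OF t] _ _ x])
  show "fnl lam (u a t) = fnl lam (u b t)" using bc[OF t] by simp
  show "(\<lambda>l. cmod (fc (\<lambda>x. fnl lam (u x t)) l)) summable_on UNIV"
    using abs_summable_wn(1)[OF wn_F[OF t] s0_1] by (simp add: F_def)
qed

lemma cn_le:
  assumes "\<And>A. finite A \<Longrightarrow> w A s0 c \<le> B" "s \<le> s0"
  shows "cn s c \<le> rho * B"
  unfolding cn_def using wn_mono_exp[OF assms(2), of a b M c] assms(1)[OF finite_modes]
  by (intro mult_left_mono) auto

lemma cn_U: "t \<in> {0..T} \<Longrightarrow> s \<le> s0 \<Longrightarrow> cn s (\<lambda>l. U l t) \<le> rho * C"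
  and cn_V: "t \<in> {0..T} \<Longrightarrow> s \<le> s0 \<Longrightarrow> cn s (\<lambda>l. of_real (eps\<^sup>2) * V l t) \<le> rho * C"
  and cn_F: "t \<in> {0..T} \<Longrightarrow> s \<le> s0 \<Longrightarrow> cn s (\<lambda>l. F l t) \<le> rho * CF"
  by (rule cn_le; use wn_U wn_V wn_F in blast)+

lemma alias_cn:
  assumes "\<And>A. finite A \<Longrightarrow> w A s0 c \<le> B" "s \<le> 4"
    "\<And>x. x \<in> {a..b} \<Longrightarrow> ((\<lambda>l. c l * e l x) has_sum g x) UNIV"
  shows "cn s (\<lambda>l. D (\<lambda>j. g (xg j)) l - c l) \<le> rho * alias_const s * B * hh"
proof -
  have s: "s \<le> s0" using s0 assms(2) by simp
  have B: "0 \<le> B" using assms(1)[of "{}"] order_trans[OF wn_nonneg] by blast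
  have "cn s (\<lambda>l. D (\<lambda>j. g (xg j)) l - c l) \<le> rho * (alias_const s * h ^ (s0 - s) * B)"
    unfolding cn_def
    by (intro mult_left_mono alias_bound[OF assms(1) s s0_1 h1]) (use assms(3) xg_in in auto)
  also have "\<dots> \<le> rho * (alias_const s * hh * B)"
    using assms(2) B by (intro mult_left_mono mult_right_mono h_power) auto
  finally show ?thesis by (simp add: mult_ac)
qed

text \<open>The modes of f(u) differ from the grid nonlinearity of the truncated solution for two
  reasons, which are the summands of \<open>Keta\<close>: aliasing of f(u) itself, and the Lipschitz
  image of the aliasing error of u.\<close>

lemma consistency:
  assumes t: "t \<in> {0..T}"
  shows "cn 2 (\<lambda>l. F l t - D (fN lam (ID (\<lambda>l. U l t))) l) \<le> Keta * hh"
proof -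
  let ?g = "\<lambda>j. u (xg j) t" and ?U = "ID (\<lambda>l. U l t)" and ?d = "rho * alias_const 2 * C * hh"
  have DU: "D ?U l = U l t" if "l \<in> M" for l by (rule dft_idft[OF that])
  have d: "nm 2 (\<lambda>j. ?g j - ?U j) \<le> ?d"
  proof -
    have "nm 2 (\<lambda>j. ?g j - ?U j) = cn 2 (\<lambda>l. D ?g l - U l t)"
      unfolding nm_def by (rule cn_cong) (simp add: dft_diff DU)
    also have "\<dots> \<le> ?d" by (rule alias_cn) (use t wn_U u_series in auto)
    finally show ?thesis .
  qed
  have hh1: "hh \<le> 1" using h1 h_pos by (intro power_le_one) auto
  have RC: "0 \<le> rho * alias_const 2 * C" using C_nonneg by simp
  have U: "nm 2 ?U \<le> R"
    unfolding nm_idft using cn_U[OF t, of 2] s0 R_bounds(2) by simp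
  have "nm 2 (\<lambda>j. (?g j - ?U j) + ?U j) \<le> ?d + R"
    by (rule order_trans[OF n2.nm_add add_mono[OF d U]])
  then have "nm 2 ?g \<le> ?d + R" by simp
  moreover have "?d \<le> rho * alias_const 2 * C" by (rule mult_left_le[OF hh1 RC])
  ultimately have g: "nm 2 ?g \<le> Bg" unfolding Bg_def by linarith
  have "n2.close Bg ?d ?g ?U"
    unfolding n2.close_def using g d U RC unfolding Bg_def by linarith
  from n2.close_fN[OF this] have f: "nm 2 (\<lambda>j. fN lam ?g j - fN lam ?U j) \<le> 3 * (Bg\<^sup>2 * ?d)"
    unfolding n2.close_def by blast
  have "cn 2 (\<lambda>l. F l t - D (fN lam ?U) l) = cn 2 (\<lambda>l. D (\<lambda>j. fN lam ?g j - fN lam ?U j) l - (D (\<lambda>j. fnl lam (u (xg j) t)) l - F l t))"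
    by (rule cn_cong) (simp add: dft_diff fN_def[abs_def])
  also have "\<dots> \<le> 3 * (Bg\<^sup>2 * ?d) + rho * alias_const 2 * CF * hh"
    by (intro cn_diff_le f[unfolded nm_def] alias_cn) (use t wn_F F_series in auto)
  also have "\<dots> = Keta * hh" unfolding Keta_def by (simp only: algebra_simps)
  finally show ?thesis .
qed

lemma exact_step:
  assumes t: "0 \<le> t" "t + tau \<le> T"
  shows "mti_exact a b N lam eps tau (\<lambda>l s. U l (t + s)) (\<lambda>l s. V l (t + s)) (\<lambda>l s. F l (t + s)) R (Keta * hh)"
proof
  show "1 \<le> R" by (rule R_bounds)
  show "0 \<le> Keta * hh" using Keta_nonneg hh_pos by (intro mult_nonneg_nonneg) auto
  have ts: "t + s \<in> {0..T}" if "s \<in> {0..tau}" for s using that t by auto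
  fix l :: int and s :: real
  have sub: "(\<lambda>s. t + s) ` {0..tau} \<subseteq> {0..T}" using ts by blast
  show "continuous_on {0..tau} (\<lambda>s. U l (t + s))" "continuous_on {0..tau} (\<lambda>s. V l (t + s))"
    by (rule continuous_on_compose2[OF _ _ sub]; intro U_cont V_cont continuous_intros)+
  { assume s: "s \<in> {0<..<tau}"
    then have ts': "t + s \<in> {0<..<T}" using t by auto
    show "((\<lambda>s. V l (t + s)) has_vector_derivative
       - of_real kap * (of_real ((mu a b l)\<^sup>2 + kap) * U l (t + s) + F l (t + s))) (at s)"
      unfolding kap_def by (rule has_vector_derivative_shift_arg[OF V_derivative[OF ts']])
    have "(U l has_vector_derivative V l (t + s)) (at (t + s) within {0<..<T})"
      by (rule has_vector_derivative_within_subset[OF U_derivative]) (use ts' in auto)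
    then show "((\<lambda>s. U l (t + s)) has_vector_derivative V l (t + s)) (at s)"
      using has_vector_derivative_shift_arg at_within_open[OF ts' open_greaterThanLessThan] by metis }
  assume s: "s \<in> {0..tau}"
  show "cn 6 (\<lambda>l. U l (t + s)) \<le> R" "cn 6 (\<lambda>l. of_real (eps\<^sup>2) * V l (t + s)) \<le> R" "cn 4 (\<lambda>l. F l (t + s)) \<le> R"
    using cn_U[OF ts[OF s], of 6] cn_V[OF ts[OF s], of 6] cn_F[OF ts[OF s], of 4] R_bounds s0 by linarith+
  show "cn 2 (\<lambda>l. F l (t + s) - D (fN lam (ID (\<lambda>l. U l (t + s)))) l) \<le> Keta * hh"
    by (rule consistency[OF ts[OF s]])
qed

text \<open>The constants of the two local bounds are added, so that either of them is covered;
  \<open>2 + Keta\<close> absorbs the aliasing defect and the factor 2 from comparing the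
  regimes.\<close>

definition KL :: real where
  "KL = ((2 + 1648 * R ^ 5 + 81 * (B1c R)\<^sup>2 * R ^ 9) + (2 + 360 * R ^ 5 + cW1 R)) * (2 + Keta)"
abbreviation tm :: real where "tm \<equiv> min (tau\<^sup>2 / eps\<^sup>2) (tau\<^sup>2 + eps\<^sup>2)"
abbreviation delta :: real where "delta \<equiv> hh + tm"
abbreviation gU :: "real \<Rightarrow> nat \<Rightarrow> complex" where "gU t \<equiv> ID (\<lambda>l. U l t)"
abbreviation gV :: "real \<Rightarrow> nat \<Rightarrow> complex" where "gV t \<equiv> ID (\<lambda>l. V l t)"

lemma delta_pos: "0 \<le> tm" "0 < delta"
proof -
  show "0 \<le> tm" by simp
  with hh_pos show "0 < delta" by linarith
qed

lemma KL_nonneg: "0 \<le> cW1 R" "0 \<le> KL"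
proof -
  have B: "0 \<le> B1c R" using R_bounds(1) unfolding B1c_def by (intro add_nonneg_nonneg mult_nonneg_nonneg zero_le_power) auto
  have R: "0 \<le> R" using R_bounds(1) by linarith
  have "cW1 R = 3 * (B1c R)\<^sup>2 * (66 * R ^ 9) + (3 * B1c R * (70 * R ^ 9)\<^sup>2 + (70 * R ^ 9) ^ 3)
     + 6 * B1c R * (4 * R ^ 3) * (198 * R ^ 9)" by (simp only: cW1_def)
  also have "0 \<le> \<dots>" using B R
    by (intro add_nonneg_nonneg mult_nonneg_nonneg zero_le_power) auto
  finally show c: "0 \<le> cW1 R" .
  show "0 \<le> KL" unfolding KL_def using c B R Keta_nonneg
    by (intro mult_nonneg_nonneg add_nonneg_nonneg zero_le_power) auto
qed

lemma local_error:
  assumes t: "0 \<le> t" "t + tau \<le> T"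
  shows "en (\<lambda>j. gU (t + tau) j - (V1 (gU t) (gV t) j + R1 (gU t) (gV t) j))
      (\<lambda>j. gV (t + tau) j - UD1 (gU t) (gV t) j) \<le> tau * (KL * delta)" (is "?E \<le> _")
proof -
  interpret E: mti_exact a b N lam eps tau "\<lambda>l s. U l (t + s)" "\<lambda>l s. V l (t + s)" "\<lambda>l s. F l (t + s)" R "Keta * hh"
    by (rule exact_step[OF t])
  define c1 where "c1 = 2 + 1648 * R ^ 5 + 81 * (B1c R)\<^sup>2 * R ^ 9"
  define c2 where "c2 = 2 + 360 * R ^ 5 + cW1 R"
  have R0: "0 \<le> R ^ 5" "0 \<le> R ^ 9" using R_bounds(1) by (simp_all add: zero_le_power)
  have c0: "0 \<le> c1" "0 \<le> c2"
    unfolding c1_def c2_def using R0 KL_nonneg(1)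
    by (intro add_nonneg_nonneg mult_nonneg_nonneg; simp)+
  have 1: "?E \<le> tau * (c1 * (tau\<^sup>2 + eps\<^sup>2 + Keta * hh))"
    using E.local_error_uniform unfolding E.gu_def E.gv_def E.sig_def c1_def by simp
  have 2: "?E \<le> tau * (c2 * (Keta * hh + kap * tau\<^sup>2))" if "kap * tau \<le> 1"
    using E.local_error_small_step[OF that] unfolding E.gu_def E.gv_def c2_def by simp
  have kt: "kap * tau\<^sup>2 = tau\<^sup>2 / eps\<^sup>2" by (simp add: kap_def)
  let ?X = "Keta * hh + 2 * tm"
  have X0: "0 \<le> ?X" using Keta_nonneg hh_pos delta_pos(1) by (intro add_nonneg_nonneg mult_nonneg_nonneg) auto
  have "?E \<le> tau * ((c1 + c2) * ?X)"
  proof (cases "tau\<^sup>2 / eps\<^sup>2 \<le> tau\<^sup>2 + eps\<^sup>2 \<and> kap * tau \<le> 1")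
    case True
    have "?E \<le> tau * (c2 * ?X)"
    proof (rule order_trans[OF 2])
      show "kap * tau \<le> 1" using True by simp
      have "tau\<^sup>2 / eps\<^sup>2 = tm" using True by simp
      then have "Keta * hh + kap * tau\<^sup>2 \<le> ?X" using delta_pos(1) unfolding kt by linarith
      then show "tau * (c2 * (Keta * hh + kap * tau\<^sup>2)) \<le> tau * (c2 * ?X)"
        using c0 tau by (intro mult_left_mono) auto
    qed
    also have "\<dots> \<le> tau * ((c1 + c2) * ?X)"
      using c0 X0 tau by (intro mult_left_mono mult_right_mono) auto
    finally show ?thesis .
  next
    case False
    have "tau\<^sup>2 + eps\<^sup>2 \<le> 2 * tm"
    proof (cases "tau\<^sup>2 / eps\<^sup>2 \<le> tau\<^sup>2 + eps\<^sup>2")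
      case True
      with False have kt1: "1 < kap * tau" by auto
      then have "eps\<^sup>2 < tau" using eps by (simp add: kap_def pos_less_divide_eq)
      then have "eps\<^sup>2 * eps\<^sup>2 \<le> tau * tau" using tau by (intro mult_mono) auto
      then have "eps\<^sup>2 \<le> tau\<^sup>2 / eps\<^sup>2" using eps by (simp add: pos_le_divide_eq power2_eq_square)
      moreover have "tau\<^sup>2 \<le> tau\<^sup>2 / eps\<^sup>2" using eps eps2_le_1 mult_left_le[OF eps2_le_1, of "tau\<^sup>2"] by (simp add: pos_le_divide_eq)
      ultimately show ?thesis using True by simp
    qed simp
    then have "tau\<^sup>2 + eps\<^sup>2 + Keta * hh \<le> ?X" by simp
    then have "?E \<le> tau * (c1 * ?X)" using c0 tau by (intro order_trans[OF 1] mult_left_mono) auto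
    also have "\<dots> \<le> tau * ((c1 + c2) * ?X)"
      using c0 X0 tau by (intro mult_left_mono mult_right_mono) auto
    finally show ?thesis .
  qed
  also have "\<dots> \<le> tau * ((c1 + c2) * ((2 + Keta) * delta))"
  proof -
    have "0 \<le> Keta * tm" "0 \<le> hh" using Keta_nonneg delta_pos(1) hh_pos by (simp_all add: less_imp_le)
    then have "?X \<le> (2 + Keta) * delta" by (simp add: distrib_left distrib_right)
    then show ?thesis using c0 tau by (intro mult_left_mono) auto
  qed
  also have "\<dots> = tau * (KL * delta)" unfolding c1_def c2_def KL_def by (simp only: mult.assoc)
  finally show ?thesis .
qed

end

section \<open>Accumulation over all steps\<close>

context mti_small begin

lemma en_cong:
  assumes "\<And>j. j < N \<Longrightarrow> x j = x' j" "\<And>j. j < N \<Longrightarrow> y j = y' j"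
  shows "en x y = en x' y'"
  unfolding en_def using dft_cong[of x x'] dft_cong[of y y'] assms by simp

lemma en_triangle:
  "en (\<lambda>j. x j - z j) (\<lambda>j. y j - w' j) \<le> en (\<lambda>j. x j - x' j) (\<lambda>j. y j - y' j) + en (\<lambda>j. x' j - z j) (\<lambda>j. y' j - w' j)"
proof -
  have "en (\<lambda>j. x j - z j) (\<lambda>j. y j - w' j)
      = ec (\<lambda>l. of_real (rt l) * D (\<lambda>j. x j - x' j) l - (- (of_real (rt l) * D (\<lambda>j. x' j - z j) l)))
          (\<lambda>l. of_real (eps\<^sup>2) * D (\<lambda>j. y j - y' j) l - (- (of_real (eps\<^sup>2) * D (\<lambda>j. y' j - w' j) l)))"
    unfolding en_def by (simp add: dft_diff right_diff_distrib)
  also have "\<dots> \<le> en (\<lambda>j. x j - x' j) (\<lambda>j. y j - y' j) + en (\<lambda>j. x' j - z j) (\<lambda>j. y' j - w' j)"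
    by (rule order_trans[OF ec_diff]) (simp add: en_def ec_def)
  finally show ?thesis .
qed

end

text \<open>The iterates enter as an abstract sequence, so the constants below refer to the
  parameters of the solution and not to the initial functions.\<close>

locale mti_run = mti_kg +
  fixes Z :: "nat \<Rightarrow> (nat \<Rightarrow> complex) \<times> (nat \<Rightarrow> complex)"
  assumes Z0: "j < N \<Longrightarrow> fst (Z 0) j = u (xg j) 0 \<and> snd (Z 0) j = ut (xg j) 0"
    and ZS: "Z (Suc n) = mti_step lam a b N eps tau (Z n)"
begin

definition K0 :: real where "K0 = rho * alias_const 3 * C + rho * alias_const 2 * C"
definition Ks :: real where "Ks = stab_const (R + 1)"
text \<open>The Gronwall constant: initial aliasing and accumulated local errors, amplified by exp
  (Ks T). The summand 1 lets the final choice of step sizes divide by it.\<close>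

definition Kf :: real where "Kf = 1 + exp (Ks * T) * (K0 + T * KL)"

definition err :: "nat \<Rightarrow> real" where
  "err n = en (\<lambda>j. gU (real n * tau) j - fst (Z n) j) (\<lambda>j. gV (real n * tau) j - snd (Z n) j)"

lemma K_nonneg: "0 \<le> K0" "0 \<le> Ks" "1 \<le> Kf"
proof -
  show k: "0 \<le> K0" using C_nonneg by (simp add: K0_def)
  show "0 \<le> Ks" unfolding Ks_def using R_bounds(1) by (intro stab_const_nonneg) simp
  have "0 \<le> T * KL" using T KL_nonneg(2) by simp
  then show "1 \<le> Kf" unfolding Kf_def using k by simp
qed

text \<open>The weight \<open>rt\<close> on the position costs one derivative, hence aliasing in
  H^3; for the velocity, eps^2 \<open>ut\<close> is sampled in H^2.\<close>

lemma err_0: "err 0 \<le> K0 * hh"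
proof -
  let ?x = "\<lambda>j. u (xg j) 0" and ?y = "\<lambda>j. ut (xg j) 0"
  have t: "0 \<in> {0..T}" using T by simp
  have "err 0 = en (\<lambda>j. gU 0 j - ?x j) (\<lambda>j. gV 0 j - ?y j)"
    unfolding err_def by (rule en_cong) (use Z0 in auto)
  also have "\<dots> \<le> cn 2 (\<lambda>l. of_real (rt l) * D (\<lambda>j. gU 0 j - ?x j) l) + cn 2 (\<lambda>l. of_real (eps\<^sup>2) * D (\<lambda>j. gV 0 j - ?y j) l)"
    unfolding en_def by (rule ec_le_add)
  also have "\<dots> \<le> rho * alias_const 3 * C * hh + rho * alias_const 2 * C * hh"
  proof (rule add_mono)
    have "cn 2 (\<lambda>l. of_real (rt l) * D (\<lambda>j. gU 0 j - ?x j) l) \<le> 1 * cn 3 (\<lambda>l. D (\<lambda>j. gU 0 j - ?x j) l)"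
      by (rule cn_mult_rt) (simp_all add: rt_def)
    also have "cn 3 (\<lambda>l. D (\<lambda>j. gU 0 j - ?x j) l) = cn 3 (\<lambda>l. - (D ?x l - U l 0))"
      by (rule cn_cong) (simp add: dft_diff dft_idft)
    also have "\<dots> \<le> rho * alias_const 3 * C * hh"
      unfolding cn_minus by (rule alias_cn) (use t wn_U u_series in auto)
    finally show "cn 2 (\<lambda>l. of_real (rt l) * D (\<lambda>j. gU 0 j - ?x j) l) \<le> rho * alias_const 3 * C * hh" by simp
    have "cn 2 (\<lambda>l. of_real (eps\<^sup>2) * D (\<lambda>j. gV 0 j - ?y j) l)
        = cn 2 (\<lambda>l. - (D (\<lambda>j. of_real (eps\<^sup>2) * ?y j) l - of_real (eps\<^sup>2) * V l 0))"
      by (rule cn_cong) (simp add: dft_diff dft_idft dft_scale right_diff_distrib)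
    also have "\<dots> \<le> rho * alias_const 2 * C * hh"
      unfolding cn_minus
    proof (rule alias_cn)
      fix x assume "x \<in> {a..b}"
      from has_sum_cmult_right[OF ut_series[OF t this], of "of_real (eps\<^sup>2)"]
      show "((\<lambda>l. of_real (eps\<^sup>2) * V l 0 * e l x) has_sum of_real (eps\<^sup>2) * ut x 0) UNIV" by (simp add: mult.assoc)
    qed (use t wn_V in auto)
    finally show "cn 2 (\<lambda>l. of_real (eps\<^sup>2) * D (\<lambda>j. gV 0 j - ?y j) l) \<le> rho * alias_const 2 * C * hh" .
  qed
  also have "\<dots> = K0 * hh" by (simp add: K0_def distrib_right)
  finally show ?thesis .
qed

text \<open>An error of at most one keeps the iterate in the ball of radius \<open>R + 1\<close>, on
  which \<open>stability\<close> holds with the rate \<open>Ks\<close>.\<close>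

lemma err_Suc:
  assumes n: "real (Suc n) * tau \<le> T" and e1: "err n \<le> 1"
  shows "err (Suc n) \<le> tau * (KL * delta) + (1 + Ks * tau) * err n"
proof -
  let ?t = "real n * tau"
  have t: "0 \<le> ?t" "?t + tau \<le> T" "?t \<in> {0..T}" using n tau by (auto simp: algebra_simps)
  have t1: "real (Suc n) * tau = ?t + tau" by (simp add: algebra_simps)
  let ?X = "fst (Z n)" and ?Y = "snd (Z n)"
  have B: "1 \<le> R + 1" using R_bounds(1) by simp
  have gu: "nm 2 (gU ?t) \<le> R" unfolding nm_idft using cn_U[OF t(3), of 2] R_bounds(2) s0 by linarith
  have gv: "nm 2 (\<lambda>j. of_real (eps\<^sup>2) * gV ?t j) \<le> R"
  proof -
    have "nm 2 (\<lambda>j. of_real (eps\<^sup>2) * gV ?t j) = cn 2 (\<lambda>l. of_real (eps\<^sup>2) * V l ?t)"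
      unfolding nm_def by (rule cn_cong) (simp add: dft_scale dft_idft)
    then show ?thesis using cn_V[OF t(3), of 2] R_bounds(2) s0 by linarith
  qed
  have x: "nm 2 ?X \<le> R + 1"
  proof -
    have "nm 2 (\<lambda>j. gU ?t j - (gU ?t j - ?X j)) \<le> R + 1"
      using gu en_ge(1)[of "\<lambda>j. gU ?t j - ?X j" "\<lambda>j. gV ?t j - ?Y j"] e1
      unfolding err_def by (intro order_trans[OF n2.nm_diff[of "gU ?t" "\<lambda>j. gU ?t j - ?X j"]] add_mono) auto
    then show ?thesis by simp
  qed
  have y: "nm 2 (\<lambda>j. of_real (eps\<^sup>2) * ?Y j) \<le> R + 1"
  proof -
    have "nm 2 (\<lambda>j. of_real (eps\<^sup>2) * gV ?t j - of_real (eps\<^sup>2) * (gV ?t j - ?Y j)) \<le> R + 1"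
      using gv en_ge(2)[of "\<lambda>j. gV ?t j - ?Y j" "\<lambda>j. gU ?t j - ?X j"] e1
      unfolding err_def by (intro order_trans[OF n2.nm_diff[of "\<lambda>j. of_real (eps\<^sup>2) * gV ?t j" "\<lambda>j. of_real (eps\<^sup>2) * (gV ?t j - ?Y j)"]] add_mono) auto
    then show ?thesis by (simp add: right_diff_distrib)
  qed
  have S: "err (Suc n) = en (\<lambda>j. gU (?t + tau) j - (V1 ?X ?Y j + R1 ?X ?Y j)) (\<lambda>j. gV (?t + tau) j - UD1 ?X ?Y j)"
    unfolding err_def t1
    by (rule en_cong) (simp_all only: ZS mti_step_eq[of _ ?X ?Y, unfolded prod.collapse])
  also have "\<dots> \<le> tau * (KL * delta) + (1 + Ks * tau) * err n"
    unfolding err_def Ks_def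
    by (intro order_trans[OF en_triangle[where x' = "\<lambda>j. V1 (gU ?t) (gV ?t) j + R1 (gU ?t) (gV ?t) j" and y' = "UD1 (gU ?t) (gV ?t)"]]
        add_mono local_error[OF t(1,2)] stability[OF B] x y) (use gu gv in auto)
  finally show ?thesis .
qed

text \<open>Bootstrap: the induction hypothesis and the smallness assumption give
  \<open>err n \<le> 1\<close>, which is exactly what the next step requires.\<close>

lemma err_bound:
  assumes small: "Kf * delta \<le> 1" and n: "real n * tau \<le> T"
  shows "err n \<le> Kf * delta"
proof -
  have d: "0 \<le> delta" "hh \<le> delta" using delta_pos by auto
  have step: "(1 + Ks * tau) ^ n * (K0 * hh + real n * (tau * (KL * delta))) \<le> Kf * delta" if "real n * tau \<le> T" for n
  proof -
    have "(1 + Ks * tau) ^ n \<le> exp (Ks * tau) ^ n"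
      using K_nonneg(2) tau by (intro power_mono exp_ge_add_one_self) auto
    also have "\<dots> = exp (real n * (Ks * tau))" by (rule exp_of_nat_mult[symmetric])
    also have "\<dots> \<le> exp (Ks * T)"
      using mult_left_mono[OF that K_nonneg(2)] by (simp add: mult_ac)
    finally have 1: "(1 + Ks * tau) ^ n \<le> exp (Ks * T)" .
    have "real n * (tau * (KL * delta)) = (real n * tau) * (KL * delta)" by (simp only: mult.assoc)
    also have "\<dots> \<le> T * (KL * delta)" using that KL_nonneg(2) d by (intro mult_right_mono mult_nonneg_nonneg) auto
    finally have "K0 * hh + real n * (tau * (KL * delta)) \<le> K0 * delta + T * (KL * delta)"
      using mult_left_mono[OF d(2) K_nonneg(1)] by linarith
    then have "(1 + Ks * tau) ^ n * (K0 * hh + real n * (tau * (KL * delta))) \<le> exp (Ks * T) * (K0 * delta + T * (KL * delta))"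
      using 1 K_nonneg tau KL_nonneg(2) d hh_pos by (intro mult_mono add_nonneg_nonneg mult_nonneg_nonneg) auto
    also have "\<dots> \<le> Kf * delta" using d(1) unfolding Kf_def by (simp add: distrib_left distrib_right mult.assoc)
    finally show ?thesis .
  qed
  have "err n \<le> (1 + Ks * tau) ^ n * (K0 * hh + real n * (tau * (KL * delta)))" using n
  proof (induction n)
    case 0
    then show ?case using err_0 by simp
  next
    case (Suc n)
    have n': "real n * tau \<le> T" using Suc.prems tau by (simp add: algebra_simps)
    let ?A = "1 + Ks * tau" and ?c = "tau * (KL * delta)"
    have A: "1 \<le> ?A" using K_nonneg(2) tau by simp
    have c: "0 \<le> ?c" using tau KL_nonneg(2) d by (intro mult_nonneg_nonneg) auto
    have IH: "err n \<le> ?A ^ n * (K0 * hh + real n * ?c)" by (rule Suc.IH[OF n'])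
    have "err n \<le> 1" using IH step[OF n'] small by linarith
    from err_Suc[OF Suc.prems this]
    have "err (Suc n) \<le> 1 * ?c + ?A * (?A ^ n * (K0 * hh + real n * ?c))"
      using mult_left_mono[OF IH, of ?A] A by linarith
    also have "\<dots> \<le> ?A ^ Suc n * ?c + ?A ^ Suc n * (K0 * hh + real n * ?c)"
      using one_le_power[OF A, of "Suc n"] c by (intro add_mono mult_right_mono) (auto simp: mult.assoc)
    also have "\<dots> = ?A ^ Suc n * (K0 * hh + real (Suc n) * ?c)"
      by (simp add: distrib_left distrib_right)
    finally show ?case .
  qed
  also have "\<dots> \<le> Kf * delta" by (rule step[OF n])
  finally show ?thesis .
qed

end

section \<open>Interpolation and truncation\<close>

context grid begin

text \<open>The interpolant is an absolutely convergent series with finitely many terms, so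
  \<open>abs_series\<close> yields its coefficients and its continuity.\<close>

lemma interp_fc:
  "fc (interp a b N v) l = (if l \<in> M then D v l else 0)"
  "(\<lambda>x. interp a b N v x * e l x) integrable_on {a..b}"
proof -
  let ?c = "\<lambda>l. if l \<in> M then D v l else 0"
  have s: "(\<lambda>l. cmod (?c l)) summable_on UNIV"
    by (rule summable_on_cong_neutral[THEN iffD1, OF _ _ _ summable_on_finite[OF finite_modes]]) auto
  have S: "(\<lambda>x. \<Sum>\<^sub>\<infinity>l. ?c l * e l x) = interp a b N v"
  proof
    fix x
    have "(\<Sum>\<^sub>\<infinity>l. ?c l * e l x) = infsum (\<lambda>l. D v l * e l x) M"
      by (rule infsum_cong_neutral) auto
    then show "(\<Sum>\<^sub>\<infinity>l. ?c l * e l x) = interp a b N v x" by (simp add: interp_def ef_def)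
  qed
  show "fc (interp a b N v) l = ?c l" using abs_series(4)[OF s, of l] unfolding S .
  show "(\<lambda>x. interp a b N v x * e l x) integrable_on {a..b}"
    by (rule continuous_integrable[OF abs_series(2)[OF s, unfolded S]])
qed

lemma Hnorm_interp: "Hnorm a b s (interp a b N v) \<le> wn a b M s (D v)"
proof (rule Hnorm_le)
  fix A :: "int set" assume A: "finite A"

  have "(w A s (fc (interp a b N v)))\<^sup>2 = (\<Sum>l\<in>A \<inter> M. wt a b l ^ s * (cmod (D v l))\<^sup>2)"
    unfolding wn_sq interp_fc(1) using A by (intro sum.mono_neutral_cong_right) auto
  also have "\<dots> \<le> (w M s (D v))\<^sup>2"
    unfolding wn_sq by (rule sum_mono2) auto
  finally show "w A s (fc (interp a b N v)) \<le> w M s (D v)" by (rule power2_le_imp_le) simp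
qed

text \<open>A mode outside \<open>M\<close> is an alias with k \<noteq> 0 of its representative, so
  its weight is at least (pi / h)^2, which exceeds 1 / h^2.\<close>

lemma off_modes: "l \<notin> M \<Longrightarrow> 1 \<le> h\<^sup>2 * wt a b l"
proof -
  assume l: "l \<notin> M"
  obtain k where k: "l = red l + k * int N"
    using red_mod[of l] by (metis add.commute diff_add_cancel mod_eq_dvd_iff dvd_def mult.commute minus_diff_eq)
  have "k \<noteq> 0" using k l red_in[of l] by (intro notI) simp
  from mode_bounds(2)[OF red_in this k] have 1: "(pi / h)\<^sup>2 * (real_of_int k)\<^sup>2 \<le> wt a b l" .
  have "1 \<le> \<bar>k\<bar>" using \<open>k \<noteq> 0\<close> by simp
  then have "1 \<le> \<bar>real_of_int k\<bar>" by (simp flip: of_int_abs)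
  then have "1 \<le> (real_of_int k)\<^sup>2" using abs_le_square_iff[of 1 "real_of_int k"] by simp
  then have "pi\<^sup>2 * 1 \<le> pi\<^sup>2 * (real_of_int k)\<^sup>2" by (intro mult_left_mono) auto
  moreover have "1 \<le> pi\<^sup>2" using pi_gt3 by (intro one_le_power) simp
  moreover have "pi\<^sup>2 * (real_of_int k)\<^sup>2 = h\<^sup>2 * ((pi / h)\<^sup>2 * (real_of_int k)\<^sup>2)"
  proof -
    have "h\<^sup>2 \<noteq> 0" using h_pos by (metis less_irrefl power_eq_0_iff)
    then show ?thesis unfolding power_divide[of pi h] by (simp del: power_eq_0_iff divide_eq_0_iff power_divide)
  qed
  moreover have "h\<^sup>2 * ((pi / h)\<^sup>2 * (real_of_int k)\<^sup>2) \<le> h\<^sup>2 * wt a b l" by (rule mult_left_mono[OF 1]) simp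
  ultimately show ?thesis by linarith
qed

text \<open>Modes on the grid contribute the error \<open>E\<close>. The others have weight at least
  1 / h^2, so passing from order \<open>s0\<close> to order \<open>s\<close> gains one power of h
  per derivative.\<close>

lemma truncation:
  assumes A: "finite A" and s: "s \<le> s0" and c: "\<And>A. finite A \<Longrightarrow> w A s0 c \<le> B"
    and d: "w M s (\<lambda>l. c l - D v l) \<le> E"
  shows "w A s (\<lambda>l. c l - (if l \<in> M then D v l else 0)) \<le> E + h ^ (s0 - s) * B"
proof -
  let ?i = "\<lambda>l. if l \<in> M then (0::complex) else 1"
  have hp: "0 \<le> h ^ (s0 - s)" using h_pos by simp
  have 1: "w A s (\<lambda>l. if l \<in> M then c l - D v l else 0) \<le> E"
  proof -
    have "(w A s (\<lambda>l. if l \<in> M then c l - D v l else 0))\<^sup>2 = (\<Sum>l\<in>A \<inter> M. wt a b l ^ s * (cmod (c l - D v l))\<^sup>2)"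
      unfolding wn_sq using A by (intro sum.mono_neutral_cong_right) auto
    also have "\<dots> \<le> (w M s (\<lambda>l. c l - D v l))\<^sup>2" unfolding wn_sq by (rule sum_mono2) auto
    finally have "w A s (\<lambda>l. if l \<in> M then c l - D v l else 0) \<le> w M s (\<lambda>l. c l - D v l)" by (rule power2_le_imp_le) simp
    then show ?thesis using d by linarith
  qed
  have "w A s (\<lambda>l. ?i l * c l) \<le> h ^ (s0 - s) * w A s0 c"
  proof (rule wn_mult)
    fix l
    show "(cmod (?i l))\<^sup>2 * wt a b l ^ s \<le> (h ^ (s0 - s))\<^sup>2 * wt a b l ^ s0"
    proof (cases "l \<in> M")
      case False
      have "1 * wt a b l ^ s \<le> (h\<^sup>2 * wt a b l) ^ (s0 - s) * wt a b l ^ s"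
        by (intro mult_right_mono one_le_power off_modes False) simp
      also have "\<dots> = (h ^ (s0 - s))\<^sup>2 * (wt a b l ^ (s0 - s) * wt a b l ^ s)"
        by (simp add: power_mult_distrib power_mult[symmetric] mult.commute)
      also have "\<dots> = (h ^ (s0 - s))\<^sup>2 * wt a b l ^ s0" unfolding power_add[symmetric] using s by simp
      finally show ?thesis using False by simp
    qed simp
  qed (rule hp)
  also have "\<dots> \<le> h ^ (s0 - s) * B" by (rule mult_left_mono[OF c[OF A] hp])
  finally have 2: "w A s (\<lambda>l. ?i l * c l) \<le> h ^ (s0 - s) * B" .
  have "w A s (\<lambda>l. c l - (if l \<in> M then D v l else 0)) = w A s (\<lambda>l. (if l \<in> M then c l - D v l else 0) + ?i l * c l)"
    by (rule wn_cong) simp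
  also have "\<dots> \<le> E + h ^ (s0 - s) * B" by (rule order_trans[OF wn_add add_mono[OF 1 2]])
  finally show ?thesis .
qed

end

context mti_run begin

text \<open>The bounds on the interpolants compare coefficients on \<open>M\<close> with those of
  the exact solution and leave the truncation error aside, so the excess is at most
  \<open>Kf * delta \<le> 1\<close>.\<close>

lemma final_bounds:
  fixes n :: nat
  assumes small: "Kf * delta \<le> 1" and n: "real n * tau \<le> T"
  defines "t \<equiv> real n * tau"
  shows "Hnorm a b 2 (\<lambda>x. u x t - interp a b N (fst (Z n)) x)
      + eps\<^sup>2 * Hnorm a b 2 (\<lambda>x. ut x t - interp a b N (snd (Z n)) x) \<le> (2 * Kf + 2 * C) * delta"
    "Hnorm a b 2 (interp a b N (fst (Z n))) \<le> Hnorm a b s0 (\<lambda>x. u x t) + 1"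
    "eps\<^sup>2 * Hnorm a b 2 (interp a b N (snd (Z n))) \<le> eps\<^sup>2 * Hnorm a b s0 (\<lambda>x. ut x t) + 1"
proof -
  let ?X = "fst (Z n)" and ?Y = "snd (Z n)"
  have t: "t \<in> {0..T}" using n tau by (simp add: t_def)
  have e: "err n \<le> Kf * delta" by (rule err_bound[OF small n])
  have e2: "0 < eps\<^sup>2" using eps by simp
  have rho: "w M 2 c \<le> cn 2 c" for c
    unfolding cn_def using mult_right_mono[OF rho_ge_1 wn_nonneg] by simp
  have X: "w M 2 (\<lambda>l. U l t - D ?X l) \<le> Kf * delta"
  proof -
    have "w M 2 (\<lambda>l. U l t - D ?X l) = w M 2 (D (\<lambda>j. gU t j - ?X j))"
      by (rule wn_cong) (simp add: dft_diff dft_idft)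
    also have "\<dots> \<le> nm 2 (\<lambda>j. gU t j - ?X j)" unfolding nm_def by (rule rho)
    also have "\<dots> \<le> err n" unfolding err_def t_def by (rule en_ge)
    finally show ?thesis using e by linarith
  qed
  have Y: "eps\<^sup>2 * w M 2 (\<lambda>l. V l t - D ?Y l) \<le> Kf * delta"
  proof -
    have "eps\<^sup>2 * w M 2 (\<lambda>l. V l t - D ?Y l) = w M 2 (\<lambda>l. of_real (eps\<^sup>2) * (V l t - D ?Y l))"
      unfolding wn_scale by (simp add: norm_power)
    also have "\<dots> = w M 2 (D (\<lambda>j. of_real (eps\<^sup>2) * (gV t j - ?Y j)))"
      by (rule wn_cong) (simp add: dft_diff dft_idft dft_scale)
    also have "\<dots> \<le> nm 2 (\<lambda>j. of_real (eps\<^sup>2) * (gV t j - ?Y j))" unfolding nm_def by (rule rho)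
    also have "\<dots> \<le> err n" unfolding err_def t_def by (rule en_ge)
    finally show ?thesis using e by linarith
  qed
  have hC: "h ^ (s0 - 2) * C \<le> C * delta"
  proof -
    have "h ^ (s0 - 2) \<le> hh" by (rule h_power) simp
    then have "h ^ (s0 - 2) \<le> delta" using delta_pos(1) by linarith
    from mult_right_mono[OF this C_nonneg] show ?thesis by (simp only: mult.commute)
  qed
  have fu: "fc (\<lambda>x. u x t - interp a b N ?X x) l = U l t - (if l \<in> M then D ?X l else 0)" for l
    unfolding U_def interp_fc(1)[symmetric] by (rule fc_diff) (simp_all only: interp_fc(2) e_integrable t)
  have fv: "fc (\<lambda>x. ut x t - interp a b N ?Y x) l = V l t - (if l \<in> M then D ?Y l else 0)" for l
    unfolding V_def interp_fc(1)[symmetric] by (rule fc_diff) (simp_all only: interp_fc(2) e_integrable t)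
  have 1: "Hnorm a b 2 (\<lambda>x. u x t - interp a b N ?X x) \<le> Kf * delta + h ^ (s0 - 2) * C"
    unfolding fu[abs_def]
    by (rule Hnorm_le, unfold fu[abs_def], rule truncation[OF _ _ wn_U[OF t] X]) (use s0 in auto)
  have VC: "w A s0 (\<lambda>l. V l t) \<le> C / eps\<^sup>2" if "finite A" for A
    using wn_V_H[OF t that] H_bounds(2)[OF t] e2 by (simp add: pos_le_divide_eq mult.commute order_trans[OF mult_left_mono])
  have Y': "w M 2 (\<lambda>l. V l t - D ?Y l) \<le> Kf * delta / eps\<^sup>2"
    using Y e2 by (simp add: pos_le_divide_eq mult.commute)
  have "Hnorm a b 2 (\<lambda>x. ut x t - interp a b N ?Y x) \<le> Kf * delta / eps\<^sup>2 + h ^ (s0 - 2) * (C / eps\<^sup>2)"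
    by (rule Hnorm_le, unfold fv[abs_def], rule truncation[OF _ _ VC Y']) (use s0 in auto)
  then have "eps\<^sup>2 * Hnorm a b 2 (\<lambda>x. ut x t - interp a b N ?Y x) \<le> eps\<^sup>2 * (Kf * delta / eps\<^sup>2 + h ^ (s0 - 2) * (C / eps\<^sup>2))"
    using e2 by (intro mult_left_mono) auto
  also have "\<dots> = Kf * delta + h ^ (s0 - 2) * C"
  proof -
    have "x * (p / x + q * (C / x)) = p + q * C" if "x \<noteq> 0" for x p q :: real using that by (simp add: field_simps)
    from this[of "eps\<^sup>2"] show ?thesis using e2 by simp
  qed
  finally show "Hnorm a b 2 (\<lambda>x. u x t - interp a b N ?X x)
      + eps\<^sup>2 * Hnorm a b 2 (\<lambda>x. ut x t - interp a b N ?Y x) \<le> (2 * Kf + 2 * C) * delta"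
    using 1 hC by (simp add: distrib_right mult.assoc)
  have K1: "Kf * delta \<le> 1" by (rule small)
  have "w M 2 (D ?X) = w M 2 (\<lambda>l. U l t - (U l t - D ?X l))" by simp
  also have "\<dots> \<le> Hnorm a b s0 (\<lambda>x. u x t) + 1"
  proof (rule order_trans[OF wn_diff], rule add_mono)
    show "w M 2 (\<lambda>l. U l t) \<le> Hnorm a b s0 (\<lambda>x. u x t)"
      using wn_U_H[OF t finite_modes] wn_mono_exp[of 2 s0 a b M "\<lambda>l. U l t"] s0 by linarith
    show "w M 2 (\<lambda>l. U l t - D ?X l) \<le> 1" using X K1 by linarith
  qed
  finally show "Hnorm a b 2 (interp a b N ?X) \<le> Hnorm a b s0 (\<lambda>x. u x t) + 1"
    using Hnorm_interp[of 2 ?X] by linarith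
  have "w M 2 (D ?Y) = w M 2 (\<lambda>l. V l t - (V l t - D ?Y l))" by simp
  also have "\<dots> \<le> Hnorm a b s0 (\<lambda>x. ut x t) + 1 / eps\<^sup>2"
  proof (rule order_trans[OF wn_diff], rule add_mono)
    show "w M 2 (\<lambda>l. V l t) \<le> Hnorm a b s0 (\<lambda>x. ut x t)"
      using wn_V_H[OF t finite_modes] wn_mono_exp[of 2 s0 a b M "\<lambda>l. V l t"] s0 by linarith
    show "w M 2 (\<lambda>l. V l t - D ?Y l) \<le> 1 / eps\<^sup>2"
      using Y K1 e2 by (simp add: pos_le_divide_eq mult.commute)
  qed
  finally have "Hnorm a b 2 (interp a b N ?Y) \<le> Hnorm a b s0 (\<lambda>x. ut x t) + 1 / eps\<^sup>2"
    using Hnorm_interp[of 2 ?Y] by linarith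
  from mult_left_mono[OF this, of "eps\<^sup>2"] e2
  show "eps\<^sup>2 * Hnorm a b 2 (interp a b N ?Y) \<le> eps\<^sup>2 * Hnorm a b s0 (\<lambda>x. ut x t) + 1"
    by (simp add: distrib_left)
qed

end

section \<open>Choice of step sizes and conclusion\<close>

theorem theorem4p1:
  fixes a b T lam C :: real and m0 :: nat
    and phi1 phi2 :: "real \<Rightarrow> complex"
    and u ut utt ux uxx :: "real \<Rightarrow> real \<Rightarrow> real \<Rightarrow> complex"
  assumes ab: "a < b" and T: "0 < T" and m0: "2 \<le> m0"
    and deriv_t: "\<And>eps x t. 0 < eps \<Longrightarrow> eps \<le> 1 \<Longrightarrow> x \<in> {a..b} \<Longrightarrow> t \<in> {0..T} \<Longrightarrow>
        ((\<lambda>s. u eps x s) has_vector_derivative ut eps x t) (at t within {0..T}) \<and>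
        ((\<lambda>s. ut eps x s) has_vector_derivative utt eps x t) (at t within {0..T})"
    and deriv_x: "\<And>eps x t. 0 < eps \<Longrightarrow> eps \<le> 1 \<Longrightarrow> x \<in> {a..b} \<Longrightarrow> t \<in> {0..T} \<Longrightarrow>
        ((\<lambda>y. u eps y t) has_vector_derivative ux eps x t) (at x within {a..b}) \<and>
        ((\<lambda>y. ux eps y t) has_vector_derivative uxx eps x t) (at x within {a..b})"
    and pde: "\<And>eps x t. 0 < eps \<Longrightarrow> eps \<le> 1 \<Longrightarrow> x \<in> {a<..<b} \<Longrightarrow> t \<in> {0<..T} \<Longrightarrow>
        complex_of_real (eps^2) * utt eps x t - uxx eps x t
        + u eps x t / complex_of_real (eps^2) + fnl lam (u eps x t) = 0"
    and bc: "\<And>eps t. 0 < eps \<Longrightarrow> eps \<le> 1 \<Longrightarrow> t \<in> {0..T} \<Longrightarrow>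
        u eps a t = u eps b t \<and> ux eps a t = ux eps b t"
    and ic: "\<And>eps x. 0 < eps \<Longrightarrow> eps \<le> 1 \<Longrightarrow> x \<in> {a..b} \<Longrightarrow>
        u eps x 0 = phi1 x \<and> ut eps x 0 = phi2 x / complex_of_real (eps^2)"
    and regA: "\<And>eps. 0 < eps \<Longrightarrow> eps \<le> 1 \<Longrightarrow>
        C1_Hp a b (m0 + 4) T (\<lambda>t x. u eps x t) (\<lambda>t x. ut eps x t)"
    and boundA: "\<And>eps t s. 0 < eps \<Longrightarrow> eps \<le> 1 \<Longrightarrow> t \<in> {0..T} \<Longrightarrow> s \<in> {0..T} \<Longrightarrow>
        Hnorm a b (m0 + 4) (\<lambda>x. u eps x t) + eps^2 * Hnorm a b (m0 + 4) (\<lambda>x. ut eps x s) \<le> C"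
  shows "\<exists>h0 tau0 K. 0 < h0 \<and> h0 \<le> 1 \<and> 0 < tau0 \<and> tau0 \<le> 1 \<and> 0 < K \<and>
     (\<forall>eps N tau n. 0 < eps \<and> eps \<le> 1 \<and> even N \<and> 0 < N \<and> (b - a) / real N \<le> h0 \<and>
        0 < tau \<and> tau \<le> tau0 \<and> real n * tau \<le> T \<longrightarrow>
       (let h = (b - a) / real N;
            U = mti lam a b N eps tau phi1 phi2 n;
            uI = interp a b N (fst U);
            udI = interp a b N (snd U);
            E = Hnorm a b 2 (\<lambda>x. u eps x (real n * tau) - uI x)
                + eps^2 * Hnorm a b 2 (\<lambda>x. ut eps x (real n * tau) - udI x);
            C0 = (SUP e\<in>{0<..1}. max (SUP t\<in>{0..T}. Hnorm a b (m0 + 4) (\<lambda>x. u e x t))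
                                       (e^2 * (SUP t\<in>{0..T}. Hnorm a b (m0 + 4) (\<lambda>x. ut e x t))))
        in E \<le> K * (h ^ m0 + tau^2 / eps^2)
         \<and> E \<le> K * (h ^ m0 + tau^2 + eps^2)
         \<and> Hnorm a b 2 uI \<le> C0 + 1
         \<and> Hnorm a b 2 udI \<le> (C0 + 1) / eps^2
         \<and> E \<le> K * (h ^ m0 + tau^2 + min (tau^2 / eps^2) (eps^2))
         \<and> E \<le> K * (h ^ m0 + tau)))"
proof -
  \<comment> \<open>The arguments of this constant show that it is independent of eps,
    \<open>N\<close> and tau.\<close>
  define Kg where "Kg = mti_run.Kf a b T lam C (m0 + 4)"
  \<comment> \<open>The outer factor 2 pays for the estimate of \<open>tm\<close> by 2 tau in the
    last of the error bounds.\<close>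
  define K where "K = 2 * (2 * max 1 Kg + 2 * \<bar>C\<bar>)"
  \<comment> \<open>Together with \<open>tau0\<close> chosen so that delta <= h0 + 2 tau0 makes the
    constant times delta at most 1/2. The maximum with 1 is taken because the lower bound for
    \<open>Kf\<close> becomes available only once a run has been fixed.\<close>
  define h0 where "h0 = 1 / (4 * max 1 Kg)"
  define tau0 where "tau0 = 1 / (8 * max 1 Kg)"
  have m1: "1 \<le> max 1 Kg" by simp
  have pos: "0 < h0" "h0 \<le> 1" "0 < tau0" "tau0 \<le> 1" "0 < K"
    unfolding h0_def tau0_def K_def using m1 by (simp_all add: divide_le_eq add_pos_nonneg)
  define C0 where "C0 = (SUP e\<in>{0<..1}. max (SUP t\<in>{0..T}. Hnorm a b (m0 + 4) (\<lambda>x. u e x t))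
                                       (e^2 * (SUP t\<in>{0..T}. Hnorm a b (m0 + 4) (\<lambda>x. ut e x t))))"
  interpret period a b by standard (rule ab)
  have kg: "kg_solution a b T lam eps C (m0 + 4) (u eps) (ut eps) (utt eps) (ux eps) (uxx eps)"
    if "0 < eps" "eps \<le> 1" for eps
    using that m0 T deriv_t deriv_x pde bc regA boundA by unfold_locales auto
  \<comment> \<open>The suprema are genuine: the uniform bound \<open>C\<close> makes all the sets
    bounded above, so that each single norm lies below \<open>C0\<close>.\<close>
  have C0: "Hnorm a b (m0 + 4) (\<lambda>x. u eps x t) \<le> C0" "eps\<^sup>2 * Hnorm a b (m0 + 4) (\<lambda>x. ut eps x t) \<le> C0"
    if eps: "0 < eps" "eps \<le> 1" and t: "t \<in> {0..T}" for eps t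
  proof -
    let ?H = "\<lambda>e t. Hnorm a b (m0 + 4) (\<lambda>x. u e x t)" and ?G = "\<lambda>e t. Hnorm a b (m0 + 4) (\<lambda>x. ut e x t)"
    let ?m = "\<lambda>e. max (SUP t\<in>{0..T}. ?H e t) (e\<^sup>2 * (SUP t\<in>{0..T}. ?G e t))"
    have ne: "{0..T} \<noteq> {}" using T by simp
    have H: "?H e t \<le> C" and G: "?G e t \<le> C / e\<^sup>2" if "0 < e" "e \<le> 1" "t \<in> {0..T}" for e t
      using kg_solution.H_bounds[OF kg[OF that(1,2)] that(3)] that(1) by (simp_all add: pos_le_divide_eq mult.commute)
    have bH: "bdd_above (?H e ` {0..T})" and bG: "bdd_above (?G e ` {0..T})" if "0 < e" "e \<le> 1" for e
      by (rule bdd_aboveI2, erule H[OF that], rule bdd_aboveI2, erule G[OF that])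
    have "?m e \<le> C" if "e \<in> {0<..1}" for e
    proof -
      have e: "0 < e" "e \<le> 1" using that by auto
      have "(SUP t\<in>{0..T}. ?H e t) \<le> C" by (rule cSUP_least[OF ne]) (rule H[OF e])
      moreover have "(SUP t\<in>{0..T}. ?G e t) \<le> C / e\<^sup>2" by (rule cSUP_least[OF ne]) (rule G[OF e])
      then have "e\<^sup>2 * (SUP t\<in>{0..T}. ?G e t) \<le> C" using e by (simp add: pos_le_divide_eq mult.commute)
      ultimately show ?thesis by simp
    qed
    then have "bdd_above (?m ` {0<..1})" by (rule bdd_aboveI2)
    then have m: "?m eps \<le> C0" unfolding C0_def by (rule cSUP_upper2) (use eps in auto)
    have "?H eps t \<le> (SUP t\<in>{0..T}. ?H eps t)" by (rule cSUP_upper[OF t bH[OF eps]])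
    then show "?H eps t \<le> C0" using m by simp
    have "eps\<^sup>2 * ?G eps t \<le> eps\<^sup>2 * (SUP t\<in>{0..T}. ?G eps t)"
      by (rule mult_left_mono[OF cSUP_upper[OF t bG[OF eps]]]) simp
    then show "eps\<^sup>2 * ?G eps t \<le> C0" using m by simp
  qed
  show ?thesis
  proof (rule exI[of _ h0], rule exI[of _ tau0], rule exI[of _ K], intro conjI allI impI pos)
    fix eps :: real and N :: nat and tau :: real and n :: nat
    assume asm: "0 < eps \<and> eps \<le> 1 \<and> even N \<and> 0 < N \<and> (b - a) / real N \<le> h0 \<and>
        0 < tau \<and> tau \<le> tau0 \<and> real n * tau \<le> T"
    then have ep: "0 < eps" "eps \<le> 1" and ta: "0 < tau" "tau \<le> tau0" and n: "real n * tau \<le> T"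
      and h: "(b - a) / real N \<le> h0" by auto
    interpret kg_solution a b T lam eps C "m0 + 4" "u eps" "ut eps" "utt eps" "ux eps" "uxx eps"
      by (rule kg[OF ep])
    have h1': "(b - a) / real N \<le> 1" using h pos by linarith
    let ?Z = "mti lam a b N eps tau phi1 phi2"
    interpret mti_run a b T lam eps C "m0 + 4" "u eps" "ut eps" "utt eps" "ux eps" "uxx eps" N tau ?Z
    proof unfold_locales
      fix j n assume j: "j < N"
      have "gridx a b N j \<in> {a..b}"
        using grid.xg_in[of a b N j] j asm ab by (simp add: grid_def)
      then show "fst (?Z 0) j = u eps (gridx a b N j) 0 \<and> snd (?Z 0) j = ut eps (gridx a b N j) 0"
        using ic[OF ep, of "gridx a b N j"] by (simp add: mti_def)
    qed (use asm pos(4) ab h1' in \<open>auto simp: mti_def\<close>)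
    let ?t = "real n * tau" and ?h = "(b - a) / real N"
    have t: "?t \<in> {0..T}" using n tau by simp
    have KM: "max 1 Kg = mti_run.Kf a b T lam C (m0 + 4)" using K_nonneg(3) by (simp add: Kg_def)
    have hp: "0 < ?h" by (rule h_pos)
    have hm: "?h ^ m0 \<le> ?h" using power_decreasing[of 1 m0 ?h] m0 hp h pos by simp
    \<comment> \<open>The last bound joins the regimes: for tau <= eps^2 the first entry of the
      minimum is at most tau, and otherwise eps^2 < tau.\<close>
    have tm: "tm \<le> tau\<^sup>2 / eps\<^sup>2" "tm \<le> tau\<^sup>2 + eps\<^sup>2" "tm \<le> tau\<^sup>2 + min (tau\<^sup>2 / eps\<^sup>2) (eps\<^sup>2)" "tm \<le> 2 * tau"
    proof -
      show "tm \<le> tau\<^sup>2 / eps\<^sup>2" "tm \<le> tau\<^sup>2 + eps\<^sup>2" by simp_all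
      have "min p (q + r) \<le> q + min p r" if "0 \<le> q" for p q r :: real
        using that by (auto simp: min_def)
      then show "tm \<le> tau\<^sup>2 + min (tau\<^sup>2 / eps\<^sup>2) (eps\<^sup>2)" by simp
      have t2: "tau\<^sup>2 \<le> tau" using ta pos by (simp add: power2_eq_square mult_left_le)
      show "tm \<le> 2 * tau"
      proof (cases "tau \<le> eps\<^sup>2")
        case True
        have "tau\<^sup>2 \<le> tau * eps\<^sup>2" using mult_left_mono[OF True, of tau] tau by (simp add: power2_eq_square)
        then have "tau\<^sup>2 / eps\<^sup>2 \<le> tau" using ep by (simp add: pos_divide_le_eq)
        then show ?thesis using tau by linarith
      next
        case False
        then show ?thesis using t2 by linarith
      qed
    qed
    have d: "?h ^ m0 + tm \<le> h0 + 2 * tau0" using hm h tm(4) ta by linarith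
    have small: "mti_run.Kf a b T lam C (m0 + 4) * delta \<le> 1"
    proof -
      have "max 1 Kg * (?h ^ m0 + tm) \<le> max 1 Kg * (h0 + 2 * tau0)" by (rule mult_left_mono[OF d]) simp
      also have "\<dots> \<le> 1" proof -
        have "m * (1 / (4 * m) + 2 * (1 / (8 * m))) \<le> 1" if "1 \<le> m" for m :: real
          using that by (simp add: field_simps)
        from this[OF m1] show ?thesis unfolding h0_def tau0_def .
      qed
      finally show ?thesis by (simp add: KM)
    qed
    note fb = final_bounds[OF small n]
    define E where "E = Hnorm a b 2 (\<lambda>x. u eps x ?t - interp a b N (fst (?Z n)) x)
                + eps\<^sup>2 * Hnorm a b 2 (\<lambda>x. ut eps x ?t - interp a b N (snd (?Z n)) x)"
    have E: "E \<le> K * q" if "?h ^ m0 + tm \<le> 2 * q" for q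
    proof -
      have "E \<le> (2 * max 1 Kg + 2 * C) * (?h ^ m0 + tm)" using fb(1) by (simp add: E_def KM)
      also have "\<dots> \<le> (2 * max 1 Kg + 2 * \<bar>C\<bar>) * (2 * q)"
        using that delta_pos C_nonneg by (intro mult_mono) auto
      also have "\<dots> = K * q" unfolding K_def by (simp only: mult_ac)
      finally show ?thesis .
    qed
    have hm0: "0 \<le> ?h ^ m0" using hp by simp

    have "E \<le> K * (?h ^ m0 + tau\<^sup>2 / eps\<^sup>2)" "E \<le> K * (?h ^ m0 + tau\<^sup>2 + eps\<^sup>2)"
      "E \<le> K * (?h ^ m0 + tau\<^sup>2 + min (tau\<^sup>2 / eps\<^sup>2) (eps\<^sup>2))" "E \<le> K * (?h ^ m0 + tau)"
    proof -
      have EE: "E \<le> K * (?h ^ m0 + r)" if "tm \<le> 2 * r" for r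
        by (rule E) (use that hm0 in simp)
      have tm2: "tm \<le> 2 * r" if "tm \<le> r" for r using that delta_pos(1) by linarith
      show "E \<le> K * (?h ^ m0 + tau\<^sup>2 / eps\<^sup>2)" by (rule EE[OF tm2[OF tm(1)]])
      show "E \<le> K * (?h ^ m0 + tau\<^sup>2 + eps\<^sup>2)" using EE[OF tm2[OF tm(2)]] by (simp only: add.assoc)
      show "E \<le> K * (?h ^ m0 + tau\<^sup>2 + min (tau\<^sup>2 / eps\<^sup>2) (eps\<^sup>2))"
        using EE[OF tm2[OF tm(3)]] by (simp only: add.assoc)
      show "E \<le> K * (?h ^ m0 + tau)" by (rule EE[OF tm(4)])
    qed
    moreover have "Hnorm a b 2 (interp a b N (fst (?Z n))) \<le> C0 + 1"
      using fb(2) C0(1)[OF ep t] by linarith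
    moreover have "Hnorm a b 2 (interp a b N (snd (?Z n))) \<le> (C0 + 1) / eps\<^sup>2"
    proof -
      have "eps\<^sup>2 * Hnorm a b 2 (interp a b N (snd (?Z n))) \<le> C0 + 1"
        using fb(3) C0(2)[OF ep t] by linarith
      then show ?thesis using ep by (simp add: pos_le_divide_eq mult.commute)
    qed
    ultimately show "let h = (b - a) / real N;
            U = mti lam a b N eps tau phi1 phi2 n;
            uI = interp a b N (fst U);
            udI = interp a b N (snd U);
            E = Hnorm a b 2 (\<lambda>x. u eps x (real n * tau) - uI x)
                + eps^2 * Hnorm a b 2 (\<lambda>x. ut eps x (real n * tau) - udI x);
            C0 = (SUP e\<in>{0<..1}. max (SUP t\<in>{0..T}. Hnorm a b (m0 + 4) (\<lambda>x. u e x t))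
                                       (e^2 * (SUP t\<in>{0..T}. Hnorm a b (m0 + 4) (\<lambda>x. ut e x t))))
        in E \<le> K * (h ^ m0 + tau^2 / eps^2)
         \<and> E \<le> K * (h ^ m0 + tau^2 + eps^2)
         \<and> Hnorm a b 2 uI \<le> C0 + 1
         \<and> Hnorm a b 2 udI \<le> (C0 + 1) / eps^2
         \<and> E \<le> K * (h ^ m0 + tau^2 + min (tau^2 / eps^2) (eps^2))
         \<and> E \<le> K * (h ^ m0 + tau)"
      unfolding Let_def E_def C0_def by (intro conjI)
  qed
qed

end
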